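(* Given an undirected graph $G=(V,E)$ and an integer $k$, one can find $k$ edge-disjoint spanning trees in $G$ or determine that no such $k$ trees exist in $\tilde O\big(|E|+(k|V|)^{3/2}\big)$ time, with high probability (probability at least $1-|V|^{-c}$ for an arbitrarily large constant $c$).
   Context: $\tilde O$ hides polylogarithmic factors in $|V|$ (and $|E|$). *)

theory Defs
  imports "HOL-Probability.Probability_Mass_Function"
begin

section \<open>Undirected graphs and edge-disjoint spanning trees\<close>

text \<open>
  An undirected graph is given by a vertex set \<open>V\<close>, a set \<open>E\<close> of edge names and a map \<open>ends\<close> sending
  each edge to the set of its end points (a singleton for a loop), so parallel edges are allowed.
\<close>

definition connected_by :: "'v set \<Rightarrow> 'e set \<Rightarrow> ('e \<Rightarrow> 'v set) \<Rightarrow> bool" where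
  "connected_by V F ends \<longleftrightarrow>
     V \<noteq> {} \<and> (\<forall>u\<in>V. \<forall>v\<in>V. (u, v) \<in> {(x, y). \<exists>e\<in>F. ends e = {x, y}}\<^sup>*)"

text \<open>A loop is a cycle of length 1, and two parallel edges form a cycle of length 2.\<close>

definition is_cycle :: "'e set \<Rightarrow> ('e \<Rightarrow> 'v set) \<Rightarrow> 'v list \<Rightarrow> 'e list \<Rightarrow> bool" where
  "is_cycle F ends vs es \<longleftrightarrow>
     vs \<noteq> [] \<and> length es = length vs \<and> distinct vs \<and> distinct es \<and> set es \<subseteq> F \<and>
     (\<forall>i<length vs. ends (es ! i) = {vs ! i, vs ! (Suc i mod length vs)})"

definition acyclic_edges :: "'e set \<Rightarrow> ('e \<Rightarrow> 'v set) \<Rightarrow> bool" where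
  "acyclic_edges F ends \<longleftrightarrow> (\<nexists>vs es. is_cycle F ends vs es)"

definition spanning_tree :: "'v set \<Rightarrow> 'e set \<Rightarrow> ('e \<Rightarrow> 'v set) \<Rightarrow> 'e set \<Rightarrow> bool" where
  "spanning_tree V E ends F \<longleftrightarrow> F \<subseteq> E \<and> connected_by V F ends \<and> acyclic_edges F ends"

definition edge_disjoint_spanning_trees ::
    "'v set \<Rightarrow> 'e set \<Rightarrow> ('e \<Rightarrow> 'v set) \<Rightarrow> nat \<Rightarrow> (nat \<Rightarrow> 'e set) \<Rightarrow> bool" where
  "edge_disjoint_spanning_trees V E ends k T \<longleftrightarrow>
     (\<forall>i<k. spanning_tree V E ends (T i)) \<and> (\<forall>i<k. \<forall>j<k. i \<noteq> j \<longrightarrow> T i \<inter> T j = {})"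

text \<open>
  As an input to an algorithm, a graph consists of the number \<open>n\<close> of vertices, which are
  \<open>0, \<dots>, n - 1\<close>, and the list of its edges; the name of an edge is its position in the list.
\<close>

definition is_graph :: "nat \<Rightarrow> (nat \<times> nat) list \<Rightarrow> bool" where
  "is_graph n es \<longleftrightarrow> n \<ge> 1 \<and> (\<forall>(u, v)\<in>set es. u < n \<and> v < n)"

definition edge_ends :: "(nat \<times> nat) list \<Rightarrow> nat \<Rightarrow> nat set" where
  "edge_ends es i = {fst (es ! i), snd (es ! i)}"

definition are_disjoint_trees ::
    "nat \<Rightarrow> (nat \<times> nat) list \<Rightarrow> nat \<Rightarrow> (nat \<Rightarrow> nat set) \<Rightarrow> bool" where
  "are_disjoint_trees n es k T \<longleftrightarrow>
     edge_disjoint_spanning_trees {..<n} {..<length es} (edge_ends es) k T"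

section \<open>The randomized word RAM\<close>

text \<open>
  Registers and memory cells hold \<open>w\<close>-bit words, i.e. numbers below \<open>2 ^ w\<close>; arithmetic is modulo
  \<open>2 ^ w\<close>. Every instruction, including drawing a uniformly random word, costs one time unit. A
  program is a fixed finite list of instructions, so it uses finitely many registers, and it does
  not depend on the input or on the word size.
\<close>

datatype binop = Add | Sub | Mul | Div | Mod | And | Or | Xor | Shl | Shr

datatype instr =
    Const nat nat
  | Op binop nat nat nat
  | Load nat nat
  | Store nat nat
  | Rand nat
  | JmpLess nat nat nat
  | JmpEq nat nat nat

type_synonym program = "instr list"

record config =
  pc :: nat
  reg :: "nat \<Rightarrow> nat"
  mem :: "nat \<Rightarrow> nat"

definition wrap :: "nat \<Rightarrow> nat \<Rightarrow> nat" where
  "wrap w x = x mod 2 ^ w"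

fun apply_op :: "nat \<Rightarrow> binop \<Rightarrow> nat \<Rightarrow> nat \<Rightarrow> nat" where
  "apply_op w Add x y = wrap w (x + y)"
| "apply_op w Sub x y = nat ((int x - int y) mod 2 ^ w)"
| "apply_op w Mul x y = wrap w (x * y)"
| "apply_op w Div x y = wrap w (x div y)"
| "apply_op w Mod x y = wrap w (x mod y)"
| "apply_op w And x y = wrap w (and x y)"
| "apply_op w Or x y = wrap w (or x y)"
| "apply_op w Xor x y = wrap w (xor x y)"
| "apply_op w Shl x y = wrap w (push_bit y x)"
| "apply_op w Shr x y = wrap w (drop_bit y x)"

definition set_reg :: "nat \<Rightarrow> nat \<Rightarrow> config \<Rightarrow> config" where
  "set_reg r x s = s\<lparr>pc := pc s + 1, reg := (reg s)(r := x)\<rparr>"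

fun exec_instr :: "nat \<Rightarrow> instr \<Rightarrow> config \<Rightarrow> config pmf" where
  "exec_instr w (Const r a) s = return_pmf (set_reg r (wrap w a) s)"
| "exec_instr w (Op f r p q) s = return_pmf (set_reg r (apply_op w f (reg s p) (reg s q)) s)"
| "exec_instr w (Load r p) s = return_pmf (set_reg r (mem s (reg s p)) s)"
| "exec_instr w (Store r p) s =
     return_pmf (s\<lparr>pc := pc s + 1, mem := (mem s)(reg s r := reg s p)\<rparr>)"
| "exec_instr w (Rand r) s = map_pmf (\<lambda>x. set_reg r x s) (pmf_of_set {..<2 ^ w})"
| "exec_instr w (JmpLess p q l) s =
     return_pmf (s\<lparr>pc := (if reg s p < reg s q then l else pc s + 1)\<rparr>)"
| "exec_instr w (JmpEq p q l) s =
     return_pmf (s\<lparr>pc := (if reg s p = reg s q then l else pc s + 1)\<rparr>)"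

text \<open>The machine halts when the program counter leaves the program.\<close>

definition halted :: "program \<Rightarrow> config \<Rightarrow> bool" where
  "halted P s \<longleftrightarrow> pc s \<ge> length P"

definition step :: "program \<Rightarrow> nat \<Rightarrow> config \<Rightarrow> config pmf" where
  "step P w s = (if halted P s then return_pmf s else exec_instr w (P ! pc s) s)"

text \<open>The distribution of the configuration after \<open>t\<close> time units; halted configurations persist.\<close>

fun run :: "program \<Rightarrow> nat \<Rightarrow> nat \<Rightarrow> config \<Rightarrow> config pmf" where
  "run P w 0 s = return_pmf s"
| "run P w (Suc t) s = bind_pmf (step P w s) (run P w t)"

section \<open>Input and output of the algorithm\<close>

text \<open>
  Initially the memory is \<open>n, m, k, u\<^sub>0, v\<^sub>0, \<dots>, u\<^sub>m\<^sub>-\<^sub>1, v\<^sub>m\<^sub>-\<^sub>1, 0, 0, \<dots>\<close> where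
  the edges are \<open>(u\<^sub>i, v\<^sub>i)\<close>, and all registers are 0.
\<close>

definition input_words :: "nat \<Rightarrow> (nat \<times> nat) list \<Rightarrow> nat \<Rightarrow> nat list" where
  "input_words n es k = [n, length es, k] @ concat (map (\<lambda>(u, v). [u, v]) es)"

definition init_config :: "nat \<Rightarrow> (nat \<times> nat) list \<Rightarrow> nat \<Rightarrow> config" where
  "init_config n es k =
     \<lparr>pc = 0, reg = (\<lambda>_. 0),
      mem = (\<lambda>a. if a < length (input_words n es k) then input_words n es k ! a else 0)\<rparr>"

text \<open>
  Words have \<open>\<Theta>(log (n + m + k))\<close> bits; the factor \<open>K \<ge> 1\<close> may depend on the program.
  In particular \<open>n\<close>, \<open>m\<close> and \<open>k\<close> fit into one word each.
\<close>

definition word_size :: "nat \<Rightarrow> nat \<Rightarrow> (nat \<times> nat) list \<Rightarrow> nat \<Rightarrow> nat" where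
  "word_size K n es k = K * nat \<lceil>log 2 (real (n + length es + k + 2))\<rceil>"

text \<open>
  Register 0 holds the verdict: 0 for ``no such trees exist'', and 1 for ``trees found''. In the
  latter case register 1 points to an array listing the trees one after the other, each by the
  positions of its \<open>n - 1\<close> edges.
\<close>

definition output_trees :: "nat \<Rightarrow> config \<Rightarrow> nat \<Rightarrow> nat set" where
  "output_trees n s j = (\<lambda>i. mem s (reg s 1 + j * (n - 1) + i)) ` {..<n - 1}"

definition correct_output :: "nat \<Rightarrow> (nat \<times> nat) list \<Rightarrow> nat \<Rightarrow> config \<Rightarrow> bool" where
  "correct_output n es k s \<longleftrightarrow>
     reg s 0 = 1 \<and> are_disjoint_trees n es k (output_trees n s) \<or>
     reg s 0 = 0 \<and> (\<nexists>T. are_disjoint_trees n es k T)"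

text \<open>
  The summand 1 only matters for \<open>k = 0\<close> and \<open>m = 0\<close>, where the other summands vanish.
\<close>

definition time_bound :: "real \<Rightarrow> nat \<Rightarrow> nat \<Rightarrow> (nat \<times> nat) list \<Rightarrow> nat \<Rightarrow> nat" where
  "time_bound C d n es k =
     nat \<lfloor>C * (real (length es) + (real k * real n) powr (3/2) + 1) *
          log 2 (real (n + length es + 2)) ^ d\<rfloor>"

end

theory Submission
  imports Defs "HOL-Library.Discrete_Functions"
begin

text \<open>
  A deterministic algorithm suffices. First the edges are sparsified: they are packed greedily into
  \<open>2 k (log n + 1)\<close> forests, each spanning the next one, and an edge that is spanned by all of them is
  discarded. If a maximum packing of \<open>k\<close> forests in the remaining \<open>H\<close> is certified by a tight set \<open>X\<close>,
  which is spanned by each forest inside \<open>X\<close> and contains all unused edges, then the ranks of \<open>X\<close>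
  united with the sparsifying forests decrease geometrically, so \<open>X\<close> spans the last of them and hence all
  discarded edges; so the packing is maximum in the whole graph. On the \<open>O(k n log n)\<close> edges of \<open>H\<close>,
  push-relabel with about \<open>sqrt (k n)\<close> levels finds \<open>k\<close> forests that are at most \<open>sqrt (k n)\<close> edges short of a
  maximum, and the remaining edges are gained one by one along augmenting paths, each found in
  near-linear time by a search that otherwise ends with a tight set. Spans are tested by component labels, where the
  smaller component is relabelled. The algorithm is written in a structured language whose
  programs are compiled to the word RAM.
\<close>

section \<open>A structured language and its compilation to the word RAM\<close>

text \<open>The obstacle is to exchange edges quickly without dynamic trees. No tree is ever split
  here: an edge that enters a forest at some level is contracted in the structure one level below,
  where it displaces one edge of its fundamental circuit. Contracted components and trees only
  merge, so relabelling the smaller part costs \<open>O(n log n)\<close> per structure over its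
  whole life. An edge of the circuit is found in constant time by labels that grow from parents to
  children: of two components of one tree, the one with the larger label is no ancestor of the
  other, so its parent edge lies on the path between them. The same contraction lets the search for
  an augmenting path reach every edge at most once. The exponent 3/2 comes from a balance: at most
  \<open>k n\<close> edges are assigned, so among \<open>D >= sqrt (k n)\<close> levels some level
  holds at most \<open>D\<close> of them, which bounds the deficit left by push-relabel; both the
  pushes and the later rounds then cost about \<open>D k n\<close> up to logarithms.\<close>

datatype exp =
  Num nat
 | Var nat
 | Plus exp exp
 | Minus exp exp
 | Times exp exp
 | Half exp
 | Arr nat exp exp
 | Raw exp

datatype bexp = Less exp exp | Eq exp exp

datatype com =
  Asg nat exp
 | Put nat exp exp exp
 | PutRaw exp exp
 | Seq com com  (infixr ";;" 60)
 | Cond bexp com com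
 | Loop bexp com

text \<open>
 \<open>vr\<close> are the variables, \<open>ar t p q\<close> is the cell \<open>(p, q)\<close> of the two-dimensional array \<open>t\<close>, \<open>rw\<close> is the
 part of the memory that holds the input, and the ghost component \<open>ck\<close> counts elapsed time.
\<close>

record st =
 vr :: "nat => nat"
 ar :: "nat => nat => nat => nat"
 rw :: "nat => nat"
 ck :: nat

fun ev :: "exp => st => nat" where
 "ev (Num c) s = c"
| "ev (Var x) s = vr s x"
| "ev (Plus a b) s = ev a s + ev b s"
| "ev (Minus a b) s = ev a s - ev b s"
| "ev (Times a b) s = ev a s * ev b s"
| "ev (Half a) s = ev a s div 2"
| "ev (Arr t a b) s = ar s t (ev a s) (ev b s)"
| "ev (Raw a) s = rw s (ev a s)"

fun bv :: "bexp => st => bool" where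
 "bv (Less a b) s \<longleftrightarrow> ev a s < ev b s"
| "bv (Eq a b) s \<longleftrightarrow> ev a s = ev b s"

abbreviation tick :: "st => st" where
 "tick s \<equiv> s\<lparr>ck := Suc (ck s)\<rparr>"

abbreviation put :: "nat => nat => nat => nat => (nat => nat => nat => nat) => nat => nat => nat => nat" where
 "put t p q x f \<equiv> f(t := (f t)(p := (f t p)(q := x)))"

text \<open>
 All values must stay below \<open>cap\<close>; then no operation overflows and every pair of values is a valid
 array index. The raw memory consists of the first \<open>rb\<close> cells.
\<close>

locale imp =
 fixes cap rb :: nat
begin

text \<open>These conditions make evaluation over the naturals agree with machine arithmetic, where
  sums, products and differences wrap around. Literals up to 4 are safe because \<open>cap\<close>
  will be assumed to exceed 4.\<close>

fun ok :: "exp => st => bool" where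
 "ok (Num c) s \<longleftrightarrow> c <= 4"
| "ok (Var x) s \<longleftrightarrow> True"
| "ok (Plus a b) s \<longleftrightarrow> ok a s & ok b s & ev a s + ev b s < cap"
| "ok (Minus a b) s \<longleftrightarrow> ok a s & ok b s & ev b s <= ev a s"
| "ok (Times a b) s \<longleftrightarrow> ok a s & ok b s & ev a s * ev b s < cap"
| "ok (Half a) s \<longleftrightarrow> ok a s"
| "ok (Arr t a b) s \<longleftrightarrow> ok a s & ok b s"
| "ok (Raw a) s \<longleftrightarrow> ok a s & ev a s < rb"

fun okb :: "bexp => st => bool" where
 "okb (Less a b) s \<longleftrightarrow> ok a s & ok b s"
| "okb (Eq a b) s \<longleftrightarrow> ok a s & ok b s"

inductive big :: "com => st => st => bool" where
 Asg: "ok e s ==> big (Asg x e) s (s\<lparr>vr := (vr s)(x := ev e s), ck := Suc (ck s)\<rparr>)"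
| Put: "ok a s ==> ok b s ==> ok e s ==>
  big (Put t a b e) s (s\<lparr>ar := put t (ev a s) (ev b s) (ev e s) (ar s), ck := Suc (ck s)\<rparr>)"
| PutRaw: "ok a s ==> ok e s ==> ev a s < rb ==>
  big (PutRaw a e) s (s\<lparr>rw := (rw s)(ev a s := ev e s), ck := Suc (ck s)\<rparr>)"
| Seq: "big c s s' ==> big d s' s'' ==> big (c ;; d) s s''"
| CondT: "okb b s ==> bv b s ==> big c (tick s) s' ==> big (Cond b c d) s s'"
| CondF: "okb b s ==> \<not> bv b s ==> big d (tick s) s' ==> big (Cond b c d) s s'"
| LoopT: "okb b s ==> bv b s ==> big c (tick s) s' ==> big (Loop b c) s' s'' ==> big (Loop b c) s s''"
| LoopF: "okb b s ==> \<not> bv b s ==> big (Loop b c) s (tick s)"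

inductive_cases AsgE: "big (Asg x e) s s'"
inductive_cases PutE: "big (Put t a b e) s s'"
inductive_cases PutRawE: "big (PutRaw a e) s s'"
inductive_cases SeqE: "big (c ;; d) s s'"
inductive_cases CondE: "big (Cond b c d) s s'"

lemma big_ck_mono: "big c s s' ==> ck s <= ck s'"
 by (induction rule: big.induct) auto

text \<open>The existential demands a terminating run, so this is total correctness; the clock in
  the final state then bounds the running time.\<close>

definition wp :: "com => (st => bool) => st => bool" where
 "wp c Q s \<longleftrightarrow> (\<exists>s'. big c s s' & Q s')"

lemma wp_Asg [simp]:
 "wp (Asg x e) Q s \<longleftrightarrow> ok e s & Q (s\<lparr>vr := (vr s)(x := ev e s), ck := Suc (ck s)\<rparr>)"
 unfolding wp_def by (auto elim: AsgE intro: big.Asg)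

lemma wp_Put [simp]:
 "wp (Put t a b e) Q s \<longleftrightarrow> ok a s & ok b s & ok e s &
  Q (s\<lparr>ar := put t (ev a s) (ev b s) (ev e s) (ar s), ck := Suc (ck s)\<rparr>)"
 unfolding wp_def by (auto elim: PutE intro: big.Put)

lemma wp_PutRaw [simp]:
 "wp (PutRaw a e) Q s \<longleftrightarrow> ok a s & ok e s & ev a s < rb &
  Q (s\<lparr>rw := (rw s)(ev a s := ev e s), ck := Suc (ck s)\<rparr>)"
 unfolding wp_def by (auto elim: PutRawE intro: big.PutRaw)

lemma wp_Seq [simp]: "wp (c ;; d) Q s \<longleftrightarrow> wp c (wp d Q) s"
 unfolding wp_def by (blast elim: SeqE intro: big.Seq)

lemma wp_Cond [simp]:
 "wp (Cond b c d) Q s \<longleftrightarrow> okb b s & (if bv b s then wp c Q (tick s) else wp d Q (tick s))"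
 unfolding wp_def by (auto elim!: CondE intro: big.CondT big.CondF)

lemma wp_mono: "wp c Q s ==> (\<And>s'. Q s' ==> Q' s') ==> wp c Q' s"
 unfolding wp_def by blast

text \<open>Every test costs time, so a bound on the clock entails termination.\<close>

lemma wp_Loop:
 assumes "I s"
  and bound: "\<And>s. I s ==> ck s <= B"
  and okb: "\<And>s. I s ==> okb b s"
  and body: "\<And>s. I s ==> bv b s ==> wp c I (tick s)"
  and exit: "\<And>s. I s ==> \<not> bv b s ==> Q (tick s)"
 shows "wp (Loop b c) Q s"
 using \<open>I s\<close>
proof (induction "B - ck s" arbitrary: s rule: less_induct)
 case less
 show ?case
 proof (cases "bv b s")
  case True
  from body[OF less.prems True] obtain s' where s': "big c (tick s) s'" "I s'"
  unfolding wp_def by blast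
  have "ck s < ck s'" using big_ck_mono[OF s'(1)] by simp
  moreover have "ck s' <= B" using bound s' by blast
  ultimately have "B - ck s' < B - ck s" by linarith
  from less.hyps[OF this s'(2)] obtain s'' where "big (Loop b c) s' s''" "Q s''"
  unfolding wp_def by blast
  then show ?thesis
  unfolding wp_def using s' okb[OF less.prems] True big.LoopT by blast
 next
  case False
  then show ?thesis
  unfolding wp_def using okb exit less.prems big.LoopF by blast
 qed
qed

end

subsection \<open>Code generation\<close>

text \<open>
 Variables occupy the registers below 100. The registers 100 and 101 hold the stride of the arrays
 and the first address behind the raw memory; registers from 102 on hold intermediate results.
\<close>

fun addr_code :: "nat => nat => instr list" where
 "addr_code d t =
  [Op Mul d d 100, Op Add d d (Suc d), Const (Suc d) 20, Op Mul d d (Suc d),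
  Const (Suc d) t, Op Add d d (Suc d), Op Add d d 101]"

lemma length_addr_code [simp]: "length (addr_code d t) = 7"
 by simp

declare addr_code.simps [simp del]

text \<open>Stack discipline: the value is left in register \<open>d\<close> and only registers from
  \<open>d\<close> on are overwritten, so operands computed earlier survive.
  \<open>Op Or d x x\<close> serves as a move instruction.\<close>

fun cexp :: "nat => exp => instr list" where
 "cexp d (Num c) = [Const d c]"
| "cexp d (Var x) = [Op Or d x x]"
| "cexp d (Plus a b) = cexp d a @ cexp (Suc d) b @ [Op Add d d (Suc d)]"
| "cexp d (Minus a b) = cexp d a @ cexp (Suc d) b @ [Op Sub d d (Suc d)]"
| "cexp d (Times a b) = cexp d a @ cexp (Suc d) b @ [Op Mul d d (Suc d)]"
| "cexp d (Half a) = cexp d a @ [Const (Suc d) 2, Op Div d d (Suc d)]"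
| "cexp d (Arr t a b) = cexp d a @ cexp (Suc d) b @ addr_code d t @ [Load d d]"
| "cexp d (Raw a) = cexp d a @ [Load d d]"

fun ctest :: "bexp => nat => instr list" where
 "ctest (Less a b) l = cexp 102 a @ cexp 103 b @ [JmpLess 102 103 l]"
| "ctest (Eq a b) l = cexp 102 a @ cexp 103 b @ [JmpEq 102 103 l]"

fun tlen :: "bexp => nat" where
 "tlen (Less a b) = length (cexp 102 a) + length (cexp 103 b) + 1"
| "tlen (Eq a b) = length (cexp 102 a) + length (cexp 103 b) + 1"

text \<open>The length does not depend on the position of the code, so jump targets can be computed
  before the code of the branches is generated.\<close>

fun clen :: "com => nat" where
 "clen (Asg x e) = length (cexp 102 e) + 1"
| "clen (Put t a b e) = length (cexp 102 a) + length (cexp 103 b) + 7 + length (cexp 103 e) + 1"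
| "clen (PutRaw a e) = length (cexp 102 a) + length (cexp 103 e) + 1"
| "clen (c ;; d) = clen c + clen d"
| "clen (Cond b c d) = tlen b + clen d + 1 + clen c"
| "clen (Loop b c) = tlen b + 1 + clen c + 1"

text \<open>\<open>i\<close> is the absolute start address, and \<open>JmpEq 102 102\<close> is an
  unconditional jump. The negative branch comes first because a test jumps exactly when it
  holds.\<close>

fun ccom :: "nat => com => instr list" where
 "ccom i (Asg x e) = cexp 102 e @ [Op Or x 102 102]"
| "ccom i (Put t a b e) = cexp 102 a @ cexp 103 b @ addr_code 102 t @ cexp 103 e @ [Store 102 103]"
| "ccom i (PutRaw a e) = cexp 102 a @ cexp 103 e @ [Store 102 103]"
| "ccom i (c ;; d) = ccom i c @ ccom (i + clen c) d"
| "ccom i (Cond b c d) =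
  ctest b (i + tlen b + clen d + 1) @ ccom (i + tlen b) d @
  [JmpEq 102 102 (i + clen (Cond b c d))] @ ccom (i + tlen b + clen d + 1) c"
| "ccom i (Loop b c) =
  ctest b (i + tlen b + 1) @ [JmpEq 102 102 (i + clen (Loop b c))] @
  ccom (i + tlen b + 1) c @ [JmpEq 102 102 i]"

lemma length_ctest [simp]: "length (ctest b l) = tlen b"
 by (cases b) auto

lemma length_ccom [simp]: "length (ccom i c) = clen c"
 by (induction c arbitrary: i) auto

fun wfe :: "exp => bool" where
 "wfe (Num c) \<longleftrightarrow> True"
| "wfe (Var x) \<longleftrightarrow> x < 100"
| "wfe (Plus a b) \<longleftrightarrow> wfe a & wfe b"
| "wfe (Minus a b) \<longleftrightarrow> wfe a & wfe b"
| "wfe (Times a b) \<longleftrightarrow> wfe a & wfe b"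
| "wfe (Half a) \<longleftrightarrow> wfe a"
| "wfe (Arr t a b) \<longleftrightarrow> t < 20 & wfe a & wfe b"
| "wfe (Raw a) \<longleftrightarrow> wfe a"

fun wfb :: "bexp => bool" where
 "wfb (Less a b) \<longleftrightarrow> wfe a & wfe b"
| "wfb (Eq a b) \<longleftrightarrow> wfe a & wfe b"

fun wfc :: "com => bool" where
 "wfc (Asg x e) \<longleftrightarrow> x < 100 & wfe e"
| "wfc (Put t a b e) \<longleftrightarrow> t < 20 & wfe a & wfe b & wfe e"
| "wfc (PutRaw a e) \<longleftrightarrow> wfe a & wfe e"
| "wfc (c ;; d) \<longleftrightarrow> wfc c & wfc d"
| "wfc (Cond b c d) \<longleftrightarrow> wfb b & wfc c & wfc d"
| "wfc (Loop b c) \<longleftrightarrow> wfb b & wfc c"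

subsection \<open>Deterministic executions of the RAM\<close>

fun sx :: "nat => instr => (nat => nat) \<times> (nat => nat) => (nat => nat) \<times> (nat => nat)" where
 "sx w (Const r a) (R, M) = (R(r := wrap w a), M)"
| "sx w (Op f r p q) (R, M) = (R(r := apply_op w f (R p) (R q)), M)"
| "sx w (Load r p) (R, M) = (R(r := M (R p)), M)"
| "sx w (Store r p) (R, M) = (R, M(R r := R p))"
| "sx w _ x = x"

fun straight :: "instr => bool" where
 "straight (Rand r) = False"
| "straight (JmpLess p q l) = False"
| "straight (JmpEq p q l) = False"
| "straight _ = True"

definition code_at :: "program => nat => instr list => bool" where
 "code_at P i c \<longleftrightarrow> (\<exists>a b. P = a @ c @ b & length a = i)"

lemma code_at_append:
 "code_at P i (c @ d) \<longleftrightarrow> code_at P i c & code_at P (i + length c) d"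
proof
 assume "code_at P i (c @ d)"
 then obtain a b where "P = a @ (c @ d) @ b" "length a = i"
  unfolding code_at_def by blast
 then have "P = a @ c @ (d @ b) & length a = i"
  "P = (a @ c) @ d @ b & length (a @ c) = i + length c" by simp_all
 then show "code_at P i c & code_at P (i + length c) d"
  unfolding code_at_def by blast
next
 assume "code_at P i c & code_at P (i + length c) d"
 then obtain a b a' b' where P: "P = a @ c @ b" "length a = i"
  "P = a' @ d @ b'" "length a' = i + length c"
  unfolding code_at_def by blast
 then have "(a @ c) @ b = a' @ (d @ b')" "length (a @ c) = length a'" by simp_all
 then have "b = d @ b'" using append_eq_append_conv[of "a @ c" a' b "d @ b'"] by blast
 then show "code_at P i (c @ d)" using P unfolding code_at_def by auto
qed

lemma code_at_single: "code_at P i [a] ==> i < length P & P ! i = a"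
 unfolding code_at_def by auto

abbreviation conf :: "nat => (nat => nat) \<times> (nat => nat) => config" where
 "conf i x \<equiv> \<lparr>pc = i, reg = fst x, mem = snd x\<rparr>"

lemma run_add: "run P w (t + u) s = bind_pmf (run P w t s) (run P w u)"
proof (induction t arbitrary: s)
 case (Suc t)
 have "run P w (t + u) = (\<lambda>s. bind_pmf (run P w t s) (run P w u))"
  using Suc.IH by (rule ext)
 then show ?case by (simp add: bind_assoc_pmf)
qed (simp add: bind_return_pmf)

lemma run_trans:
 "run P w t s = return_pmf s' ==> run P w u s' = return_pmf s'' ==>
  run P w (t + u) s = return_pmf s''"
 by (simp add: run_add bind_return_pmf)

lemma run_halted: "halted P s ==> run P w t s = return_pmf s"
 by (induction t) (auto simp: step_def bind_return_pmf)

lemma run_straight: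
 assumes "code_at P i c" "list_all straight c"
 shows "run P w (length c) (conf i x) = return_pmf (conf (i + length c) (fold (sx w) c x))"
 using assms
proof (induction c arbitrary: i x)
 case (Cons a c)
 obtain R M where x: "x = (R, M)" by (cases x)
 have c: "code_at P i [a]" "code_at P (Suc i) c"
  using Cons.prems(1) code_at_append[of P i "[a]" c] by auto
 then have "\<not> halted P (conf i x)" "P ! i = a"
  using code_at_single[OF c(1)] unfolding halted_def by auto
 then have "step P w (conf i x) = return_pmf (conf (Suc i) (sx w a x))"
  using Cons.prems(2) unfolding step_def x by (cases a) (auto simp: set_reg_def)
 then show ?case
  using Cons.IH[OF c(2)] Cons.prems by (simp add: bind_return_pmf)
qed simp

lemma run_jump:
 assumes "code_at P i [J]" "J = JmpLess p q l \<or> J = JmpEq p q l"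
 shows "run P w 1 (conf i x) = return_pmf (conf (if (case J of JmpLess p q l => fst x p < fst x q | _ => fst x p = fst x q) then l else Suc i) x)"
 using code_at_single[OF assms(1)] assms(2)
 by (auto simp: step_def halted_def bind_return_pmf)

lemma straight_addr_code [simp]: "list_all straight (addr_code d t)"
 by (simp add: addr_code.simps)

lemma straight_cexp: "list_all straight (cexp d e)"
 by (induction e arbitrary: d) auto

subsection \<open>Correctness of the compilation\<close>

locale ram = imp +
 fixes w :: nat
 assumes cap: "cap > 4" and space: "20 * (cap * cap) + rb <= 2 ^ w"
begin

text \<open>The 20 arrays are interleaved: \<open>t\<close> is a residue modulo 20 and
  \<open>p * cap + q\<close> pairs two indices below \<open>cap\<close>. Hence different cells have
  different addresses, all of them behind the raw memory.\<close>

definition addr :: "nat => nat => nat => nat" where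
 "addr t p q = 20 * (p * cap + q) + t + rb"

text \<open>The scratch registers from 102 on and the ghost clock are left free, so that the
  relation survives the evaluation of expressions. Requiring all contents to be below
  \<open>cap\<close> makes every stored value a legal array index.\<close>

definition sim :: "st => (nat => nat) \<times> (nat => nat) => bool" where
 "sim s x \<longleftrightarrow>
  (\<forall>i<100. fst x i = vr s i & vr s i < cap) & fst x 100 = cap & fst x 101 = rb &
  (\<forall>a<rb. snd x a = rw s a & rw s a < cap) &
  (\<forall>t<20. \<forall>p<cap. \<forall>q<cap. snd x (addr t p q) = ar s t p q & ar s t p q < cap)"

lemma pair_less: "p < cap ==> q < cap ==> p * cap + q < cap * cap"
proof -
 assume "p < cap" "q < cap"
 then have "Suc p * cap <= cap * cap" by (intro mult_right_mono) auto
 then show ?thesis using \<open>q < cap\<close> by simp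
qed

lemma addr_less: "t < 20 ==> p < cap ==> q < cap ==> addr t p q < 2 ^ w"
proof -
 assume a: "t < 20" "p < cap" "q < cap"
 obtain z where z: "z = p * cap + q" by blast
 then have "z < cap * cap" using pair_less[of p q] a by simp
 then show ?thesis using space a(1) unfolding addr_def z[symmetric] by linarith
qed

lemma cap_less: "20 * cap < 2 ^ w"
proof -
 have "cap * 1 < cap * cap" using cap by (intro mult_strict_left_mono) auto
 then show ?thesis using space by linarith
qed

lemma addr_eq_iff:
 assumes "t < 20" "p < cap" "q < cap" "t' < 20" "p' < cap" "q' < cap"
 shows "addr t p q = addr t' p' q' \<longleftrightarrow> t = t' & p = p' & q = q'"
proof
 assume eq: "addr t p q = addr t' p' q'"
 then have e: "20 * (p * cap + q) + t = 20 * (p' * cap + q') + t'" by (simp add: addr_def)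
 then have "(20 * (p * cap + q) + t) mod 20 = (20 * (p' * cap + q') + t') mod 20" by simp
 then have t: "t = t'" using assms by (simp only: mod_mult_self4 mod_less)
 then have e: "q + p * cap = q' + p' * cap" using e by simp
 then have "(q + p * cap) mod cap = (q' + p' * cap) mod cap" by simp
 then have q: "q = q'" using assms by simp
 then show "t = t' & p = p' & q = q'" using e t assms cap by simp
qed simp

lemma addr_ge: "rb <= addr t p q"
 by (simp add: addr_def)

definition evals :: "nat => nat => instr list => (nat => nat) \<times> (nat => nat) => bool" where
 "evals d v c x \<longleftrightarrow> (let y = fold (sx w) c x in
  fst y d = v & (\<forall>i<d. fst y i = fst x i) & snd y = snd x)"

lemma sim_cong:
 "sim s x ==> \<forall>i<102. fst y i = fst x i ==> snd y = snd x ==> sim s y"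
 unfolding sim_def by simp

lemma sim_tick [simp]: "sim (s\<lparr>ck := k\<rparr>) x \<longleftrightarrow> sim s x"
 unfolding sim_def by simp

lemma addr_code_correct:
 assumes "102 <= d" "fst x 100 = cap" "fst x 101 = rb" "fst x d = p" "fst x (Suc d) = q"
  "p < cap" "q < cap" "t < 20"
 shows "evals d (addr t p q) (addr_code d t) x"
proof -
 obtain R M where x: "x = (R, M)" by (cases x)
 note l = addr_less[OF assms(8,6,7)]
 have "p * cap < 2 ^ w" "p * cap + q < 2 ^ w" "(p * cap + q) * 20 < 2 ^ w"
  "(p * cap + q) * 20 + t < 2 ^ w" "(p * cap + q) * 20 + t + rb < 2 ^ w"
  "20 < (2::nat) ^ w" "t < 2 ^ w"
 proof -
  show *: "(p * cap + q) * 20 + t + rb < 2 ^ w" "20 < (2::nat) ^ w" "t < 2 ^ w"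
  using l cap_less cap assms(8) unfolding addr_def by linarith+
  then show "p * cap < 2 ^ w" "p * cap + q < 2 ^ w" "(p * cap + q) * 20 < 2 ^ w"
  "(p * cap + q) * 20 + t < 2 ^ w"
  by (auto elim: le_less_trans[rotated])
 qed
 then show ?thesis
  using assms unfolding evals_def x by (simp add: wrap_def addr_def Let_def mult.commute addr_code.simps)
qed

lemma cexp_correct:
 "102 <= d ==> wfe e ==> ok e s ==> sim s x ==> evals d (ev e s) (cexp d e) x & ev e s < cap"
proof (induction e arbitrary: d x)
 case (Num c)
 obtain R M where x: "x = (R, M)" by (cases x)
 have "c < cap" "c < 2 ^ w" using Num cap cap_less by auto
 then show ?case using Num cap unfolding evals_def x by (simp add: wrap_def Let_def)
next
 case (Var v)
 obtain R M where x: "x = (R, M)" by (cases x)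
 have "vr s v < cap" "R v = vr s v" using Var unfolding sim_def x by auto
 moreover then have "vr s v < 2 ^ w" using cap_less by linarith
 ultimately show ?case unfolding evals_def x by (simp add: wrap_def Let_def)
next
 case (Raw a)
 let ?y = "fold (sx w) (cexp d a) x"
 have a: "evals d (ev a s) (cexp d a) x" using Raw by auto
 obtain R M where y: "?y = (R, M)" by (cases ?y)
 show ?case using a Raw.prems unfolding evals_def
  by (simp add: y Let_def) (auto simp: sim_def)
next
 case (Half a)
 let ?y = "fold (sx w) (cexp d a) x"
 have a: "evals d (ev a s) (cexp d a) x" "ev a s < cap" using Half by auto
 obtain R M where y: "?y = (R, M)" by (cases ?y)
 have "ev a s div 2 < cap" "(2::nat) < 2 ^ w" "ev a s div 2 < 2 ^ w" using a cap_less cap by auto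
 then show ?case using a Half.prems unfolding evals_def
  by (simp add: y Let_def wrap_def)
next
 case (Arr t a b)
 let ?y = "fold (sx w) (cexp d a) x"
 let ?z = "fold (sx w) (cexp (Suc d) b) ?y"
 have a: "evals d (ev a s) (cexp d a) x" "ev a s < cap" using Arr by auto
 have "sim s ?y" using sim_cong[of s x ?y] a Arr.prems by (auto simp: evals_def Let_def)
 then have b: "evals (Suc d) (ev b s) (cexp (Suc d) b) ?y" "ev b s < cap" using Arr by auto
 have z: "fst ?z d = ev a s" "fst ?z (Suc d) = ev b s" "snd ?z = snd x" "\<forall>i<d. fst ?z i = fst x i"
  using a b by (auto simp: evals_def Let_def)
 let ?u = "fold (sx w) (addr_code d t) ?z"
 have u: "evals d (addr t (ev a s) (ev b s)) (addr_code d t) ?z"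
  by (rule addr_code_correct) (use z a b Arr.prems in \<open>auto simp: sim_def\<close>)
 obtain R M where u': "?u = (R, M)" by (cases ?u)
 have *: "fst ?u d = addr t (ev a s) (ev b s)" "\<forall>i<d. fst ?u i = fst x i" "snd ?u = snd x"
  using u z by (auto simp: evals_def Let_def)
 have m: "snd x (addr t (ev a s) (ev b s)) = ar s t (ev a s) (ev b s)"
  "ar s t (ev a s) (ev b s) < cap"
  using Arr.prems a b unfolding sim_def by auto
 have "fold (sx w) (cexp d (Arr t a b)) x = sx w (Load d d) ?u" by simp
 then show ?case unfolding evals_def Let_def using * m unfolding u' by simp
next
 case (Plus a b)
 let ?y = "fold (sx w) (cexp d a) x"
 let ?z = "fold (sx w) (cexp (Suc d) b) ?y"
 have a: "evals d (ev a s) (cexp d a) x" "ev a s < cap" using Plus by auto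
 have "sim s ?y" using sim_cong[of s x ?y] a Plus.prems by (auto simp: evals_def Let_def)
 then have b: "evals (Suc d) (ev b s) (cexp (Suc d) b) ?y" "ev b s < cap" using Plus by auto
 have z: "fst ?z d = ev a s" "fst ?z (Suc d) = ev b s" "snd ?z = snd x" "\<forall>i<d. fst ?z i = fst x i"
  using a b by (auto simp: evals_def Let_def)
 have "ev a s + ev b s < cap" "ev a s + ev b s < 2 ^ w" using Plus.prems cap_less by auto
 moreover obtain R M where z': "?z = (R, M)" by (cases ?z)
 ultimately show ?case unfolding evals_def using z by (simp add: Let_def wrap_def)
next
 case (Minus a b)
 let ?y = "fold (sx w) (cexp d a) x"
 let ?z = "fold (sx w) (cexp (Suc d) b) ?y"
 have a: "evals d (ev a s) (cexp d a) x" "ev a s < cap" using Minus by auto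
 have "sim s ?y" using sim_cong[of s x ?y] a Minus.prems by (auto simp: evals_def Let_def)
 then have b: "evals (Suc d) (ev b s) (cexp (Suc d) b) ?y" "ev b s < cap" using Minus by auto
 have z: "fst ?z d = ev a s" "fst ?z (Suc d) = ev b s" "snd ?z = snd x" "\<forall>i<d. fst ?z i = fst x i"
  using a b by (auto simp: evals_def Let_def)
 have le: "ev b s <= ev a s" "ev a s - ev b s < 2 ^ w" using Minus.prems cap_less a by auto
 then have "(int (ev a s) - int (ev b s)) mod 2 ^ w = int ((ev a s - ev b s) mod 2 ^ w)"
  by (simp only: of_nat_diff[symmetric] zmod_int of_nat_power of_nat_numeral)
 then have "nat ((int (ev a s) - int (ev b s)) mod 2 ^ w) = ev a s - ev b s"
  using le by simp
 moreover have "ev a s - ev b s < cap" using a by simp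
 moreover obtain R M where z': "?z = (R, M)" by (cases ?z)
 ultimately show ?case unfolding evals_def using z by (simp add: Let_def wrap_def)
next
 case (Times a b)
 let ?y = "fold (sx w) (cexp d a) x"
 let ?z = "fold (sx w) (cexp (Suc d) b) ?y"
 have a: "evals d (ev a s) (cexp d a) x" "ev a s < cap" using Times by auto
 have "sim s ?y" using sim_cong[of s x ?y] a Times.prems by (auto simp: evals_def Let_def)
 then have b: "evals (Suc d) (ev b s) (cexp (Suc d) b) ?y" "ev b s < cap" using Times by auto
 have z: "fst ?z d = ev a s" "fst ?z (Suc d) = ev b s" "snd ?z = snd x" "\<forall>i<d. fst ?z i = fst x i"
  using a b by (auto simp: evals_def Let_def)
 have "ev a s * ev b s < cap" "ev a s * ev b s < 2 ^ w" using Times.prems cap_less by auto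
 moreover obtain R M where z': "?z = (R, M)" by (cases ?z)
 ultimately show ?case unfolding evals_def using z by (simp add: Let_def wrap_def)
qed

definition leads :: "program => nat => nat => (nat => nat) \<times> (nat => nat) => nat => st => bool" where
 "leads P T i x j s \<longleftrightarrow> (\<exists>t y. t <= T & run P w t (conf i x) = return_pmf (conf j y) & sim s y)"

lemma leadsI:
 "run P w t (conf i x) = return_pmf (conf j y) ==> sim s y ==> t <= T ==> leads P T i x j s"
 unfolding leads_def by blast

lemma leads_trans:
 assumes "leads P T i x j s" "\<And>y. sim s y ==> leads P U j y l s'" "T + U <= B"
 shows "leads P B i x l s'"
proof -
 obtain t y where t: "t <= T" "run P w t (conf i x) = return_pmf (conf j y)" "sim s y"
  using assms(1) unfolding leads_def by blast
 obtain u z where u: "u <= U" "run P w u (conf j y) = return_pmf (conf l z)" "sim s' z"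
  using assms(2)[OF t(3)] unfolding leads_def by blast
 show ?thesis using run_trans[OF t(2) u(2)] u(3) by (rule leadsI) (use t u assms(3) in linarith)
qed

lemma leads_jump:
 assumes "code_at P i [JmpEq 102 102 l]" "sim s x"
 shows "leads P 1 i x l s"
 using run_jump[OF assms(1), of 102 102 l w x] assms(2) by (intro leadsI[where t = 1]) auto

lemma leads_test:
 assumes "code_at P i (ctest b l)" "okb b s" "wfb b" "sim s x"
 shows "leads P (tlen b) i x (if bv b s then l else i + tlen b) s"
proof -
 obtain e f J where b: "b = Less e f & J = JmpLess 102 103 l \<or> b = Eq e f & J = JmpEq 102 103 l"
  by (cases b) auto
 then have c: "ctest b l = cexp 102 e @ cexp 103 f @ [J]"
  and ok: "ok e s" "ok f s" "wfe e" "wfe f" using assms by auto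
 let ?y = "fold (sx w) (cexp 102 e) x"
 let ?z = "fold (sx w) (cexp 103 f) ?y"
 have e: "evals 102 (ev e s) (cexp 102 e) x" using cexp_correct[of 102 e s x] ok assms(4) by simp
 then have y: "sim s ?y" using sim_cong[of s x ?y] assms(4) by (auto simp: evals_def Let_def)
 then have f: "evals 103 (ev f s) (cexp 103 f) ?y" using cexp_correct[of 103 f s ?y] ok by simp
 have z: "fst ?z 102 = ev e s" "fst ?z 103 = ev f s" "sim s ?z"
  using e f sim_cong[OF y, of ?z] by (auto simp: evals_def Let_def)
 let ?c = "cexp 102 e @ cexp 103 f"
 have "code_at P i (?c @ [J])" using assms(1) c by simp
 then have ca: "code_at P i ?c" "code_at P (i + length ?c) [J]"
  by (simp_all only: code_at_append)
 have r1: "run P w (length ?c) (conf i x) = return_pmf (conf (i + length ?c) ?z)"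
  using run_straight[OF ca(1), of w x] straight_cexp by simp
 have r2: "run P w 1 (conf (i + length ?c) ?z) =
  return_pmf (conf (if bv b s then l else Suc (i + length ?c)) ?z)"
  using run_jump[OF ca(2), of 102 103 l w ?z] b z by auto
 have len: "tlen b = length ?c + 1" using b by auto
 show ?thesis
  by (rule leadsI[OF run_trans[OF r1 r2, THEN trans]]) (use z(3) len in auto)
qed

lemma leads_straight:
 assumes "code_at P i c" "list_all straight c" "sim s (fold (sx w) c x)" "length c <= T"
 shows "leads P T i x (i + length c) s"
 using run_straight[OF assms(1,2), of w x] assms(3,4) by (rule leadsI)

lemma compile_Asg:
 assumes "ok e s" "wfc (Asg v e)" "clen (Asg v e) + 3 <= M" "code_at P i (ccom i (Asg v e))" "sim s x"
 shows "leads P M i x (i + clen (Asg v e)) (s\<lparr>vr := (vr s)(v := ev e s), ck := Suc (ck s)\<rparr>)"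
proof -
 let ?y = "fold (sx w) (cexp 102 e) x"
 have e: "evals 102 (ev e s) (cexp 102 e) x" "ev e s < cap" using cexp_correct[of 102 e s x] assms by simp_all
 obtain R N where y: "?y = (R, N)" by (cases ?y)
 have "ev e s < 2 ^ w" using e cap_less by linarith
 then have z: "fold (sx w) (ccom i (Asg v e)) x = (R(v := ev e s), N)"
  using e y by (simp add: evals_def wrap_def)
 have "sim (s\<lparr>vr := (vr s)(v := ev e s), ck := Suc (ck s)\<rparr>) (R(v := ev e s), N)"
  using assms e y unfolding sim_def evals_def by auto
 moreover have "list_all straight (ccom i (Asg v e))" using straight_cexp by simp
 ultimately show ?thesis
  using leads_straight[OF assms(4), of _ x M] assms(3) z by (simp del: ccom.simps)
qed

lemma compile_Put:
 assumes "ok a s" "ok b s" "ok e s" "wfc (Put t a b e)" "clen (Put t a b e) + 3 <= M" "code_at P i (ccom i (Put t a b e))" "sim s x"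
 shows "leads P M i x (i + clen (Put t a b e)) (s\<lparr>ar := put t (ev a s) (ev b s) (ev e s) (ar s), ck := Suc (ck s)\<rparr>)"
proof -
 let ?y = "fold (sx w) (cexp 102 a) x"
 let ?z = "fold (sx w) (cexp 103 b) ?y"
 let ?u = "fold (sx w) (addr_code 102 t) ?z"
 let ?v = "fold (sx w) (cexp 103 e) ?u"
 have a: "evals 102 (ev a s) (cexp 102 a) x" "ev a s < cap" using cexp_correct[of 102 a s x] assms by simp_all
 then have y: "sim s ?y" using sim_cong[of s x ?y] assms by (auto simp: evals_def Let_def)
 then have b: "evals 103 (ev b s) (cexp 103 b) ?y" "ev b s < cap" using cexp_correct[of 103 b s ?y] assms by simp_all
 then have z: "sim s ?z" using sim_cong[OF y, of ?z] by (auto simp: evals_def Let_def)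
 have z': "fst ?z 102 = ev a s" "fst ?z 103 = ev b s" using a b by (auto simp: evals_def Let_def)
 have u: "evals 102 (addr t (ev a s) (ev b s)) (addr_code 102 t) ?z"
  by (rule addr_code_correct) (use z z' a b assms in \<open>auto simp: sim_def\<close>)
 have u': "sim s ?u" using sim_cong[OF z, of ?u] u unfolding evals_def Let_def by blast
 then have e: "evals 103 (ev e s) (cexp 103 e) ?u" "ev e s < cap" using cexp_correct[of 103 e s ?u] assms by simp_all
 then have v: "sim s ?v" using sim_cong[OF u', of ?v] by (auto simp: evals_def Let_def)
 have v': "fst ?v 102 = addr t (ev a s) (ev b s)" "fst ?v 103 = ev e s"
  using u e unfolding evals_def Let_def by auto
 obtain R N where vRN: "?v = (R, N)" by (cases ?v)
 have f: "fold (sx w) (ccom i (Put t a b e)) x = (R, N(addr t (ev a s) (ev b s) := ev e s))"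
  using v' vRN by simp
 have "sim (s\<lparr>ar := put t (ev a s) (ev b s) (ev e s) (ar s), ck := Suc (ck s)\<rparr>)
  (R, N(addr t (ev a s) (ev b s) := ev e s))"
 proof -
  have ne: "q < rb ==> q ~= addr t (ev a s) (ev b s)" for q
  using addr_ge[of t "ev a s" "ev b s"] by linarith
  show ?thesis
  using v a(2) b(2) e(2) assms ne unfolding vRN sim_def
  by (auto simp: addr_eq_iff)
 qed
 moreover have "list_all straight (ccom i (Put t a b e))" using straight_cexp by simp
 ultimately show ?thesis
  using leads_straight[OF assms(6), of _ x M] assms(5) f by (simp del: ccom.simps)
qed

lemma compile_PutRaw:
 assumes "ok a s" "ok e s" "ev a s < rb" "wfc (PutRaw a e)" "clen (PutRaw a e) + 3 <= M" "code_at P i (ccom i (PutRaw a e))" "sim s x"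
 shows "leads P M i x (i + clen (PutRaw a e)) (s\<lparr>rw := (rw s)(ev a s := ev e s), ck := Suc (ck s)\<rparr>)"
proof -
 let ?y = "fold (sx w) (cexp 102 a) x"
 let ?z = "fold (sx w) (cexp 103 e) ?y"
 have a: "evals 102 (ev a s) (cexp 102 a) x" using cexp_correct[of 102 a s x] assms by simp
 then have y: "sim s ?y" using sim_cong[of s x ?y] assms by (auto simp: evals_def Let_def)
 then have b: "evals 103 (ev e s) (cexp 103 e) ?y" "ev e s < cap" using cexp_correct[of 103 e s ?y] assms by simp_all
 then have z: "sim s ?z" using sim_cong[OF y, of ?z] by (auto simp: evals_def Let_def)
 have z': "fst ?z 102 = ev a s" "fst ?z 103 = ev e s" using a b by (auto simp: evals_def Let_def)
 obtain R N where zRN: "?z = (R, N)" by (cases ?z)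
 have f: "fold (sx w) (ccom i (PutRaw a e)) x = (R, N(ev a s := ev e s))" using z' zRN by simp
 have "sim (s\<lparr>rw := (rw s)(ev a s := ev e s), ck := Suc (ck s)\<rparr>) (R, N(ev a s := ev e s))"
 proof -
  have ne: "addr t p q ~= ev a s" for t p q
  using addr_ge[of t p q] assms(3) by linarith
  show ?thesis using z b(2) assms ne unfolding zRN sim_def by auto
 qed
 moreover have "list_all straight (ccom i (PutRaw a e))" using straight_cexp by simp
 ultimately show ?thesis
  using leads_straight[OF assms(6), of _ x M] assms(5) f by (simp del: ccom.simps)
qed

text \<open>Behind one tick stands one straight piece of code, or one test with at most one further
  jump. This is never longer than the code of the command, so \<open>M\<close> instructions per tick
  suffice and machine time is at most \<open>M\<close> times the clock.\<close>

theorem compile_correct: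
 assumes "big c s s'"
 shows "wfc c ==> clen c + 3 <= M ==> code_at P i (ccom i c) ==> sim s x ==>
  leads P (M * (ck s' - ck s)) i x (i + clen c) s'"
 using assms
proof (induction arbitrary: i x rule: big.induct)
 case (Asg e s v)
 then show ?case using compile_Asg[of e s v] by simp
next
 case (Put a s b e t)
 then show ?case using compile_Put[of a s b e t] by simp
next
 case (PutRaw a s e)
 then show ?case using compile_PutRaw[of a s e] by simp
next
 case (Seq c s s' d s'')
 have ca: "code_at P i (ccom i c)" "code_at P (i + clen c) (ccom (i + clen c) d)"
  using Seq.prems(3) by (simp_all add: code_at_append)
 have le: "ck s <= ck s'" "ck s' <= ck s''" using Seq.hyps big_ck_mono by auto
 have "leads P (M * (ck s' - ck s)) i x (i + clen c) s'" using Seq.IH(1)[OF _ _ ca(1)] Seq.prems by simp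
 moreover have "leads P (M * (ck s'' - ck s')) (i + clen c) y (i + clen c + clen d) s''"
  if "sim s' y" for y using Seq.IH(2)[OF _ _ ca(2), of y] Seq.prems that by simp
 moreover have "M * (ck s' - ck s) + M * (ck s'' - ck s') <= M * (ck s'' - ck s)"
  using le by (simp add: add_mult_distrib2[symmetric])
 ultimately have "leads P (M * (ck s'' - ck s)) i x (i + clen c + clen d) s''"
  by (rule leads_trans)
 then show ?case by (simp add: add.assoc)
next
 case (CondT b s c s' d)
 let ?L = "tlen b"
 have ca: "code_at P i (ctest b (i + ?L + clen d + 1))"
  "code_at P (i + ?L + clen d + 1) (ccom (i + ?L + clen d + 1) c)"
  using CondT.prems(3) by (simp_all add: code_at_append ac_simps del: append_Cons append_Nil)
 have le: "Suc (ck s) <= ck s'" using big_ck_mono[OF CondT.hyps(3)] by simp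
 have "leads P ?L i x (i + ?L + clen d + 1) s"
  using leads_test[OF ca(1) CondT.hyps(1) _ CondT.prems(4)] CondT.prems CondT.hyps by simp
 moreover have "leads P (M * (ck s' - Suc (ck s))) (i + ?L + clen d + 1) y (i + ?L + clen d + 1 + clen c) s'"
  if "sim s y" for y using CondT.IH[OF _ _ ca(2), of y] CondT.prems that by simp
 moreover have "?L + M * (ck s' - Suc (ck s)) <= M * (ck s' - ck s)"
 proof -
  have "ck s' - ck s = Suc (ck s' - Suc (ck s))" using le by linarith
  then show ?thesis using CondT.prems(2) by simp
 qed
 ultimately have "leads P (M * (ck s' - ck s)) i x (i + ?L + clen d + 1 + clen c) s'"
  by (rule leads_trans)
 then show ?case by (simp add: ac_simps)
next
 case (CondF b s d s' c)
 let ?L = "tlen b"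
 let ?e = "i + ?L + clen d + 1 + clen c"
 have ca: "code_at P i (ctest b (i + ?L + clen d + 1))"
  "code_at P (i + ?L) (ccom (i + ?L) d)"
  "code_at P (i + ?L + clen d) [JmpEq 102 102 ?e]"
  using CondF.prems(3) by (simp_all add: code_at_append ac_simps del: append_Cons append_Nil)
 have le: "Suc (ck s) <= ck s'" using big_ck_mono[OF CondF.hyps(3)] by simp
 have "leads P ?L i x (i + ?L) s"
  using leads_test[OF ca(1) CondF.hyps(1) _ CondF.prems(4)] CondF.prems CondF.hyps by simp
 moreover have "leads P (M * (ck s' - Suc (ck s))) (i + ?L) y (i + ?L + clen d) s'"
  if "sim s y" for y using CondF.IH[OF _ _ ca(2), of y] CondF.prems that by simp
 ultimately have "leads P (?L + M * (ck s' - Suc (ck s))) i x (i + ?L + clen d) s'"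
  by (rule leads_trans) auto
 then have "leads P (M * (ck s' - ck s)) i x ?e s'"
 proof (rule leads_trans)
  show "leads P 1 (i + ?L + clen d) y ?e s'" if "sim s' y" for y using leads_jump[OF ca(3) that] .
  have "ck s' - ck s = Suc (ck s' - Suc (ck s))" using le by linarith
  then show "?L + M * (ck s' - Suc (ck s)) + 1 <= M * (ck s' - ck s)" using CondF.prems(2) by simp
 qed
 then show ?case by (simp add: ac_simps)
next
 case (LoopT b s c s' s'')
 let ?L = "tlen b"
 have ca: "code_at P i (ctest b (i + ?L + 1))"
  "code_at P (i + ?L + 1) (ccom (i + ?L + 1) c)"
  "code_at P (i + ?L + 1 + clen c) [JmpEq 102 102 i]"
  using LoopT.prems(3) by (simp_all add: code_at_append ac_simps del: append_Cons append_Nil)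
 have le: "Suc (ck s) <= ck s'" "ck s' <= ck s''" using big_ck_mono[OF LoopT.hyps(3)] big_ck_mono[OF LoopT.hyps(4)] by simp_all
 have "leads P ?L i x (i + ?L + 1) s"
  using leads_test[OF ca(1) LoopT.hyps(1) _ LoopT.prems(4)] LoopT.prems LoopT.hyps by simp
 moreover have "leads P (M * (ck s' - Suc (ck s))) (i + ?L + 1) y (i + ?L + 1 + clen c) s'"
  if "sim s y" for y using LoopT.IH(1)[OF _ _ ca(2), of y] LoopT.prems that by simp
 ultimately have "leads P (?L + M * (ck s' - Suc (ck s))) i x (i + ?L + 1 + clen c) s'"
  by (rule leads_trans) auto
 then have "leads P (M * (ck s' - ck s)) i x i s'"
 proof (rule leads_trans)
  show "leads P 1 (i + ?L + 1 + clen c) y i s'" if "sim s' y" for y using leads_jump[OF ca(3) that] .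
  have "ck s' - ck s = Suc (ck s' - Suc (ck s))" using le by linarith
  then show "?L + M * (ck s' - Suc (ck s)) + 1 <= M * (ck s' - ck s)" using LoopT.prems(2) by simp
 qed
 moreover have "leads P (M * (ck s'' - ck s')) i y (i + clen (Loop b c)) s''"
  if "sim s' y" for y using LoopT.IH(2)[of i y] LoopT.prems that by blast
 moreover have "M * (ck s' - ck s) + M * (ck s'' - ck s') <= M * (ck s'' - ck s)"
  using le by (simp add: add_mult_distrib2[symmetric])
 ultimately show ?case by (rule leads_trans)
next
 case (LoopF b s c)
 let ?L = "tlen b"
 have ca: "code_at P i (ctest b (i + ?L + 1))"
  "code_at P (i + ?L) [JmpEq 102 102 (i + clen (Loop b c))]"
  using LoopF.prems(3) by (simp_all add: code_at_append ac_simps del: append_Cons append_Nil)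
 have "leads P ?L i x (i + ?L) s"
  using leads_test[OF ca(1) LoopF.hyps(1) _ LoopF.prems(4)] LoopF.prems LoopF.hyps by simp
 moreover have "leads P 1 (i + ?L) y (i + clen (Loop b c)) s" if "sim s y" for y
  using leads_jump[OF ca(2) that] .
 ultimately have "leads P M i x (i + clen (Loop b c)) s"
  by (rule leads_trans) (use LoopF.prems(2) in auto)
 then show ?case by (simp add: leads_def)
qed

end

section \<open>Matroids given by a closure operator\<close>

text \<open>The ground set is a whole type, which is infinite in the case of edge names; finiteness
  enters through \<open>ind\<close> and through explicit finite sets.\<close>

locale matroid =
 fixes sp :: "'a set => 'a set"
 assumes sp_mono: "A \<subseteq> B ==> sp A \<subseteq> sp B"
  and sp_ext: "A \<subseteq> sp A"
  and sp_least: "A \<subseteq> sp B ==> sp A \<subseteq> sp B"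
  and exchange: "f \<in> sp (insert e A) ==> f \<notin> sp A ==> e \<in> sp (insert f A)"
begin

definition ind :: "'a set => bool" where
 "ind A \<longleftrightarrow> finite A & (\<forall>e\<in>A. e \<notin> sp (A - {e}))"

lemma spD: "x \<in> sp A ==> A \<subseteq> sp B ==> x \<in> sp B"
 using sp_least by blast

lemma sp_mono': "x \<in> sp A ==> A \<subseteq> B ==> x \<in> sp B"
 using sp_mono by blast

lemma sp_base: "x \<in> A ==> x \<in> sp A"
 using sp_ext by blast

lemma ind_subset: "ind A ==> B \<subseteq> A ==> ind B"
 unfolding ind_def using sp_mono[of "B - {e}" "A - {e}" for e] finite_subset by blast

lemma ind_empty: "ind {}"
 unfolding ind_def by simp

lemma ind_finite: "ind A ==> finite A"
 unfolding ind_def by simp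

lemma ind_not_span: "ind A ==> e \<in> A ==> e \<notin> sp (A - {e})"
 unfolding ind_def by blast

lemma ind_insert:
 assumes "ind A" "e \<notin> sp A"
 shows "ind (insert e A)"
 unfolding ind_def
proof (intro conjI ballI notI)
 show "finite (insert e A)" using assms ind_finite by simp
 fix f assume f: "f \<in> insert e A" "f \<in> sp (insert e A - {f})"
 have "e \<notin> A" using assms(2) sp_ext[of A] by blast
 show False
 proof (cases "f = e")
  case True
  then show False using f(2) assms(2) \<open>e \<notin> A\<close> by simp
 next
  case False
  then have "f \<in> A" "insert e A - {f} = insert e (A - {f})" using f by auto
  then have "f \<in> sp (insert e (A - {f}))" "f \<notin> sp (A - {f})"
  using f(2) ind_not_span[OF assms(1)] by auto
  then have "e \<in> sp (insert f (A - {f}))" by (rule exchange)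
  then show False using assms(2) \<open>f \<in> A\<close> by (simp add: insert_absorb)
 qed
qed

text \<open>Induction on \<open>card (F - J)\<close>. An element \<open>f\<close> of
  \<open>F\<close> outside \<open>J\<close> is either dropped, if the rest still spans
  \<open>J\<close>, or traded by the exchange axiom for an element of \<open>J\<close> that the rest
  does not span; neither increases the size of \<open>F\<close> nor loses the span.\<close>

lemma steinitz:
 assumes "finite F" "ind J" "J \<subseteq> sp F"
 shows "card J <= card F"
 using assms
proof (induction "card (F - J)" arbitrary: F rule: less_induct)
 case less
 show ?case
 proof (cases "F \<subseteq> J")
  case True
  have "J \<subseteq> F"
  proof
  fix e assume "e \<in> J"
  then have "e \<in> sp F" "e \<notin> sp (J - {e})" using less.prems(3) ind_not_span[OF less.prems(2)] by auto
  then show "e \<in> F" using True sp_mono[of F "J - {e}"] by blast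
  qed
  then show ?thesis using less.prems card_mono by blast
 next
  case False
  then obtain f where f: "f \<in> F" "f \<notin> J" by blast
  show ?thesis
  proof (cases "J \<subseteq> sp (F - {f})")
  case True
  have "card (F - {f} - J) < card (F - J)"
  using f less.prems(1) by (intro psubset_card_mono) auto
  from less.hyps[OF this] have "card J <= card (F - {f})" using True less.prems by simp
  then show ?thesis using card_Diff1_le[of F f] by linarith
  next
  case False
  then obtain e where e: "e \<in> J" "e \<notin> sp (F - {f})" by blast
  have "insert f (F - {f}) = F" using f by blast
  then have "e \<in> sp (insert f (F - {f}))" using e less.prems(3) by auto
  then have fe: "f \<in> sp (insert e (F - {f}))" by (rule exchange[OF _ e(2)])
  have eF: "e \<notin> F - {f}" using e sp_ext[of "F - {f}"] by blast
  let ?G = "insert e (F - {f})"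
  have "F \<subseteq> sp ?G" using fe sp_ext[of ?G] by blast
  then have "J \<subseteq> sp ?G" using less.prems(3) sp_least[of F ?G] by blast
  moreover have "card (?G - J) < card (F - J)"
  using e f less.prems(1) by (intro psubset_card_mono) auto
  moreover have "finite ?G" using less.prems by simp
  ultimately have "card J <= card ?G" using less.hyps[of ?G] less.prems(2) by simp
  also have "card ?G = card F" using eF f less.prems(1)
  by (simp add: card_Suc_Diff1 del: card_Diff_insert)
  finally show ?thesis .
  qed
 qed
qed

lemma extend:
 assumes "ind I" "I \<subseteq> F" "finite F"
 obtains B where "I \<subseteq> B" "B \<subseteq> F" "ind B" "F \<subseteq> sp B"
proof -
 have "\<exists>B. I \<subseteq> B & B \<subseteq> F & ind B & F \<subseteq> sp B"
  using assms(1,2)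
 proof (induction "card (F - I)" arbitrary: I rule: less_induct)
  case less
  show ?case
  proof (cases "F \<subseteq> sp I")
  case False
  then obtain f where f: "f \<in> F" "f \<notin> sp I" by blast
  then have "f \<notin> I" using sp_ext[of I] by blast
  then have "card (F - insert f I) < card (F - I)"
  using f assms(3) by (intro psubset_card_mono) auto
  moreover have "insert f I \<subseteq> F" using less.prems(2) f by simp
  ultimately obtain B where "insert f I \<subseteq> B" "B \<subseteq> F" "ind B" "F \<subseteq> sp B"
  using less.hyps[of "insert f I"] ind_insert[OF less.prems(1) f(2)] by metis
  then show ?thesis by (intro exI[of _ B]) simp
  next
  case True
  then show ?thesis using less.prems by (intro exI[of _ I]) simp
  qed
 qed
 then show thesis using that by blast
qed

definition rk :: "'a set => nat" where
 "rk F = (SOME r. \<exists>B. B \<subseteq> F & ind B & F \<subseteq> sp B & r = card B)"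

lemma basis_card_le:
 assumes "B \<subseteq> F" "ind B" "F \<subseteq> sp B" "B' \<subseteq> F" "ind B'" "F \<subseteq> sp B'"
 shows "card B <= card B'"
proof (rule steinitz)
 show "finite B'" by (rule ind_finite) fact
 show "B \<subseteq> sp B'" using assms(1,6) by (rule order_trans)
qed fact

lemma rk_eq:
 assumes "finite F" "B \<subseteq> F" "ind B" "F \<subseteq> sp B"
 shows "rk F = card B"
 unfolding rk_def
proof (rule some_equality)
 show "\<exists>B'. B' \<subseteq> F & ind B' & F \<subseteq> sp B' & card B = card B'" using assms by blast
 fix r assume "\<exists>B'. B' \<subseteq> F & ind B' & F \<subseteq> sp B' & r = card B'"
 then show "r = card B"
  using basis_card_le[OF assms(2-4)] basis_card_le[OF _ _ _ assms(2-4)]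
  by (elim exE conjE) (simp add: le_antisym)
qed

lemma basis_exists:
 assumes "finite F"
 obtains B where "B \<subseteq> F" "ind B" "F \<subseteq> sp B" "rk F = card B"
proof -
 obtain B where "{} \<subseteq> B" "B \<subseteq> F" "ind B" "F \<subseteq> sp B" by (rule extend[OF ind_empty _ assms]) simp
 then show thesis using that rk_eq[OF assms] by simp
qed

lemma rk_ind: "ind B ==> rk B = card B"
 using rk_eq[of B B] ind_finite[of B] sp_ext[of B] by simp

lemma ind_card_le_rk: "finite F ==> ind J ==> J \<subseteq> sp F ==> card J <= rk F"
proof -
 assume a: "finite F" "ind J" "J \<subseteq> sp F"
 obtain B where B: "B \<subseteq> F" "ind B" "F \<subseteq> sp B" "rk F = card B" by (rule basis_exists[OF a(1)])
 have "J \<subseteq> sp B" using a(3) sp_least[OF B(3)] by blast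
 then show ?thesis using steinitz[of B J] a(2) B ind_finite by simp
qed

lemma rk_le: "finite F ==> finite G ==> F \<subseteq> sp G ==> rk F <= rk G"
proof -
 assume a: "finite F" "finite G" "F \<subseteq> sp G"
 obtain B where B: "B \<subseteq> F" "ind B" "F \<subseteq> sp B" "rk F = card B" by (rule basis_exists[OF a(1)])
 then show ?thesis using ind_card_le_rk[OF a(2) B(2)] a(3) by auto
qed

lemma rk_le_card: "finite F ==> rk F <= card F"
proof -
 assume a: "finite F"
 obtain B where "B \<subseteq> F" "ind B" "F \<subseteq> sp B" "rk F = card B" by (rule basis_exists[OF a])
 then show ?thesis using card_mono[OF a] by simp
qed

lemma ind_iff_rk: "finite F ==> ind F \<longleftrightarrow> rk F = card F"
proof
 assume "finite F" "rk F = card F"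
 moreover obtain B where "B \<subseteq> F" "ind B" "F \<subseteq> sp B" "rk F = card B"
  using basis_exists \<open>finite F\<close> by blast
 ultimately show "ind F" using card_subset_eq[of F B] by simp
qed (simp add: rk_ind)

lemma span_of_rk:
 assumes "finite F" "finite G" "F \<subseteq> G" "rk G <= rk F"
 shows "G \<subseteq> sp F"
proof -
 obtain B where B: "B \<subseteq> F" "ind B" "F \<subseteq> sp B" "rk F = card B" using basis_exists assms(1) by blast
 obtain B' where B': "B \<subseteq> B'" "B' \<subseteq> G" "ind B'" "G \<subseteq> sp B'"
  using extend[OF B(2), of G] B assms by blast
 then have "card B' = rk G" using rk_eq assms(2) by metis
 then have "B = B'" using B B' assms(4) card_seteq[of B' B] ind_finite by simp
 then show ?thesis using B' B sp_mono[of B F] by blast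
qed

text \<open>The rank of \<open>I'\<close> is at least \<open>card I\<close>, hence at least its own
  size. This is how a swap is seen to keep a forest independent.\<close>

lemma ind_exchange_card:
 assumes "ind I" "finite I'" "card I' <= card I" "I \<subseteq> sp I'"
 shows "ind I'"
proof -
 have "card I <= rk I'" using ind_card_le_rk assms by blast
 then show ?thesis using ind_iff_rk[OF assms(2)] rk_le_card[OF assms(2)] assms(3) by linarith
qed

text \<open>The fundamental circuit of \<open>e\<close> is the intersection of all subsets of \<open>I\<close> that span \<open>e\<close>.\<close>

lemma sp_Diff_Diff:
 assumes "ind I" "e \<in> sp (I - {f})" "e \<in> sp (I - {g})"
 shows "e \<in> sp (I - {f} - {g})"
proof (rule ccontr)
 assume n: "e \<notin> sp (I - {f} - {g})"
 then have g: "g \<in> I - {f}" using assms(2) by (cases "g \<in> I - {f}") simp_all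
 have "insert g (I - {f} - {g}) = I - {f}" using g by blast
 then have "e \<in> sp (insert g (I - {f} - {g}))" using assms(2) by simp
 then have "g \<in> sp (insert e (I - {f} - {g}))" by (rule exchange[OF _ n])
 moreover have "insert e (I - {f} - {g}) \<subseteq> sp (I - {g})"
  using assms(3) by (auto intro: sp_base)
 ultimately have "g \<in> sp (I - {g})" by (rule spD)
 then show False using g ind_not_span[OF assms(1)] by blast
qed

text \<open>Adding an element outside the span leaves all fundamental circuits of \<open>I\<close>
  as they are: if \<open>f\<close> could now be bypassed through \<open>e\<close>, exchange would
  put \<open>e\<close> into the span of \<open>I\<close>.\<close>

lemma not_span_insert:
 assumes "a \<in> sp I" "a \<notin> sp (I - {f})" "e \<notin> sp I" "f ~= e"
 shows "a \<notin> sp (insert e I - {f})"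
proof
 assume "a \<in> sp (insert e I - {f})"
 then have "a \<in> sp (insert e (I - {f}))" using assms(4) by (simp add: insert_Diff_if)
 then have "e \<in> sp (insert a (I - {f}))" by (rule exchange[OF _ assms(2)])
 moreover have "insert a (I - {f}) \<subseteq> sp I" using assms(1) sp_base by auto
 ultimately show False using assms(3) spD[of e] by blast
qed

subsection \<open>Packing independent sets\<close>

definition packs :: "nat => 'a set => (nat => 'a set) => bool" where
 "packs k N J \<longleftrightarrow> (\<forall>i<k. ind (J i) & J i \<subseteq> N) & (\<forall>i<k. \<forall>j<k. i ~= j --> J i \<inter> J j = {})"

lemma card_packed:
 assumes "packs k N J" "finite N"
 shows "card (\<Union>i<k. J i \<inter> A) = (\<Sum>i<k. card (J i \<inter> A))"
proof (rule card_UN_disjoint)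
 show "\<forall>i\<in>{..<k}. finite (J i \<inter> A)" using assms(1) ind_finite unfolding packs_def by blast
 show "\<forall>i\<in>{..<k}. \<forall>j\<in>{..<k}. i ~= j --> J i \<inter> A \<inter> (J j \<inter> A) = {}"
  using assms(1) unfolding packs_def by blast
qed simp

text \<open>The weak duality of matroid partition, with a spanning set one level below \<open>A\<close>.\<close>

lemma packing_gap:
 assumes "finite N" "packs k N I" "packs k N J"
  and assigned: "N - A \<subseteq> (\<Union>i<k. I i)"
  and spans: "\<And>i. i < k ==> N \<inter> A \<subseteq> sp (I i \<inter> A')" and "A \<subseteq> A'"
 shows "(\<Sum>i<k. card (J i)) <= (\<Sum>i<k. card (I i)) + card ((\<Union>i<k. I i) \<inter> (A' - A))"
proof -
 have fin: "finite (I i)" "finite (J i)" if "i < k" for i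
  using that assms(2,3) ind_finite unfolding packs_def by auto
 have sub: "J i \<subseteq> N" "I i \<subseteq> N" "ind (I i)" "ind (J i)" if "i < k" for i
  using that assms(2,3) unfolding packs_def by auto
 have "(\<Sum>i<k. card (J i)) = (\<Sum>i<k. card (J i \<inter> - A)) + (\<Sum>i<k. card (J i \<inter> A))"
  unfolding sum.distrib[symmetric]
 proof (rule sum.cong)
  fix i assume "i \<in> {..<k}"
  then show "card (J i) = card (J i \<inter> - A) + card (J i \<inter> A)"
  using fin by (subst card_Un_disjoint[symmetric]) (auto intro!: arg_cong[where f = card])
 qed simp
 also have "(\<Sum>i<k. card (J i \<inter> - A)) = card (\<Union>i<k. J i \<inter> - A)"
  by (rule card_packed[OF assms(3,1), symmetric])
 \<comment> \<open>Outside \<open>A\<close> every element is already used by \<open>I\<close>, so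
   \<open>J\<close> cannot use more of them.\<close>
 also have "\<dots> <= card (\<Union>i<k. I i \<inter> - A)"
  using assigned sub fin by (intro card_mono) auto
 also have "\<dots> = (\<Sum>i<k. card (I i \<inter> - A))"
  by (rule card_packed[OF assms(2,1)])
 \<comment> \<open>Inside \<open>A\<close> each \<open>J i\<close> is independent and spanned by
   \<open>I i \<inter> A'\<close>. Replacing \<open>A'\<close> by \<open>A\<close> afterwards costs
   exactly the assigned elements of \<open>A' - A\<close>.\<close>
 also have "(\<Sum>i<k. card (J i \<inter> A)) <= (\<Sum>i<k. card (I i \<inter> A'))"
 proof (rule sum_mono)
  fix i assume "i \<in> {..<k}"
  then have i: "i < k" by simp
  show "card (J i \<inter> A) <= card (I i \<inter> A')"
  proof (rule steinitz)
  show "J i \<inter> A \<subseteq> sp (I i \<inter> A')" using spans[OF i] sub[OF i] by blast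
  show "ind (J i \<inter> A)" using ind_subset[OF sub(4)[OF i]] by blast
  qed (use fin i in auto)
 qed
 also have "(\<Sum>i<k. card (I i \<inter> A')) = (\<Sum>i<k. card (I i \<inter> A)) + (\<Sum>i<k. card (I i \<inter> (A' - A)))"
  unfolding sum.distrib[symmetric]
 proof (rule sum.cong)
  fix i assume "i \<in> {..<k}"
  then show "card (I i \<inter> A') = card (I i \<inter> A) + card (I i \<inter> (A' - A))"
  using fin \<open>A \<subseteq> A'\<close> by (subst card_Un_disjoint[symmetric]) (auto intro!: arg_cong[where f = card])
 qed simp
 also have "(\<Sum>i<k. card (I i \<inter> (A' - A))) = card (\<Union>i<k. I i \<inter> (A' - A))"
  by (rule card_packed[OF assms(2,1), symmetric])
 finally have "(\<Sum>i<k. card (J i)) \<le>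
  ((\<Sum>i<k. card (I i \<inter> - A)) + (\<Sum>i<k. card (I i \<inter> A))) + card (\<Union>i<k. I i \<inter> (A' - A))"
  by simp
 also have "(\<Sum>i<k. card (I i \<inter> - A)) + (\<Sum>i<k. card (I i \<inter> A)) = (\<Sum>i<k. card (I i))"
  unfolding sum.distrib[symmetric]
 proof (rule sum.cong)
  fix i assume "i \<in> {..<k}"
  then show "card (I i \<inter> - A) + card (I i \<inter> A) = card (I i)"
  using fin by (subst card_Un_disjoint[symmetric]) (auto intro!: arg_cong[where f = card])
 qed simp
 also have "(\<Union>i<k. I i \<inter> (A' - A)) = (\<Union>i<k. I i) \<inter> (A' - A)" by blast
 finally show ?thesis .
qed

text \<open>
 The rank of \<open>F j\<close> in the contraction by \<open>X\<close> halves over any \<open>2 k\<close> consecutive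
 indices \<open>j\<close>, because the part of these sets outside \<open>X\<close> splits into \<open>k\<close> sets that are
 independent in the contraction.
\<close>

lemma sparsifier_span:
 assumes I: "packs k H I" and finH: "finite H"
  and F: "\<And>j. j < L ==> F j \<subseteq> H" "\<And>j. Suc j < L ==> F (Suc j) \<subseteq> sp (F j)"
  and disj: "\<And>i j. i < j ==> j < L ==> F i \<inter> F j = {}"
  and tight: "\<And>i. i < k ==> X \<subseteq> sp (I i \<inter> X)" and rest: "H - X \<subseteq> (\<Union>i<k. I i)" and "X \<subseteq> H"
  and k: "k > 0" and lg: "rk H < 2 ^ lg" and L: "L = 2 * k * lg" and lg0: "lg > 0"
 shows "F (L - 1) \<subseteq> sp X"
proof -
 have finF: "finite (F j)" if "j < L" for j by (rule finite_subset[OF F(1)[OF that] finH])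
 have finX: "finite X" by (rule finite_subset[OF \<open>X \<subseteq> H\<close> finH])
 \<comment> \<open>The rank of \<open>F j\<close> after contracting \<open>X\<close>.\<close>
 define \<rho> where "\<rho> j = rk (X \<union> F j) - rk X" for j
 have rkX: "rk X = card (I i \<inter> X)" if "i < k" for i
 proof (rule rk_eq[OF finX])
  show "ind (I i \<inter> X)" using I that ind_subset[of "I i"] unfolding packs_def by auto
 qed (use tight[OF that] in auto)
 have F_le: "F j \<subseteq> sp (F i)" if "i <= j" "j < L" for i j
  using that
 proof (induction j rule: dec_induct)
  case base then show ?case using sp_ext[of "F i"] by simp
 next
  case (step j) then show ?case using F(2)[of j] sp_least[of "F j" "F i"] by auto
 qed
 have \<rho>_le: "rk (X \<union> F j) <= rk (X \<union> F i)" if "i <= j" "j < L" for i j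
 proof (rule rk_le)
  show "X \<union> F j \<subseteq> sp (X \<union> F i)" using F_le[OF that] sp_mono[of "F i" "X \<union> F i"] sp_ext[of "X \<union> F i"] by blast
 qed (use finX finF that in auto)
 \<comment> \<open>Double counting of the elements outside \<open>X\<close> in the
   \<open>2 k\<close> disjoint sets \<open>F a\<close>, ..., \<open>F b\<close>: each set
   contributes at least \<open>\<rho> b\<close> of them, while the \<open>k\<close> sets
   \<open>I i\<close> cover them all with at most \<open>\<rho> a\<close> each.\<close>
 have half: "2 * \<rho> b <= \<rho> a" if ab: "b = a + 2 * k - 1" "b < L" for a b
 proof -
  let ?Z = "\<Union>j\<in>{a..b}. F j"
  have "a <= b" using ab k by linarith
  have finZ: "finite ?Z" using finF ab by auto
  have ZH: "?Z \<subseteq> H"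
  proof (rule UN_least)
  show "F j \<subseteq> H" if "j \<in> {a..b}" for j using F(1)[of j] that ab by simp
  qed
  have ZF: "X \<union> ?Z \<subseteq> sp (X \<union> F a)"
  proof -
  have "F j \<subseteq> sp (X \<union> F a)" if "j \<in> {a..b}" for j
  using F_le[of a j] that ab sp_mono[of "F a" "X \<union> F a"] by auto
  then show ?thesis using sp_ext[of "X \<union> F a"] by blast
  qed
  \<comment> \<open>By tightness \<open>I i\<close> meets \<open>X\<close> in a basis of
    \<open>X\<close>, so its part outside \<open>X\<close> remains independent when \<open>X\<close>
    is contracted.\<close>
  have card_i: "card (I i \<inter> (?Z - X)) <= \<rho> a" if "i < k" for i
  proof -
  have fI: "finite (I i)" "ind (I i)" using that I ind_finite unfolding packs_def by auto
  have "card (I i \<inter> (X \<union> ?Z)) <= rk (X \<union> F a)"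
  proof (rule ind_card_le_rk)
  show "ind (I i \<inter> (X \<union> ?Z))" using ind_subset[OF fI(2)] by blast
  show "finite (X \<union> F a)" using finX finF \<open>a <= b\<close> ab by simp
  show "I i \<inter> (X \<union> ?Z) \<subseteq> sp (X \<union> F a)" using ZF by blast
  qed
  moreover have "card (I i \<inter> (X \<union> ?Z)) = card (I i \<inter> X) + card (I i \<inter> (?Z - X))"
  using fI by (subst card_Un_disjoint[symmetric]) (auto intro!: arg_cong[where f = card])
  ultimately show ?thesis using rkX[OF that] unfolding \<rho>_def by linarith
  qed
  have "?Z - X \<subseteq> (\<Union>i<k. I i \<inter> (?Z - X))" using rest ZH by blast
  then have "card (?Z - X) <= card (\<Union>i<k. I i \<inter> (?Z - X))"
  using finZ by (intro card_mono) auto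
  also have "\<dots> = (\<Sum>i<k. card (I i \<inter> (?Z - X)))" by (rule card_packed[OF I finH])
  also have "\<dots> <= (\<Sum>i<k. \<rho> a)" using card_i by (intro sum_mono) auto
  finally have up: "card (?Z - X) <= k * \<rho> a" by simp
  \<comment> \<open>A basis of \<open>X\<close> together with \<open>F j - X\<close> spans
    \<open>X \<union> F j\<close>, and the contracted rank does not grow with the index.\<close>
  have lo: "\<rho> b <= card (F j - X)" if "j \<in> {a..b}" for j
  proof -
  have j: "j <= b" "j < L" using that ab by auto
  obtain B where B: "B \<subseteq> X" "ind B" "X \<subseteq> sp B" "rk X = card B"
  using basis_exists[OF finX] by blast
  have "rk (X \<union> F j) <= rk (B \<union> (F j - X))"
  proof (rule rk_le)
  have "X \<subseteq> sp (B \<union> (F j - X))" using B(3) sp_mono[of B "B \<union> (F j - X)"] by blast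
  then show "X \<union> F j \<subseteq> sp (B \<union> (F j - X))" using sp_ext[of "B \<union> (F j - X)"] by blast
  qed (use finX finF j ind_finite[OF B(2)] in auto)
  also have "\<dots> <= card (B \<union> (F j - X))" using finF j ind_finite[OF B(2)] by (intro rk_le_card) auto
  also have "\<dots> <= rk X + card (F j - X)" using B(4) card_Un_le[of B "F j - X"] by simp
  finally show ?thesis using \<rho>_le[OF j(1) ab(2)] unfolding \<rho>_def by linarith
  qed
  have "card (?Z - X) = (\<Sum>j\<in>{a..b}. card (F j - X))"
  proof -
  have Z: "?Z - X = (\<Union>j\<in>{a..b}. F j - X)" by blast
  have "F i \<inter> F j = {}" if "i \<in> {a..b}" "j \<in> {a..b}" "i ~= j" for i j
  using disj[of i j] disj[of j i] that ab by (cases "i < j") auto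
  moreover have "finite (F j - X)" if "j \<in> {a..b}" for j using finF that ab by simp
  ultimately show ?thesis unfolding Z by (intro card_UN_disjoint) (simp, blast, blast)
  qed
  also have "\<dots> \<ge> (\<Sum>j\<in>{a..b}. \<rho> b)" using lo by (intro sum_mono) auto
  finally have "(Suc b - a) * \<rho> b <= card (?Z - X)" by simp
  then have "(Suc b - a) * \<rho> b <= k * \<rho> a" using up by (rule order_trans)
  moreover have "Suc b - a = k * 2" using ab k by linarith
  ultimately show ?thesis using k by (simp add: mult.assoc)
 qed
 \<comment> \<open>After \<open>lg\<close> blocks of \<open>2 k\<close> indices the contracted rank,
   initially below \<open>2 ^ lg\<close>, must be 0.\<close>
 have dec: "\<rho> (2 * k * t - 1) * 2 ^ t <= \<rho> 0" if "t <= lg" "t > 0" for t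
  using that(2,1)
 proof (induction t rule: nat_induct_non_zero)
  case 1
  have "2 * k * 1 <= 2 * k * lg" using lg0 by (intro mult_left_mono) auto
  then have "2 * k - 1 < L" using L k by linarith
  then show ?case using half[of "2 * k - 1" 0] by (simp add: mult.commute)
 next
  case (Suc t)
  have lt: "2 * k * Suc t - 1 < L" "2 * k * t <= 2 * k * Suc t - 1" "2 * k * t - 1 <= 2 * k * t"
  proof -
  have "2 * k * Suc t <= 2 * k * lg" using Suc.prems by (intro mult_left_mono) auto
  moreover have "2 * k * Suc t > 0" using k by simp
  ultimately show "2 * k * Suc t - 1 < L" using L by linarith
  qed (use k in simp_all)
  have "2 * k * Suc t - 1 = 2 * k * t + 2 * k - 1" using k by simp
  then have "2 * \<rho> (2 * k * Suc t - 1) <= \<rho> (2 * k * t)" using half[of "2 * k * Suc t - 1" "2 * k * t"] lt(1) by simp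
  also have "\<dots> <= \<rho> (2 * k * t - 1)"
  using \<rho>_le[OF lt(3)] lt(1,2) unfolding \<rho>_def by (intro diff_le_mono) linarith
  finally have "2 * \<rho> (2 * k * Suc t - 1) * 2 ^ t <= \<rho> (2 * k * t - 1) * 2 ^ t" by simp
  also have "\<dots> <= \<rho> 0" using Suc by simp
  finally show ?case by (simp add: ac_simps)
 qed
 have L1: "L - 1 < L" "0 < L" using L k lg0 by auto
 have "\<rho> 0 <= rk (X \<union> F 0)" unfolding \<rho>_def by simp
 also have "\<dots> <= rk H"
 proof (rule rk_le)
  show "X \<union> F 0 \<subseteq> sp H" using \<open>X \<subseteq> H\<close> F(1)[OF L1(2)] sp_ext[of H] by blast
 qed (use finH finX finF[OF L1(2)] in simp_all)
 also have "\<dots> < 2 ^ lg" by (rule lg)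
 finally have "\<rho> 0 < 2 ^ lg" .
 moreover have "\<rho> (L - 1) * 2 ^ lg <= \<rho> 0" using dec[of lg] lg0 L by blast
 ultimately have "\<rho> (L - 1) * 2 ^ lg < 1 * 2 ^ lg" by linarith
 then have "\<rho> (L - 1) = 0" by (simp only: mult_less_cancel2) simp
 then have "rk (X \<union> F (L - 1)) <= rk X" unfolding \<rho>_def by simp
 then have "X \<union> F (L - 1) \<subseteq> sp X" using finX finF[OF L1(1)] by (intro span_of_rk) simp_all
 then show ?thesis by blast
qed

text \<open>The case \<open>A = A' = sp X\<close> of \<open>packing_gap\<close>, in which the error
  term is empty: whatever lies outside \<open>sp X\<close> belongs to \<open>H\<close> and is
  assigned, and each \<open>I i \<inter> X\<close> spans all of \<open>sp X\<close>.\<close>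

lemma packing_optimal:
 assumes I: "packs k H I" and J: "packs k G J" and fin: "finite G" and "H \<subseteq> G"
  and tight: "\<And>i. i < k ==> X \<subseteq> sp (I i \<inter> X)" and rest: "H - X \<subseteq> (\<Union>i<k. I i)"
  and "X \<subseteq> H" and out: "G - H \<subseteq> sp X"
 shows "(\<Sum>i<k. card (J i)) <= (\<Sum>i<k. card (I i))"
proof -
 let ?A = "sp X"
 have "packs k G I" using I \<open>H \<subseteq> G\<close> unfolding packs_def by blast
 moreover have "G - ?A \<subseteq> (\<Union>i<k. I i)" using rest out sp_ext[of X] by blast
 moreover have "G \<inter> ?A \<subseteq> sp (I i \<inter> ?A)" if "i < k" for i
 proof -
  have "?A \<subseteq> sp (I i \<inter> X)" using tight[OF that] by (rule sp_least)
  also have "\<dots> \<subseteq> sp (I i \<inter> ?A)" using sp_ext[of X] by (intro sp_mono) blast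
  finally show ?thesis by blast
 qed
 ultimately have "(\<Sum>i<k. card (J i)) <= (\<Sum>i<k. card (I i)) + card ((\<Union>i<k. I i) \<inter> (?A - ?A))"
  by (intro packing_gap[OF fin _ J]) simp_all
 then show ?thesis by simp
qed

subsection \<open>Augmenting a packing\<close>

text \<open>
 \<open>q\<close> lists the elements in the order in which a search reached them, and \<open>par b\<close> is the position of
 the element from which \<open>q b\<close> was reached. The last condition excludes shortcuts.
\<close>

definition chain :: "(nat => 'a set) => (nat => 'a) => (nat => nat) => nat => bool" where
 "chain I q par b \<longleftrightarrow> (\<forall>b'\<le>b. \<forall>h. q b' \<in> I h -->
  par b' < b' & q (par b') \<in> sp (I h) & q (par b') \<notin> sp (I h - {q b'}) &
  (\<forall>a<par b'. q a \<in> sp (I h - {q b'})))"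

definition free_for :: "(nat => 'a set) => (nat => 'a) => nat => nat => bool" where
 "free_for I q b i \<longleftrightarrow> q b \<notin> sp (I i) & (\<forall>a<b. q a \<in> sp (I i))"

text \<open>The path is executed from its end: once \<open>q b\<close> has left \<open>I h\<close>,
  its predecessor is free for \<open>h\<close>. The rest of the path survives the move. In
  \<open>I i\<close> the circuits are intact because \<open>q b\<close> lay outside the span; in
  \<open>I h\<close> the elements before \<open>par b\<close> are spanned without
  \<open>q b\<close>, which is where the absence of shortcuts is used.\<close>

lemma move_chain:
 assumes ch: "chain I q par b" and fr: "free_for I q b i" and h: "q b \<in> I h"
  and ind: "\<And>j. ind (I j)" and disj: "\<And>j l. j ~= l ==> I j \<inter> I l = {}"
  and inj: "\<And>a a'. a <= b ==> a' <= b ==> q a = q a' ==> a = a'"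
  and I': "I' = I(i := insert (q b) (I i), h := I h - {q b})"
 shows "par b < b" "chain I' q par (par b)" "free_for I' q (par b) h" "ind (I' j)"
  "j ~= l ==> I' j \<inter> I' l = {}"
proof -
 have ih: "i ~= h" using fr h sp_ext[of "I h"] unfolding free_for_def by blast
 have pb: "par b < b" "q (par b) \<in> sp (I h)" "q (par b) \<notin> sp (I h - {q b})"
  "\<And>a. a < par b ==> q a \<in> sp (I h - {q b})"
  using ch[unfolded chain_def, rule_format, OF order.refl h] by simp_all
 show "par b < b" by fact
 have ind': "ind (insert (q b) (I i))"
  using fr ind_insert[OF ind, of "q b" i] unfolding free_for_def by simp
 show "ind (I' j)" using ind ind' ind_subset[OF ind, of "I h - {q b}" h] ih unfolding I' by auto
 show "I' j \<inter> I' l = {}" if "j ~= l"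
 proof -
  have d: "x \<in> I j ==> x \<in> I l ==> j = l" for x j l using disj[of j l] by blast
  have m: "x \<in> I' j ==> if x = q b then j = i else x \<in> I j" for x j
  using d[of "q b" j h] h ih unfolding I' by (cases "j = i"; cases "j = h") auto
  have "j = l" if "x \<in> I' j" "x \<in> I' l" for x
  using m[OF that(1)] m[OF that(2)] d[of x j l] by (cases "x = q b") simp_all
  then show ?thesis using that by blast
 qed
 show "free_for I' q (par b) h" using pb unfolding free_for_def I' by auto
 show "chain I' q par (par b)" unfolding chain_def
 proof (intro allI impI)
  fix b' g assume b': "b' <= par b" and g: "q b' \<in> I' g"
  have ne: "q b' ~= q b" using inj[of b' b] b' pb(1) by auto
  then have gI: "q b' \<in> I g" using g ih unfolding I' by (auto split: if_splits)
  have b'b: "b' <= b" using b' pb(1) by simp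
  then have c: "par b' < b'" "q (par b') \<in> sp (I g)" "q (par b') \<notin> sp (I g - {q b'})"
  "\<And>a. a < par b' ==> q a \<in> sp (I g - {q b'})"
  using ch[unfolded chain_def, rule_format, OF b'b gI] by simp_all
  have pp: "par b' < par b" using c(1) b' by simp
  have early: "q a \<in> sp (I h - {q b})" if "a <= par b'" for a using pb(4) that pp by simp
  have "q (par b') \<in> sp (I' g) & q (par b') \<notin> sp (I' g - {q b'}) &
  (\<forall>a<par b'. q a \<in> sp (I' g - {q b'}))"
  proof (cases "g = i")
  case True
  have g: "I' g = insert (q b) (I g)" using True ih unfolding I' by simp
  have "q b \<notin> sp (I g)" using fr True unfolding free_for_def by simp
  then have "q (par b') \<notin> sp (I' g - {q b'})"
  using not_span_insert[OF c(2,3)] ne unfolding g by simp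
  moreover have "q (par b') \<in> sp (I' g)" using c(2) unfolding g by (rule sp_mono') auto
  moreover have "q a \<in> sp (I' g - {q b'})" if "a < par b'" for a
  using c(4)[OF that] unfolding g by (rule sp_mono') auto
  ultimately show ?thesis by simp
  next
  case False
  show ?thesis
  proof (cases "g = h")
  case True
  have g: "I' g = I h - {q b}" using True ih unfolding I' by simp
  have "I' g - {q b'} \<subseteq> I g - {q b'}" using True unfolding g by auto
  from sp_mono[OF this] have "q (par b') \<notin> sp (I' g - {q b'})" using c(3) by blast
  moreover have "q a \<in> sp (I' g - {q b'})" if "a < par b'" for a
  proof -
  have "q a \<in> sp (I h - {q b})" by (rule early) (use that in simp)
  moreover have "q a \<in> sp (I h - {q b'})" using c(4)[OF that] True by simp
  ultimately show ?thesis unfolding g by (rule sp_Diff_Diff[OF ind])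
  qed
  moreover have "q (par b') \<in> sp (I' g)" unfolding g by (rule early) simp
  ultimately show ?thesis by simp
  next
  case False
  then have "I' g = I g" using \<open>g ~= i\<close> unfolding I' by simp
  then show ?thesis using c by simp
  qed
  qed
  then show "par b' < b' & q (par b') \<in> sp (I' g) & q (par b') \<notin> sp (I' g - {q b'}) &
  (\<forall>a<par b'. q a \<in> sp (I' g - {q b'}))" using c(1) by blast
 qed
qed

end

section \<open>The cycle matroid of a graph\<close>

definition conn :: "('e => 'v \<times> 'v) => 'e set => ('v \<times> 'v) set" where
 "conn ep F = (ep ` F \<union> (ep ` F)\<inverse>)\<^sup>*"

lemma conn_refl [simp]: "(x, x) \<in> conn ep F"
 unfolding conn_def by simp

lemma conn_sym: "(x, y) \<in> conn ep F ==> (y, x) \<in> conn ep F"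
proof -
 assume "(x, y) \<in> conn ep F"
 moreover have "sym (conn ep F)" unfolding conn_def by (intro sym_rtrancl symI) auto
 ultimately show ?thesis by (rule symD[rotated])
qed

lemma conn_trans: "(x, y) \<in> conn ep F ==> (y, z) \<in> conn ep F ==> (x, z) \<in> conn ep F"
 unfolding conn_def by (rule rtrancl_trans)

lemma conn_mono: "F \<subseteq> G ==> conn ep F \<subseteq> conn ep G"
 unfolding conn_def by (intro rtrancl_mono) blast

lemma conn_edge: "e \<in> F ==> ep e \<in> conn ep F"
 unfolding conn_def by (intro r_into_rtrancl) blast

lemma conn_least:
 assumes "\<And>e. e \<in> F ==> ep e \<in> conn ep' G"
 shows "conn ep F \<subseteq> conn ep' G"
proof -
 have "ep ` F \<union> (ep ` F)\<inverse> \<subseteq> conn ep' G"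
 proof
  fix x assume "x \<in> ep ` F \<union> (ep ` F)\<inverse>"
  then obtain u v where "(u, v) \<in> ep ` F" "x = (u, v) \<or> x = (v, u)" by (cases x) auto
  then show "x \<in> conn ep' G" using assms conn_sym[of u v ep' G] by auto
 qed
 then have "conn ep F \<subseteq> (conn ep' G)\<^sup>*" unfolding conn_def by (rule rtrancl_mono)
 then show ?thesis unfolding conn_def by simp
qed

text \<open>A connection needs to cross the new edge at most once, in one of its two
  directions.\<close>

lemma conn_insert:
 assumes "ep e = (u, v)"
 shows "(x, y) \<in> conn ep (insert e F) \<longleftrightarrow> (x, y) \<in> conn ep F \<or>
  (x, u) \<in> conn ep F & (v, y) \<in> conn ep F \<or> (x, v) \<in> conn ep F & (u, y) \<in> conn ep F"
  (is "?L \<longleftrightarrow> ?R y")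
proof
 assume ?L
 then have "(x, y) \<in> (ep ` insert e F \<union> (ep ` insert e F)\<inverse>)\<^sup>*" unfolding conn_def .
 then show "?R y"
 proof (induction rule: rtrancl_induct)
  case (step y z)
  have "(y, z) \<in> ep ` insert e F \<or> (z, y) \<in> ep ` insert e F" using step(2) by simp
  then obtain g where "g \<in> insert e F" "(y, z) = ep g \<or> (z, y) = ep g" by (elim disjE imageE) blast+
  then have "(y, z) \<in> conn ep F \<or> y = u & z = v \<or> y = v & z = u"
  using assms conn_edge[of g F ep] conn_sym[of z y ep F] by auto
  then show ?case
  proof (elim disjE)
  assume "(y, z) \<in> conn ep F"
  then show ?thesis
  using step.IH conn_trans[of x y ep F z] conn_trans[of v y ep F z] conn_trans[of u y ep F z] by blast
  next
  assume "y = u & z = v"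
  then show ?thesis using step.IH by simp blast
  next
  assume "y = v & z = u"
  then show ?thesis using step.IH by simp blast
  qed
 qed simp
next
 assume R: "?R y"
 have m: "conn ep F \<subseteq> conn ep (insert e F)" by (rule conn_mono) blast
 have uv: "(u, v) \<in> conn ep (insert e F)" using conn_edge[of e "insert e F" ep] assms by simp
 have vu: "(v, u) \<in> conn ep (insert e F)" using uv by (rule conn_sym)
 from R show ?L
 proof (elim disjE conjE)
  assume "(x, u) \<in> conn ep F" "(v, y) \<in> conn ep F"
  then have "(x, u) \<in> conn ep (insert e F)" "(v, y) \<in> conn ep (insert e F)" using m by auto
  then show ?L using conn_trans[OF conn_trans[OF _ uv]] by simp
 next
  assume "(x, v) \<in> conn ep F" "(u, y) \<in> conn ep F"
  then have "(x, v) \<in> conn ep (insert e F)" "(u, y) \<in> conn ep (insert e F)" using m by auto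
  then show ?L using conn_trans[OF conn_trans[OF _ vu]] by simp
 qed (use m in blast)
qed

definition espan :: "('e => 'v \<times> 'v) => 'e set => 'e set" where
 "espan ep F = {e. ep e \<in> conn ep F}"

interpretation graphic: matroid "espan ep" for ep :: "'e => 'v \<times> 'v"
proof
 fix A B :: "'e set" and e f :: 'e
 show "espan ep A \<subseteq> espan ep B" if "A \<subseteq> B" using conn_mono[OF that, of ep] unfolding espan_def by auto
 show "A \<subseteq> espan ep A" unfolding espan_def using conn_edge[of _ A ep] by auto
 show "espan ep A \<subseteq> espan ep B" if "A \<subseteq> espan ep B"
 proof -
  have "conn ep A \<subseteq> conn ep B" by (rule conn_least) (use that in \<open>auto simp: espan_def\<close>)
  then show ?thesis unfolding espan_def by auto
 qed
 show "e \<in> espan ep (insert f A)" if fe: "f \<in> espan ep (insert e A)" "f \<notin> espan ep A"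
 proof -
  obtain u v x y where uv: "ep e = (u, v)" "ep f = (x, y)" by fastforce
  then have "(x, y) \<in> conn ep (insert e A)" "(x, y) \<notin> conn ep A"
  using fe unfolding espan_def by auto
  then have "(x, u) \<in> conn ep A & (v, y) \<in> conn ep A \<or> (x, v) \<in> conn ep A & (u, y) \<in> conn ep A"
  using conn_insert[of ep e u v x y A, OF uv(1)] by simp
  then have "(u, v) \<in> conn ep (insert f A)"
  using conn_insert[of ep f x y u v A, OF uv(2)]
  conn_sym[of x u ep A] conn_sym[of v y ep A] conn_sym[of x v ep A] by blast
  then show ?thesis unfolding espan_def using uv by simp
 qed
qed

section \<open>Contractible rooted forests\<close>

text \<open>The labels in a tree will be bounded by the square of the number of its vertices; hence
  the assumption \<open>n * n < cap\<close>.\<close>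

locale net = imp +
 fixes n m :: nat and ep :: "nat => nat \<times> nat"
 assumes ep: "e < m ==> fst (ep e) < n & snd (ep e) < n"
  and cap_n: "n * n < cap" and cap_m: "m < cap" and cap4: "4 < cap"
begin

subsection \<open>Partitions with linked member lists\<close>

text \<open>
 \<open>c\<close> maps a vertex to the representative of its class; the members of the class of \<open>r\<close> form a list
 that starts with \<open>r\<close>, is linked by \<open>nx\<close>, ends with \<open>l r\<close> and has length \<open>z r\<close>.
\<close>

definition members where
 "members c nx z l r xs \<longleftrightarrow> xs ~= [] & hd xs = r & last xs = l r & distinct xs &
  set xs = {v. v < n & c v = r} & length xs = z r &
  (\<forall>i. Suc i < length xs --> nx (xs ! i) = xs ! Suc i)"

definition parts :: "(nat => nat) => (nat => nat) => (nat => nat) => (nat => nat) => bool" where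
 "parts c nx z l \<longleftrightarrow> (\<forall>v<n. c v < n & c (c v) = c v) &
  (\<forall>r<n. c r = r --> (\<exists>xs. members c nx z l r xs))"

definition relabel :: "nat set => nat => (nat => nat) => nat => nat" where
 "relabel X a c = (\<lambda>v. if v \<in> X then a else c v)"

lemma parts_rep: "parts c nx z l ==> v < n ==> c v < n & c (c v) = c v"
 unfolding parts_def by blast

lemma parts_members:
 assumes "parts c nx z l" "r < n" "c r = r"
 obtains xs where "members c nx z l r xs"
 using assms unfolding parts_def by blast

lemma parts_size:
 assumes "parts c nx z l" "r < n" "c r = r"
 shows "z r = card {v. v < n & c v = r}" "0 < z r" "z r <= n"
proof -
 obtain xs where xs: "members c nx z l r xs" using parts_members[OF assms] .
 then have "distinct xs" "set xs = {v. v < n & c v = r}" "length xs = z r" "xs ~= []"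
  unfolding members_def by auto
 then show 1: "z r = card {v. v < n & c v = r}" using distinct_card[of xs] by simp
 show "0 < z r" using \<open>xs ~= []\<close> unfolding \<open>length xs = z r\<close>[symmetric] by simp
 have "card {v. v < n & c v = r} <= card {..<n}" by (rule card_mono) auto
 then show "z r <= n" using 1 by simp
qed

text \<open>The member lists are concatenated by a single new link from the last member of
  \<open>a\<close> to \<open>b\<close>, and only the members of \<open>b\<close> change their
  representative. This is why merging costs time proportional to the class of \<open>b\<close>
  alone.\<close>

lemma parts_merge:
 assumes P: "parts c nx z l" and ab: "a < n" "c a = a" "b < n" "c b = b" "a ~= b"
 shows "parts (relabel {v. v < n & c v = b} a c) (nx(l a := b)) (z(a := z a + z b)) (l(a := l b))"
proof -
 let ?c = "relabel {v. v < n & c v = b} a c"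
 have cr: "?c v = (if c v = b then a else c v)" if "v < n" for v
  using that unfolding relabel_def by simp
 have 1: "\<forall>v<n. ?c v < n & ?c (?c v) = ?c v"
  using parts_rep[OF P] ab cr by simp
 have "\<exists>ys. members ?c (nx(l a := b)) (z(a := z a + z b)) (l(a := l b)) r ys"
  if r: "r < n" "?c r = r" for r
 proof -
  obtain xa where xa: "members c nx z l a xa" using parts_members[OF P ab(1,2)] .
  obtain xb where xb: "members c nx z l b xb" using parts_members[OF P ab(3,4)] .
  have A: "xa ~= []" "hd xa = a" "last xa = l a" "distinct xa" "set xa = {v. v < n & c v = a}"
  "length xa = z a" "\<And>i. Suc i < length xa ==> nx (xa ! i) = xa ! Suc i"
  using xa unfolding members_def by simp_all
  have B: "xb ~= []" "hd xb = b" "last xb = l b" "distinct xb" "set xb = {v. v < n & c v = b}"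
  "length xb = z b" "\<And>i. Suc i < length xb ==> nx (xb ! i) = xb ! Suc i"
  using xb unfolding members_def by simp_all
  have la: "l a \<in> set xa" using last_in_set[OF A(1)] A(3) by simp
  have la': "l a = xa ! (length xa - 1)" using last_conv_nth[OF A(1)] A(3) by simp
  have b0: "xb ! 0 = b" using hd_conv_nth[OF B(1)] B(2) by simp
  have disj: "set xa \<inter> set xb = {}" unfolding A(5) B(5) using ab(5) by auto
  show ?thesis
  proof (cases "r = a")
  case True
  have "members ?c (nx(l a := b)) (z(a := z a + z b)) (l(a := l b)) a (xa @ xb)"
  unfolding members_def
  proof (intro conjI allI impI)
  show "set (xa @ xb) = {v. v < n & ?c v = a}"
  unfolding set_append A(5) B(5) using ab(5) cr by auto
  fix i assume i: "Suc i < length (xa @ xb)"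
  show "(nx(l a := b)) ((xa @ xb) ! i) = (xa @ xb) ! Suc i"
  proof (cases "Suc i < length xa")
  case True
  have "xa ! i ~= l a"
  unfolding la' using True nth_eq_iff_index_eq[OF A(4), of i "length xa - 1"] by simp
  then show ?thesis using True A(7) by (simp add: nth_append)
  next
  case False
  show ?thesis
  proof (cases "Suc i = length xa")
  case True
  then have "i = length xa - 1" by simp
  then have "xa ! i = l a" unfolding la' by simp
  then show ?thesis using True b0 by (simp add: nth_append)
  next
  case F: False
  define j where "j = i - length xa"
  have j: "i = length xa + j" "Suc j < length xb" using False F i unfolding j_def by auto
  have "xb ! j \<in> set xb" using j(2) by simp
  then have "xb ! j ~= l a" using la disj by auto
  moreover have "(xa @ xb) ! i = xb ! j" "(xa @ xb) ! Suc i = xb ! Suc j"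
  unfolding j(1) using nth_append_length_plus[of xa xb j] nth_append_length_plus[of xa xb "Suc j"]
  by simp_all
  ultimately show ?thesis using B(7)[OF j(2)] by simp
  qed
  qed
  qed (use A(1-4,6) B(1-4,6) disj in simp_all)
  then show ?thesis using True by blast
  next
  case False
  then have rb: "r ~= b" "c r = r" using r cr[OF r(1)] ab(5) by (auto split: if_splits)
  obtain xs where xs: "members c nx z l r xs" using parts_members[OF P r(1) rb(2)] .
  have X: "xs ~= []" "hd xs = r" "last xs = l r" "distinct xs" "set xs = {v. v < n & c v = r}"
  "length xs = z r" "\<And>i. Suc i < length xs ==> nx (xs ! i) = xs ! Suc i"
  using xs unfolding members_def by simp_all
  have "set xa \<inter> set xs = {}" unfolding A(5) X(5) using False by auto
  then have ne: "xs ! i ~= l a" if "i < length xs" for i using la nth_mem[OF that] by auto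
  have "members ?c (nx(l a := b)) (z(a := z a + z b)) (l(a := l b)) r xs"
  unfolding members_def
  proof (intro conjI allI impI)
  show "set xs = {v. v < n & ?c v = r}" unfolding X(5) using rb False cr by auto
  qed (use X(1-4,6,7) ne False in simp_all)
  then show ?thesis by blast
  qed
 qed
 then show ?thesis using 1 unfolding parts_def by blast
qed

text \<open>Every merge of a smaller into a larger class lowers this potential by the size of the smaller.\<close>

definition potc :: "(nat => nat) => (nat => nat) => nat" where
 "potc c z = (\<Sum>v<n. floor_log n - floor_log (z (c v)))"

lemma potc_le: "potc c z <= n * floor_log n"
proof -
 have "potc c z <= (\<Sum>v<n. floor_log n)" unfolding potc_def by (intro sum_mono) auto
 then show ?thesis by simp
qed

text \<open>Each of the \<open>z b\<close> relabelled vertices moves into a class at least twice as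
  large as its old one, which raises the rounded logarithm by at least 1.\<close>

lemma potc_merge:
 assumes P: "parts c nx z l" and ab: "a < n" "c a = a" "b < n" "c b = b" "a ~= b" "z b <= z a"
 shows "potc (relabel {v. v < n & c v = b} a c) (z(a := z a + z b)) + z b <= potc c z"
proof -
 let ?c = "relabel {v. v < n & c v = b} a c" and ?z = "z(a := z a + z b)"
 have P': "parts ?c (nx(l a := b)) ?z (l(a := l b))" by (rule parts_merge) fact+
 have "?c a = a" unfolding relabel_def using ab by simp
 from parts_size(3)[OF P' ab(1) this] have zn: "z a + z b <= n" by simp
 have zb: "0 < z b" using parts_size[OF P ab(3,4)] by simp
 have fl: "Suc (floor_log (z b)) <= floor_log (z a + z b)" "floor_log (z a) <= floor_log (z a + z b)"
  "floor_log (z a + z b) <= floor_log n"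
 proof -
  have "Suc (floor_log (z b)) = floor_log (2 * z b)" using floor_log_twice[of "z b"] zb by simp
  also have "\<dots> <= floor_log (z a + z b)" using ab(6) by (intro floor_log_le_iff) simp
  finally show "Suc (floor_log (z b)) <= floor_log (z a + z b)" .
 qed (use zn in \<open>auto intro: floor_log_le_iff\<close>)
 have "potc ?c ?z + z b =
  (\<Sum>v<n. floor_log n - floor_log (?z (?c v))) + (\<Sum>v<n. if c v = b then 1 else 0)"
 proof -
  have "{..<n} \<inter> {v. c v = b} = {v. v < n & c v = b}" by auto
  then have "(\<Sum>v<n. if c v = b then 1 else 0) = z b"
  using parts_size(1)[OF P ab(3,4)] by (simp add: sum.If_cases)
  then show ?thesis unfolding potc_def by simp
 qed
 also have "\<dots> = (\<Sum>v<n. (floor_log n - floor_log (?z (?c v))) + (if c v = b then 1 else 0))"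
  by (simp only: sum.distrib)
 also have "\<dots> <= (\<Sum>v<n. floor_log n - floor_log (z (c v)))"
 proof (rule sum_mono)
  fix v assume "v \<in> {..<n}"
  then have v: "?c v = (if c v = b then a else c v)" unfolding relabel_def by simp
  show "(floor_log n - floor_log (?z (?c v))) + (if c v = b then 1 else 0)
  <= floor_log n - floor_log (z (c v))"
  unfolding v using fl ab(5) by (cases "c v = b"; cases "c v = a") auto
 qed
 finally show ?thesis unfolding potc_def .
qed

subsection \<open>The representation invariant\<close>

text \<open>
 A structure represents a contracted edge set \<open>K\<close> and a set \<open>L\<close> of tree edges. Its fields are the
 partition into the components of \<open>K \<union> L\<close> (0 to 3), a strict upper bound on the labels in each of
 these components (4), the partition into the components of \<open>K\<close> (5 to 8), and for every component
 of \<open>K\<close> the successor of the tree edge to its parent, or 0 for a root, (9) and a label that is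
 larger than that of the parent (10).
\<close>

definition isrep :: "(nat => nat) => nat => bool" where
 "isrep f x \<longleftrightarrow> x < n & f x = x"

definition joins :: "(nat => nat) => nat => nat => nat => bool" where
 "joins f g x y \<longleftrightarrow> f (fst (ep g)) = x & f (snd (ep g)) = y \<or> f (fst (ep g)) = y & f (snd (ep g)) = x"

text \<open>Distinct components own distinct parent edges, so overwriting one entry removes exactly
  one edge from \<open>treeset\<close>.\<close>

definition inj_pe :: "(nat => nat) => (nat => nat) => bool" where
 "inj_pe f pe \<longleftrightarrow> (\<forall>x y. isrep f x --> isrep f y --> pe x = pe y --> pe x ~= 0 --> x = y)"

definition treeset :: "(nat => nat) => (nat => nat) => nat set" where
 "treeset f pe = {g. \<exists>x. isrep f x & pe x = Suc g}"

definition oriented :: "(nat => nat) => (nat => nat) => (nat => nat) => nat => bool" where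
 "oriented f pe lb x \<longleftrightarrow> (\<forall>g. pe x = Suc g --> (\<exists>y. isrep f y & lb y < lb x & joins f g x y))"

definition forest where
 "forest cc f pe lb L \<longleftrightarrow> inj_pe f pe & treeset f pe = L & (\<forall>x. isrep f x --> oriented f pe lb x) &
  (\<forall>x y. isrep f x --> isrep f y --> pe x = 0 --> pe y = 0 --> cc x = cc y --> x = y)"

definition comps :: "(nat => nat) => nat set => bool" where
 "comps c F \<longleftrightarrow> (\<forall>u<n. \<forall>v<n. c u = c v \<longleftrightarrow> (u, v) \<in> conn ep F)"

definition rep :: "(nat => nat => nat) => nat set => nat set => bool" where
 "rep D K L \<longleftrightarrow> parts (D 0) (D 1) (D 2) (D 3) & parts (D 5) (D 6) (D 7) (D 8) &
  comps (D 0) (K \<union> L) & comps (D 5) K & L \<subseteq> {..<m} &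
  forest (D 0) (D 5) (D 9) (D 10) L &
  (\<forall>v<n. D 10 v < D 4 (D 0 v)) & (\<forall>r<n. D 0 r = r --> D 4 r <= D 2 r * D 2 r)"

definition pot :: "(nat => nat => nat) => nat" where
 "pot D = potc (D 0) (D 2) + potc (D 5) (D 7)"

lemma comps_iff: "comps c F ==> u < n ==> v < n ==> c u = c v \<longleftrightarrow> (u, v) \<in> conn ep F"
 unfolding comps_def by blast

lemma comps_insert:
 assumes "comps c F" "parts c nx z l" "ep e = (u, v)" "u < n" "v < n"
  and ab: "{c u, c v} = {a, b}"
 shows "comps (relabel {x. x < n & c x = b} a c) (insert e F)"
 unfolding comps_def
proof (intro allI impI)
 fix x y assume xy: "x < n" "y < n"
 note ci = comps_iff[OF assms(1)]
 have "(x, y) \<in> conn ep (insert e F) \<longleftrightarrow> c x = c y \<or> c x = c u & c v = c y \<or> c x = c v & c u = c y"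
  unfolding conn_insert[of ep e u v x y F, OF assms(3)]
  using ci[of x y] ci[of x u] ci[of v y] ci[of x v] ci[of u y] xy assms(4,5) by simp
 also have "\<dots> \<longleftrightarrow> (if c x = b then a else c x) = (if c y = b then a else c y)"
  using ab by (auto simp: doubleton_eq_iff)
 finally show "relabel {x. x < n & c x = b} a c x = relabel {x. x < n & c x = b} a c y \<longleftrightarrow>
  (x, y) \<in> conn ep (insert e F)"
  using xy unfolding relabel_def by simp
qed

lemma joins_sym: "joins f g x y \<longleftrightarrow> joins f g y x"
 unfolding joins_def by blast

lemma joins_conn:
 assumes c: "comps f K" and P: "parts f nx z l" and j: "joins f g x y" and g: "g < m"
  and "K \<subseteq> F" "g \<in> F"
 shows "(x, y) \<in> conn ep F"
proof -
 obtain u v where uv: "ep g = (u, v)" by fastforce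
 then have "u < n" "v < n" using ep[OF g] by auto
 then have "(u, f u) \<in> conn ep K" "(v, f v) \<in> conn ep K"
  using comps_iff[OF c, of u "f u"] comps_iff[OF c, of v "f v"] parts_rep[OF P] by simp_all
 then have fu: "(u, f u) \<in> conn ep F" "(v, f v) \<in> conn ep F" using conn_mono[OF \<open>K \<subseteq> F\<close>, of ep] by auto
 have "(u, v) \<in> conn ep F" using conn_edge[OF \<open>g \<in> F\<close>, of ep] uv by simp
 then have "(f u, f v) \<in> conn ep F"
  using conn_trans[OF conn_sym[OF fu(1)]] conn_trans[OF _ fu(2)] by blast
 then show ?thesis using j uv conn_sym[of "f u" "f v" ep F] unfolding joins_def by auto
qed

text \<open>Climbing from \<open>x\<close> to a root meets smaller and smaller labels and therefore never reaches \<open>y\<close>.\<close>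

lemma climb:
 assumes rep: "rep D K L" and x: "isrep (D 5) x" and y: "isrep (D 5) y" "x ~= y" "D 10 x <= D 10 y"
  and F: "K \<union> {g \<in> L. D 9 y ~= Suc g} \<subseteq> F"
 obtains r where "isrep (D 5) r" "D 9 r = 0" "r ~= y" "(x, r) \<in> conn ep F" "D 0 r = D 0 x"
proof -
 have R: "parts (D 5) (D 6) (D 7) (D 8)" "comps (D 0) (K \<union> L)" "comps (D 5) K" "L \<subseteq> {..<m}"
  "inj_pe (D 5) (D 9)" "treeset (D 5) (D 9) = L" "\<And>x. isrep (D 5) x ==> oriented (D 5) (D 9) (D 10) x"
  using rep unfolding rep_def forest_def by auto
 have "\<exists>r. isrep (D 5) r & D 9 r = 0 & r ~= y & (x, r) \<in> conn ep F & D 0 r = D 0 x"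
  using x y(2,3)
 proof (induction "D 10 x" arbitrary: x rule: less_induct)
  case less
  show ?case
  proof (cases "D 9 x")
  case 0
  then show ?thesis using less.prems by (intro exI[of _ x]) simp
  next
  case (Suc g)
  then obtain z where z: "isrep (D 5) z" "D 10 z < D 10 x" "joins (D 5) g x z"
  using R(7)[OF less.prems(1)] unfolding oriented_def by blast
  have g: "g \<in> L" using R(6) Suc less.prems(1) unfolding treeset_def by blast
  have "D 9 y ~= Suc g"
  proof
  assume "D 9 y = Suc g"
  then show False using R(5) Suc less.prems(1,2) y(1) unfolding inj_pe_def by simp
  qed
  then have "g \<in> F" using F g by blast
  have gm: "g < m" using g R(4) by auto
  have xz: "(x, z) \<in> conn ep F"
  by (rule joins_conn[OF R(3,1) z(3) gm]) (use F \<open>g \<in> F\<close> in auto)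
  have "(x, z) \<in> conn ep (K \<union> L)"
  by (rule joins_conn[OF R(3,1) z(3) gm]) (use g in auto)
  then have "D 0 x = D 0 z"
  using comps_iff[OF R(2), of x z] less.prems(1) z(1) unfolding isrep_def by simp
  moreover obtain r where "isrep (D 5) r" "D 9 r = 0" "r ~= y" "(z, r) \<in> conn ep F" "D 0 r = D 0 z"
  proof -
  have "z ~= y" "D 10 z <= D 10 y" using z(2) less.prems(3) by auto
  then show ?thesis using less.hyps[OF z(2,1)] that by blast
  qed
  ultimately show ?thesis using conn_trans[OF xz] by (intro exI[of _ r]) simp
  qed
 qed
 then show thesis using that by blast
qed

text \<open>Having the smaller label, \<open>x\<close> reaches its root without the parent edge
  \<open>g\<close> of \<open>y\<close>, and so does the parent \<open>z\<close> of \<open>y\<close>.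
  A tree has only one root, so \<open>x\<close> and \<open>z\<close> are connected without
  \<open>g\<close>. Hence \<open>e\<close>, which joins \<open>x\<close> to \<open>y\<close>, closes
  a circuit through \<open>g\<close>.\<close>

lemma choose_edge:
 assumes rep: "rep D K L" and uv: "u < n" "v < n" "D 5 u ~= D 5 v" "D 0 u = D 0 v"
  and xy: "{x, y} = {D 5 u, D 5 v}" "D 10 x <= D 10 y" and e: "ep e = (u, v)"
 obtains g where "D 9 y = Suc g" "g \<in> L"
  "conn ep (insert e K \<union> (L - {g})) = conn ep (K \<union> L)"
proof -
 have R: "parts (D 5) (D 6) (D 7) (D 8)" "comps (D 0) (K \<union> L)" "comps (D 5) K" "L \<subseteq> {..<m}"
  "inj_pe (D 5) (D 9)" "treeset (D 5) (D 9) = L" "\<And>x. isrep (D 5) x ==> oriented (D 5) (D 9) (D 10) x"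
  and root: "\<And>x y. isrep (D 5) x ==> isrep (D 5) y ==> D 9 x = 0 ==> D 9 y = 0 ==> D 0 x = D 0 y ==> x = y"
  using rep unfolding rep_def forest_def by auto
 have f: "isrep (D 5) (D 5 w)" "(w, D 5 w) \<in> conn ep K" "D 0 (D 5 w) = D 0 w" if "w < n" for w
 proof -
  have w: "D 5 w < n" "D 5 (D 5 w) = D 5 w" using parts_rep[OF R(1) that] by auto
  then show "isrep (D 5) (D 5 w)" unfolding isrep_def by simp
  show 1: "(w, D 5 w) \<in> conn ep K" using comps_iff[OF R(3) that w(1)] w(2) by simp
  have "conn ep K \<subseteq> conn ep (K \<union> L)" by (rule conn_mono) blast
  then show "D 0 (D 5 w) = D 0 w" using 1 comps_iff[OF R(2) that w(1)] by auto
 qed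
 have xy': "isrep (D 5) x" "isrep (D 5) y" "x ~= y" "D 0 x = D 0 y"
  using xy(1) f(1,3)[OF uv(1)] f(1,3)[OF uv(2)] uv(3,4) by (auto simp: doubleton_eq_iff)
 obtain r where r: "isrep (D 5) r" "D 9 r = 0" "r ~= y" "(x, r) \<in> conn ep (K \<union> {g \<in> L. D 9 y ~= Suc g})"
  "D 0 r = D 0 x"
  using climb[OF rep xy'(1,2,3) xy(2) order.refl] .
 have "D 9 y ~= 0" using root[OF r(1) xy'(2) r(2)] r(3,5) xy'(4) by auto
 then obtain g where g: "D 9 y = Suc g" using not0_implies_Suc by blast
 have gL: "g \<in> L" using R(6) g xy'(2) unfolding treeset_def by blast
 then have gm: "g < m" using R(4) by auto
 obtain z where z: "isrep (D 5) z" "D 10 z < D 10 y" "joins (D 5) g y z"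
  using R(7)[OF xy'(2)] g unfolding oriented_def by blast
 have Lg: "{h \<in> L. D 9 y ~= Suc h} = L - {g}" using g by auto
 have zy: "z ~= y" using z(2) by auto
 obtain r' where r': "isrep (D 5) r'" "D 9 r' = 0" "r' ~= y" "(z, r') \<in> conn ep (K \<union> (L - {g}))" "D 0 r' = D 0 z"
  using climb[OF rep z(1) xy'(2) zy less_imp_le[OF z(2)] order.refl] unfolding Lg .
 have "(y, z) \<in> conn ep (K \<union> L)" by (rule joins_conn[OF R(3,1) z(3) gm]) (use gL in auto)
 then have "D 0 y = D 0 z" using comps_iff[OF R(2)] xy'(2) z(1) unfolding isrep_def by simp
 then have "r = r'" using root[OF r(1) r'(1) r(2) r'(2)] r(5) r'(5) xy'(4) by simp
 then have xz: "(x, z) \<in> conn ep (K \<union> (L - {g}))"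
  using r(4) conn_trans[OF _ conn_sym[OF r'(4)], of x] unfolding Lg by simp
 let ?F = "insert e K \<union> (L - {g})"
 have sub: "conn ep (K \<union> (L - {g})) \<subseteq> conn ep ?F" "conn ep K \<subseteq> conn ep ?F" by (rule conn_mono, blast)+
 have "(u, v) \<in> conn ep ?F" using conn_edge[of e ?F ep] e by simp
 then have "(D 5 u, D 5 v) \<in> conn ep ?F"
 proof -
  have "(D 5 u, u) \<in> conn ep ?F" "(v, D 5 v) \<in> conn ep ?F"
  using conn_sym[OF f(2)[OF uv(1)]] f(2)[OF uv(2)] sub(2) by auto
  then show ?thesis using conn_trans[OF conn_trans[OF _ \<open>(u, v) \<in> conn ep ?F\<close>]] by simp
 qed
 then have "(y, x) \<in> conn ep ?F" using xy(1) conn_sym[of "D 5 u" "D 5 v"] by (auto simp: doubleton_eq_iff)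
 then have yz: "(y, z) \<in> conn ep ?F" using conn_trans[of y x ep ?F z] xz sub(1) by auto
 have gF: "ep g \<in> conn ep ?F"
 proof -
  obtain a b where ab: "ep g = (a, b)" by fastforce
  then have "a < n" "b < n" using ep[OF gm] by auto
  then have "(a, D 5 a) \<in> conn ep ?F" "(D 5 b, b) \<in> conn ep ?F"
  using f(2)[of a] conn_sym[OF f(2)[of b]] sub(2) by auto
  moreover have "(D 5 a, D 5 b) \<in> conn ep ?F"
  using z(3) yz conn_sym[OF yz] ab unfolding joins_def by auto
  ultimately show ?thesis unfolding ab using conn_trans[OF conn_trans[of a "D 5 a" ep ?F "D 5 b"], of b] by simp
 qed
 have "conn ep ?F \<subseteq> conn ep (K \<union> L)"
 proof (rule conn_least)
  fix h assume "h \<in> ?F"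
  then show "ep h \<in> conn ep (K \<union> L)"
  using conn_edge[of h "K \<union> L" ep] comps_iff[OF R(2) uv(1,2)] uv(4) e by auto
 qed
 moreover have "conn ep (K \<union> L) \<subseteq> conn ep ?F"
 proof (rule conn_least)
  fix h assume "h \<in> K \<union> L"
  then show "ep h \<in> conn ep ?F" using conn_edge[of h ?F ep] gF by (cases "h = g") auto
 qed
 ultimately show thesis using that[OF g gL] by blast
qed

text \<open>Two independent choices meet here. The larger class \<open>a\<close> gives its name to
  the union, which saves time, whereas parent edge and label are taken from \<open>x\<close>, the
  end with the smaller label. Lowering the label of \<open>y\<close> to that of \<open>x\<close>
  keeps it below the labels of all children.\<close>

lemma rep_contract:
 assumes rep: "rep D K L" and uv: "u < n" "v < n" "D 5 u ~= D 5 v" "D 0 u = D 0 v"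
  and xy: "{x, y} = {D 5 u, D 5 v}" "D 10 x <= D 10 y" and e: "ep e = (u, v)"
  and g: "D 9 y = Suc g" "conn ep (insert e K \<union> (L - {g})) = conn ep (K \<union> L)"
  and ab: "{a, b} = {x, y}" "D 7 b <= D 7 a"
  and D': "D' = D(5 := relabel {w. w < n & D 5 w = b} a (D 5), 6 := (D 6)(D 8 a := b),
  7 := (D 7)(a := D 7 a + D 7 b), 8 := (D 8)(a := D 8 b),
  9 := (D 9)(a := D 9 x), 10 := (D 10)(a := D 10 x))"
 shows "rep D' (insert e K) (L - {g})" "pot D' + D 7 b <= pot D"
proof -
 have R: "parts (D 0) (D 1) (D 2) (D 3)" "parts (D 5) (D 6) (D 7) (D 8)" "comps (D 0) (K \<union> L)"
  "comps (D 5) K" "L \<subseteq> {..<m}"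
  "treeset (D 5) (D 9) = L" "\<And>x. isrep (D 5) x ==> oriented (D 5) (D 9) (D 10) x"
  and inj: "\<And>x y. isrep (D 5) x ==> isrep (D 5) y ==> D 9 x = D 9 y ==> D 9 x ~= 0 ==> x = y"
  and root: "\<And>x y. isrep (D 5) x ==> isrep (D 5) y ==> D 9 x = 0 ==> D 9 y = 0 ==> D 0 x = D 0 y ==> x = y"
  and lab: "\<forall>v<n. D 10 v < D 4 (D 0 v)" "\<forall>r<n. D 0 r = r --> D 4 r <= D 2 r * D 2 r"
  using rep unfolding rep_def forest_def inj_pe_def by auto
 let ?f = "D 5" let ?f' = "relabel {w. w < n & D 5 w = b} a (D 5)"
 have frep: "isrep ?f (?f w)" "D 0 (?f w) = D 0 w" if "w < n" for w
 proof -
  have w: "?f w < n" "?f (?f w) = ?f w" using parts_rep[OF R(2) that] by auto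
  then show "isrep ?f (?f w)" unfolding isrep_def by simp
  have "(w, ?f w) \<in> conn ep K" using comps_iff[OF R(4) that w(1)] w(2) by simp
  moreover have "conn ep K \<subseteq> conn ep (K \<union> L)" by (rule conn_mono) blast
  ultimately show "D 0 (?f w) = D 0 w" using comps_iff[OF R(3) that w(1)] by auto
 qed
 have xy': "isrep ?f x" "isrep ?f y" "x ~= y" "D 0 x = D 0 y"
  using xy(1) frep[OF uv(1)] frep[OF uv(2)] uv(3,4) by (auto simp: doubleton_eq_iff)
 have ab': "isrep ?f a" "isrep ?f b" "a ~= b" "D 0 a = D 0 x" "D 0 b = D 0 x"
  using ab(1) xy' by (auto simp: doubleton_eq_iff)
 have abn: "a < n" "?f a = a" "b < n" "?f b = b" using ab'(1,2) unfolding isrep_def by auto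
 have f': "?f' w = (if ?f w = b then a else ?f w)" if "w < n" for w
  using that unfolding relabel_def by simp
 have isrep': "isrep ?f' w \<longleftrightarrow> isrep ?f w & w ~= b" for w
  using f'[of w] abn ab'(3) unfolding isrep_def by (cases "D 5 w = b") auto
 have ne0: "D 9 y ~= 0" using g(1) by simp
 have joins': "joins ?f' h (if p = b then a else p) (if q = b then a else q)"
  if "joins ?f h p q" "h < m" for h p q
  using that ep[OF that(2)] f'[of "fst (ep h)"] f'[of "snd (ep h)"] unfolding joins_def by auto
 have LB: "D 10 x <= D 10 w" if "w = x \<or> w = y" for w using that xy(2) by auto
 have axy: "a = x \<or> a = y" "b = x \<or> b = y" using ab(1) by (auto simp: doubleton_eq_iff)
 have xyab: "x = a \<or> x = b" "y = a \<or> y = b" using ab(1) by (auto simp: doubleton_eq_iff)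
 let ?pe = "(D 9)(a := D 9 x)" and ?lb = "(D 10)(a := D 10 x)"
 have lb_le: "?lb (if w = b then a else w) <= D 10 w" for w
  using LB axy by auto
 have gm: "h < m" if "D 9 w = Suc h" "isrep ?f w" for w h
  using that R(5,6) unfolding treeset_def by blast
 have fo: "forest (D 0) ?f' ?pe ?lb (L - {g})"
  unfolding forest_def
 proof (intro conjI allI impI)
  show "inj_pe ?f' ?pe"
  unfolding inj_pe_def
  proof (intro allI impI)
  fix p q assume pq: "isrep ?f' p" "isrep ?f' q" "?pe p = ?pe q" "?pe p ~= 0"
  then have pq': "isrep ?f p" "isrep ?f q" "p ~= b" "q ~= b" using isrep' by auto
  \<comment> \<open>The entry now stored at \<open>a\<close> is the former entry of
    \<open>x\<close>; the primed components name the places where the entries stood before the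
    merge.\<close>
  define p' q' where "p' = (if p = a then x else p)" and "q' = (if q = a then x else q)"
  have "isrep ?f p'" "D 9 p' = ?pe p" using pq'(1) xy'(1) unfolding p'_def by auto
  moreover have "isrep ?f q'" "D 9 q' = ?pe q" using pq'(2) xy'(1) unfolding q'_def by auto
  ultimately have "p' = q'" using inj[of p' q'] pq(3,4) by simp
  then show "p = q" using pq'(3,4) xyab(1) unfolding p'_def q'_def by (cases "p = a"; cases "q = a") auto
  qed
  show "treeset ?f' ?pe = L - {g}"
  proof (intro equalityI subsetI)
  fix h assume "h \<in> treeset ?f' ?pe"
  then obtain p where p: "isrep ?f p" "p ~= b" "?pe p = Suc h" unfolding treeset_def isrep' by blast
  define p' where "p' = (if p = a then x else p)"
  have p': "isrep ?f p'" "D 9 p' = Suc h" "p' ~= y" using p xy' xyab unfolding p'_def by auto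
  then have "h \<in> L" using R(6) unfolding treeset_def by blast
  moreover have "h ~= g" using inj[OF p'(1) xy'(2)] p' g(1) by auto
  ultimately show "h \<in> L - {g}" by simp
  next
  fix h assume h: "h \<in> L - {g}"
  then obtain p where p: "isrep ?f p" "D 9 p = Suc h" using R(6) unfolding treeset_def by blast
  then have "p ~= y" using g(1) h by auto
  define p' where "p' = (if p = x then a else p)"
  have "isrep ?f' p'" "?pe p' = Suc h"
  using p \<open>p ~= y\<close> ab'(1,3) axy xyab unfolding p'_def isrep' by auto
  then show "h \<in> treeset ?f' ?pe" unfolding treeset_def by blast
  qed
  show "oriented ?f' ?pe ?lb p" if "isrep ?f' p" for p
  unfolding oriented_def
  proof (intro allI impI)
  fix h assume h: "?pe p = Suc h"
  have p: "isrep ?f p" "p ~= b" using that isrep' by auto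
  define p' where "p' = (if p = a then x else p)"
  have p': "isrep ?f p'" "D 9 p' = Suc h" "?lb p = D 10 p'" "(if p' = b then a else p') = p"
  using h p xy' xyab unfolding p'_def by auto
  obtain q where q: "isrep ?f q" "D 10 q < D 10 p'" "joins ?f h p' q"
  using R(7)[OF p'(1)] p'(2) unfolding oriented_def by blast
  let ?q = "if q = b then a else q"
  have "isrep ?f' ?q" using q(1) ab'(1,3) isrep' by auto
  moreover have "?lb ?q < ?lb p" using lb_le[of q] q(2) p'(3) by simp
  moreover have "joins ?f' h p ?q" using joins'[OF q(3) gm[OF p'(2,1)]] p'(4) by simp
  ultimately show "\<exists>y. isrep ?f' y & ?lb y < ?lb p & joins ?f' h p y" by blast
  qed
  show "p = q" if pq: "isrep ?f' p" "isrep ?f' q" "?pe p = 0" "?pe q = 0" "D 0 p = D 0 q" for p q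
  proof -
  have pq': "isrep ?f p" "isrep ?f q" "p ~= b" "q ~= b" using pq isrep' by auto
  define p' q' where "p' = (if p = a then x else p)" and "q' = (if q = a then x else q)"
  have "isrep ?f p'" "D 9 p' = 0" "D 0 p' = D 0 p" using pq(3) pq'(1) xy'(1) ab'(4) unfolding p'_def by auto
  moreover have "isrep ?f q'" "D 9 q' = 0" "D 0 q' = D 0 q" using pq(4) pq'(2) xy'(1) ab'(4) unfolding q'_def by auto
  ultimately have "p' = q'" using root[of p' q'] pq(5) by simp
  then show "p = q" using pq'(3,4) xyab(1) unfolding p'_def q'_def by (cases "p = a"; cases "q = a") auto
  qed
 qed
 have pm: "parts ?f' ((D 6)(D 8 a := b)) ((D 7)(a := D 7 a + D 7 b)) ((D 8)(a := D 8 b))"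
  by (rule parts_merge[OF R(2) abn ab'(3)])
 have cf: "comps ?f' (insert e K)"
  by (rule comps_insert[OF R(4,2) e uv(1,2)]) (use ab(1) xy(1) in simp)
 have cc: "comps (D 0) (insert e K \<union> (L - {g}))" using R(3) g(2) unfolding comps_def by simp
 have l1: "\<forall>v<n. ?lb v < D 4 (D 0 v)" using lab(1) ab'(4) xy'(1) unfolding isrep_def by auto
 show "rep D' (insert e K) (L - {g})"
  unfolding rep_def D' using R(1,5) pm cf cc fo l1 lab(2) by auto
 show "pot D' + D 7 b <= pot D"
  using potc_merge[OF R(2) abn ab'(3) ab(2)] unfolding pot_def D' by simp
qed

lemma rep_init:
 assumes "\<forall>v<n. D 0 v = v & D 2 v = 1 & D 3 v = v & D 4 v = 1 & D 5 v = v & D 7 v = 1 & D 8 v = v &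
  D 9 v = 0 & D 10 v = 0"
 shows "rep D {} {}"
proof -
 have P: "parts c nx z l" if "\<forall>v<n. c v = v & z v = 1 & l v = v" for c nx z l
  unfolding parts_def
 proof (intro conjI allI impI)
  fix r assume "r < n"
  then have "members c nx z l r [r]" using that unfolding members_def by auto
  then show "\<exists>xs. members c nx z l r xs" by blast
 qed (use that in auto)
 have c0: "conn ep {} = Id" unfolding conn_def by simp
 have "comps (D 0) {}" "comps (D 5) {}" using assms unfolding comps_def c0 by auto
 moreover have "forest (D 0) (D 5) (D 9) (D 10) {}"
  unfolding forest_def inj_pe_def treeset_def oriented_def isrep_def using assms by auto
 ultimately show ?thesis unfolding rep_def using assms P by auto
qed

lemma rep_bounds:
 assumes "rep D K L" "v < n"
 shows "D 0 v < n" "D 0 (D 0 v) = D 0 v" "D 5 v < n" "D 5 (D 5 v) = D 5 v"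
  "D 2 (D 0 v) <= n" "D 7 (D 5 v) <= n" "D 4 (D 0 v) <= D 2 (D 0 v) * D 2 (D 0 v)"
proof -
 have R: "parts (D 0) (D 1) (D 2) (D 3)" "parts (D 5) (D 6) (D 7) (D 8)"
  "\<forall>r<n. D 0 r = r --> D 4 r <= D 2 r * D 2 r"
  using assms(1) unfolding rep_def by auto
 show 1: "D 0 v < n" "D 0 (D 0 v) = D 0 v" "D 5 v < n" "D 5 (D 5 v) = D 5 v"
  using parts_rep[OF R(1) assms(2)] parts_rep[OF R(2) assms(2)] by auto
 show "D 2 (D 0 v) <= n" "D 7 (D 5 v) <= n" using parts_size(3)[OF R(1) 1(1,2)] parts_size(3)[OF R(2) 1(3,4)] by auto
 show "D 4 (D 0 v) <= D 2 (D 0 v) * D 2 (D 0 v)" using R(3) 1 by auto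
qed

end

subsection \<open>Linking two trees\<close>

context net
begin

text \<open>
 The loop that reverses the path from the attached component to its old root: \<open>X\<close> are the
 components already processed, \<open>pr\<close> is the successor of the edge that becomes the parent edge of
 \<open>cur\<close>, and the labels of the other components of the smaller tree exceed \<open>t\<close>.
\<close>

definition evert where
 "evert D L e a b PE LB cur pr t X \<longleftrightarrow>
  finite X & (\<forall>x\<in>X. isrep (D 5) x & D 0 x = b) & t = D 4 a + card X &
  (\<forall>x. x \<notin> X --> PE x = D 9 x &
  LB x = (if x < n & D 0 x = b then D 10 x + (D 4 a + D 2 b) else D 10 x)) &
  (\<forall>x\<in>X. LB x < t & PE x ~= 0 & oriented (D 5) PE LB x) & inj_pe (D 5) PE &
  (pr = 0 --> treeset (D 5) PE = insert e L & (\<exists>x\<in>X. D 9 x = 0)) &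
  (\<forall>h. pr = Suc h --> treeset (D 5) PE = insert e L - {h} & h \<in> insert e L &
  isrep (D 5) cur & D 0 cur = b & cur \<notin> X & (\<forall>x\<in>X. D 10 cur < D 10 x) &
  (\<exists>y. isrep (D 5) y & LB y < t & joins (D 5) h cur y))"

lemma rep_tree_same:
 assumes "rep D K L" "joins (D 5) g x y" "g \<in> L" "isrep (D 5) x" "isrep (D 5) y"
 shows "D 0 x = D 0 y"
proof -
 have R: "parts (D 5) (D 6) (D 7) (D 8)" "comps (D 0) (K \<union> L)" "comps (D 5) K" "L \<subseteq> {..<m}"
  using assms(1) unfolding rep_def by auto
 have "(x, y) \<in> conn ep (K \<union> L)"
  by (rule joins_conn[OF R(3,1) assms(2)]) (use assms(3) R(4) in auto)
 then show ?thesis using comps_iff[OF R(2)] assms(4,5) unfolding isrep_def by simp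
qed

text \<open>Raising all labels of the smaller tree by \<open>D 4 a + D 2 b\<close> opens a gap of
  \<open>D 2 b\<close> values above the labels of \<open>a\<close>. The components on the reversed
  path will receive their new labels from this gap.\<close>

lemma evert_init:
 assumes rep: "rep D K L" and e: "e < m" "ep e = (p, q) \<or> ep e = (q, p)"
  and ab: "D 0 p = a" "D 0 q = b" "a ~= b"
 shows "evert D L e a b (D 9) (\<lambda>v. if v < n & D 0 v = b then D 10 v + (D 4 a + D 2 b) else D 10 v)
  (D 5 q) (Suc e) (D 4 a) {}"
proof -
 have R: "parts (D 5) (D 6) (D 7) (D 8)" "comps (D 0) (K \<union> L)" "comps (D 5) K"
  "inj_pe (D 5) (D 9)" "treeset (D 5) (D 9) = L" "\<forall>v<n. D 10 v < D 4 (D 0 v)"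
  using rep unfolding rep_def forest_def by auto
 have pq: "p < n" "q < n" using ep[OF e(1)] e(2) by auto
 have eL: "e \<notin> L"
 proof
  assume "e \<in> L"
  then have "ep e \<in> conn ep (K \<union> L)" by (intro conn_edge) simp
  then have "(p, q) \<in> conn ep (K \<union> L)" using e(2) conn_sym[of q p ep "K \<union> L"] by auto
  then show False using comps_iff[OF R(2) pq] ab by simp
 qed
 have f: "isrep (D 5) (D 5 w)" "D 0 (D 5 w) = D 0 w" if "w < n" for w
 proof -
  have w: "D 5 w < n" "D 5 (D 5 w) = D 5 w" using parts_rep[OF R(1) that] by auto
  then show "isrep (D 5) (D 5 w)" unfolding isrep_def by simp
  have "(w, D 5 w) \<in> conn ep K" using comps_iff[OF R(3) that w(1)] w(2) by simp
  moreover have "conn ep K \<subseteq> conn ep (K \<union> L)" by (rule conn_mono) blast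
  ultimately show "D 0 (D 5 w) = D 0 w" using comps_iff[OF R(2) that w(1)] by auto
 qed
 have j: "joins (D 5) e (D 5 q) (D 5 p)" using e(2) unfolding joins_def by auto
 have lp: "D 10 (D 5 p) < D 4 a" using R(6) f[OF pq(1)] ab(1) unfolding isrep_def by auto
 have "\<exists>y. isrep (D 5) y & (if y < n & D 0 y = b then D 10 y + (D 4 a + D 2 b) else D 10 y) < D 4 a &
  joins (D 5) e (D 5 q) y"
  using f[OF pq(1)] j lp ab by (intro exI[of _ "D 5 p"]) simp
 then show ?thesis
  unfolding evert_def using R(4,5) eL f[OF pq(2)] ab(2) by simp
qed

text \<open>The path visits distinct vertices of class \<open>b\<close>, so it cannot exhaust the
  gap of \<open>D 2 b\<close> labels.\<close>

lemma evert_card: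
 assumes "rep D K L" "evert D L e a b PE LB cur (Suc h) t X" "b < n" "D 0 b = b"
 shows "card X < D 2 b" "t < D 4 a + D 2 b"
proof -
 have P: "parts (D 0) (D 1) (D 2) (D 3)" using assms(1) unfolding rep_def by simp
 have E: "finite X" "\<forall>x\<in>X. isrep (D 5) x & D 0 x = b" "t = D 4 a + card X"
  "isrep (D 5) cur" "D 0 cur = b" "cur \<notin> X"
  using assms(2) unfolding evert_def by simp_all
 have "insert cur X \<subseteq> {v. v < n & D 0 v = b}" using E unfolding isrep_def by auto
 then have "card (insert cur X) <= card {v. v < n & D 0 v = b}" by (intro card_mono) auto
 then show 1: "card X < D 2 b" using E parts_size(1)[OF P assms(3,4)] by simp
 then show "t < D 4 a + D 2 b" using E by simp
qed

text \<open>\<open>cur\<close> takes over the edge \<open>h\<close> and hands its former parent edge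
  on to its former parent. That component had a smaller old label than all those visited before, so
  the walk never returns.\<close>

lemma evert_step:
 assumes rep: "rep D K L" and ev: "evert D L e a b PE LB cur (Suc h) t X" and b: "b < n" "D 0 b = b"
  and cur': "\<And>g. PE cur = Suc g ==>
  cur' = (if D 5 (fst (ep g)) = cur then D 5 (snd (ep g)) else D 5 (fst (ep g)))"
 shows "evert D L e a b (PE(cur := Suc h)) (LB(cur := t)) cur' (PE cur) (Suc t) (insert cur X)"
proof -
 have R: "inj_pe (D 5) (D 9)" "treeset (D 5) (D 9) = L" "\<And>x. isrep (D 5) x ==> oriented (D 5) (D 9) (D 10) x"
  using rep unfolding rep_def forest_def by auto
 have E: "finite X" "\<And>x. x \<in> X ==> isrep (D 5) x & D 0 x = b" "t = D 4 a + card X"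
  "\<And>x. x \<notin> X ==> PE x = D 9 x"
  "\<And>x. x \<notin> X ==> LB x = (if x < n & D 0 x = b then D 10 x + (D 4 a + D 2 b) else D 10 x)"
  "\<And>x. x \<in> X ==> PE x ~= 0" "\<And>x. x \<in> X ==> oriented (D 5) PE LB x"
  "inj_pe (D 5) PE" "treeset (D 5) PE = insert e L - {h}" "h \<in> insert e L"
  "isrep (D 5) cur" "D 0 cur = b" "cur \<notin> X" "\<And>x. x \<in> X ==> D 10 cur < D 10 x"
  using ev unfolding evert_def by simp_all
 have "\<forall>x\<in>X. LB x < t & PE x ~= 0 & oriented (D 5) PE LB x"
  using ev unfolding evert_def by (elim conjE) assumption
 then have E6: "\<And>x. x \<in> X ==> LB x < t" by simp
 obtain y where y: "isrep (D 5) y" "LB y < t" "joins (D 5) h cur y"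
  using ev unfolding evert_def by simp metis
 note t = evert_card(2)[OF rep ev b]
 \<comment> \<open>An unprocessed component still carries a raised label, above every label given
   out so far. Hence none of the parents chosen up to now is \<open>cur\<close>, and relabelling
   \<open>cur\<close> does not disturb them.\<close>
 have LBc: "t < LB cur" using E(5)[OF E(13)] E(11,12) t unfolding isrep_def by simp
 have PEc: "PE cur = D 9 cur" using E(4)[OF E(13)] .
 have yc: "y ~= cur" using y(2) LBc by auto
 let ?PE = "PE(cur := Suc h)" and ?LB = "LB(cur := t)" and ?X = "insert cur X"
 have hPE: "PE x ~= Suc h" if "isrep (D 5) x" for x
  using E(9) that unfolding treeset_def by blast
 have inj: "inj_pe (D 5) ?PE"
  unfolding inj_pe_def
 proof (intro allI impI)
  fix p q assume pq: "isrep (D 5) p" "isrep (D 5) q" "?PE p = ?PE q" "?PE p ~= 0"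
  have "p = q" if "p ~= cur" "q ~= cur"
  using E(8) pq that unfolding inj_pe_def by simp
  then show "p = q" using pq hPE[OF pq(1)] hPE[OF pq(2)] by (cases "p = cur"; cases "q = cur") auto
 qed
 have ts: "treeset (D 5) ?PE = insert e L - {g. PE cur = Suc g}"
 proof (intro equalityI subsetI)
  fix k assume "k \<in> treeset (D 5) ?PE"
  then obtain x where x: "isrep (D 5) x" "?PE x = Suc k" unfolding treeset_def by blast
  show "k \<in> insert e L - {g. PE cur = Suc g}"
  proof (cases "x = cur")
  case True
  then show ?thesis using x E(10) hPE[OF E(11)] by auto
  next
  case False
  then have "PE x = Suc k" using x by simp
  moreover have "PE cur ~= Suc k"
  using E(8) \<open>PE x = Suc k\<close> False x(1) E(11) unfolding inj_pe_def by auto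
  ultimately show ?thesis using E(9) x(1) unfolding treeset_def by blast
  qed
 next
  fix k assume k: "k \<in> insert e L - {g. PE cur = Suc g}"
  show "k \<in> treeset (D 5) ?PE"
  proof (cases "k = h")
  case True
  then show ?thesis using E(11) unfolding treeset_def by auto
  next
  case False
  then have "k \<in> treeset (D 5) PE" using k E(9) by blast
  then obtain x where "isrep (D 5) x" "PE x = Suc k" unfolding treeset_def by blast
  moreover then have "x ~= cur" using k by auto
  ultimately show ?thesis unfolding treeset_def by auto
  qed
 qed
 have orient: "oriented (D 5) ?PE ?LB x" if "x \<in> ?X" for x
 proof (cases "x = cur")
  case True
  then show ?thesis unfolding oriented_def using y yc by auto
 next
  case False
  then have x: "x \<in> X" using that by simp
  show ?thesis unfolding oriented_def
  proof (intro allI impI)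
  fix g assume "?PE x = Suc g"
  then obtain z where z: "isrep (D 5) z" "LB z < LB x" "joins (D 5) g x z"
  using E(7)[OF x] False unfolding oriented_def by auto
  have "z ~= cur" using z(2) E6[OF x] LBc by auto
  then show "\<exists>y. isrep (D 5) y & ?LB y < ?LB x & joins (D 5) g x y" using z False by (intro exI[of _ z]) simp
  qed
 qed
 have "(PE cur = 0 --> treeset (D 5) ?PE = insert e L & (\<exists>x\<in>?X. D 9 x = 0))"
  using ts PEc by auto
 moreover have "treeset (D 5) ?PE = insert e L - {g} & g \<in> insert e L &
  isrep (D 5) cur' & D 0 cur' = b & cur' \<notin> ?X & (\<forall>x\<in>?X. D 10 cur' < D 10 x) &
  (\<exists>y. isrep (D 5) y & ?LB y < Suc t & joins (D 5) g cur' y)" if g: "PE cur = Suc g" for g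
 proof -
  obtain z where z: "isrep (D 5) z" "D 10 z < D 10 cur" "joins (D 5) g cur z"
  using R(3)[OF E(11)] g PEc unfolding oriented_def by auto
  have "cur' = z" using cur'[OF g] z(2,3) unfolding joins_def by auto
  have gL: "g \<in> L" using R(2) g PEc E(11) unfolding treeset_def by auto
  have "D 0 z = b" using rep_tree_same[OF rep z(3) gL E(11) z(1)] E(12) by simp
  moreover have "z \<notin> ?X" using z(2) E(14) by fastforce
  moreover have "\<forall>x\<in>?X. D 10 z < D 10 x" using z(2) E(14) by fastforce
  moreover have "joins (D 5) g z cur" using z(3) joins_sym by simp
  moreover have "{k. PE cur = Suc k} = {g}" using g by auto
  ultimately show ?thesis using ts gL z(1) E(11) unfolding \<open>cur' = z\<close> by auto
 qed
 moreover have "\<forall>x\<in>?X. ?LB x < Suc t" using E6 E(13) by fastforce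
 ultimately show ?thesis
  unfolding evert_def using E(1-6,11-13) orient inj by auto
qed

text \<open>The walk has ended at the old root of \<open>b\<close>, so the only root left in the
  united tree is that of \<open>a\<close>. Unvisited components of \<open>b\<close> keep their
  mutual order, as their labels were raised by the same amount, and they stay above the labels of
  the whole path.\<close>

lemma evert_finish:
 assumes rep: "rep D K L" and ev: "evert D L e a b PE LB cur 0 t X"
  and e: "e < m" "ep e = (p, q) \<or> ep e = (q, p)"
  and ab: "D 0 p = a" "D 0 q = b" "a ~= b" "D 2 b <= D 2 a"
  and D': "D' = D(0 := relabel {w. w < n & D 0 w = b} a (D 0), 1 := (D 1)(D 3 a := b),
  2 := (D 2)(a := D 2 a + D 2 b), 3 := (D 3)(a := D 3 b),
  4 := (D 4)(a := D 4 a + D 2 b + D 4 b), 9 := PE, 10 := LB)"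
 shows "rep D' K (insert e L)" "pot D' + D 2 b <= pot D"
proof -
 have R: "parts (D 0) (D 1) (D 2) (D 3)" "parts (D 5) (D 6) (D 7) (D 8)" "comps (D 0) (K \<union> L)"
  "comps (D 5) K" "L \<subseteq> {..<m}" "treeset (D 5) (D 9) = L"
  "\<And>x. isrep (D 5) x ==> oriented (D 5) (D 9) (D 10) x"
  and root: "\<And>x y. isrep (D 5) x ==> isrep (D 5) y ==> D 9 x = 0 ==> D 9 y = 0 ==> D 0 x = D 0 y ==> x = y"
  and lab: "\<forall>v<n. D 10 v < D 4 (D 0 v)" "\<forall>r<n. D 0 r = r --> D 4 r <= D 2 r * D 2 r"
  using rep unfolding rep_def forest_def by auto
 have E: "finite X" "\<And>x. x \<in> X ==> isrep (D 5) x & D 0 x = b" "t = D 4 a + card X"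
  "\<And>x. x \<notin> X ==> PE x = D 9 x"
  "\<And>x. x \<notin> X ==> LB x = (if x < n & D 0 x = b then D 10 x + (D 4 a + D 2 b) else D 10 x)"
  "\<And>x. x \<in> X ==> PE x ~= 0" "\<And>x. x \<in> X ==> oriented (D 5) PE LB x"
  "inj_pe (D 5) PE" "treeset (D 5) PE = insert e L" "\<exists>x\<in>X. D 9 x = 0"
  using ev unfolding evert_def by simp_all
 have "\<forall>x\<in>X. LB x < t & PE x ~= 0 & oriented (D 5) PE LB x"
  using ev unfolding evert_def by (elim conjE) assumption
 then have E6: "\<And>x. x \<in> X ==> LB x < t" by simp
 have pq: "p < n" "q < n" using ep[OF e(1)] e(2) by auto
 have abn: "a < n" "D 0 a = a" "b < n" "D 0 b = b"
  using parts_rep[OF R(1) pq(1)] parts_rep[OF R(1) pq(2)] ab by auto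
 have cardX: "card X <= D 2 b"
  unfolding parts_size(1)[OF R(1) abn(3,4)] using E(2) unfolding isrep_def by (intro card_mono) auto
 let ?cc = "relabel {w. w < n & D 0 w = b} a (D 0)"
 have cc: "?cc w = (if D 0 w = b then a else D 0 w)" if "w < n" for w
  using that unfolding relabel_def by simp
 obtain x0 where x0: "x0 \<in> X" "D 9 x0 = 0" using E(10) by blast
 have XPE: "PE x ~= 0" if "x \<in> X" for x using ev that unfolding evert_def by simp
 have orient: "oriented (D 5) PE LB x" if x: "isrep (D 5) x" for x
 proof (cases "x \<in> X")
  case False
  show ?thesis unfolding oriented_def
  proof (intro allI impI)
  fix g assume "PE x = Suc g"
  then have g: "D 9 x = Suc g" using E(4)[OF False] by simp
  then obtain y where y: "isrep (D 5) y" "D 10 y < D 10 x" "joins (D 5) g x y"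
  using R(7)[OF x] unfolding oriented_def by blast
  have gL: "g \<in> L" using R(6) g x unfolding treeset_def by blast
  have same: "D 0 x = D 0 y" by (rule rep_tree_same[OF rep y(3) gL x y(1)])
  have xn: "x < n" "y < n" using x y(1) unfolding isrep_def by auto
  have "LB y < LB x"
  proof (cases "y \<in> X")
  case True
  then have "LB y < t" "D 0 x = b" using E6 E(2) same by auto
  then show ?thesis using E(5)[OF False] xn E(3) cardX by simp
  next
  case yX: False
  show ?thesis using E(5)[OF False] E(5)[OF yX] y(2) same xn by simp
  qed
  then show "\<exists>y. isrep (D 5) y & LB y < LB x & joins (D 5) g x y" using y by blast
  qed
 qed (use E(7) in blast)
 have roots: "x = y" if xy: "isrep (D 5) x" "isrep (D 5) y" "PE x = 0" "PE y = 0" "?cc x = ?cc y" for x y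
 proof -
  have xX: "x \<notin> X" "y \<notin> X" using XPE[of x] XPE[of y] xy(3,4) by auto
  then have z: "D 9 x = 0" "D 9 y = 0" using E(4) xy by auto
  \<comment> \<open>The unique old root of class \<open>b\<close> has been visited and has a parent
    edge now.\<close>
  have nb: "D 0 w ~= b" if "isrep (D 5) w" "D 9 w = 0" "w \<notin> X" for w
  proof
  assume "D 0 w = b"
  then have "w = x0" using root[OF that(1) _ that(2) x0(2)] E(2)[OF x0(1)] by simp
  then show False using that(3) x0(1) by simp
  qed
  have "x < n" "y < n" using xy unfolding isrep_def by auto
  then have "D 0 x = D 0 y" using xy(5) cc[of x] cc[of y] nb[OF xy(1) z(1) xX(1)] nb[OF xy(2) z(2) xX(2)] by simp
  then show ?thesis using root[OF xy(1,2) z] by simp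
 qed
 have fo: "forest ?cc (D 5) PE LB (insert e L)"
  unfolding forest_def using E(8,9) orient roots by blast
 have pm: "parts ?cc ((D 1)(D 3 a := b)) ((D 2)(a := D 2 a + D 2 b)) ((D 3)(a := D 3 b))"
  by (rule parts_merge[OF R(1) abn ab(3)])
 have co: "comps ?cc (K \<union> insert e L)"
 proof -
  obtain u v where uv: "ep e = (u, v)" by fastforce
  have "{D 0 u, D 0 v} = {a, b}" using uv e(2) ab(1,2) by auto
  then have "comps ?cc (insert e (K \<union> L))"
  using comps_insert[OF R(3,1) uv] ep[OF e(1)] uv by simp
  then show ?thesis by simp
 qed
 let ?ct = "(D 4)(a := D 4 a + D 2 b + D 4 b)"
 have l1: "LB v < ?ct (?cc v)" if "v < n" for v
 proof (cases "v \<in> X")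
  case True
  then show ?thesis using E6[OF True] E(2)[OF True] E(3) cardX cc[OF that] by simp
 next
  case False
  have "D 10 v < D 4 (D 0 v)" using lab(1) that by simp
  then show ?thesis using E(5)[OF False] cc[OF that] that ab(3) by auto
 qed
 have za: "0 < D 2 a" using parts_size(2)[OF R(1) abn(1,2)] .
 \<comment> \<open>The quadratic bound is closed under merging because the mixed term of the square
   pays for the \<open>D 2 b\<close> labels of the gap.\<close>
 have sq: "D 4 a + D 2 b + D 4 b <= (D 2 a + D 2 b) * (D 2 a + D 2 b)"
 proof -
  have "D 4 a <= D 2 a * D 2 a" "D 4 b <= D 2 b * D 2 b" using lab(2) abn by auto
  moreover have "D 2 b <= D 2 a * D 2 b" using za by (cases "D 2 a") auto
  moreover have "(D 2 a + D 2 b) * (D 2 a + D 2 b) = D 2 a * D 2 a + 2 * (D 2 a * D 2 b) + D 2 b * D 2 b"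
  by (simp add: algebra_simps)
  ultimately show ?thesis by linarith
 qed
 have l2: "?ct r <= ((D 2)(a := D 2 a + D 2 b)) r * ((D 2)(a := D 2 a + D 2 b)) r"
  if "r < n" "?cc r = r" for r
 proof (cases "r = a")
  case False
  then have "D 0 r = r" using that cc[OF that(1)] by (auto split: if_splits)
  then show ?thesis using lab(2) that(1) False by simp
 qed (use sq in simp)
 show "rep D' K (insert e L)"
  unfolding rep_def D' using R(2,4,5) e(1) pm co fo l1 l2 by auto
 show "pot D' + D 2 b <= pot D"
  using potc_merge[OF R(1) abn ab(3,4)] unfolding pot_def D' by simp
qed

subsection \<open>The operations on structures\<close>

text \<open>
 Variable 5 selects the structure. Arrays 11 and 12 hold the end points of the edges. The operations
 only change variables from 30 on and the arrays 0 to 10 of the selected structure.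
\<close>

definition edges :: "st => bool" where
 "edges s \<longleftrightarrow> (\<forall>e<m. ar s 11 0 e = fst (ep e) & ar s 12 0 e = snd (ep e))"

abbreviation view :: "st => nat => nat => nat => nat" where
 "view s p \<equiv> (\<lambda>t. ar s t p)"

definition touches :: "nat set => st => st => bool" where
 "touches T s s' \<longleftrightarrow> (\<forall>x<30. vr s' x = vr s x) & rw s' = rw s &
  (\<forall>t p. p ~= vr s 5 \<or> t \<notin> T --> ar s' t p = ar s t p)"

end

abbreviation F5 :: "nat => exp => exp" where "F5 t x \<equiv> Arr t (Var 5) x"

text \<open>After this, variable 32 is the larger class, 33 the smaller one, 31 the end of the edge
  in the smaller class, and 35 the amount by which the labels of that class are raised.\<close>

definition link_begin :: com where
 "link_begin = Asg 30 (Arr 11 (Num 0) (Var 6)) ;; Asg 31 (Arr 12 (Num 0) (Var 6)) ;;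
  Asg 32 (F5 0 (Var 30)) ;; Asg 33 (F5 0 (Var 31)) ;;
  Cond (Less (F5 2 (Var 32)) (F5 2 (Var 33)))
  (Asg 31 (Var 30) ;; Asg 34 (Var 32) ;; Asg 32 (Var 33) ;; Asg 33 (Var 34)) (Asg 34 (Num 0)) ;;
  Asg 35 (Plus (F5 4 (Var 32)) (F5 2 (Var 33))) ;; Asg 36 (Var 33) ;; Asg 37 (Num 0)"

definition link_relabel :: com where
 "link_relabel = Loop (Less (Var 37) (F5 2 (Var 33)))
  (Put 0 (Var 5) (Var 36) (Var 32) ;; Put 10 (Var 5) (Var 36) (Plus (F5 10 (Var 36)) (Var 35)) ;;
  Asg 36 (F5 1 (Var 36)) ;; Asg 37 (Plus (Var 37) (Num 1)))"

definition link_mid :: com where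
 "link_mid = Asg 38 (F5 5 (Var 31)) ;; Asg 39 (Plus (Var 6) (Num 1)) ;; Asg 34 (F5 4 (Var 32))"

definition link_evert :: com where
 "link_evert = Loop (Less (Num 0) (Var 39))
  (Asg 40 (F5 9 (Var 38)) ;; Put 9 (Var 5) (Var 38) (Var 39) ;; Put 10 (Var 5) (Var 38) (Var 34) ;;
  Asg 34 (Plus (Var 34) (Num 1)) ;; Asg 39 (Var 40) ;;
  Cond (Less (Num 0) (Var 40))
  (Asg 41 (Minus (Var 40) (Num 1)) ;; Asg 42 (F5 5 (Arr 11 (Num 0) (Var 41))) ;;
  Cond (Eq (Var 42) (Var 38)) (Asg 38 (F5 5 (Arr 12 (Num 0) (Var 41)))) (Asg 38 (Var 42)))
  (Asg 42 (Num 0)))"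

definition link_end :: com where
 "link_end = Put 1 (Var 5) (F5 3 (Var 32)) (Var 33) ;; Put 3 (Var 5) (Var 32) (F5 3 (Var 33)) ;;
  Put 4 (Var 5) (Var 32) (Plus (Var 35) (F5 4 (Var 33))) ;;
  Put 2 (Var 5) (Var 32) (Plus (F5 2 (Var 32)) (F5 2 (Var 33)))"

definition link :: com where
 "link = link_begin ;; link_relabel ;; link_mid ;; link_evert ;; link_end"

context net
begin

lemma wp_link_relabel:
 assumes xs: "members (ar s 0 P) (ar s 1 P) (ar s 2 P) (ar s 3 P) b xs"
  and v: "vr s 5 = P" "vr s 32 = a" "vr s 33 = b" "vr s 35 = off" "vr s 36 = b" "vr s 37 = 0"
  and cap: "\<And>x. x \<in> set xs ==> ar s 10 P x + off < cap" "length xs < cap"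
 shows "wp link_relabel (\<lambda>s'. (\<forall>x. x ~= 36 & x ~= 37 --> vr s' x = vr s x) & rw s' = rw s &
  (\<forall>t p. p ~= P \<or> t ~= 0 & t ~= 10 --> ar s' t p = ar s t p) &
  ar s' 0 P = relabel (set xs) a (ar s 0 P) &
  ar s' 10 P = (\<lambda>v. if v \<in> set xs then ar s 10 P v + off else ar s 10 P v) &
  ck s' = ck s + 5 * length xs + 1) s"
proof -
 have X: "xs ~= []" "hd xs = b" "distinct xs" "length xs = ar s 2 P b"
  "\<And>i. Suc i < length xs ==> ar s 1 P (xs ! i) = xs ! Suc i"
  using xs unfolding members_def by simp_all
 define I where "I s' \<longleftrightarrow> vr s' 37 <= length xs & (vr s' 37 < length xs --> vr s' 36 = xs ! vr s' 37) &
  (\<forall>x. x ~= 36 & x ~= 37 --> vr s' x = vr s x) & rw s' = rw s &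
  (\<forall>t p. p ~= P \<or> t ~= 0 & t ~= 10 --> ar s' t p = ar s t p) &
  ar s' 0 P = relabel (set (take (vr s' 37) xs)) a (ar s 0 P) &
  ar s' 10 P = (\<lambda>v. if v \<in> set (take (vr s' 37) xs) then ar s 10 P v + off else ar s 10 P v) &
  ck s' = ck s + 5 * vr s' 37" for s' :: st
 show ?thesis
  unfolding link_relabel_def
 proof (rule wp_Loop[where I = I and B = "ck s + 5 * length xs"])
  show "I s" unfolding I_def relabel_def using v X(1,2) by (simp add: hd_conv_nth[symmetric])
 next
  fix s' assume "I s'"
  then show "ck s' <= ck s + 5 * length xs" unfolding I_def by simp
 next
  fix s' show "okb (Less (Var 37) (F5 2 (Var 33))) s'" by simp
 next
  fix s' assume I: "I s'" and b: "bv (Less (Var 37) (F5 2 (Var 33))) s'"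
  define j where "j = vr s' 37"
  have j: "j < length xs --> vr s' 36 = xs ! j"
  "\<forall>x. x ~= 36 & x ~= 37 --> vr s' x = vr s x" "rw s' = rw s"
  "\<forall>t p. p ~= P \<or> t ~= 0 & t ~= 10 --> ar s' t p = ar s t p"
  "ar s' 0 P = relabel (set (take j xs)) a (ar s 0 P)"
  "ar s' 10 P = (\<lambda>v. if v \<in> set (take j xs) then ar s 10 P v + off else ar s 10 P v)"
  "ck s' = ck s + 5 * j" using I unfolding I_def j_def by simp_all
  have jl: "j < length xs" using b j(2,4) v X(4) unfolding j_def by simp
  have nj: "xs ! j \<notin> set (take j xs)"
  using X(3) jl by (auto simp: in_set_conv_nth nth_eq_iff_index_eq)
  have tk: "set (take (Suc j) xs) = insert (xs ! j) (set (take j xs))"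
  using jl by (simp add: take_Suc_conv_app_nth)
  have w: "vr s' 36 = xs ! j" "vr s' 5 = P" "vr s' 32 = a" "vr s' 35 = off" "vr s' 37 = j"
  using j(1,2) jl v unfolding j_def by auto
  have old: "ar s' 10 P (xs ! j) = ar s 10 P (xs ! j)" "ar s' 1 P = ar s 1 P" using j(4,6) nj by auto
  have c: "ar s 10 P (xs ! j) + off < cap" "Suc j < cap" using cap jl by auto
  define s2 where "s2 = s'\<lparr>ar := put 10 P (xs ! j) (ar s 10 P (xs ! j) + off) (put 0 P (xs ! j) a (ar s')),
  vr := (vr s')(36 := ar s 1 P (xs ! j), 37 := Suc j), ck := Suc (Suc (Suc (Suc (Suc (ck s')))))\<rparr>"
  have "I s2"
  unfolding I_def s2_def using jl X(5)[of j] j(2-4,7)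
  by (auto simp: tk relabel_def fun_eq_iff j(5,6))
  then show "wp (Put 0 (Var 5) (Var 36) (Var 32) ;; Put 10 (Var 5) (Var 36) (Plus (F5 10 (Var 36)) (Var 35)) ;;
  Asg 36 (F5 1 (Var 36)) ;; Asg 37 (Plus (Var 37) (Num 1))) I (tick s')"
  unfolding s2_def using w old c by simp
 next
  fix s' assume I: "I s'" and b: "\<not> bv (Less (Var 37) (F5 2 (Var 33))) s'"
  have "vr s' 37 = length xs" using b I v X(4) unfolding I_def by simp
  then show "(\<forall>x. x ~= 36 & x ~= 37 --> vr (tick s') x = vr s x) & rw (tick s') = rw s &
  (\<forall>t p. p ~= P \<or> t ~= 0 & t ~= 10 --> ar (tick s') t p = ar s t p) &
  ar (tick s') 0 P = relabel (set xs) a (ar s 0 P) &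
  ar (tick s') 10 P = (\<lambda>v. if v \<in> set xs then ar s 10 P v + off else ar s 10 P v) &
  ck (tick s') = ck s + 5 * length xs + 1"
  using I unfolding I_def by simp
 qed
qed

lemma wp_link_evert:
 assumes rep: "rep D K L" and b: "b < n" "D 0 b = b" and ea: "e < m" "D 4 a + D 2 b < cap"
  and ev: "evert D L e a b (ar s 9 P) (ar s 10 P) (vr s 38) (vr s 39) (vr s 34) {}"
  and f: "ar s 5 P = D 5" and v: "vr s 5 = P" "edges s"
 shows "wp link_evert (\<lambda>s'. (\<forall>x. x < 30 \<or> x \<in> {32, 33, 35} --> vr s' x = vr s x) & rw s' = rw s &
  (\<forall>t p. p ~= P \<or> t ~= 9 & t ~= 10 --> ar s' t p = ar s t p) &
  (\<exists>cur t X. evert D L e a b (ar s' 9 P) (ar s' 10 P) cur 0 t X) &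
  ck s' <= ck s + 11 * D 2 b + 1) s"
proof -
 have Lm: "L \<subseteq> {..<m}" using rep unfolding rep_def by simp
 have P0: "parts (D 0) (D 1) (D 2) (D 3)" using rep unfolding rep_def by simp
 define I where "I s' \<longleftrightarrow> (\<exists>X. evert D L e a b (ar s' 9 P) (ar s' 10 P) (vr s' 38) (vr s' 39) (vr s' 34) X &
  (\<forall>x. x < 30 \<or> x \<in> {32, 33, 35} --> vr s' x = vr s x) & rw s' = rw s &
  (\<forall>t p. p ~= P \<or> t ~= 9 & t ~= 10 --> ar s' t p = ar s t p) &
  ck s' <= ck s + 11 * card X)" for s' :: st
 have I_intro: "I s'" if "evert D L e a b (ar s' 9 P) (ar s' 10 P) (vr s' 38) (vr s' 39) (vr s' 34) X"
  "\<forall>x. x < 30 \<or> x \<in> {32, 33, 35} --> vr s' x = vr s x" "rw s' = rw s"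
  "\<forall>t p. p ~= P \<or> t ~= 9 & t ~= 10 --> ar s' t p = ar s t p" "ck s' <= ck s + 11 * card X" for s' X
  unfolding I_def using that by blast
 have cX: "card X <= D 2 b" if "evert D L e a b PE LB cur pr t X" for PE LB cur pr t X
  unfolding parts_size(1)[OF P0 b]
  using that unfolding evert_def isrep_def by (intro card_mono) auto
 show ?thesis
  unfolding link_evert_def
 proof (rule wp_Loop[where I = I and B = "ck s + 11 * D 2 b"])
  show "I s" unfolding I_def using ev by (intro exI[of _ "{}"]) simp
 next
  fix s' assume "I s'"
  then obtain X where "evert D L e a b (ar s' 9 P) (ar s' 10 P) (vr s' 38) (vr s' 39) (vr s' 34) X"
  "ck s' <= ck s + 11 * card X" unfolding I_def by blast
  then show "ck s' <= ck s + 11 * D 2 b" using cX by fastforce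
 next
  fix s' show "okb (Less (Num 0) (Var 39)) s'" by simp
 next
  fix s' assume I: "I s'" and bb: "bv (Less (Num 0) (Var 39)) s'"
  from I obtain X where X: "evert D L e a b (ar s' 9 P) (ar s' 10 P) (vr s' 38) (vr s' 39) (vr s' 34) X"
  "\<forall>x. x < 30 \<or> x \<in> {32, 33, 35} --> vr s' x = vr s x" "rw s' = rw s"
  "\<forall>t p. p ~= P \<or> t ~= 9 & t ~= 10 --> ar s' t p = ar s t p" "ck s' <= ck s + 11 * card X"
  unfolding I_def by blast
  obtain h where h: "vr s' 39 = Suc h" using bb by (cases "vr s' 39") auto
  note X1 = X(1)[unfolded h]
  note step = evert_step[OF rep X1 b]
  have cur: "isrep (D 5) (vr s' 38)" "vr s' 38 \<notin> X" "finite X"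
  using X1 unfolding evert_def by simp_all
  have t: "vr s' 34 < D 4 a + D 2 b" by (rule evert_card(2)[OF rep X1 b])
  have PEc: "ar s' 9 P (vr s' 38) = D 9 (vr s' 38)" using X1 cur(2) unfolding evert_def by simp
  have gm: "g < m" if "ar s' 9 P (vr s' 38) = Suc g" for g
  proof -
  have "treeset (D 5) (D 9) = L" using rep unfolding rep_def forest_def by simp
  then have "g \<in> L" using that PEc cur(1) unfolding treeset_def by auto
  then show ?thesis using Lm by auto
  qed
  have v': "vr s' 5 = P" "ar s' 5 P = D 5" using X(2,4) v(1) f by simp_all
  have ed: "ar s' 11 0 g = fst (ep g)" "ar s' 12 0 g = snd (ep g)" if "g < m" for g
  using v(2) that X(4) unfolding edges_def by simp_all
  show "wp (Asg 40 (F5 9 (Var 38)) ;; Put 9 (Var 5) (Var 38) (Var 39) ;; Put 10 (Var 5) (Var 38) (Var 34) ;;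
  Asg 34 (Plus (Var 34) (Num 1)) ;; Asg 39 (Var 40) ;;
  Cond (Less (Num 0) (Var 40))
  (Asg 41 (Minus (Var 40) (Num 1)) ;; Asg 42 (F5 5 (Arr 11 (Num 0) (Var 41))) ;;
  Cond (Eq (Var 42) (Var 38)) (Asg 38 (F5 5 (Arr 12 (Num 0) (Var 41)))) (Asg 38 (Var 42)))
  (Asg 42 (Num 0))) I (tick s')"
  proof (cases "ar s' 9 P (vr s' 38)")
  case 0
  have st: "evert D L e a b ((ar s' 9 P)(vr s' 38 := Suc h)) ((ar s' 10 P)(vr s' 38 := vr s' 34))
  (vr s' 38) 0 (Suc (vr s' 34)) (insert (vr s' 38) X)"
  using step[of "vr s' 38"] 0 by simp
  show ?thesis
  using 0 v' t ea(2) h by simp (rule I_intro[of _ "insert (vr s' 38) X"], use st cur X(2-5) v' h in auto)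
  next
  case (Suc g)
  have st: "evert D L e a b ((ar s' 9 P)(vr s' 38 := Suc h)) ((ar s' 10 P)(vr s' 38 := vr s' 34))
  (if D 5 (fst (ep g)) = vr s' 38 then D 5 (snd (ep g)) else D 5 (fst (ep g)))
  (Suc g) (Suc (vr s' 34)) (insert (vr s' 38) X)"
  using step Suc by simp
  show ?thesis
  using Suc v' t ea(2) h ed[OF gm[OF Suc]]
  by simp (intro conjI impI; rule I_intro[of _ "insert (vr s' 38) X"]; use st cur X(2-5) v' h in auto)
  qed
 next
  fix s' assume I: "I s'" and bb: "\<not> bv (Less (Num 0) (Var 39)) s'"
  from I obtain X where X: "evert D L e a b (ar s' 9 P) (ar s' 10 P) (vr s' 38) (vr s' 39) (vr s' 34) X"
  "\<forall>x. x < 30 \<or> x \<in> {32, 33, 35} --> vr s' x = vr s x" "rw s' = rw s"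
  "\<forall>t p. p ~= P \<or> t ~= 9 & t ~= 10 --> ar s' t p = ar s t p" "ck s' <= ck s + 11 * card X"
  unfolding I_def by blast
  have "vr s' 39 = 0" using bb by simp
  then have "\<exists>cur t X. evert D L e a b (ar s' 9 P) (ar s' 10 P) cur 0 t X" using X(1) by metis
  then show "(\<forall>x. x < 30 \<or> x \<in> {32, 33, 35} --> vr (tick s') x = vr s x) & rw (tick s') = rw s &
  (\<forall>t p. p ~= P \<or> t ~= 9 & t ~= 10 --> ar (tick s') t p = ar s t p) &
  (\<exists>cur t X. evert D L e a b (ar (tick s') 9 P) (ar (tick s') 10 P) cur 0 t X) &
  ck (tick s') <= ck s + 11 * D 2 b + 1"
  using X(2-5) cX[OF X(1)] by simp
 qed
qed

text \<open>The relabelling loop takes 5 ticks per vertex of the smaller class and the reversal at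
  most 11, while the potential falls by at least the size of that class. So the factor 20 pays for
  both loops, and 30 covers the straight parts.\<close>

theorem wp_link:
 assumes rep: "rep (view s P) K L" and v: "vr s 5 = P" "vr s 6 = e" "edges s" and e: "e < m"
  and nc: "ar s 0 P (fst (ep e)) ~= ar s 0 P (snd (ep e))"
 shows "wp link (\<lambda>s'. touches {..10} s s' & rep (view s' P) K (insert e L) &
  ck s' + 20 * pot (view s' P) <= ck s + 30 + 20 * pot (view s P)) s"
proof -
 define D where "D = view s P"
 define b1 where "b1 \<longleftrightarrow> D 2 (D 0 (fst (ep e))) < D 2 (D 0 (snd (ep e)))"
 define p where "p = (if b1 then snd (ep e) else fst (ep e))"
 define q where "q = (if b1 then fst (ep e) else snd (ep e))"
 define a b where "a = D 0 p" and "b = D 0 q"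
 have rD: "rep D K L" using rep unfolding D_def .
 have pq: "ep e = (p, q) \<or> ep e = (q, p)" "p < n" "q < n" using ep[OF e] unfolding p_def q_def by (cases "ep e"; auto)+
 have ab: "a ~= b" "D 2 b <= D 2 a" using nc unfolding a_def b_def p_def q_def D_def b1_def by auto
 have P0: "parts (D 0) (D 1) (D 2) (D 3)" using rD unfolding rep_def by simp
 have abn: "a < n" "D 0 a = a" "b < n" "D 0 b = b"
  using rep_bounds[OF rD pq(2)] rep_bounds[OF rD pq(3)] unfolding a_def b_def by auto
 obtain xs where xs: "members (D 0) (D 1) (D 2) (D 3) b xs" using parts_members[OF P0 abn(3,4)] .
 have xs': "set xs = {v. v < n & D 0 v = b}" "length xs = D 2 b" using xs unfolding members_def by auto
 have tot: "D 4 a + D 2 b + D 4 b < cap" "D 2 a + D 2 b < cap" "D 2 a + D 2 b <= n"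
 proof -
  have "parts (relabel {w. w < n & D 0 w = b} a (D 0)) ((D 1)(D 3 a := b)) ((D 2)(a := D 2 a + D 2 b)) ((D 3)(a := D 3 b))"
  by (rule parts_merge[OF P0 abn ab(1)])
  from parts_size(3)[OF this abn(1)] show z: "D 2 a + D 2 b <= n" using abn ab unfolding relabel_def by simp
  have za: "0 < D 2 a" using parts_size(2)[OF P0 abn(1,2)] .
  have "D 4 a <= D 2 a * D 2 a" "D 4 b <= D 2 b * D 2 b" using rD abn unfolding rep_def by auto
  moreover have "D 2 b <= D 2 a * D 2 b" using za by (cases "D 2 a") auto
  moreover have "(D 2 a + D 2 b) * (D 2 a + D 2 b) = D 2 a * D 2 a + 2 * (D 2 a * D 2 b) + D 2 b * D 2 b"
  by (simp add: algebra_simps)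
  ultimately have "D 4 a + D 2 b + D 4 b <= (D 2 a + D 2 b) * (D 2 a + D 2 b)" by linarith
  also have "\<dots> <= n * n" using z by (intro mult_mono) auto
  also have "\<dots> < cap" by (rule cap_n)
  finally show "D 4 a + D 2 b + D 4 b < cap" .
  have "D 2 a + D 2 b <= n * n" using z le_square[of n] by linarith
  then show "D 2 a + D 2 b < cap" using cap_n by linarith
 qed
 have Dl: "D 10 x < D 4 (D 0 x)" if "x < n" for x using rD that unfolding rep_def by auto
 have ed: "ar s 11 0 e = fst (ep e)" "ar s 12 0 e = snd (ep e)" using v(3) e unfolding edges_def by auto
 define R1 where "R1 s1 \<longleftrightarrow> (\<forall>x<30. vr s1 x = vr s x) & rw s1 = rw s & ar s1 = ar s & vr s1 31 = q & vr s1 32 = a &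
  vr s1 33 = b & vr s1 35 = D 4 a + D 2 b & vr s1 36 = b & vr s1 37 = 0 & ck s1 <= ck s + 12" for s1 :: st
 have 1: "wp link_begin R1 s"
  unfolding link_begin_def R1_def using v ed tot(1)
  by (auto simp: a_def b_def p_def q_def b1_def D_def)
 have 2: "wp (link_relabel ;; link_mid ;; link_evert ;; link_end) (\<lambda>s'. touches {..10} s s' & rep (view s' P) K (insert e L) &
  ck s' + 20 * pot (view s' P) <= ck s + 30 + 20 * pot (view s P)) s1" if R1: "R1 s1" for s1
 proof -
  have r1: "\<forall>x<30. vr s1 x = vr s x" "rw s1 = rw s" "ar s1 = ar s" "vr s1 31 = q" "vr s1 32 = a" "vr s1 33 = b"
  "vr s1 35 = D 4 a + D 2 b" "vr s1 36 = b" "vr s1 37 = 0" "ck s1 <= ck s + 12"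
  using R1 unfolding R1_def by auto
  define R2 where "R2 s2 \<longleftrightarrow> (\<forall>x. x ~= 36 & x ~= 37 --> vr s2 x = vr s1 x) & rw s2 = rw s1 &
  (\<forall>t p. p ~= P \<or> t ~= 0 & t ~= 10 --> ar s2 t p = ar s1 t p) &
  ar s2 0 P = relabel (set xs) a (ar s1 0 P) &
  ar s2 10 P = (\<lambda>v. if v \<in> set xs then ar s1 10 P v + (D 4 a + D 2 b) else ar s1 10 P v) &
  ck s2 = ck s1 + 5 * length xs + 1" for s2 :: st
  have w2: "wp link_relabel R2 s1"
  unfolding R2_def
  proof (rule wp_link_relabel)
  show "members (ar s1 0 P) (ar s1 1 P) (ar s1 2 P) (ar s1 3 P) b xs" using xs unfolding r1(3) D_def .
  show "ar s1 10 P x + (D 4 a + D 2 b) < cap" if "x \<in> set xs" for x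
  using that Dl[of x] tot(1) unfolding xs'(1) r1(3) D_def by auto
  qed (use r1 v tot xs' in auto)
  have w3: "wp (link_mid ;; link_evert ;; link_end) (\<lambda>s'. touches {..10} s s' & rep (view s' P) K (insert e L) &
  ck s' + 20 * pot (view s' P) <= ck s + 30 + 20 * pot (view s P)) s2" if R2: "R2 s2" for s2
  proof -
  have r2: "\<forall>x. x ~= 36 & x ~= 37 --> vr s2 x = vr s1 x" "rw s2 = rw s"
  "\<forall>t p. p ~= P \<or> t ~= 0 & t ~= 10 --> ar s2 t p = ar s t p"
  "ar s2 0 P = relabel {w. w < n & D 0 w = b} a (D 0)"
  "ar s2 10 P = (\<lambda>v. if v < n & D 0 v = b then D 10 v + (D 4 a + D 2 b) else D 10 v)"
  "ck s2 <= ck s + 13 + 5 * D 2 b"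
  using R2 r1(2,10) xs' unfolding R2_def D_def r1(3) by simp_all
  define s3 where "s3 = s2\<lparr>vr := (vr s2)(38 := D 5 q, 39 := Suc e, 34 := D 4 a), ck := Suc (Suc (Suc (ck s2)))\<rparr>"
  have v2: "vr s2 5 = P" "vr s2 6 = e" "vr s2 31 = q" "vr s2 32 = a" using r1 r2(1) v by simp_all
  have a2: "ar s2 t P = D t" if "t ~= 0" "t ~= 10" for t using r2(3) that unfolding D_def by simp
  have w4: "wp link_evert (\<lambda>s'. (\<forall>x. x < 30 \<or> x \<in> {32, 33, 35} --> vr s' x = vr s3 x) & rw s' = rw s3 &
  (\<forall>t p. p ~= P \<or> t ~= 9 & t ~= 10 --> ar s' t p = ar s3 t p) &
  (\<exists>cur t X. evert D L e a b (ar s' 9 P) (ar s' 10 P) cur 0 t X) &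
  ck s' <= ck s3 + 11 * D 2 b + 1) s3"
  proof (rule wp_link_evert[OF rD abn(3,4) e])
  show "evert D L e a b (ar s3 9 P) (ar s3 10 P) (vr s3 38) (vr s3 39) (vr s3 34) {}"
  using evert_init[OF rD e pq(1)] ab(1) r2(5) a2[of 9] unfolding s3_def a_def b_def by simp
  show "D 4 a + D 2 b < cap" using tot by simp
  show "ar s3 5 P = D 5" using a2[of 5] unfolding s3_def by simp
  show "vr s3 5 = P" using v2 unfolding s3_def by simp
  show "edges s3" using v(3) r2(3) unfolding edges_def s3_def by simp
  qed
  have w5: "wp link_end (\<lambda>s'. touches {..10} s s' & rep (view s' P) K (insert e L) &
  ck s' + 20 * pot (view s' P) <= ck s + 30 + 20 * pot (view s P)) s4"
  if r4: "\<forall>x. x < 30 \<or> x \<in> {32, 33, 35} --> vr s4 x = vr s3 x" "rw s4 = rw s3"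
  "\<forall>t p. p ~= P \<or> t ~= 9 & t ~= 10 --> ar s4 t p = ar s3 t p"
  "\<exists>cur t X. evert D L e a b (ar s4 9 P) (ar s4 10 P) cur 0 t X"
  "ck s4 <= ck s3 + 11 * D 2 b + 1" for s4
  proof -
  have v4: "\<forall>x<30. vr s4 x = vr s x" "vr s4 32 = a" "vr s4 33 = b" "vr s4 35 = D 4 a + D 2 b" "vr s4 5 = P"
  using r4(1) r2(1) r1 v(1) unfolding s3_def by auto
  have a4: "ar s4 t P = D t" if "t ~= 0" "t ~= 9" "t ~= 10" for t
  using r4(3) a2 that unfolding s3_def by simp
  have a40: "ar s4 0 P = relabel {w. w < n & D 0 w = b} a (D 0)" using r4(3) r2(4) unfolding s3_def by simp
  have ao: "ar s4 t p = ar s t p" if "p ~= P \<or> t \<notin> {..10}" for t p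
  using r4(3) r2(3) that unfolding s3_def by auto
  obtain cur t X where evf: "evert D L e a b (ar s4 9 P) (ar s4 10 P) cur 0 t X" using r4(4) by blast
  define D' where "D' = D(0 := relabel {w. w < n & D 0 w = b} a (D 0), 1 := (D 1)(D 3 a := b),
  2 := (D 2)(a := D 2 a + D 2 b), 3 := (D 3)(a := D 3 b),
  4 := (D 4)(a := D 4 a + D 2 b + D 4 b), 9 := ar s4 9 P, 10 := ar s4 10 P)"
  note fin = evert_finish[OF rD evf e pq(1) a_def[symmetric] b_def[symmetric] ab D'_def]
  define s5 where "s5 = s4\<lparr>ar := put 2 P a (D 2 a + D 2 b) (put 4 P a (D 4 a + D 2 b + D 4 b)
  (put 3 P a (D 3 b) (put 1 P (D 3 a) b (ar s4)))), ck := ck s4 + 4\<rparr>"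
  have "view s5 P = D'"
  unfolding s5_def D'_def using a4 a40 by (auto simp: fun_eq_iff)
  moreover have "touches {..10} s s5"
  unfolding touches_def s5_def v(1) using v4(1) ao r4(2) r2(2) unfolding s3_def by auto
  moreover have "ck s5 + 20 * pot D' <= ck s + 30 + 20 * pot D"
  using fin(2) r4(5) r2(6) unfolding s5_def s3_def by simp
  ultimately have Q: "touches {..10} s s5 & rep (view s5 P) K (insert e L) &
  ck s5 + 20 * pot (view s5 P) <= ck s + 30 + 20 * pot (view s P)"
  using fin(1) unfolding D_def by simp
  have s5': "s5 = s4\<lparr>ar := put 2 P a (D 2 a + D 2 b) (put 4 P a (D 4 a + D 2 b + D 4 b)
  (put 3 P a (D 3 b) (put 1 P (D 3 a) b (ar s4)))), ck := Suc (Suc (Suc (Suc (ck s4))))\<rparr>"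
  unfolding s5_def by simp
  show ?thesis
  unfolding link_end_def using Q tot v4 a4 ab(1)
  unfolding s5' by simp
  qed
  have "wp link_evert (wp link_end (\<lambda>s'. touches {..10} s s' & rep (view s' P) K (insert e L) &
  ck s' + 20 * pot (view s' P) <= ck s + 30 + 20 * pot (view s P))) s3"
  by (rule wp_mono[OF w4]) (rule w5, blast+)
  then show ?thesis
  unfolding link_mid_def using v2 a2[of 5] a2[of 4] cap_m e unfolding s3_def by simp
  qed
  show ?thesis unfolding wp_Seq[of link_relabel] by (rule wp_mono[OF w2 w3])
 qed
 show ?thesis unfolding link_def wp_Seq[of link_begin] by (rule wp_mono[OF 1 2])
qed

end

section \<open>Contraction, initialization and binary search on the machine\<close>

definition pick :: com where
 "pick = Asg 40 (F5 5 (Var 7)) ;; Asg 43 (F5 5 (Var 8)) ;;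
  Cond (Less (F5 10 (Var 43)) (F5 10 (Var 40)))
  (Asg 34 (Var 40) ;; Asg 40 (Var 43) ;; Asg 43 (Var 34)) (Asg 34 (Num 0)) ;;
  Asg 41 (Minus (F5 9 (Var 43)) (Num 1))"

definition merge_begin :: com where
 "merge_begin = Asg 44 (F5 9 (Var 40)) ;; Asg 45 (F5 10 (Var 40)) ;;
  Cond (Less (F5 7 (Var 40)) (F5 7 (Var 43)))
  (Asg 34 (Var 40) ;; Asg 40 (Var 43) ;; Asg 43 (Var 34)) (Asg 34 (Num 0)) ;;
  Asg 36 (Var 43) ;; Asg 37 (Num 0)"

definition merge_relabel :: com where
 "merge_relabel = Loop (Less (Var 37) (F5 7 (Var 43)))
  (Put 5 (Var 5) (Var 36) (Var 40) ;; Asg 36 (F5 6 (Var 36)) ;; Asg 37 (Plus (Var 37) (Num 1)))"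

definition merge_end :: com where
 "merge_end = Put 6 (Var 5) (F5 8 (Var 40)) (Var 43) ;; Put 8 (Var 5) (Var 40) (F5 8 (Var 43)) ;;
  Put 7 (Var 5) (Var 40) (Plus (F5 7 (Var 40)) (F5 7 (Var 43))) ;;
  Put 9 (Var 5) (Var 40) (Var 44) ;; Put 10 (Var 5) (Var 40) (Var 45)"

definition contract :: com where
 "contract = pick ;; merge_begin ;; merge_relabel ;; merge_end"

definition init_one :: com where
 "init_one = Asg 37 (Num 0) ;; Loop (Less (Var 37) (Var 2))
  (Put 0 (Var 5) (Var 37) (Var 37) ;; Put 2 (Var 5) (Var 37) (Num 1) ;; Put 3 (Var 5) (Var 37) (Var 37) ;;
  Put 4 (Var 5) (Var 37) (Num 1) ;; Put 5 (Var 5) (Var 37) (Var 37) ;; Put 7 (Var 5) (Var 37) (Num 1) ;;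
  Put 8 (Var 5) (Var 37) (Var 37) ;; Put 9 (Var 5) (Var 37) (Num 0) ;; Put 10 (Var 5) (Var 37) (Num 0) ;;
  Asg 37 (Plus (Var 37) (Num 1)))"

definition init_all :: com where
 "init_all = Asg 5 (Num 0) ;; Loop (Less (Var 5) (Var 9)) (init_one ;; Asg 5 (Plus (Var 5) (Num 1)))"

text \<open>Binary search for the first of the structures \<open>base + i\<close>, \<open>i < cnt\<close>, that separates two vertices.\<close>

definition search :: com where
 "search = Asg 46 (Num 0) ;; Asg 47 (Var 11) ;; Loop (Less (Var 46) (Var 47))
  (Asg 48 (Half (Plus (Var 46) (Var 47))) ;; Asg 49 (Plus (Var 10) (Var 48)) ;;
  Cond (Eq (Arr 0 (Var 49) (Var 7)) (Arr 0 (Var 49) (Var 8)))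
  (Asg 46 (Plus (Var 48) (Num 1))) (Asg 47 (Var 48)))"

context net
begin

lemma wp_pick:
 assumes rep: "rep (view s P) K L" and v: "vr s 5 = P" "vr s 7 = u" "vr s 8 = v"
  and uv: "u < n" "v < n" "ar s 5 P u ~= ar s 5 P v" "ar s 0 P u = ar s 0 P v" and e: "ep e = (u, v)"
 shows "wp pick (\<lambda>s'. (\<forall>x<30. vr s' x = vr s x) & rw s' = rw s & ar s' = ar s & ck s' <= ck s + 7 &
  (\<exists>x y g. vr s' 40 = x & vr s' 43 = y & vr s' 41 = g & {x, y} = {ar s 5 P u, ar s 5 P v} &
  ar s 10 P x <= ar s 10 P y & ar s 9 P y = Suc g & g \<in> L &
  conn ep (insert e K \<union> (L - {g})) = conn ep (K \<union> L))) s"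
proof -
 define x where "x = (if ar s 10 P (ar s 5 P v) < ar s 10 P (ar s 5 P u) then ar s 5 P v else ar s 5 P u)"
 define y where "y = (if ar s 10 P (ar s 5 P v) < ar s 10 P (ar s 5 P u) then ar s 5 P u else ar s 5 P v)"
 have xy: "{x, y} = {ar s 5 P u, ar s 5 P v}" "ar s 10 P x <= ar s 10 P y" unfolding x_def y_def by auto
 obtain g where g: "ar s 9 P y = Suc g" "g \<in> L" "conn ep (insert e K \<union> (L - {g})) = conn ep (K \<union> L)"
  using choose_edge[OF rep uv xy e] .
 show ?thesis
 proof (cases "ar s 10 P (ar s 5 P v) < ar s 10 P (ar s 5 P u)")
  case True
  then have "x = ar s 5 P v" "y = ar s 5 P u" unfolding x_def y_def by auto
  then show ?thesis unfolding pick_def using True v g xy by simp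
 next
  case False
  then have "x = ar s 5 P u" "y = ar s 5 P v" unfolding x_def y_def by auto
  then show ?thesis unfolding pick_def using False v g xy by simp
 qed
qed

lemma wp_merge_relabel:
 assumes xs: "members (ar s 5 P) (ar s 6 P) (ar s 7 P) (ar s 8 P) b xs"
  and v: "vr s 5 = P" "vr s 40 = a" "vr s 43 = b" "vr s 36 = b" "vr s 37 = 0" and cap: "length xs < cap"
 shows "wp merge_relabel (\<lambda>s'. (\<forall>x. x ~= 36 & x ~= 37 --> vr s' x = vr s x) & rw s' = rw s &
  (\<forall>t p. p ~= P \<or> t ~= 5 --> ar s' t p = ar s t p) &
  ar s' 5 P = relabel (set xs) a (ar s 5 P) & ck s' = ck s + 4 * length xs + 1) s"
proof -
 have X: "xs ~= []" "hd xs = b" "distinct xs" "length xs = ar s 7 P b"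
  "\<And>i. Suc i < length xs ==> ar s 6 P (xs ! i) = xs ! Suc i"
  using xs unfolding members_def by simp_all
 define I where "I s' \<longleftrightarrow> vr s' 37 <= length xs & (vr s' 37 < length xs --> vr s' 36 = xs ! vr s' 37) &
  (\<forall>x. x ~= 36 & x ~= 37 --> vr s' x = vr s x) & rw s' = rw s &
  (\<forall>t p. p ~= P \<or> t ~= 5 --> ar s' t p = ar s t p) &
  ar s' 5 P = relabel (set (take (vr s' 37) xs)) a (ar s 5 P) &
  ck s' = ck s + 4 * vr s' 37" for s' :: st
 show ?thesis
  unfolding merge_relabel_def
 proof (rule wp_Loop[where I = I and B = "ck s + 4 * length xs"])
  show "I s" unfolding I_def relabel_def using v X(1,2) by (simp add: hd_conv_nth[symmetric])
 next
  fix s' assume "I s'"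
  then show "ck s' <= ck s + 4 * length xs" unfolding I_def by simp
 next
  fix s' show "okb (Less (Var 37) (F5 7 (Var 43))) s'" by simp
 next
  fix s' assume I: "I s'" and b: "bv (Less (Var 37) (F5 7 (Var 43))) s'"
  define j where "j = vr s' 37"
  have j: "j < length xs --> vr s' 36 = xs ! j"
  "\<forall>x. x ~= 36 & x ~= 37 --> vr s' x = vr s x" "rw s' = rw s"
  "\<forall>t p. p ~= P \<or> t ~= 5 --> ar s' t p = ar s t p"
  "ar s' 5 P = relabel (set (take j xs)) a (ar s 5 P)"
  "ck s' = ck s + 4 * j" using I unfolding I_def j_def by simp_all
  have jl: "j < length xs" using b j(2,4) v X(4) unfolding j_def by simp
  have tk: "set (take (Suc j) xs) = insert (xs ! j) (set (take j xs))"
  using jl by (simp add: take_Suc_conv_app_nth)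
  have w: "vr s' 36 = xs ! j" "vr s' 5 = P" "vr s' 40 = a" "vr s' 37 = j"
  using j(1,2) jl v unfolding j_def by auto
  have old: "ar s' 6 P = ar s 6 P" using j(4) by auto
  have c: "Suc j < cap" using cap jl by auto
  define s2 where "s2 = s'\<lparr>ar := put 5 P (xs ! j) a (ar s'),
  vr := (vr s')(36 := ar s 6 P (xs ! j), 37 := Suc j), ck := Suc (Suc (Suc (Suc (ck s'))))\<rparr>"
  have "I s2"
  unfolding I_def s2_def using jl X(5)[of j] j(2-4,6)
  by (auto simp: tk relabel_def fun_eq_iff j(5))
  then show "wp (Put 5 (Var 5) (Var 36) (Var 40) ;; Asg 36 (F5 6 (Var 36)) ;; Asg 37 (Plus (Var 37) (Num 1))) I (tick s')"
  unfolding s2_def using w old c by simp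
 next
  fix s' assume I: "I s'" and b: "\<not> bv (Less (Var 37) (F5 7 (Var 43))) s'"
  have "vr s' 37 = length xs" using b I v X(4) unfolding I_def by simp
  then show "(\<forall>x. x ~= 36 & x ~= 37 --> vr (tick s') x = vr s x) & rw (tick s') = rw s &
  (\<forall>t p. p ~= P \<or> t ~= 5 --> ar (tick s') t p = ar s t p) &
  ar (tick s') 5 P = relabel (set xs) a (ar s 5 P) & ck (tick s') = ck s + 4 * length xs + 1"
  using I unfolding I_def by simp
 qed
qed

text \<open>The only loop spends 4 ticks per vertex of the smaller class. The bound is stated with
  the same constants as that of \<open>wp_link\<close>, so that one accounting serves both
  operations.\<close>

theorem wp_contract:
 assumes rep: "rep (view s P) K L" and v: "vr s 5 = P" "vr s 7 = u" "vr s 8 = v"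
  and uv: "u < n" "v < n" "ar s 5 P u ~= ar s 5 P v" "ar s 0 P u = ar s 0 P v" and e: "ep e = (u, v)"
 shows "wp contract (\<lambda>s'. touches {..10} s s' &
  (\<exists>g\<in>L. vr s' 41 = g & conn ep (insert e K \<union> (L - {g})) = conn ep (K \<union> L) &
  rep (view s' P) (insert e K) (L - {g})) &
  ck s' + 20 * pot (view s' P) <= ck s + 30 + 20 * pot (view s P)) s"
proof -
 define D where "D = view s P"
 have rD: "rep D K L" using rep unfolding D_def .
 define Q where "Q s' \<longleftrightarrow> touches {..10} s s' &
  (\<exists>g\<in>L. vr s' 41 = g & conn ep (insert e K \<union> (L - {g})) = conn ep (K \<union> L) &
  rep (view s' P) (insert e K) (L - {g})) &
  ck s' + 20 * pot (view s' P) <= ck s + 30 + 20 * pot (view s P)" for s' :: st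
 have P5: "parts (D 5) (D 6) (D 7) (D 8)" using rD unfolding rep_def by simp
 have main: "wp (merge_begin ;; merge_relabel ;; merge_end) Q s1"
  if s1: "\<forall>x<30. vr s1 x = vr s x" "rw s1 = rw s" "ar s1 = ar s" "ck s1 <= ck s + 7"
  and xy: "vr s1 40 = x" "vr s1 43 = y" "vr s1 41 = g" "{x, y} = {D 5 u, D 5 v}" "D 10 x <= D 10 y"
  and g: "D 9 y = Suc g" "g \<in> L" "conn ep (insert e K \<union> (L - {g})) = conn ep (K \<union> L)" for s1 x y g
 proof -
  define a where "a = (if D 7 x < D 7 y then y else x)"
  define b where "b = (if D 7 x < D 7 y then x else y)"
  have ab: "{a, b} = {x, y}" "D 7 b <= D 7 a" unfolding a_def b_def by auto
  have fu: "D 5 u < n" "D 5 (D 5 u) = D 5 u" "D 5 v < n" "D 5 (D 5 v) = D 5 v"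
  using rep_bounds(3,4)[OF rD uv(1)] rep_bounds(3,4)[OF rD uv(2)] by auto
  have xyn: "x < n" "D 5 x = x" "y < n" "D 5 y = y" "x ~= y"
  using fu xy(4) uv(3) unfolding D_def by (auto simp: doubleton_eq_iff)
  then have abn: "a < n" "D 5 a = a" "b < n" "D 5 b = b" "a ~= b" unfolding a_def b_def by auto
  obtain xs where xs: "members (D 5) (D 6) (D 7) (D 8) b xs" using parts_members[OF P5 abn(3,4)] .
  have xs': "set xs = {w. w < n & D 5 w = b}" "length xs = D 7 b" using xs unfolding members_def by auto
  have sz: "D 7 a + D 7 b < cap"
  proof -
  have "parts (relabel {w. w < n & D 5 w = b} a (D 5)) ((D 6)(D 8 a := b)) ((D 7)(a := D 7 a + D 7 b)) ((D 8)(a := D 8 b))"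
  by (rule parts_merge[OF P5 abn])
  from parts_size(3)[OF this abn(1)] have "D 7 a + D 7 b <= n" using abn unfolding relabel_def by simp
  then show ?thesis using cap_n le_square[of n] by linarith
  qed
  define R2 where "R2 s2 \<longleftrightarrow> (\<forall>x<30. vr s2 x = vr s x) & rw s2 = rw s & ar s2 = ar s & ck s2 <= ck s + 15 &
  vr s2 40 = a & vr s2 43 = b & vr s2 41 = g & vr s2 44 = D 9 x & vr s2 45 = D 10 x & vr s2 36 = b & vr s2 37 = 0"
  for s2 :: st
  have w2: "wp merge_begin R2 s1"
  unfolding merge_begin_def R2_def using s1 xy(1-3) v(1)
  by (auto simp: a_def b_def D_def)
  have w3: "wp (merge_relabel ;; merge_end) Q s2" if R2: "R2 s2" for s2
  proof -
  have r2: "\<forall>x<30. vr s2 x = vr s x" "rw s2 = rw s" "ar s2 = ar s" "ck s2 <= ck s + 15"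
  "vr s2 40 = a" "vr s2 43 = b" "vr s2 41 = g" "vr s2 44 = D 9 x" "vr s2 45 = D 10 x" "vr s2 36 = b" "vr s2 37 = 0"
  using R2 unfolding R2_def by simp_all
  have w4: "wp merge_relabel (\<lambda>s'. (\<forall>x. x ~= 36 & x ~= 37 --> vr s' x = vr s2 x) & rw s' = rw s2 &
  (\<forall>t p. p ~= P \<or> t ~= 5 --> ar s' t p = ar s2 t p) &
  ar s' 5 P = relabel (set xs) a (ar s2 5 P) & ck s' = ck s2 + 4 * length xs + 1) s2"
  proof (rule wp_merge_relabel)
  show "members (ar s2 5 P) (ar s2 6 P) (ar s2 7 P) (ar s2 8 P) b xs" using xs unfolding r2(3) D_def .
  show "vr s2 5 = P" using r2(1) v(1) by simp
  show "length xs < cap" using xs'(2) sz by simp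
  qed (use r2 in simp_all)
  have w5: "wp merge_end Q s4"
  if r4: "\<forall>x. x ~= 36 & x ~= 37 --> vr s4 x = vr s2 x" "rw s4 = rw s2"
  "\<forall>t p. p ~= P \<or> t ~= 5 --> ar s4 t p = ar s2 t p"
  "ar s4 5 P = relabel (set xs) a (ar s2 5 P)" "ck s4 = ck s2 + 4 * length xs + 1" for s4
  proof -
  have v4: "\<forall>x<30. vr s4 x = vr s x" "vr s4 40 = a" "vr s4 43 = b" "vr s4 41 = g" "vr s4 44 = D 9 x"
  "vr s4 45 = D 10 x" "vr s4 5 = P" using r4(1) r2 v(1) by simp_all
  have a4: "ar s4 t P = D t" if "t ~= 5" for t using r4(3) r2(3) that unfolding D_def by simp
  have a45: "ar s4 5 P = relabel {w. w < n & D 5 w = b} a (D 5)" using r4(4) r2(3) xs'(1) unfolding D_def by simp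
  have ao: "ar s4 t p = ar s t p" if "p ~= P \<or> t \<notin> {..10}" for t p using r4(3) r2(3) that by auto
  define D' where "D' = D(5 := relabel {w. w < n & D 5 w = b} a (D 5), 6 := (D 6)(D 8 a := b),
  7 := (D 7)(a := D 7 a + D 7 b), 8 := (D 8)(a := D 8 b),
  9 := (D 9)(a := D 9 x), 10 := (D 10)(a := D 10 x))"
  have uv': "D 5 u ~= D 5 v" "D 0 u = D 0 v" using uv unfolding D_def by auto
  note fin = rep_contract[OF rD uv(1,2) uv' xy(4,5) e g(1,3) ab D'_def]
  define s5 where "s5 = s4\<lparr>ar := put 10 P a (D 10 x) (put 9 P a (D 9 x) (put 7 P a (D 7 a + D 7 b)
  (put 8 P a (D 8 b) (put 6 P (D 8 a) b (ar s4))))), ck := Suc (Suc (Suc (Suc (Suc (ck s4)))))\<rparr>"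
  have v5: "view s5 P = D'"
  unfolding s5_def D'_def using a4 a45 by (auto simp: fun_eq_iff)
  have "touches {..10} s s5"
  unfolding touches_def s5_def v(1) using v4(1) ao r4(2) r2(2) by auto
  moreover have "ck s5 + 20 * pot D' <= ck s + 30 + 20 * pot D"
  using fin(2) r4(5) r2(4) xs'(2) unfolding s5_def by simp
  moreover have "vr s5 41 = g" unfolding s5_def using v4 by simp
  ultimately have "Q s5" unfolding Q_def v5 using fin(1) g unfolding D_def by auto
  then show ?thesis
  unfolding merge_end_def s5_def using sz v4 a4 abn(5) by simp
  qed
  show ?thesis unfolding wp_Seq by (rule wp_mono[OF w4]) (rule w5, blast+)
  qed
  show ?thesis unfolding wp_Seq[of merge_begin] by (rule wp_mono[OF w2 w3])
 qed
 have "wp contract Q s"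
  unfolding contract_def wp_Seq[of pick]
 proof (rule wp_mono[OF wp_pick[OF rep v uv e]], elim conjE exE)
  fix s1 :: st and x y g
  assume "\<forall>x<30. vr s1 x = vr s x" "rw s1 = rw s" "ar s1 = ar s" "ck s1 <= ck s + 7"
  "vr s1 40 = x" "vr s1 43 = y" "vr s1 41 = g" "{x, y} = {ar s 5 P u, ar s 5 P v}"
  "ar s 10 P x <= ar s 10 P y" "ar s 9 P y = Suc g" "g \<in> L"
  "conn ep (insert e K \<union> (L - {g})) = conn ep (K \<union> L)"
  then show "wp (merge_begin ;; merge_relabel ;; merge_end) Q s1"
  by (intro main[of s1 x y g]) (simp_all add: D_def)
 qed
 then show ?thesis unfolding Q_def .
qed

lemma n_cap: "n < cap"
 using cap_n le_square[of n] by linarith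

lemma wp_init_one:
 assumes v: "vr s 2 = n" "vr s 5 = P"
 shows "wp init_one (\<lambda>s'. touches {..10} s s' & rep (view s' P) {} {} & ck s' = ck s + 11 * n + 2) s"
proof -
 define I where "I s' \<longleftrightarrow> vr s' 37 <= n & (\<forall>x<30. vr s' x = vr s x) & rw s' = rw s &
  (\<forall>t p. p ~= P \<or> t \<notin> {..10} --> ar s' t p = ar s t p) &
  (\<forall>v<vr s' 37. ar s' 0 P v = v & ar s' 2 P v = 1 & ar s' 3 P v = v & ar s' 4 P v = 1 & ar s' 5 P v = v &
  ar s' 7 P v = 1 & ar s' 8 P v = v & ar s' 9 P v = 0 & ar s' 10 P v = 0) &
  ck s' = ck s + 1 + 11 * vr s' 37" for s' :: st
 have "wp (Loop (Less (Var 37) (Var 2))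
  (Put 0 (Var 5) (Var 37) (Var 37) ;; Put 2 (Var 5) (Var 37) (Num 1) ;; Put 3 (Var 5) (Var 37) (Var 37) ;;
  Put 4 (Var 5) (Var 37) (Num 1) ;; Put 5 (Var 5) (Var 37) (Var 37) ;; Put 7 (Var 5) (Var 37) (Num 1) ;;
  Put 8 (Var 5) (Var 37) (Var 37) ;; Put 9 (Var 5) (Var 37) (Num 0) ;; Put 10 (Var 5) (Var 37) (Num 0) ;;
  Asg 37 (Plus (Var 37) (Num 1))))
  (\<lambda>s'. touches {..10} s s' & rep (view s' P) {} {} & ck s' = ck s + 11 * n + 2)
  (s\<lparr>vr := (vr s)(37 := 0), ck := Suc (ck s)\<rparr>)"
 proof (rule wp_Loop[where I = I and B = "ck s + 1 + 11 * n"])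
  show "I (s\<lparr>vr := (vr s)(37 := 0), ck := Suc (ck s)\<rparr>)" unfolding I_def by simp
 next
  fix s' assume "I s'"
  then show "ck s' <= ck s + 1 + 11 * n" unfolding I_def by simp
 next
  fix s' show "okb (Less (Var 37) (Var 2)) s'" by simp
 next
  fix s' assume I: "I s'" and b: "bv (Less (Var 37) (Var 2)) s'"
  have I': "\<forall>x<30. vr s' x = vr s x" "rw s' = rw s" "\<forall>t p. p ~= P \<or> t \<notin> {..10} --> ar s' t p = ar s t p"
  "\<forall>v<vr s' 37. ar s' 0 P v = v & ar s' 2 P v = 1 & ar s' 3 P v = v & ar s' 4 P v = 1 & ar s' 5 P v = v &
  ar s' 7 P v = 1 & ar s' 8 P v = v & ar s' 9 P v = 0 & ar s' 10 P v = 0"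
  "ck s' = ck s + 1 + 11 * vr s' 37" using I unfolding I_def by simp_all
  have lt: "vr s' 37 < n" "Suc (vr s' 37) < cap" "vr s' 5 = P" using b I'(1) v n_cap by auto
  show "wp (Put 0 (Var 5) (Var 37) (Var 37) ;; Put 2 (Var 5) (Var 37) (Num 1) ;; Put 3 (Var 5) (Var 37) (Var 37) ;;
  Put 4 (Var 5) (Var 37) (Num 1) ;; Put 5 (Var 5) (Var 37) (Var 37) ;; Put 7 (Var 5) (Var 37) (Num 1) ;;
  Put 8 (Var 5) (Var 37) (Var 37) ;; Put 9 (Var 5) (Var 37) (Num 0) ;; Put 10 (Var 5) (Var 37) (Num 0) ;;
  Asg 37 (Plus (Var 37) (Num 1))) I (tick s')"
  unfolding I_def using lt I' by (simp add: less_Suc_eq)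
 next
  fix s' assume I: "I s'" and b: "\<not> bv (Less (Var 37) (Var 2)) s'"
  have I': "\<forall>x<30. vr s' x = vr s x" "rw s' = rw s" "\<forall>t p. p ~= P \<or> t \<notin> {..10} --> ar s' t p = ar s t p"
  "\<forall>v<vr s' 37. ar s' 0 P v = v & ar s' 2 P v = 1 & ar s' 3 P v = v & ar s' 4 P v = 1 & ar s' 5 P v = v &
  ar s' 7 P v = 1 & ar s' 8 P v = v & ar s' 9 P v = 0 & ar s' 10 P v = 0"
  "ck s' = ck s + 1 + 11 * vr s' 37" "vr s' 37 <= n" using I unfolding I_def by simp_all
  have "vr s' 37 = n" using b I'(1,6) v by simp
  then have "rep (view s' P) {} {}" using I'(4) by (intro rep_init) simp
  then show "touches {..10} s (tick s') & rep (view (tick s') P) {} {} & ck (tick s') = ck s + 11 * n + 2"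
  using I' \<open>vr s' 37 = n\<close> v unfolding touches_def by simp
 qed
 then show ?thesis unfolding init_one_def by simp
qed

theorem wp_init_all:
 assumes v: "vr s 2 = n" "vr s 9 = c" "c < cap"
 shows "wp init_all (\<lambda>s'. (\<forall>x<30. x ~= 5 --> vr s' x = vr s x) & rw s' = rw s &
  (\<forall>t p. 10 < t --> ar s' t p = ar s t p) & (\<forall>p<c. rep (view s' p) {} {}) &
  ck s' = ck s + c * (11 * n + 4) + 2) s"
proof -
 define I where "I s' \<longleftrightarrow> vr s' 5 <= c & (\<forall>x<30. x ~= 5 --> vr s' x = vr s x) & rw s' = rw s &
  (\<forall>t p. 10 < t --> ar s' t p = ar s t p) & (\<forall>p<vr s' 5. rep (view s' p) {} {}) &
  ck s' = ck s + 1 + vr s' 5 * (11 * n + 4)" for s' :: st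
 have "wp (Loop (Less (Var 5) (Var 9)) (init_one ;; Asg 5 (Plus (Var 5) (Num 1))))
  (\<lambda>s'. (\<forall>x<30. x ~= 5 --> vr s' x = vr s x) & rw s' = rw s &
  (\<forall>t p. 10 < t --> ar s' t p = ar s t p) & (\<forall>p<c. rep (view s' p) {} {}) &
  ck s' = ck s + c * (11 * n + 4) + 2) (s\<lparr>vr := (vr s)(5 := 0), ck := Suc (ck s)\<rparr>)"
 proof (rule wp_Loop[where I = I and B = "ck s + 1 + c * (11 * n + 4)"])
  show "I (s\<lparr>vr := (vr s)(5 := 0), ck := Suc (ck s)\<rparr>)" unfolding I_def by simp
 next
  fix s' assume "I s'"
  then have "ck s' = ck s + 1 + vr s' 5 * (11 * n + 4)" "vr s' 5 <= c" unfolding I_def by simp_all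
  then show "ck s' <= ck s + 1 + c * (11 * n + 4)" using mult_right_mono[of "vr s' 5" c "11 * n + 4"] by linarith
 next
  fix s' show "okb (Less (Var 5) (Var 9)) s'" by simp
 next
  fix s' assume I: "I s'" and b: "bv (Less (Var 5) (Var 9)) s'"
  have I': "\<forall>x<30. x ~= 5 --> vr s' x = vr s x" "rw s' = rw s" "\<forall>t p. 10 < t --> ar s' t p = ar s t p"
  "\<forall>p<vr s' 5. rep (view s' p) {} {}" "ck s' = ck s + 1 + vr s' 5 * (11 * n + 4)" using I unfolding I_def by simp_all
  have lt: "vr s' 5 < c" "Suc (vr s' 5) < cap" using b I'(1) v by auto
  have v2: "vr (tick s') 2 = n" "vr (tick s') 5 = vr s' 5" using I'(1) v by simp_all
  show "wp (init_one ;; Asg 5 (Plus (Var 5) (Num 1))) I (tick s')"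
  unfolding wp_Seq
  proof (rule wp_mono[OF wp_init_one[OF v2]])
  fix s2 assume s2: "touches {..10} (tick s') s2 & rep (view s2 (vr s' 5)) {} {} & ck s2 = ck (tick s') + 11 * n + 2"
  then have t: "\<forall>x<30. vr s2 x = vr s' x" "rw s2 = rw s'" "\<And>t p. p ~= vr s' 5 \<or> 10 < t ==> ar s2 t p = ar s' t p"
  unfolding touches_def by auto
  have "rep (view s2 p) {} {}" if "p < Suc (vr s' 5)" for p
  proof (cases "p = vr s' 5")
  case False
  then have "view s2 p = view s' p" using t(3) by auto
  then show ?thesis using I'(4) that False by simp
  qed (use s2 in simp)
  then show "wp (Asg 5 (Plus (Var 5) (Num 1))) I s2"
  unfolding I_def using t I'(1-3,5) s2 lt by simp
  qed
 next
  fix s' assume I: "I s'" and b: "\<not> bv (Less (Var 5) (Var 9)) s'"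
  have "vr s' 5 = c" using I b v unfolding I_def by simp
  then show "(\<forall>x<30. x ~= 5 --> vr (tick s') x = vr s x) & rw (tick s') = rw s &
  (\<forall>t p. 10 < t --> ar (tick s') t p = ar s t p) & (\<forall>p<c. rep (view (tick s') p) {} {}) &
  ck (tick s') = ck s + c * (11 * n + 4) + 2" using I unfolding I_def by simp
 qed
 then show ?thesis unfolding init_all_def by simp
qed

theorem wp_search:
 assumes v: "vr s 7 = u" "vr s 8 = v" "vr s 10 = base" "vr s 11 = cnt"
  and cap: "2 * cnt < cap" "base + cnt < cap" and w: "cnt < 2 ^ w"
  and mono: "\<And>i j. i <= j ==> j < cnt ==> ar s 0 (base + j) u = ar s 0 (base + j) v ==>
  ar s 0 (base + i) u = ar s 0 (base + i) v"
 shows "wp search (\<lambda>s'. (\<forall>x<30. vr s' x = vr s x) & rw s' = rw s & ar s' = ar s & vr s' 46 <= cnt &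
  (\<forall>i<vr s' 46. ar s 0 (base + i) u = ar s 0 (base + i) v) &
  (vr s' 46 < cnt --> ar s 0 (base + vr s' 46) u ~= ar s 0 (base + vr s' 46) v) &
  ck s' <= ck s + 3 + 5 * w) s"
proof -
 define c where "c i \<longleftrightarrow> ar s 0 (base + i) u = ar s 0 (base + i) v" for i
 have mono: "\<And>i j. i <= j ==> j < cnt ==> c j ==> c i" using mono unfolding c_def by blast
 \<comment> \<open>The witness \<open>g\<close> bounds the number of halvings still to come; each of
   them costs 5 ticks.\<close>
 define I where "I s' \<longleftrightarrow> (\<forall>x<30. vr s' x = vr s x) & rw s' = rw s & ar s' = ar s &
  vr s' 46 <= vr s' 47 & vr s' 47 <= cnt & (\<forall>i<vr s' 46. c i) & (vr s' 47 < cnt --> \<not> c (vr s' 47)) &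
  (\<exists>g. vr s' 47 - vr s' 46 < 2 ^ g & ck s' + 5 * g <= ck s + 2 + 5 * w)" for s' :: st
 have "wp (Loop (Less (Var 46) (Var 47))
  (Asg 48 (Half (Plus (Var 46) (Var 47))) ;; Asg 49 (Plus (Var 10) (Var 48)) ;;
  Cond (Eq (Arr 0 (Var 49) (Var 7)) (Arr 0 (Var 49) (Var 8)))
  (Asg 46 (Plus (Var 48) (Num 1))) (Asg 47 (Var 48))))
  (\<lambda>s'. (\<forall>x<30. vr s' x = vr s x) & rw s' = rw s & ar s' = ar s & vr s' 46 <= cnt &
  (\<forall>i<vr s' 46. c i) & (vr s' 46 < cnt --> \<not> c (vr s' 46)) & ck s' <= ck s + 3 + 5 * w)
  (s\<lparr>vr := (vr s)(46 := 0, 47 := cnt), ck := Suc (Suc (ck s))\<rparr>)"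
 proof (rule wp_Loop[where I = I and B = "ck s + 2 + 5 * w"])
  show "I (s\<lparr>vr := (vr s)(46 := 0, 47 := cnt), ck := Suc (Suc (ck s))\<rparr>)"
  unfolding I_def using w by (simp add: exI[of _ w])
 next
  fix s' assume "I s'"
  then show "ck s' <= ck s + 2 + 5 * w" unfolding I_def by auto
 next
  fix s' show "okb (Less (Var 46) (Var 47)) s'" by simp
 next
  fix s' assume I: "I s'" and b: "bv (Less (Var 46) (Var 47)) s'"
  define lo hi where "lo = vr s' 46" and "hi = vr s' 47"
  obtain g where g: "hi - lo < 2 ^ g" "ck s' + 5 * g <= ck s + 2 + 5 * w" using I unfolding I_def lo_def hi_def by auto
  have I': "\<forall>x<30. vr s' x = vr s x" "rw s' = rw s" "ar s' = ar s" "hi <= cnt" "\<forall>i<lo. c i" "hi < cnt --> \<not> c hi"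
  using I unfolding I_def lo_def hi_def by simp_all
  have lh: "lo < hi" using b unfolding lo_def hi_def by simp
  obtain g' where g': "g = Suc g'" using g(1) lh by (cases g) auto
  define mid where "mid = (lo + hi) div 2"
  have md: "lo <= mid" "mid < hi" "lo + hi < cap" "base + mid < cap" "Suc mid < cap"
  using lh I'(4) cap unfolding mid_def by auto
  have wd: "hi - Suc mid < 2 ^ g'" "mid - lo < 2 ^ g'" using g(1) lh unfolding g' mid_def by auto
  have vv: "vr s' 7 = u" "vr s' 8 = v" "vr s' 10 = base" "vr s' 46 = lo" "vr s' 47 = hi"
  using I'(1) v unfolding lo_def hi_def by simp_all
  show "wp (Asg 48 (Half (Plus (Var 46) (Var 47))) ;; Asg 49 (Plus (Var 10) (Var 48)) ;;
  Cond (Eq (Arr 0 (Var 49) (Var 7)) (Arr 0 (Var 49) (Var 8)))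
  (Asg 46 (Plus (Var 48) (Num 1))) (Asg 47 (Var 48))) I (tick s')"
  proof (cases "c mid")
  case True
  define s2 where "s2 = s'\<lparr>vr := (vr s')(48 := mid, 49 := base + mid, 46 := Suc mid),
  ck := Suc (Suc (Suc (Suc (Suc (ck s')))))\<rparr>"
  have "\<forall>i<Suc mid. c i" using mono[of _ mid] True md(2) I'(4) by auto
  moreover have "\<exists>g. hi - Suc mid < 2 ^ g & ck s2 + 5 * g <= ck s + 2 + 5 * w"
  using wd g g' unfolding s2_def by (intro exI[of _ g']) simp
  ultimately have "I s2" unfolding I_def using vv md I' by (simp add: s2_def)
  then show ?thesis
  using True[unfolded c_def] vv md I'(3) unfolding s2_def by (simp add: mid_def[symmetric])
  next
  case False
  define s2 where "s2 = s'\<lparr>vr := (vr s')(48 := mid, 49 := base + mid, 47 := mid),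
  ck := Suc (Suc (Suc (Suc (Suc (ck s')))))\<rparr>"
  have "\<exists>g. mid - lo < 2 ^ g & ck s2 + 5 * g <= ck s + 2 + 5 * w"
  using wd g g' unfolding s2_def by (intro exI[of _ g']) simp
  then have "I s2" unfolding I_def using vv md I' False by (simp add: s2_def)
  then show ?thesis
  using False[unfolded c_def] vv md I'(3) unfolding s2_def by (simp add: mid_def[symmetric])
  qed
 next
  fix s' assume I: "I s'" and b: "\<not> bv (Less (Var 46) (Var 47)) s'"
  then have "vr s' 46 = vr s' 47" unfolding I_def by simp
  then show "(\<forall>x<30. vr (tick s') x = vr s x) & rw (tick s') = rw s & ar (tick s') = ar s & vr (tick s') 46 <= cnt &
  (\<forall>i<vr (tick s') 46. c i) & (vr (tick s') 46 < cnt --> \<not> c (vr (tick s') 46)) & ck (tick s') <= ck s + 3 + 5 * w"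
  using I unfolding I_def by auto
 qed
 then show ?thesis unfolding search_def c_def using v by simp
qed

end

section \<open>The abstract algorithm\<close>

context matroid
begin

lemma sp_Un_cong:
 assumes "sp A = sp B"
 shows "sp (A \<union> Z) = sp (B \<union> Z)"
proof -
 have "sp (A \<union> Z) \<subseteq> sp (B \<union> Z)" if "sp A = sp B" for A B
 proof (rule sp_least)
  have "A \<subseteq> sp B" using sp_ext[of A] that by simp
  also have "sp B \<subseteq> sp (B \<union> Z)" by (rule sp_mono) blast
  finally have "A \<subseteq> sp (B \<union> Z)" .
  moreover have "Z \<subseteq> sp (B \<union> Z)" using sp_ext[of "B \<union> Z"] by blast
  ultimately show "A \<union> Z \<subseteq> sp (B \<union> Z)" by blast
 qed
 then show ?thesis using assms by (metis order.antisym)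
qed

subsection \<open>The sparsifier\<close>

definition sparse :: "nat => (nat => 'a set) => 'a set => bool" where
 "sparse L F E \<longleftrightarrow> (\<forall>j<L. ind (F j) & F j \<subseteq> E) & (\<forall>i j. i < j --> j < L --> F i \<inter> F j = {}) &
  (\<forall>j. Suc j < L --> F (Suc j) \<subseteq> sp (F j)) & E - (\<Union>j<L. F j) \<subseteq> sp (F (L - 1))"

lemma sparse_empty: "sparse L (\<lambda>_. {}) {}"
 unfolding sparse_def by (simp add: ind_empty)

text \<open>So the sets that span a given element form an initial segment, and the first set not
  spanning it can be found by binary search.\<close>

lemma sparse_nested:
 assumes "sparse L F E" "i <= j" "j < L"
 shows "F j \<subseteq> sp (F i)"
 using assms(2,3)
proof (induction j rule: dec_induct)
 case base
 show ?case by (rule sp_ext)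
next
 case (step j)
 have "F (Suc j) \<subseteq> sp (F j)" using assms(1) step.prems unfolding sparse_def by blast
 moreover have "sp (F j) \<subseteq> sp (F i)" using step by (intro sp_least) simp
 ultimately show ?case by (rule order_trans)
qed

lemma sparse_skip:
 assumes "sparse L F E" "e \<in> sp (F (L - 1))"
 shows "sparse L F (insert e E)"
 using assms unfolding sparse_def by blast

text \<open>First fit matters: since all sets before \<open>i\<close> span \<open>e\<close>, the
  enlarged \<open>F i\<close> remains in the span of its predecessor.\<close>

lemma sparse_add:
 assumes S: "sparse L F E" and i: "i < L" "e \<notin> sp (F i)" "\<And>j. j < i ==> e \<in> sp (F j)" and "e \<notin> E"
 shows "sparse L (F(i := insert e (F i))) (insert e E)"
proof -
 let ?F = "F(i := insert e (F i))"
 have s: "\<And>j. j < L ==> ind (F j)" "\<And>j. j < L ==> F j \<subseteq> E" "\<And>i j. i < j ==> j < L ==> F i \<inter> F j = {}"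
  "\<And>j. Suc j < L ==> F (Suc j) \<subseteq> sp (F j)" "E - (\<Union>j<L. F j) \<subseteq> sp (F (L - 1))"
  using S unfolding sparse_def by auto
 have sub: "sp (F j) \<subseteq> sp (?F j)" for j by (rule sp_mono) auto
 have FL: "j < L ==> e \<notin> F j" for j using s(2)[of j] \<open>e \<notin> E\<close> by blast
 show ?thesis
  unfolding sparse_def
 proof (intro conjI allI impI)
  fix j assume j: "j < L"
  show "ind (?F j)" using ind_insert[OF s(1)[OF i(1)] i(2)] s(1)[OF j] by simp
  show "?F j \<subseteq> insert e E" using s(2)[OF j] s(2)[OF i(1)] by auto
 next
  fix a b assume ab: "a < b" "b < L"
  have "e \<notin> F a" "e \<notin> F b" using FL ab by auto
  then show "?F a \<inter> ?F b = {}" using s(3)[OF ab] ab by auto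
 next
  fix j assume j: "Suc j < L"
  have "F (Suc j) \<subseteq> sp (?F j)" using s(4)[OF j] sub[of j] by blast
  moreover have "e \<in> sp (?F j)" if "Suc j = i" using i(3)[of j] that sub[of j] by blast
  ultimately show "?F (Suc j) \<subseteq> sp (?F j)" by auto
 next
  have "F j \<subseteq> ?F j" for j by auto
  then have "(\<Union>j<L. F j) \<subseteq> (\<Union>j<L. ?F j)" by (intro UN_mono) auto
  moreover have "e \<in> (\<Union>j<L. ?F j)" using i(1) by (intro UN_I[of i]) auto
  ultimately have "insert e E - (\<Union>j<L. ?F j) \<subseteq> E - (\<Union>j<L. F j)" by blast
  also note s(5)
  also note sub[of "L - 1"]
  finally show "insert e E - (\<Union>j<L. ?F j) \<subseteq> sp (?F (L - 1))" .
 qed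
qed

subsection \<open>Push-relabel\<close>

definition asg :: "'a set => ('a => nat) => nat => 'a set" where
 "asg H home i = {x \<in> H. home x = Suc i}"

definition up :: "'a set => ('a => nat) => nat => 'a set" where
 "up H lev j = {x \<in> H. j <= lev x}"

text \<open>
 \<open>home x = Suc i\<close> means that \<open>x\<close> is assigned to the \<open>i\<close>-th set, and \<open>lev x = 0\<close> that \<open>x\<close> has not yet
 been considered. Elements of level \<open>D + 1\<close> have been given up, and \<open>tok\<close> is the element being placed.
\<close>

definition pushrel :: "'a set => nat => nat => ('a => nat) => ('a => nat) => 'a set => bool" where
 "pushrel H k D lev home tok \<longleftrightarrow> finite H & tok \<subseteq> H & (\<forall>x\<in>tok. home x = 0 & 1 <= lev x) &
  (\<forall>x\<in>H. lev x <= Suc D & home x <= k & (home x ~= 0 --> 1 <= lev x & lev x <= D) &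
  (home x = 0 --> x \<in> tok \<or> lev x = 0 \<or> lev x = Suc D)) &
  (\<forall>i<k. ind (asg H home i)) &
  (\<forall>j i. 1 <= j --> j <= D --> i < k --> up H lev (Suc j) \<subseteq> sp (asg H home i \<inter> up H lev j)) &
  (\<forall>j i. 1 <= j --> j <= D --> Suc i < k -->
  asg H home (Suc i) \<inter> up H lev j \<subseteq> sp (asg H home i \<inter> up H lev j))"

text \<open>As for the sparsifier, this makes binary search possible, now among the \<open>k\<close>
  sets restricted to the elements from level \<open>j\<close> on.\<close>

lemma pushrel_nested:
 assumes P: "pushrel H k D lev home tok" and j: "1 <= j" "j <= D" and "i <= i'" "i' < k"
 shows "sp (asg H home i' \<inter> up H lev j) \<subseteq> sp (asg H home i \<inter> up H lev j)"
 using assms(4,5)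
proof (induction i' rule: dec_induct)
 case (step i')
 have "asg H home (Suc i') \<inter> up H lev j \<subseteq> sp (asg H home i' \<inter> up H lev j)"
  using P j step.prems unfolding pushrel_def by blast
 then have "sp (asg H home (Suc i') \<inter> up H lev j) \<subseteq> sp (asg H home i' \<inter> up H lev j)" by (rule sp_least)
 also have "\<dots> \<subseteq> sp (asg H home i \<inter> up H lev j)" using step by simp
 finally show ?case .
qed simp

lemma pushrel_init:
 assumes "finite H"
 shows "pushrel H k D (\<lambda>_. 0) (\<lambda>_. 0) {}"
proof -
 have "asg H (\<lambda>_. 0) i = {}" for i unfolding asg_def by simp
 moreover have "up H (\<lambda>_. 0) (Suc j) = {}" for j unfolding up_def by simp
 ultimately show ?thesis unfolding pushrel_def using assms ind_empty by simp
qed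

lemma pushrel_start:
 assumes P: "pushrel H k D lev home {}" and x: "x \<in> H" "lev x = 0" and "1 <= D"
 shows "pushrel H k D (lev(x := 1)) home {x}"
proof -
 have p: "finite H" "\<And>x. x \<in> H ==> lev x <= Suc D" "\<And>x. x \<in> H ==> home x <= k"
  "\<And>x. x \<in> H ==> home x ~= 0 ==> 1 <= lev x & lev x <= D"
  "\<And>x. x \<in> H ==> home x = 0 ==> lev x = 0 \<or> lev x = Suc D"
  "\<And>i. i < k ==> ind (asg H home i)"
  "\<And>j i. 1 <= j ==> j <= D ==> i < k ==> up H lev (Suc j) \<subseteq> sp (asg H home i \<inter> up H lev j)"
  "\<And>j i. 1 <= j ==> j <= D ==> Suc i < k ==>
  asg H home (Suc i) \<inter> up H lev j \<subseteq> sp (asg H home i \<inter> up H lev j)"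
  using P unfolding pushrel_def by auto
 have hx: "home x = 0" using p(4)[OF x(1)] x(2) by auto
 have u: "up H (lev(x := 1)) (Suc j) = up H lev (Suc j)" if "1 <= j" for j
  using that x(2) unfolding up_def by auto
 have a: "asg H home i \<inter> up H (lev(x := 1)) j = asg H home i \<inter> up H lev j" for i j
  using hx unfolding up_def asg_def by auto
 show ?thesis
  unfolding pushrel_def a using p hx x u \<open>1 <= D\<close> by (auto simp: fun_upd_def)
qed

text \<open>Raising \<open>x\<close> adds it to the elements above its old level, which every set
  must span at that level; this is just what the search has established. The restricted sets do not
  change because \<open>x\<close> is unassigned.\<close>

lemma pushrel_relabel:
 assumes P: "pushrel H k D lev home {x}" and l: "lev x <= D"
  and sp: "\<And>i. i < k ==> x \<in> sp (asg H home i \<inter> up H lev (lev x))"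
 shows "pushrel H k D (lev(x := Suc (lev x))) home {x}"
proof -
 have p: "finite H" "x \<in> H" "home x = 0" "1 <= lev x" "\<And>x. x \<in> H ==> lev x <= Suc D" "\<And>x. x \<in> H ==> home x <= k"
  "\<And>x. x \<in> H ==> home x ~= 0 ==> 1 <= lev x & lev x <= D"
  "\<And>y. y \<in> H ==> home y = 0 ==> y = x \<or> lev y = 0 \<or> lev y = Suc D"
  "\<And>i. i < k ==> ind (asg H home i)"
  "\<And>j i. 1 <= j ==> j <= D ==> i < k ==> up H lev (Suc j) \<subseteq> sp (asg H home i \<inter> up H lev j)"
  "\<And>j i. 1 <= j ==> j <= D ==> Suc i < k ==>
  asg H home (Suc i) \<inter> up H lev j \<subseteq> sp (asg H home i \<inter> up H lev j)"
  using P unfolding pushrel_def by auto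
 let ?l = "lev(x := Suc (lev x))"
 have a: "asg H home i \<inter> up H ?l j = asg H home i \<inter> up H lev j" for i j
  using p(3) unfolding up_def asg_def by auto
 have "up H ?l (Suc j) \<subseteq> sp (asg H home i \<inter> up H lev j)" if j: "1 <= j" "j <= D" "i < k" for i j
 proof
  fix y assume y: "y \<in> up H ?l (Suc j)"
  show "y \<in> sp (asg H home i \<inter> up H lev j)"
  proof (cases "y = x & lev x = j")
  case True
  then show ?thesis using sp[OF j(3)] by simp
  next
  case False
  then have "y \<in> up H lev (Suc j)" using y unfolding up_def by (auto split: if_splits)
  then show ?thesis using p(10)[OF j] by blast
  qed
 qed
 moreover have "?l y <= Suc D & home y <= k & (home y ~= 0 --> 1 <= ?l y & ?l y <= D) &
  (home y = 0 --> y \<in> {x} \<or> ?l y = 0 \<or> ?l y = Suc D)" if "y \<in> H" for y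
  using p(5-8)[OF that] p(3) l by (cases "y = x") auto
 ultimately show ?thesis
  unfolding pushrel_def a using p(1-3,9,11) by auto
qed

lemma pushrel_finish:
 assumes "pushrel H k D lev home {x}" "lev x = Suc D"
 shows "pushrel H k D lev home {}"
 using assms unfolding pushrel_def by auto

text \<open>The common core of the two insertions. Spans of restricted sets only grow, which can
  only help on the right-hand sides of the invariant. On the left-hand sides only \<open>x\<close>
  itself is new, and the predecessor of set \<open>i\<close> spans it because \<open>i\<close> is
  the first set that does not.\<close>

lemma pushrel_insert:
 assumes P: "pushrel H k D lev home {x}" and j: "lev x <= D" and i: "i < k"
  and first: "\<And>i'. i' < i ==> x \<in> sp (asg H home i' \<inter> up H lev (lev x))"
  and tok: "tok \<subseteq> H" "\<And>y. y \<in> tok ==> home' y = 0 & 1 <= lev y"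
  and home': "home' x = Suc i" "\<And>y. y \<in> H ==> y ~= x ==> y \<notin> tok ==> home' y = home y"
  and ind: "ind (asg H home' i)" and other: "\<And>i'. i' ~= i ==> asg H home' i' = asg H home i'"
  and new: "asg H home' i \<inter> up H lev (lev x) = insert x (asg H home i \<inter> up H lev (lev x))"
  and old: "\<And>j'. 1 <= j' ==> j' <= D ==> j' ~= lev x ==>
  sp (asg H home' i \<inter> up H lev j') = sp (asg H home i \<inter> up H lev j')"
 shows "pushrel H k D lev home' tok"
proof -
 have p: "finite H" "x \<in> H" "home x = 0" "1 <= lev x" "\<And>x. x \<in> H ==> lev x <= Suc D" "\<And>x. x \<in> H ==> home x <= k"
  "\<And>x. x \<in> H ==> home x ~= 0 ==> 1 <= lev x & lev x <= D"
  "\<And>y. y \<in> H ==> home y = 0 ==> y = x \<or> lev y = 0 \<or> lev y = Suc D"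
  "\<And>i. i < k ==> ind (asg H home i)"
  "\<And>j i. 1 <= j ==> j <= D ==> i < k ==> up H lev (Suc j) \<subseteq> sp (asg H home i \<inter> up H lev j)"
  "\<And>j i. 1 <= j ==> j <= D ==> Suc i < k ==>
  asg H home (Suc i) \<inter> up H lev j \<subseteq> sp (asg H home i \<inter> up H lev j)"
  using P unfolding pushrel_def by auto
 have grow: "sp (asg H home i' \<inter> up H lev j') \<subseteq> sp (asg H home' i' \<inter> up H lev j')"
  if "1 <= j'" "j' <= D" for i' j'
 proof (cases "i' = i")
  case True
  show ?thesis
  proof (cases "j' = lev x")
  case T: True
  show ?thesis unfolding True T new by (rule sp_mono) blast
  next
  case False
  show ?thesis unfolding True using old[OF that False] by simp
  qed
 qed (simp add: other)
 have c: "up H lev (Suc j') \<subseteq> sp (asg H home' i' \<inter> up H lev j')" if "1 <= j'" "j' <= D" "i' < k" for j' i'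
  using p(10)[OF that] grow[OF that(1,2), of i'] by blast
 have d: "asg H home' (Suc i') \<inter> up H lev j' \<subseteq> sp (asg H home' i' \<inter> up H lev j')"
  if "1 <= j'" "j' <= D" "Suc i' < k" for j' i'
 proof (cases "Suc i' = i")
  case False
  then show ?thesis using p(11)[OF that] grow[OF that(1,2), of i'] other[of "Suc i'"] by auto
 next
  case True
  then have i': "i' ~= i" "i' < i" by auto
  have old_le: "sp (asg H home i \<inter> up H lev j') \<subseteq> sp (asg H home i' \<inter> up H lev j')"
  using sp_least[OF p(11)[OF that]] True by simp
  have "asg H home' i \<inter> up H lev j' \<subseteq> sp (asg H home i' \<inter> up H lev j')"
  proof (cases "j' = lev x")
  case T: True
  have "asg H home i \<inter> up H lev j' \<subseteq> sp (asg H home i' \<inter> up H lev j')"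
  using old_le sp_ext[of "asg H home i \<inter> up H lev j'"] by blast
  then show ?thesis using new first[OF i'(2)] unfolding T by simp
  next
  case F: False
  have "asg H home' i \<inter> up H lev j' \<subseteq> sp (asg H home' i \<inter> up H lev j')" by (rule sp_ext)
  then show ?thesis using old[OF that(1,2) F] old_le by simp
  qed
  then show ?thesis using True other[OF i'(1)] by simp
 qed
 have a: "lev y <= Suc D & home' y <= k & (home' y ~= 0 --> 1 <= lev y & lev y <= D) &
  (home' y = 0 --> y \<in> tok \<or> lev y = 0 \<or> lev y = Suc D)" if "y \<in> H" for y
 proof (cases "y = x")
  case True
  then show ?thesis using home'(1) i j p(4) p(5)[OF that] by simp
 next
  case F: False
  show ?thesis
  proof (cases "y \<in> tok")
  case True
  then show ?thesis using tok(2)[OF True] p(5)[OF that] by simp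
  next
  case False
  have "home' y = home y" by (rule home'(2)[OF that F False])
  then show ?thesis using p(5-8)[OF that] F by auto
  qed
 qed
 have "ind (asg H home' i')" if "i' < k" for i' using ind p(9)[OF that] other[of i'] by (cases "i' = i") auto
 then show ?thesis unfolding pushrel_def using p(1) tok a c d by blast
qed

text \<open>All assigned elements have level at least 1, so at level 1 the restricted set is the
  whole set: \<open>x\<close> is independent of it and nothing needs to be displaced.\<close>

lemma pushrel_insert_free:
 assumes P: "pushrel H k D lev home {x}" and j: "lev x = 1" and i: "i < k" and "1 <= D"
  and first: "\<And>i'. i' < i ==> x \<in> sp (asg H home i' \<inter> up H lev 1)"
  and nx: "x \<notin> sp (asg H home i \<inter> up H lev 1)"
 shows "pushrel H k D lev (home(x := Suc i)) {}"
proof -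
 have p: "x \<in> H" "home x = 0" "\<And>x. x \<in> H ==> home x ~= 0 ==> 1 <= lev x & lev x <= D" "ind (asg H home i)"
  using P i unfolding pushrel_def by auto
 let ?h = "home(x := Suc i)"
 have ai: "asg H ?h i = insert x (asg H home i)" using p unfolding asg_def by auto
 have "asg H home i \<subseteq> up H lev 1" using p(3) unfolding asg_def up_def by auto
 then have full: "asg H home i \<inter> up H lev 1 = asg H home i" by blast
 show ?thesis
 proof (rule pushrel_insert[OF P])
  show "ind (asg H ?h i)" unfolding ai using nx p(4) full by (intro ind_insert) simp_all
  show "asg H ?h i' = asg H home i'" if "i' ~= i" for i' using that p(2) unfolding asg_def by auto
  show "asg H ?h i \<inter> up H lev (lev x) = insert x (asg H home i \<inter> up H lev (lev x))"
  unfolding ai using p(1) unfolding up_def by auto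
  show "sp (asg H ?h i \<inter> up H lev j') = sp (asg H home i \<inter> up H lev j')" if "1 <= j'" "j' ~= lev x" for j'
  proof -
  have "x \<notin> up H lev j'" using that j unfolding up_def by auto
  then show ?thesis unfolding ai by simp
  qed
 qed (use j i first \<open>1 <= D\<close> in auto)
qed

text \<open>\<open>x\<close> was spanned one level below before it was raised, so inserting it
  closes a circuit there, and \<open>g\<close> is an element of that circuit on level
  \<open>j'\<close>. The swap enlarges the rank at the level of \<open>x\<close> and changes no span
  at any other level, so the displaced \<open>g\<close> is the only thing left to repair.\<close>

lemma pushrel_insert_kick:
 assumes P: "pushrel H k D lev home {x}" and j: "lev x <= D" "lev x = Suc j'" "1 <= j'" and i: "i < k"
  and first: "\<And>i'. i' < i ==> x \<in> sp (asg H home i' \<inter> up H lev (lev x))"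
  and g: "g \<in> asg H home i" "lev g = j'"
  and sp: "sp (insert x (asg H home i \<inter> up H lev (Suc j')) \<union> ({y \<in> asg H home i. lev y = j'} - {g})) =
  sp (asg H home i \<inter> up H lev j')"
 shows "pushrel H k D lev (home(x := Suc i, g := 0)) {g}" (is ?P)
  and "\<And>l. 1 <= l ==> l <= j' ==> sp (asg H (home(x := Suc i, g := 0)) i \<inter> up H lev l) = sp (asg H home i \<inter> up H lev l)"
  and "\<And>l. l <= j' ==> card (asg H (home(x := Suc i, g := 0)) i \<inter> up H lev l) = card (asg H home i \<inter> up H lev l)"
  and "\<And>l. Suc j' < l ==> asg H (home(x := Suc i, g := 0)) i \<inter> up H lev l = asg H home i \<inter> up H lev l"
  and "asg H (home(x := Suc i, g := 0)) i \<inter> up H lev (Suc j') = insert x (asg H home i \<inter> up H lev (Suc j'))"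
proof -
 have p: "finite H" "x \<in> H" "home x = 0" "\<And>x. x \<in> H ==> home x ~= 0 ==> 1 <= lev x & lev x <= D" "ind (asg H home i)"
  using P i unfolding pushrel_def by auto
 let ?h = "home(x := Suc i, g := 0)"
 have gx: "g ~= x" "g \<in> H" "home g = Suc i" using g p(3) unfolding asg_def by auto
 have xi: "x \<notin> asg H home i" using p(3) unfolding asg_def by simp
 have ai: "asg H ?h i = insert x (asg H home i) - {g}" using p(2) gx unfolding asg_def by auto
 have xu: "x \<in> up H lev l \<longleftrightarrow> l <= Suc j'" "g \<in> up H lev l \<longleftrightarrow> l <= j'" for l
  using p(2) gx(2) j(2) g(2) unfolding up_def by auto
 show new: "asg H ?h i \<inter> up H lev (Suc j') = insert x (asg H home i \<inter> up H lev (Suc j'))"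
  unfolding ai using xu[of "Suc j'"] gx(1) by auto
 show high: "asg H ?h i \<inter> up H lev l = asg H home i \<inter> up H lev l" if "Suc j' < l" for l
  unfolding ai using xu[of l] that by auto
 show low: "sp (asg H ?h i \<inter> up H lev l) = sp (asg H home i \<inter> up H lev l)" if l: "1 <= l" "l <= j'" for l
 proof -
  \<comment> \<open>Joining the elements on the levels from \<open>l\<close> to below
    \<open>j'\<close> to both sides transfers the equality of spans from level \<open>j'\<close>
    down to level \<open>l\<close>.\<close>
  let ?Z = "{y \<in> asg H home i. l <= lev y & lev y < j'}"
  have m: "asg H home i \<inter> up H lev r = {y \<in> asg H home i. r <= lev y}" for r
  unfolding up_def asg_def by auto
  have e: "asg H ?h i \<inter> up H lev l = insert x (asg H home i \<inter> up H lev l - {g})"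
  unfolding ai using xu(1)[of l] l(2) gx(1) by auto
  have 1: "asg H ?h i \<inter> up H lev l =
  (insert x (asg H home i \<inter> up H lev (Suc j')) \<union> ({y \<in> asg H home i. lev y = j'} - {g})) \<union> ?Z"
  unfolding e m using l(2) g(2) by auto
  have 2: "asg H home i \<inter> up H lev l = (asg H home i \<inter> up H lev j') \<union> ?Z"
  unfolding m using l(2) by auto
  show ?thesis unfolding 1 2 by (rule sp_Un_cong[OF sp])
 qed
 show cards: "card (asg H ?h i \<inter> up H lev l) = card (asg H home i \<inter> up H lev l)" if "l <= j'" for l
 proof -
  have e: "asg H ?h i \<inter> up H lev l = insert x (asg H home i \<inter> up H lev l - {g})"
  unfolding ai using xu(1)[of l] that gx(1) by auto
  have fin: "finite (asg H home i \<inter> up H lev l)" using ind_finite[OF p(5)] by simp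
  have gin: "g \<in> asg H home i \<inter> up H lev l" using g(1) xu(2)[of l] that by simp
  have "x \<notin> asg H home i \<inter> up H lev l - {g}" using xi by simp
  then show ?thesis unfolding e using fin gin card_Suc_Diff1[OF fin gin] by simp
 qed
 have full: "asg H home i \<inter> up H lev 1 = asg H home i" using p(4) unfolding asg_def up_def by auto
 have "x \<in> up H lev 1" using xu(1)[of 1] by simp
 moreover have "asg H home i \<subseteq> up H lev 1" using full by (simp add: Int_absorb2 inf.absorb_iff1)
 ultimately have "asg H ?h i \<subseteq> up H lev 1" unfolding ai by auto
 then have full': "asg H ?h i \<inter> up H lev 1 = asg H ?h i" by (rule Int_absorb2)
 \<comment> \<open>At level 1, where the restricted set is the whole set, the swap preserves both
   the size and the span.\<close>
 have ind': "ind (asg H ?h i)"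
 proof (rule ind_exchange_card[OF p(5)])
  show "finite (asg H ?h i)" using p(1) unfolding asg_def by simp
  show "card (asg H ?h i) <= card (asg H home i)" using cards[of 1] j(3) full full' by simp
  show "asg H home i \<subseteq> sp (asg H ?h i)" using low[of 1] j(3) full full' sp_ext[of "asg H home i"] by simp
 qed
 show ?P
 proof (rule pushrel_insert[OF P j(1) i first])
  show "ind (asg H ?h i)" by (rule ind')
  show "asg H ?h i \<inter> up H lev (lev x) = insert x (asg H home i \<inter> up H lev (lev x))" unfolding j(2) by (rule new)
  show "asg H ?h i' = asg H home i'" if "i' ~= i" for i' using that p(3) gx unfolding asg_def by auto
  show "sp (asg H ?h i \<inter> up H lev l) = sp (asg H home i \<inter> up H lev l)" if "1 <= l" "l ~= lev x" for l
  proof (cases "l <= j'")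
  case True
  then show ?thesis using low that by simp
  next
  case False
  then show ?thesis using high[of l] that j(2) by simp
  qed
 qed (use gx g j in auto)
qed

text \<open>By the pigeonhole principle some level \<open>j\<close> holds at most \<open>D\<close>
  assigned elements. Cutting there, with \<open>A\<close> the elements above level \<open>j\<close>
  and \<open>A'\<close> those from level \<open>j\<close> on, \<open>packing_gap\<close> loses only
  the elements of level \<open>j\<close>. Unassigned elements lie on level \<open>D + 1\<close>,
  hence in \<open>A\<close>.\<close>

lemma pushrel_gap:
 assumes P: "pushrel H k D lev home {}" and lev: "\<And>x. x \<in> H ==> lev x ~= 0"
  and J: "packs k H J" and D: "card (\<Union>i<k. asg H home i) < D * (D + 1)"
 shows "(\<Sum>i<k. card (J i)) <= (\<Sum>i<k. card (asg H home i)) + D"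
proof -
 have p: "finite H" "\<And>x. x \<in> H ==> home x <= k"
  "\<And>x. x \<in> H ==> home x ~= 0 ==> 1 <= lev x & lev x <= D"
  "\<And>y. y \<in> H ==> home y = 0 ==> lev y = 0 \<or> lev y = Suc D"
  "\<And>i. i < k ==> ind (asg H home i)"
  "\<And>j i. 1 <= j ==> j <= D ==> i < k ==> up H lev (Suc j) \<subseteq> sp (asg H home i \<inter> up H lev j)"
  using P unfolding pushrel_def by auto
 let ?U = "\<Union>i<k. asg H home i"
 have U: "?U = {x \<in> H. home x ~= 0}"
 proof -
  have "x \<in> ?U" if "x \<in> H" "home x ~= 0" for x
  using that p(2)[OF that(1)] unfolding asg_def by (auto intro!: bexI[of _ "home x - 1"])
  then show ?thesis unfolding asg_def by auto
 qed
 let ?C = "\<lambda>j. {x \<in> ?U. lev x = j}"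
 have "\<exists>j\<in>{1..D}. card (?C j) <= D"
 proof (rule ccontr)
  assume "\<not> ?thesis"
  then have "D + 1 <= card (?C j)" if "j \<in> {1..D}" for j using that by force
  then have "(\<Sum>j\<in>{1..D}. D + 1) <= (\<Sum>j\<in>{1..D}. card (?C j))" by (intro sum_mono) simp
  also have "\<dots> = card (\<Union>j\<in>{1..D}. ?C j)"
  using p(1) unfolding U by (intro card_UN_disjoint[symmetric]) auto
  also have "\<dots> <= card ?U" using p(1) unfolding U by (intro card_mono) auto
  finally show False using D by simp
 qed
 then obtain j where j: "1 <= j" "j <= D" "card (?C j) <= D" by auto
 have pk: "packs k H (asg H home)"
  unfolding packs_def using p(5) unfolding asg_def by auto
 have "(\<Sum>i<k. card (J i)) <= (\<Sum>i<k. card (asg H home i)) + card (?U \<inter> (up H lev j - up H lev (Suc j)))"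
 proof (rule packing_gap[OF p(1) pk J])
  show "H - up H lev (Suc j) \<subseteq> ?U"
  proof
  fix x assume x: "x \<in> H - up H lev (Suc j)"
  then have "lev x <= D" using j(2) unfolding up_def by auto
  then show "x \<in> ?U" unfolding U using x lev[of x] p(4)[of x] by auto
  qed
  show "H \<inter> up H lev (Suc j) \<subseteq> sp (asg H home i \<inter> up H lev j)" if "i < k" for i
  using p(6)[OF j(1,2) that] by blast
  show "up H lev (Suc j) \<subseteq> up H lev j" unfolding up_def by auto
 qed
 moreover have "?U \<inter> (up H lev j - up H lev (Suc j)) = ?C j" unfolding U up_def by auto
 ultimately show ?thesis using j(3) by simp
qed

subsection \<open>Searching for an augmenting path\<close>

text \<open>\<open>nq\<close> elements are in the queue and the first \<open>qh\<close> of them have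
  been processed. That everything before \<open>par b\<close> is spanned by what was reached before
  \<open>b\<close> is the absence of shortcuts, in the form in which a queue provides it.\<close>

definition bfs :: "'a set => nat => (nat => 'a set) => (nat => 'a) => nat => (nat => nat) => nat => bool" where
 "bfs H k I q nq par qh \<longleftrightarrow> inj_on q {..<nq} & q ` {..<nq} \<subseteq> H & qh <= nq &
  H - (\<Union>i<k. I i) \<subseteq> q ` {..<nq} &
  (\<forall>b h. b < nq --> h < k --> q b \<in> I h --> par b < b & q (par b) \<in> sp (I h) &
  q (par b) \<notin> sp (I h - {q b}) & (\<forall>a i. a < par b --> i < k --> q a \<in> sp (I i \<inter> q ` {..<b}))) &
  (\<forall>a i. a < qh --> i < k --> q a \<in> sp (I i \<inter> q ` {..<nq}))"

lemma bfs_label: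
 assumes B: "bfs H k I q nq par qh" and f: "f \<in> I i" "i < k" "f \<in> H" "f \<notin> q ` {..<nq}" and qh: "qh < nq"
  and e: "q qh \<in> sp (I i)" "q qh \<notin> sp (I i - {f})"
  and disj: "\<And>i j. i < k ==> j < k ==> i ~= j ==> I i \<inter> I j = {}"
 shows "bfs H k I (q(nq := f)) (Suc nq) (par(nq := qh)) qh"
proof -
 have b: "inj_on q {..<nq}" "q ` {..<nq} \<subseteq> H" "H - (\<Union>i<k. I i) \<subseteq> q ` {..<nq}"
  "\<And>b h. b < nq ==> h < k ==> q b \<in> I h ==> par b < b & q (par b) \<in> sp (I h) &
  q (par b) \<notin> sp (I h - {q b}) & (\<forall>a i. a < par b --> i < k --> q a \<in> sp (I i \<inter> q ` {..<b}))"
  "\<And>a i. a < qh ==> i < k ==> q a \<in> sp (I i \<inter> q ` {..<nq})"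
  using B unfolding bfs_def by auto
 let ?q = "q(nq := f)"
 have im: "?q ` {..<b} = q ` {..<b}" if "b <= nq" for b using that by auto
 have im': "?q ` {..<Suc nq} = insert f (q ` {..<nq})" unfolding lessThan_Suc using im[of nq] by auto
 have inj: "inj_on ?q {..<Suc nq}"
  unfolding lessThan_Suc using b(1) f(4) by (auto simp: inj_on_def)
 have grow: "sp (I i \<inter> q ` {..<nq}) \<subseteq> sp (I i \<inter> insert f (q ` {..<nq}))" for i by (rule sp_mono) blast
 have main: "(par(nq := qh)) b < b & ?q ((par(nq := qh)) b) \<in> sp (I h) &
  ?q ((par(nq := qh)) b) \<notin> sp (I h - {?q b}) &
  (\<forall>a i. a < (par(nq := qh)) b --> i < k --> ?q a \<in> sp (I i \<inter> ?q ` {..<b}))"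
  if bh: "b < Suc nq" "h < k" "?q b \<in> I h" for b h
 proof (cases "b = nq")
  case True
  then have "h = i" using bh f(1,2) disj[of h i] by auto
  then show ?thesis using True qh e b(5) im[of nq] by auto
 next
  case False
  then have bn: "b < nq" using bh(1) by simp
  then have c: "par b < b" "q (par b) \<in> sp (I h)" "q (par b) \<notin> sp (I h - {q b})"
  "\<And>a i. a < par b ==> i < k ==> q a \<in> sp (I i \<inter> q ` {..<b})"
  using b(4)[OF bn bh(2)] bh(3) by auto
  show ?thesis using bn c im[of b] by auto
 qed
 show ?thesis
  unfolding bfs_def im'
 proof (intro conjI allI impI)
  show "?q a \<in> sp (I i \<inter> insert f (q ` {..<nq}))" if "a < qh" "i < k" for a i
  using b(5)[OF that] grow[of i] that(1) qh by auto
 qed (use inj b(2,3) f(3) qh main in auto)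
qed

lemma bfs_advance:
 assumes "bfs H k I q nq par qh" "qh < nq" "\<And>i. i < k ==> q qh \<in> sp (I i \<inter> q ` {..<nq})"
 shows "bfs H k I q nq par (Suc qh)"
 using assms unfolding bfs_def by (auto simp: less_Suc_eq)

text \<open>\<open>q b\<close> is not among the elements queued before it, so to be spanned by the
  earlier part of \<open>I h\<close> means to be spanned without \<open>q b\<close>.\<close>

lemma bfs_chain:
 assumes B: "bfs H k I q nq par qh" and "qh < nq" and I: "\<And>i. k <= i ==> I i = {}"
 shows "chain I q par qh"
 unfolding chain_def
proof (intro allI impI)
 fix b h assume b: "b <= qh" "q b \<in> I h"
 have h: "h < k" using I[of h] b(2) by (cases "h < k") auto
 have bn: "b < nq" using b assms(2) by simp
 have inj: "inj_on q {..<nq}" using B unfolding bfs_def by simp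
 have c: "par b < b & q (par b) \<in> sp (I h) &
  q (par b) \<notin> sp (I h - {q b}) & (\<forall>a i. a < par b --> i < k --> q a \<in> sp (I i \<inter> q ` {..<b}))"
  using B bn h b(2) unfolding bfs_def by simp
 have "q b \<notin> q ` {..<b}"
 proof
  assume "q b \<in> q ` {..<b}"
  then obtain a where a: "a < b" "q b = q a" by auto
  then show False using inj_onD[OF inj a(2)] bn by simp
 qed
 then have "I h \<inter> q ` {..<b} \<subseteq> I h - {q b}" by blast
 then have sub: "sp (I h \<inter> q ` {..<b}) \<subseteq> sp (I h - {q b})" by (rule sp_mono)
 show "par b < b & q (par b) \<in> sp (I h) & q (par b) \<notin> sp (I h - {q b}) &
  (\<forall>a<par b. q a \<in> sp (I h - {q b}))"
  using c h sub by blast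
qed

end

section \<open>Sparsification and push-relabel on the machine\<close>

lemma (in imp) wp_Seq_fun [simp]: "wp (c ;; d) Q = wp c (wp d Q)"
 by (rule ext) simp

text \<open>
 The edge names from \<open>m\<close> on are a virtual star, which witnesses that the rank is at most \<open>n - 1\<close>.
\<close>

locale task = net +
 fixes k lg L D w :: nat
 assumes n2: "2 <= n" and k1: "1 <= k" and lg: "n <= 2 ^ lg" and L: "L = 2 * k * Suc lg"
  and DD: "k * n <= D * D" and D1: "1 <= D" and km: "k * (n - 1) <= m"
  and Lw: "L < 2 ^ w" and capL: "2 * L < cap" and capD: "Suc D * Suc k < cap" and capk: "k * n < cap"
  and star: "v < n ==> ep (m + v) = (0, v)"

sublocale task \<subseteq> M: matroid "espan ep"
 by (rule graphic.matroid_axioms)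

context task
begin

lemma k_cap: "2 * k < cap" "k < 2 ^ w" "0 < L" "k <= L"
proof -
 show "k <= L" "0 < L" using k1 unfolding L by auto
 then show "2 * k < cap" "k < 2 ^ w" using capL Lw by auto
qed

lemma ind_card: "M.ind J ==> J \<subseteq> {..<m} ==> card J <= n - 1"
proof -
 assume J: "M.ind J" "J \<subseteq> {..<m}"
 \<comment> \<open>The star without its loop \<open>m + 0\<close>: it has \<open>n - 1\<close> edges
   and spans every edge of the graph.\<close>
 let ?F = "(\<lambda>v. m + v) ` {1..<n}"
 have "(0, v) \<in> conn ep ?F" if "v < n" for v
 proof (cases "v = 0")
  case False
  then have "m + v \<in> ?F" using that by auto
  from conn_edge[OF this, of ep] show ?thesis using star[OF that] by simp
 qed simp
 then have c: "(u, v) \<in> conn ep ?F" if "u < n" "v < n" for u v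
  using conn_trans[OF conn_sym[of 0 u ep ?F]] that by simp
 have "J \<subseteq> espan ep ?F"
 proof
  fix e assume "e \<in> J"
  then have "e < m" using J(2) by auto
  then show "e \<in> espan ep ?F" using c[of "fst (ep e)" "snd (ep e)"] ep[of e] unfolding espan_def by simp
 qed
 then have "card J <= card ?F" using J(1) by (intro M.steinitz) auto
 also have "card ?F = n - 1" by (simp add: card_image)
 finally show ?thesis .
qed

subsection \<open>Families of structures\<close>

definition reps :: "nat => st => (nat => nat set) => (nat => nat set) => bool" where
 "reps c s K F \<longleftrightarrow> (\<forall>p<c. rep (view s p) (K p) (F p))"

definition potall :: "nat => st => nat" where
 "potall c s = (\<Sum>p<c. pot (view s p))"

definition frame :: "st => st => bool" where
 "frame s s' \<longleftrightarrow> (\<forall>x<30. vr s' x = vr s x) & rw s' = rw s & (\<forall>t p. 10 < t --> ar s' t p = ar s t p)"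

lemma reps_cong:
 assumes "\<And>t p. t <= 10 ==> ar s' t p = ar s t p"
 shows "reps c s' K F \<longleftrightarrow> reps c s K F" "potall c s' = potall c s"
 unfolding reps_def potall_def rep_def pot_def using assms by simp_all

lemma sum_change:
 fixes f g :: "'b => nat"
 assumes "finite S" "P \<in> S" "\<And>p. p \<in> S ==> p ~= P ==> g p = f p"
 shows "sum g S + f P = sum f S + g P"
proof -
 have "sum g (S - {P}) = sum f (S - {P})" using assms(3) by (intro sum.cong) auto
 then show ?thesis using sum.remove[OF assms(1,2), of f] sum.remove[OF assms(1,2), of g] by simp
qed

text \<open>Transfers the amortized bound from one structure to the sum of all potentials, the other
  structures being untouched.\<close>

lemma reps_op:
 assumes R: "reps c s K F" and P: "P < c" "vr s 5 = P" and t: "touches {..10} s s'"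
  and r: "rep (view s' P) K' F'" and ck: "ck s' + 20 * pot (view s' P) <= ck s + 30 + 20 * pot (view s P)"
 shows "frame s s'" "reps c s' (K(P := K')) (F(P := F'))" "ck s' + 20 * potall c s' <= ck s + 30 + 20 * potall c s"
proof -
 show "frame s s'" using t unfolding frame_def touches_def by auto
 have v: "view s' p = view s p" if "p ~= P" for p using t that P unfolding touches_def by auto
 show "reps c s' (K(P := K')) (F(P := F'))" using R r v unfolding reps_def by auto
 have "potall c s' + pot (view s P) = potall c s + pot (view s' P)"
  unfolding potall_def using P v by (intro sum_change) auto
 then show "ck s' + 20 * potall c s' <= ck s + 30 + 20 * potall c s" using ck by linarith
qed

lemma coarse_iff:
 assumes "rep (view s p) K F" "e < m"
 shows "ar s 0 p (fst (ep e)) = ar s 0 p (snd (ep e)) \<longleftrightarrow> e \<in> espan ep (K \<union> F)"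
proof -
 have "comps (ar s 0 p) (K \<union> F)" using assms(1) unfolding rep_def by simp
 from comps_iff[OF this] show ?thesis using ep[OF assms(2)] unfolding espan_def by simp
qed

lemma fine_iff:
 assumes "rep (view s p) K F" "e < m"
 shows "ar s 5 p (fst (ep e)) = ar s 5 p (snd (ep e)) \<longleftrightarrow> e \<in> espan ep K"
proof -
 have "comps (ar s 5 p) K" using assms(1) unfolding rep_def by simp
 from comps_iff[OF this] show ?thesis using ep[OF assms(2)] unfolding espan_def by simp
qed

lemma wp_link_fam:
 assumes R: "reps c s K F" and P: "P < c" "vr s 5 = P" and e: "vr s 6 = e" "e < m" "edges s"
  and n: "e \<notin> espan ep (K P \<union> F P)"
  and Q: "\<And>s'. frame s s' ==> reps c s' K (F(P := insert e (F P))) ==>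
  ck s' + 20 * potall c s' <= ck s + 30 + 20 * potall c s ==> Q s'"
 shows "wp link Q s"
proof -
 have r: "rep (view s P) (K P) (F P)" using R P unfolding reps_def by simp
 have "ar s 0 P (fst (ep e)) ~= ar s 0 P (snd (ep e))" using coarse_iff[OF r e(2)] n by simp
 from wp_link[OF r P(2) e(1,3,2) this] show ?thesis
 proof (rule wp_mono)
  fix s' :: st assume *: "touches {..10} s s' & rep (view s' P) (K P) (insert e (F P)) &
  ck s' + 20 * pot (view s' P) <= ck s + 30 + 20 * pot (view s P)"
  show "Q s'" using reps_op[OF R P, of s' "K P" "insert e (F P)"] * Q by simp
 qed
qed

lemma wp_contract_fam:
 assumes R: "reps c s K F" and P: "P < c" "vr s 5 = P" and e: "vr s 7 = fst (ep e)" "vr s 8 = snd (ep e)" "e < m"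
  and i: "e \<in> espan ep (K P \<union> F P)" and n: "e \<notin> espan ep (K P)"
  and Q: "\<And>s' g. frame s s' ==> vr s' 41 = g ==> g \<in> F P ==>
  espan ep (insert e (K P) \<union> (F P - {g})) = espan ep (K P \<union> F P) ==>
  reps c s' (K(P := insert e (K P))) (F(P := F P - {g})) ==>
  ck s' + 20 * potall c s' <= ck s + 30 + 20 * potall c s ==> Q s'"
 shows "wp contract Q s"
proof -
 have r: "rep (view s P) (K P) (F P)" using R P unfolding reps_def by simp
 have c: "ar s 0 P (fst (ep e)) = ar s 0 P (snd (ep e))" using coarse_iff[OF r e(3)] i by simp
 have f: "ar s 5 P (fst (ep e)) ~= ar s 5 P (snd (ep e))" using fine_iff[OF r e(3)] n by simp
 have b: "fst (ep e) < n" "snd (ep e) < n" using ep[OF e(3)] by auto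
 from wp_contract[OF r P(2) e(1,2) b f c, of e] show ?thesis
 proof (rule wp_mono)
  show "ep e = (fst (ep e), snd (ep e))" by simp
  fix s' :: st assume *: "touches {..10} s s' &
  (\<exists>g\<in>F P. vr s' 41 = g & conn ep (insert e (K P) \<union> (F P - {g})) = conn ep (K P \<union> F P) &
  rep (view s' P) (insert e (K P)) (F P - {g})) &
  ck s' + 20 * pot (view s' P) <= ck s + 30 + 20 * pot (view s P)"
  then obtain g where g: "g \<in> F P" "vr s' 41 = g" "conn ep (insert e (K P) \<union> (F P - {g})) = conn ep (K P \<union> F P)"
  "rep (view s' P) (insert e (K P)) (F P - {g})" by blast
  show "Q s'"
  using reps_op[OF R P, of s' "insert e (K P)" "F P - {g}"] * g Q[of s' g] unfolding espan_def by simp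
 qed
qed

lemma potall_le: "potall c s <= c * (2 * (n * floor_log n))"
proof -
 have "potall c s <= (\<Sum>p<c. 2 * (n * floor_log n))" unfolding potall_def
 proof (rule sum_mono)
  fix p
  show "pot (view s p) <= 2 * (n * floor_log n)"
  unfolding pot_def using potc_le[of "ar s 0 p" "ar s 2 p"] potc_le[of "ar s 5 p" "ar s 7 p"] by linarith
 qed
 then show ?thesis by simp
qed

text \<open>The whole potential is charged here in advance: 20 times two terms of at most
  \<open>n * floor_log n\<close> per structure give the constant 40.\<close>

lemma wp_init_fam:
 assumes v: "vr s 2 = n" "vr s 9 = c" "c < cap"
  and Q: "\<And>s'. \<forall>x<30. x ~= 5 --> vr s' x = vr s x ==> rw s' = rw s ==> \<forall>t p. 10 < t --> ar s' t p = ar s t p ==>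
  reps c s' (\<lambda>_. {}) (\<lambda>_. {}) ==>
  ck s' + 20 * potall c s' <= ck s + 2 + c * (11 * n + 4 + 40 * (n * floor_log n)) ==> Q s'"
 shows "wp init_all Q s"
proof (rule wp_mono[OF wp_init_all[OF v]])
 fix s' :: st assume *: "(\<forall>x<30. x ~= 5 --> vr s' x = vr s x) & rw s' = rw s &
  (\<forall>t p. 10 < t --> ar s' t p = ar s t p) & (\<forall>p<c. rep (view s' p) {} {}) &
  ck s' = ck s + c * (11 * n + 4) + 2"
 have "ck s' + 20 * potall c s' <= ck s + 2 + c * (11 * n + 4 + 40 * (n * floor_log n))"
  using * potall_le[of c s'] by (simp add: algebra_simps)
 then show "Q s'" using * Q unfolding reps_def by simp
qed

end

subsection \<open>Computing the sparsifier\<close>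

abbreviation EU :: "exp => exp" where "EU x \<equiv> Arr 11 (Num 0) x"
abbreviation EV :: "exp => exp" where "EV x \<equiv> Arr 12 (Num 0) x"

definition sparsify_step :: com where
 "sparsify_step = Asg 7 (EU (Var 6)) ;; Asg 8 (EV (Var 6)) ;; search ;;
  Cond (Less (Var 46) (Var 11))
  (Asg 5 (Var 46) ;; link ;; Put 13 (Num 0) (Var 12) (Var 6) ;; Asg 12 (Plus (Var 12) (Num 1)))
  (Asg 34 (Num 0)) ;;
  Asg 6 (Plus (Var 6) (Num 1))"

definition sparsify :: com where
 "sparsify = Asg 9 (Var 14) ;; init_all ;; Asg 12 (Num 0) ;; Asg 10 (Num 0) ;; Asg 11 (Var 14) ;;
  Asg 6 (Num 0) ;; Loop (Less (Var 6) (Var 3)) sparsify_step"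

context task
begin

definition listing :: "st => nat list => bool" where
 "listing s hs \<longleftrightarrow> distinct hs & vr s 12 = length hs & (\<forall>i<length hs. ar s 13 0 i = hs ! i)"

definition sparsify_inv :: "st => st => bool" where
 "sparsify_inv s s' \<longleftrightarrow> vr s' 6 <= m & (\<forall>x<30. x \<notin> {5, 6, 7, 8, 12} --> vr s' x = vr s x) & rw s' = rw s &
  (\<forall>t p. 10 < t & t ~= 13 --> ar s' t p = ar s t p) &
  (\<exists>F hs. M.sparse L F {..<vr s' 6} & reps L s' (\<lambda>_. {}) F & listing s' hs & set hs = (\<Union>j<L. F j)) &
  ck s' + 20 * potall L s' <= ck s + 20 * potall L s + vr s' 6 * (60 + 5 * w)"

lemma wp_sparsify_step:
 assumes I: "sparsify_inv s s1" and lt: "vr s1 6 < m"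
  and s: "edges s" "vr s 10 = 0" "vr s 11 = L"
 shows "wp sparsify_step (sparsify_inv s) (tick s1)"
proof -
 obtain F hs where F: "M.sparse L F {..<vr s1 6}" "reps L s1 (\<lambda>_. {}) F" "listing s1 hs" "set hs = (\<Union>j<L. F j)"
  using I unfolding sparsify_inv_def by blast
 have i: "\<forall>x<30. x \<notin> {5, 6, 7, 8, 12} --> vr s1 x = vr s x" "rw s1 = rw s"
  "\<forall>t p. 10 < t & t ~= 13 --> ar s1 t p = ar s t p"
  "ck s1 + 20 * potall L s1 <= ck s + 20 * potall L s + vr s1 6 * (60 + 5 * w)"
  using I unfolding sparsify_inv_def by blast+
 define e where "e = vr s1 6"
 have em: "e < m" using lt unfolding e_def .
 have ed: "ar s1 11 0 e = fst (ep e)" "ar s1 12 0 e = snd (ep e)" "edges s1"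
  using s(1) i(3) em unfolding edges_def by auto
 define s2 where "s2 = s1\<lparr>vr := (vr s1)(7 := fst (ep e), 8 := snd (ep e)), ck := Suc (Suc (Suc (ck s1)))\<rparr>"
 have con: "ar s1 0 j (fst (ep e)) = ar s1 0 j (snd (ep e)) \<longleftrightarrow> e \<in> espan ep (F j)" if "j < L" for j
  using coarse_iff[of s1 j "{}" "F j" e] F(2) that em unfolding reps_def by simp
 have nested: "espan ep (F j) \<subseteq> espan ep (F i)" if "i <= j" "j < L" for i j
  by (rule M.sp_least) (rule M.sparse_nested[OF F(1) that])
 have sub: "F j \<subseteq> {..<e}" if "j < L" for j using F(1) that unfolding M.sparse_def e_def by blast
 have hl: "length hs < cap" "Suc (length hs) < cap \<or> length hs \<ge> m"
 proof -
  have "set hs \<subseteq> {..<e}" unfolding F(4) using sub by blast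
  then have "card (set hs) <= card {..<e}" by (intro card_mono) auto
  then have "length hs <= e" using F(3) distinct_card[of hs] unfolding listing_def by simp
  then show "length hs < cap" "Suc (length hs) < cap \<or> length hs \<ge> m" using em cap_m by auto
 qed
 have hm: "length hs <= e"
 proof -
  have "set hs \<subseteq> {..<e}" unfolding F(4) using sub by blast
  then have "card (set hs) <= card {..<e}" by (intro card_mono) auto
  then show ?thesis using F(3) distinct_card[of hs] unfolding listing_def by simp
 qed
 have wsearch: "wp search (\<lambda>s'. (\<forall>x<30. vr s' x = vr s2 x) & rw s' = rw s2 & ar s' = ar s2 & vr s' 46 <= L &
  (\<forall>i<vr s' 46. ar s2 0 (0 + i) (fst (ep e)) = ar s2 0 (0 + i) (snd (ep e))) &
  (vr s' 46 < L --> ar s2 0 (0 + vr s' 46) (fst (ep e)) ~= ar s2 0 (0 + vr s' 46) (snd (ep e))) &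
  ck s' <= ck s2 + 3 + 5 * w) s2"
 proof (rule wp_search)
  show "vr s2 10 = 0" "vr s2 11 = L" using i(1) s unfolding s2_def by simp_all
  show "2 * L < cap" "0 + L < cap" using capL by auto
  fix i j assume ij: "i <= j" "j < L" "ar s2 0 (0 + j) (fst (ep e)) = ar s2 0 (0 + j) (snd (ep e))"
  then have "e \<in> espan ep (F i)" using con[of j] nested[OF ij(1,2)] unfolding s2_def by auto
  then show "ar s2 0 (0 + i) (fst (ep e)) = ar s2 0 (0 + i) (snd (ep e))"
  using con[of i] ij(1,2) unfolding s2_def by simp
 qed (use Lw in \<open>simp_all add: s2_def\<close>)
 have "wp (search ;; Cond (Less (Var 46) (Var 11))
  (Asg 5 (Var 46) ;; link ;; Put 13 (Num 0) (Var 12) (Var 6) ;; Asg 12 (Plus (Var 12) (Num 1)))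
  (Asg 34 (Num 0)) ;; Asg 6 (Plus (Var 6) (Num 1))) (sparsify_inv s) s2"
  unfolding wp_Seq[of search]
 proof (rule wp_mono[OF wsearch], elim conjE)
  fix s3 :: st assume s3: "\<forall>x<30. vr s3 x = vr s2 x" "rw s3 = rw s2" "ar s3 = ar s2" "vr s3 46 <= L"
  "\<forall>i<vr s3 46. ar s2 0 (0 + i) (fst (ep e)) = ar s2 0 (0 + i) (snd (ep e))"
  "vr s3 46 < L --> ar s2 0 (0 + vr s3 46) (fst (ep e)) ~= ar s2 0 (0 + vr s3 46) (snd (ep e))"
  "ck s3 <= ck s2 + 3 + 5 * w"
  define l where "l = vr s3 46"
  have a3: "ar s3 = ar s1" using s3(3) unfolding s2_def by simp
  have v3: "\<forall>x<30. x \<notin> {7, 8} --> vr s3 x = vr s1 x" "vr s3 11 = L" "vr s3 6 = e"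
  using s3(1) i(1) s(3) unfolding s2_def e_def by auto
  have pot3: "potall L s3 = potall L s1" unfolding potall_def a3 by simp
  have ck3: "ck s3 <= ck s1 + 6 + 5 * w" using s3(7) unfolding s2_def by simp
  have before: "e \<in> espan ep (F j)" if "j < l" for j
  using con[of j] s3(4,5) that unfolding l_def s2_def by simp
  show "wp (Cond (Less (Var 46) (Var 11))
  (Asg 5 (Var 46) ;; link ;; Put 13 (Num 0) (Var 12) (Var 6) ;; Asg 12 (Plus (Var 12) (Num 1)))
  (Asg 34 (Num 0)) ;; Asg 6 (Plus (Var 6) (Num 1))) (sparsify_inv s) s3"
  proof (cases "l < L")
  case False
  then have "l = L" using s3(4) unfolding l_def by simp
  then have "e \<in> espan ep (F (L - 1))" using before k_cap(3) by simp
  then have sp: "M.sparse L F {..<Suc e}"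
  using M.sparse_skip[OF F(1)] unfolding e_def lessThan_Suc by simp
  define s4 where "s4 = s3\<lparr>vr := (vr s3)(34 := 0, 6 := Suc e), ck := Suc (Suc (Suc (ck s3)))\<rparr>"
  have "reps L s4 (\<lambda>_. {}) F" using F(2) a3 unfolding reps_def s4_def by simp
  moreover have "listing s4 hs" using F(3) a3 v3(1) unfolding listing_def s4_def by simp
  moreover have "potall L s4 = potall L s1" unfolding potall_def s4_def using a3 by simp
  ultimately have "sparsify_inv s s4"
  unfolding sparsify_inv_def using sp F(4) v3 i em a3 ck3 s3(2) unfolding s4_def s2_def e_def
  by auto
  then show ?thesis using False v3 em cap_m unfolding s4_def l_def by simp
  next
  case True
  define s4 where "s4 = s3\<lparr>vr := (vr s3)(5 := l), ck := Suc (Suc (ck s3))\<rparr>"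
  have ne: "e \<notin> espan ep (F l)" using con[OF True] s3(6) True unfolding l_def s2_def by simp
  have pot4: "potall L s4 = potall L s1" unfolding potall_def s4_def using a3 by simp
  have "wp link (wp (Put 13 (Num 0) (Var 12) (Var 6) ;; Asg 12 (Plus (Var 12) (Num 1)) ;; Asg 6 (Plus (Var 6) (Num 1))) (sparsify_inv s)) s4"
  proof (rule wp_link_fam[where e = e and P = l])
  show "reps L s4 (\<lambda>_. {}) F" using F(2) a3 unfolding reps_def s4_def by simp
  show "edges s4" using ed(3) a3 unfolding edges_def s4_def by simp
  show "e \<notin> espan ep ({} \<union> F l)" using ne by simp
  fix s5 :: st assume f5: "frame s4 s5" and r5: "reps L s5 (\<lambda>_. {}) (F(l := insert e (F l)))"
  and c5: "ck s5 + 20 * potall L s5 <= ck s4 + 30 + 20 * potall L s4"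
  have v5: "\<forall>x<30. x \<notin> {5, 7, 8} --> vr s5 x = vr s1 x" "rw s5 = rw s1" "\<forall>t p. 10 < t --> ar s5 t p = ar s1 t p"
  using f5 v3(1) a3 s3(2) unfolding frame_def s4_def s2_def by auto
  have v56: "vr s5 6 = e" "vr s5 12 = length hs" using v5(1) F(3) unfolding e_def listing_def by simp_all
  define s6 where "s6 = s5\<lparr>ar := put 13 0 (length hs) e (ar s5), vr := (vr s5)(12 := Suc (length hs), 6 := Suc e),
  ck := Suc (Suc (Suc (ck s5)))\<rparr>"
  have sp: "M.sparse L (F(l := insert e (F l))) {..<Suc e}"
  using M.sparse_add[OF F(1) True ne before] unfolding e_def lessThan_Suc by simp
  have eh: "e \<notin> set hs" using F(4) sub by blast
  have "listing s6 (hs @ [e])"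
  using F(3) eh v5(3) unfolding listing_def s6_def by (auto simp: nth_append)
  moreover have "set (hs @ [e]) = (\<Union>j<L. (F(l := insert e (F l))) j)"
  using F(4) True by (auto split: if_splits)
  moreover have "reps L s6 (\<lambda>_. {}) (F(l := insert e (F l)))"
  using r5 by (subst reps_cong(1)[of s6 s5]) (simp_all add: s6_def)
  moreover have "potall L s6 = potall L s5" by (rule reps_cong(2)) (simp add: s6_def)
  moreover have "ck s6 + 20 * potall L s5 <= ck s + 20 * potall L s + Suc e * (60 + 5 * w)"
  using c5 pot4 ck3 i(4) unfolding s4_def s6_def e_def by simp
  moreover have "vr s6 6 = Suc e" "Suc e <= m" "\<forall>x<30. x \<notin> {5, 6, 7, 8, 12} --> vr s6 x = vr s x" "rw s6 = rw s"
  "\<forall>t p. 10 < t & t ~= 13 --> ar s6 t p = ar s t p"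
  using v5 i em unfolding s6_def by auto
  ultimately have "sparsify_inv s s6"
  unfolding sparsify_inv_def using sp by (metis (no_types, lifting))
  then show "wp (Put 13 (Num 0) (Var 12) (Var 6) ;; Asg 12 (Plus (Var 12) (Num 1)) ;; Asg 6 (Plus (Var 6) (Num 1))) (sparsify_inv s) s5"
  using v56 hm em cap_m unfolding s6_def by simp
  qed (use True em v3 in \<open>simp_all add: s4_def\<close>)
  then show ?thesis using True v3 unfolding s4_def l_def by simp
  qed
 qed
 then show ?thesis unfolding sparsify_step_def s2_def using ed unfolding e_def by simp
qed

theorem wp_sparsify:
 assumes s: "vr s 2 = n" "vr s 3 = m" "vr s 14 = L" "edges s"
  and Q: "\<And>s' F hs. \<forall>x<30. x \<notin> {5, 6, 7, 8, 9, 10, 11, 12} --> vr s' x = vr s x ==> rw s' = rw s ==>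
  \<forall>t p. 10 < t & t ~= 13 --> ar s' t p = ar s t p ==> M.sparse L F {..<m} ==> listing s' hs ==>
  set hs = (\<Union>j<L. F j) ==>
  ck s' <= ck s + 10 + L * (11 * n + 4 + 40 * (n * floor_log n)) + m * (60 + 5 * w) ==> Q s'"
 shows "wp sparsify Q s"
proof -
 let ?C = "L * (11 * n + 4 + 40 * (n * floor_log n))"
 have "wp (init_all ;; Asg 12 (Num 0) ;; Asg 10 (Num 0) ;; Asg 11 (Var 14) ;;
  Asg 6 (Num 0) ;; Loop (Less (Var 6) (Var 3)) sparsify_step) Q (s\<lparr>vr := (vr s)(9 := L), ck := Suc (ck s)\<rparr>)"
  unfolding wp_Seq[of init_all]
 proof (rule wp_init_fam[where c = L])
  fix s1 :: st assume "\<forall>x<30. x ~= 5 --> vr s1 x = vr (s\<lparr>vr := (vr s)(9 := L), ck := Suc (ck s)\<rparr>) x"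
  "rw s1 = rw (s\<lparr>vr := (vr s)(9 := L), ck := Suc (ck s)\<rparr>)"
  "\<forall>t p. 10 < t --> ar s1 t p = ar (s\<lparr>vr := (vr s)(9 := L), ck := Suc (ck s)\<rparr>) t p"
  and r: "reps L s1 (\<lambda>_. {}) (\<lambda>_. {})"
  and "ck s1 + 20 * potall L s1 <= ck (s\<lparr>vr := (vr s)(9 := L), ck := Suc (ck s)\<rparr>) + 2 + ?C"
  then have s1: "\<forall>x<30. x ~= 5 & x ~= 9 --> vr s1 x = vr s x" "rw s1 = rw s" "\<forall>t p. 10 < t --> ar s1 t p = ar s t p"
  "ck s1 + 20 * potall L s1 <= ck s + 3 + ?C" by auto
  define s2 where "s2 = s1\<lparr>vr := (vr s1)(12 := 0, 10 := 0, 11 := L, 6 := 0), ck := Suc (Suc (Suc (Suc (ck s1))))\<rparr>"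
  have p2: "potall L s2 = potall L s1" unfolding potall_def s2_def by simp
  have "wp (Loop (Less (Var 6) (Var 3)) sparsify_step) Q s2"
  proof (rule wp_Loop[where I = "sparsify_inv s2" and B = "ck s2 + 20 * potall L s2 + m * (60 + 5 * w)"])
  have "listing s2 []" unfolding listing_def s2_def by simp
  moreover have "reps L s2 (\<lambda>_. {}) (\<lambda>_. {})" using r unfolding reps_def s2_def by simp
  moreover have "set [] = (\<Union>j<L. {})" "M.sparse L (\<lambda>_. {}) {..<vr s2 6}"
  using M.sparse_empty[of L] unfolding s2_def by simp_all
  moreover have "vr s2 6 = 0" unfolding s2_def by simp
  ultimately show "sparsify_inv s2 s2" unfolding sparsify_inv_def by (auto intro!: exI[of _ "\<lambda>_. {}"] exI[of _ "[]"])
  next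
  fix s' assume "sparsify_inv s2 s'"
  then have "ck s' + 20 * potall L s' <= ck s2 + 20 * potall L s2 + vr s' 6 * (60 + 5 * w)" "vr s' 6 <= m"
  unfolding sparsify_inv_def by auto
  moreover then have "vr s' 6 * (60 + 5 * w) <= m * (60 + 5 * w)" by (intro mult_right_mono) auto
  ultimately show "ck s' <= ck s2 + 20 * potall L s2 + m * (60 + 5 * w)" by linarith
  next
  fix s' show "okb (Less (Var 6) (Var 3)) s'" by simp
  next
  fix s' assume I: "sparsify_inv s2 s'" and b: "bv (Less (Var 6) (Var 3)) s'"
  have v3: "vr s' 3 = m" using I s1(1) s(2) unfolding sparsify_inv_def s2_def by auto
  show "wp sparsify_step (sparsify_inv s2) (tick s')"
  proof (rule wp_sparsify_step[OF I])
  show "edges s2" using s(4) s1(3) unfolding edges_def s2_def by simp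
  qed (use b v3 in \<open>simp_all add: s2_def\<close>)
  next
  fix s' assume I: "sparsify_inv s2 s'" and b: "\<not> bv (Less (Var 6) (Var 3)) s'"
  have i: "\<forall>x<30. x \<notin> {5, 6, 7, 8, 12} --> vr s' x = vr s2 x" "rw s' = rw s2"
  "\<forall>t p. 10 < t & t ~= 13 --> ar s' t p = ar s2 t p" "vr s' 6 <= m"
  "ck s' + 20 * potall L s' <= ck s2 + 20 * potall L s2 + vr s' 6 * (60 + 5 * w)"
  using I unfolding sparsify_inv_def by blast+
  have "vr s' 3 = m" using i(1) s1(1) s(2) unfolding s2_def by auto
  then have e: "vr s' 6 = m" using b i(4) by simp
  obtain F hs where F: "M.sparse L F {..<vr s' 6}" "listing s' hs" "set hs = (\<Union>j<L. F j)"
  using I unfolding sparsify_inv_def by blast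
  show "Q (tick s')"
  proof (rule Q[of "tick s'" F hs])
  show "M.sparse L F {..<m}" "set hs = (\<Union>j<L. F j)" using F e by auto
  show "listing (tick s') hs" using F(2) unfolding listing_def by simp
  show "ck (tick s') <= ck s + 10 + ?C + m * (60 + 5 * w)"
  using i(5) e p2 s1(4) unfolding s2_def by simp
  qed (use i s1 in \<open>auto simp: s2_def\<close>)
  qed
  then show "wp (Asg 12 (Num 0) ;; Asg 10 (Num 0) ;; Asg 11 (Var 14) ;;
  Asg 6 (Num 0) ;; Loop (Less (Var 6) (Var 3)) sparsify_step) Q s1"
  using s1(1) s(3) unfolding s2_def by simp
 qed (use s capL in simp_all)
 then show ?thesis unfolding sparsify_def using s(3) by simp
qed

end

subsection \<open>Push-relabel\<close>

text \<open>
 Arrays 14 and 15 hold the levels and homes of the edges. The structure \<open>j k + i\<close> contains the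
 edges of level \<open>j + 1\<close> of the \<open>i\<close>-th forest, and contracts its edges of higher level.
\<close>

definition token_kick :: com where
 "token_kick = Asg 5 (Minus (Var 5) (Var 4)) ;; contract ;; Asg 6 (Var 41) ;; Put 15 (Num 0) (Var 6) (Num 0)"

text \<open>Variable 17 tells whether some element is still to be placed, 6 is that element and 18
  its level. The structures of its level start at \<open>(level - 1) * k\<close>, and those of the
  level below are found by subtracting \<open>k\<close>.\<close>

definition token_step :: com where
 "token_step = Asg 18 (Arr 14 (Num 0) (Var 6)) ;;
  Cond (Less (Var 15) (Var 18)) (Asg 17 (Num 0))
  (Asg 10 (Times (Minus (Var 18) (Num 1)) (Var 4)) ;; Asg 7 (EU (Var 6)) ;; Asg 8 (EV (Var 6)) ;; search ;;
  Cond (Less (Var 46) (Var 4))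
  (Put 15 (Num 0) (Var 6) (Plus (Var 46) (Num 1)) ;; Asg 5 (Plus (Var 10) (Var 46)) ;; link ;;
  Cond (Eq (Var 18) (Num 1)) (Asg 17 (Num 0)) token_kick)
  (Put 14 (Num 0) (Var 6) (Plus (Var 18) (Num 1))))"

definition push_relabel :: com where
 "push_relabel = Asg 9 (Times (Var 15) (Var 4)) ;; init_all ;; Asg 11 (Var 4) ;; Asg 16 (Num 0) ;;
  Loop (Less (Var 16) (Var 12))
  (Asg 6 (Arr 13 (Num 0) (Var 16)) ;; Put 14 (Num 0) (Var 6) (Num 1) ;; Asg 17 (Num 1) ;;
  Loop (Eq (Var 17) (Num 1)) token_step ;; Asg 16 (Plus (Var 16) (Num 1)))"

context task
begin

lemma idx_eq: "i < k ==> i' < k ==> j * k + i = j' * k + i' \<longleftrightarrow> j = j' & i = i'"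
proof
 assume *: "i < k" "i' < k" "j * k + i = j' * k + i'"
 have "(j * k + i) div k = (j' * k + i') div k" "(j * k + i) mod k = (j' * k + i') mod k" using *(3) by simp_all
 then show "j = j' & i = i'" using *(1,2) k1 by simp
qed simp

lemma idx_less: "j < D ==> i < k ==> j * k + i < D * k"
proof -
 assume "j < D" "i < k"
 then have "Suc j * k <= D * k" by (intro mult_right_mono) auto
 then show ?thesis using \<open>i < k\<close> by simp
qed

text \<open>The contracted sets are prescribed only up to their span. A swap changes which edges of
  higher level a forest contains but not their span on the lower levels, so all structures further
  down can be left alone.\<close>

definition filed :: "nat set => (nat => nat) => (nat => nat) => (nat => nat set) => (nat => nat set) => bool" where
 "filed H lev home K F \<longleftrightarrow> (\<forall>j i. j < D --> i < k --> F (j * k + i) = {x \<in> M.asg H home i. lev x = Suc j} &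
  espan ep (K (j * k + i)) = espan ep (M.asg H home i \<inter> M.up H lev (Suc (Suc j))))"

definition prs :: "nat set => st => nat set => bool" where
 "prs H s tok \<longleftrightarrow> M.pushrel H k D (ar s 14 0) (ar s 15 0) tok &
  (\<exists>K F. reps (D * k) s K F & filed H (ar s 14 0) (ar s 15 0) K F)"

text \<open>Counts the pushes and raises still possible: an insertion increases the size of one
  restricted forest by 1 and leaves the others unchanged, and a raise increases one level by
  1.\<close>

definition phi :: "nat set => (nat => nat) => (nat => nat) => nat" where
 "phi H lev home = (\<Sum>(j, i)\<in>{..<D} \<times> {..<k}. n - card (M.asg H home i \<inter> M.up H lev (Suc j))) +
  (\<Sum>x\<in>H. Suc D - lev x)"

lemma filed_span:
 assumes "filed H lev home K F" "j < D" "i < k"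
 shows "espan ep (K (j * k + i) \<union> F (j * k + i)) = espan ep (M.asg H home i \<inter> M.up H lev (Suc j))"
proof -
 have "espan ep (K (j * k + i) \<union> F (j * k + i)) =
  espan ep (M.asg H home i \<inter> M.up H lev (Suc (Suc j)) \<union> F (j * k + i))"
  by (rule M.sp_Un_cong) (use assms in \<open>simp add: filed_def\<close>)
 also have "M.asg H home i \<inter> M.up H lev (Suc (Suc j)) \<union> F (j * k + i) = M.asg H home i \<inter> M.up H lev (Suc j)"
  using assms unfolding filed_def M.asg_def M.up_def by auto
 finally show ?thesis .
qed

lemma phi_relabel:
 assumes "finite H" "x \<in> H" "home x = 0" "lev x <= D" "l = Suc (lev x)"
 shows "phi H (lev(x := l)) home + 1 = phi H lev home"
proof -
 have a: "M.asg H home i \<inter> M.up H (lev(x := l)) j = M.asg H home i \<inter> M.up H lev j" for i j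
  using assms(3) unfolding M.asg_def M.up_def by auto
 have "(\<Sum>y\<in>H. Suc D - (lev(x := l)) y) + (Suc D - lev x) = (\<Sum>y\<in>H. Suc D - lev y) + (Suc D - l)"
  using sum_change[OF assms(1,2), of "\<lambda>y. Suc D - (lev(x := l)) y" "\<lambda>y. Suc D - lev y"] by simp
 then show ?thesis unfolding phi_def a using assms(4,5) by simp
qed

lemma phi_insert:
 assumes j: "j < D" "i < k" and H: "H \<subseteq> {..<m}" and ind: "M.ind (M.asg H home' i)"
  and new: "card (M.asg H home' i \<inter> M.up H lev (Suc j)) = Suc (card (M.asg H home i \<inter> M.up H lev (Suc j)))"
  and other: "\<And>i'. i' ~= i ==> M.asg H home' i' = M.asg H home i'"
  and old: "\<And>j'. j' ~= j ==> card (M.asg H home' i \<inter> M.up H lev (Suc j')) = card (M.asg H home i \<inter> M.up H lev (Suc j'))"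
 shows "phi H lev home' + 1 = phi H lev home"
proof -
 let ?f = "\<lambda>h (j, i). n - card (M.asg H h i \<inter> M.up H lev (Suc j))"
 have "M.ind (M.asg H home' i \<inter> M.up H lev (Suc j))" by (rule M.ind_subset[OF ind]) blast
 moreover have "M.asg H home' i \<inter> M.up H lev (Suc j) \<subseteq> {..<m}" using H unfolding M.asg_def by auto
 ultimately have "card (M.asg H home' i \<inter> M.up H lev (Suc j)) <= n - 1" by (rule ind_card)
 \<comment> \<open>A forest has at most \<open>n - 1\<close> edges, so the truncated difference
   really drops.\<close>
 then have d: "?f home' (j, i) + 1 = ?f home (j, i)" using new n2 by simp
 have "sum (?f home') ({..<D} \<times> {..<k}) + ?f home (j, i) = sum (?f home) ({..<D} \<times> {..<k}) + ?f home' (j, i)"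
 proof (rule sum_change)
  fix p assume p: "p \<in> {..<D} \<times> {..<k}" "p ~= (j, i)"
  obtain a b where ab: "p = (a, b)" by (cases p)
  show "?f home' p = ?f home p" unfolding ab using other[of b] old[of a] p(2) ab by (cases "b = i") auto
 qed (use j in auto)
 then show ?thesis unfolding phi_def using d by simp
qed

text \<open>A push or a raise is paid by \<open>phi\<close>, whose weight includes the
  \<open>5 * w\<close> ticks of a binary search. Giving an element up on level \<open>D + 1\<close>
  leaves \<open>phi\<close> unchanged and is paid by the reserve of 10 ticks of an active
  token.\<close>

definition token_inv :: "nat set => st => nat => st => bool" where
 "token_inv H s B s' \<longleftrightarrow> (\<forall>x<30. x \<notin> {5, 6, 7, 8, 10, 17, 18} --> vr s' x = vr s x) & rw s' = rw s &
  (\<forall>t p. 10 < t & t ~= 14 & t ~= 15 --> ar s' t p = ar s t p) &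
  (vr s' 17 = 1 & prs H s' {vr s' 6} \<or> vr s' 17 = 0 & prs H s' {}) &
  (\<forall>x\<in>H. ar s' 14 0 x = 0 \<longleftrightarrow> ar s 14 0 x = 0) &
  ck s' + 20 * potall (D * k) s' + (100 + 5 * w) * phi H (ar s' 14 0) (ar s' 15 0) +
  (if vr s' 17 = 1 then 10 else 0) <= B"

lemma wp_token_step:
 assumes I: "token_inv H s B s1" and act: "vr s1 17 = 1"
  and s: "edges s" "vr s 4 = k" "vr s 11 = k" "vr s 15 = D" and H: "H \<subseteq> {..<m}"
 shows "wp token_step (token_inv H s B) (tick s1)"
proof -
 have i: "\<forall>x<30. x \<notin> {5, 6, 7, 8, 10, 17, 18} --> vr s1 x = vr s x" "rw s1 = rw s"
  "\<forall>t p. 10 < t & t ~= 14 & t ~= 15 --> ar s1 t p = ar s t p" "prs H s1 {vr s1 6}"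
  "\<forall>x\<in>H. ar s1 14 0 x = 0 \<longleftrightarrow> ar s 14 0 x = 0"
  "ck s1 + 20 * potall (D * k) s1 + (100 + 5 * w) * phi H (ar s1 14 0) (ar s1 15 0) + 10 <= B"
  using I act unfolding token_inv_def by simp_all
 define e where "e = vr s1 6"
 define lev home where "lev = ar s1 14 0" and "home = ar s1 15 0"
 obtain K F where P: "M.pushrel H k D lev home {e}" and R: "reps (D * k) s1 K F" and fl: "filed H lev home K F"
  using i(4) unfolding prs_def lev_def home_def e_def by blast
 have p: "finite H" "e \<in> H" "home e = 0" "1 <= lev e" "lev e <= Suc D" "\<And>i. i < k ==> M.ind (M.asg H home i)"
  "\<And>j i. 1 <= j ==> j <= D ==> i < k ==> M.up H lev (Suc j) \<subseteq> espan ep (M.asg H home i \<inter> M.up H lev j)"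
  using P unfolding M.pushrel_def by auto
 have em: "e < m" using p(2) H by auto
 have ed: "ar s1 11 0 e = fst (ep e)" "ar s1 12 0 e = snd (ep e)" "edges s1"
  using s(1) i(3) em unfolding edges_def by auto
 have v1: "vr s1 4 = k" "vr s1 11 = k" "vr s1 15 = D" using i(1) s by auto
 show ?thesis
 proof (cases "D < lev e")
  case True
  then have "lev e = Suc D" using p(5) by simp
  then have P': "M.pushrel H k D lev home {}" by (rule M.pushrel_finish[OF P])
  define s2 where "s2 = s1\<lparr>vr := (vr s1)(18 := lev e, 17 := 0), ck := Suc (Suc (Suc (Suc (ck s1))))\<rparr>"
  have "reps (D * k) s2 K F" "potall (D * k) s2 = potall (D * k) s1"
  using R reps_cong[of s2 s1] unfolding s2_def by simp_all
  then have "prs H s2 {}" unfolding prs_def using P' fl unfolding s2_def lev_def home_def by auto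
  then have "token_inv H s B s2"
  unfolding token_inv_def using i \<open>potall (D * k) s2 = potall (D * k) s1\<close> unfolding s2_def by simp
  then show ?thesis
  unfolding token_step_def s2_def using True v1 unfolding lev_def e_def by simp
 next
  case False
  then obtain j where j: "lev e = Suc j" "j < D" using p(4) by (cases "lev e") auto
  have jk: "j * k + k < cap" "2 * k < cap" "Suc (Suc j) < cap"
  proof -
  have "Suc j * k <= D * k" using j(2) by (intro mult_right_mono) auto
  then have "j * k + k <= D * k" by (simp only: mult_Suc add.commute)
  also have "\<dots> <= Suc D * Suc k" by (intro mult_mono) auto
  also have "\<dots> < cap" by (rule capD)
  finally show "j * k + k < cap" .
  have "Suc D * 2 <= Suc D * Suc k" using k1 by (intro mult_left_mono) auto
  then have "Suc D * 2 < cap" using capD by (rule le_less_trans)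
  then show "Suc (Suc j) < cap" using j(2) by simp
  qed (rule k_cap)
  define s2 where "s2 = s1\<lparr>vr := (vr s1)(18 := Suc j, 10 := j * k, 7 := fst (ep e), 8 := snd (ep e)),
  ck := Suc (Suc (Suc (Suc (Suc (Suc (ck s1))))))\<rparr>"
  let ?S = "\<lambda>i. M.asg H home i \<inter> M.up H lev (Suc j)"
  have con: "ar s1 0 (j * k + i) (fst (ep e)) = ar s1 0 (j * k + i) (snd (ep e)) \<longleftrightarrow> e \<in> espan ep (?S i)" if "i < k" for i
  using coarse_iff[of s1 "j * k + i" "K (j * k + i)" "F (j * k + i)" e] R idx_less[OF j(2) that] em
  filed_span[OF fl j(2) that] unfolding reps_def by simp
  have wsearch: "wp search (\<lambda>s'. (\<forall>x<30. vr s' x = vr s2 x) & rw s' = rw s2 & ar s' = ar s2 & vr s' 46 <= k &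
  (\<forall>i<vr s' 46. ar s2 0 (j * k + i) (fst (ep e)) = ar s2 0 (j * k + i) (snd (ep e))) &
  (vr s' 46 < k --> ar s2 0 (j * k + vr s' 46) (fst (ep e)) ~= ar s2 0 (j * k + vr s' 46) (snd (ep e))) &
  ck s' <= ck s2 + 3 + 5 * w) s2"
  proof (rule wp_search)
  show "vr s2 10 = j * k" "vr s2 11 = k" using v1 unfolding s2_def by simp_all
  fix a b assume ij: "a <= b" "b < k" "ar s2 0 (j * k + b) (fst (ep e)) = ar s2 0 (j * k + b) (snd (ep e))"
  have "espan ep (?S b) \<subseteq> espan ep (?S a)" by (rule M.pushrel_nested[OF P]) (use j ij in auto)
  then have "e \<in> espan ep (?S a)" using con[of b] ij unfolding s2_def by auto
  then show "ar s2 0 (j * k + a) (fst (ep e)) = ar s2 0 (j * k + a) (snd (ep e))"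
  using con[of a] ij(1,2) unfolding s2_def by simp
  qed (use jk k_cap in \<open>simp_all add: s2_def\<close>)
  have "wp (search ;; Cond (Less (Var 46) (Var 4))
  (Put 15 (Num 0) (Var 6) (Plus (Var 46) (Num 1)) ;; Asg 5 (Plus (Var 10) (Var 46)) ;; link ;;
  Cond (Eq (Var 18) (Num 1)) (Asg 17 (Num 0)) token_kick)
  (Put 14 (Num 0) (Var 6) (Plus (Var 18) (Num 1)))) (token_inv H s B) s2"
  unfolding wp_Seq[of search]
  proof (rule wp_mono[OF wsearch], elim conjE)
  fix s3 :: st
  assume s3: "\<forall>x<30. vr s3 x = vr s2 x" "rw s3 = rw s2" "ar s3 = ar s2" "vr s3 46 <= k"
  "\<forall>i<vr s3 46. ar s2 0 (j * k + i) (fst (ep e)) = ar s2 0 (j * k + i) (snd (ep e))"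
  "vr s3 46 < k --> ar s2 0 (j * k + vr s3 46) (fst (ep e)) ~= ar s2 0 (j * k + vr s3 46) (snd (ep e))"
  "ck s3 <= ck s2 + 3 + 5 * w"
  define l where "l = vr s3 46"
  have a3: "ar s3 = ar s1" using s3(3) unfolding s2_def by simp
  have v3: "\<forall>x<30. x \<notin> {7, 8, 10, 18} --> vr s3 x = vr s1 x" "vr s3 6 = e" "vr s3 18 = Suc j" "vr s3 10 = j * k"
  "vr s3 4 = k" "vr s3 7 = fst (ep e)" "vr s3 8 = snd (ep e)"
  using s3(1) v1 unfolding s2_def e_def by auto
  have ck3: "ck s3 <= ck s1 + 9 + 5 * w" using s3(7) unfolding s2_def by simp
  have rw3: "rw s3 = rw s1" using s3(2) unfolding s2_def by simp
  have before: "e \<in> espan ep (?S i)" if "i < l" for i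
  using con[of i] s3(4,5) that unfolding l_def s2_def by simp
  show "wp (Cond (Less (Var 46) (Var 4))
  (Put 15 (Num 0) (Var 6) (Plus (Var 46) (Num 1)) ;; Asg 5 (Plus (Var 10) (Var 46)) ;; link ;;
  Cond (Eq (Var 18) (Num 1)) (Asg 17 (Num 0)) token_kick)
  (Put 14 (Num 0) (Var 6) (Plus (Var 18) (Num 1)))) (token_inv H s B) s3"
  proof (cases "l < k")
  case False
  then have lk: "l = k" using s3(4) unfolding l_def by simp
  let ?lev = "lev(e := Suc (Suc j))"
  have P': "M.pushrel H k D ?lev home {e}"
  using M.pushrel_relabel[OF P] j before lk by simp
  define s4 where "s4 = s3\<lparr>ar := put 14 0 e (Suc (Suc j)) (ar s3), ck := Suc (Suc (ck s3))\<rparr>"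
  have c4: "reps (D * k) s4 K F" "potall (D * k) s4 = potall (D * k) s1"
  using R reps_cong[of s4 s1] a3 unfolding s4_def by simp_all
  have l4: "ar s4 14 0 = ?lev" "ar s4 15 0 = home" using a3 unfolding s4_def lev_def home_def by simp_all
  have "filed H ?lev home K F"
  proof -
  have "{x \<in> M.asg H home i. ?lev x = Suc a} = {x \<in> M.asg H home i. lev x = Suc a}" for i a
  using p(3) unfolding M.asg_def by auto
  moreover have "M.asg H home i \<inter> M.up H ?lev a = M.asg H home i \<inter> M.up H lev a" for i a
  using p(3) unfolding M.asg_def M.up_def by auto
  ultimately show ?thesis using fl unfolding filed_def by simp
  qed
  then have "prs H s4 {e}" unfolding prs_def l4 using P' c4 by blast
  moreover have "phi H ?lev home + 1 = phi H lev home"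
  by (rule phi_relabel) (use p j in auto)
  moreover have "\<forall>x\<in>H. ?lev x = 0 \<longleftrightarrow> ar s 14 0 x = 0" using i(5) p(2,4) unfolding lev_def by auto
  moreover have "(100 + 5 * w) * phi H lev home = (100 + 5 * w) * phi H ?lev home + (100 + 5 * w)"
  using \<open>phi H ?lev home + 1 = phi H lev home\<close> by (metis add_mult_distrib2 mult.right_neutral)
  ultimately have "token_inv H s B s4"
  unfolding token_inv_def l4 c4(2) using i(1-3,6) v3 act a3 ck3 rw3 unfolding lev_def[symmetric] home_def[symmetric]
  by (simp add: s4_def)
  then show ?thesis using False v3 jk unfolding s4_def l_def by simp
  next
  case True
  define P1 where "P1 = j * k + l"
  have P1: "P1 < D * k" "P1 < cap" using idx_less[OF j(2) True] jk True unfolding P1_def by auto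
  have ne: "e \<notin> espan ep (?S l)" using con[OF True] s3(6) True unfolding l_def s2_def by simp
  define s4 where "s4 = s3\<lparr>ar := put 15 0 e (Suc l) (ar s3), vr := (vr s3)(5 := P1), ck := Suc (Suc (Suc (ck s3)))\<rparr>"
  have c4: "reps (D * k) s4 K F" "potall (D * k) s4 = potall (D * k) s1"
  using R reps_cong[of s4 s1] a3 unfolding s4_def by simp_all
  have "wp link (wp (Cond (Eq (Var 18) (Num 1)) (Asg 17 (Num 0)) token_kick) (token_inv H s B)) s4"
  proof (rule wp_link_fam[OF c4(1) P1(1)])
  show "vr s4 5 = P1" "vr s4 6 = e" using v3 unfolding s4_def by simp_all
  show "edges s4" using ed(3) a3 unfolding edges_def s4_def by simp
  show "e \<notin> espan ep (K P1 \<union> F P1)" using ne filed_span[OF fl j(2) True] unfolding P1_def by simp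
  fix s5 :: st
  assume f5: "frame s4 s5" and r5: "reps (D * k) s5 K (F(P1 := insert e (F P1)))"
  and c5: "ck s5 + 20 * potall (D * k) s5 <= ck s4 + 30 + 20 * potall (D * k) s4"
  have v5: "\<forall>x<30. x \<notin> {5, 7, 8, 10, 18} --> vr s5 x = vr s1 x" "rw s5 = rw s1" "vr s5 6 = e" "vr s5 18 = Suc j"
  "vr s5 5 = P1" "vr s5 7 = fst (ep e)" "vr s5 8 = snd (ep e)" "vr s5 4 = k"
  "\<forall>t p. 10 < t & t ~= 15 --> ar s5 t p = ar s1 t p" "ar s5 14 0 = lev" "ar s5 15 0 = home(e := Suc l)"
  using f5 v3 a3 rw3 v1 unfolding frame_def s4_def lev_def home_def by auto
  have c5': "ck s5 + 20 * potall (D * k) s5 <= ck s1 + 42 + 5 * w + 20 * potall (D * k) s1"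
  using c5 c4(2) ck3 unfolding s4_def by simp
  show "wp (Cond (Eq (Var 18) (Num 1)) (Asg 17 (Num 0)) token_kick) (token_inv H s B) s5"
  proof (cases "j = 0")
  case j0: True
  let ?home = "home(e := Suc l)"
  have full: "M.asg H home a \<inter> M.up H lev 1 = M.asg H home a" for a
  using P unfolding M.pushrel_def M.asg_def M.up_def by auto
  have P': "M.pushrel H k D lev ?home {}"
  by (rule M.pushrel_insert_free[OF P _ True D1]) (use j j0 before ne in auto)
  have asg': "M.asg H ?home a = (if a = l then insert e (M.asg H home a) else M.asg H home a)" for a
  using p(2,3) unfolding M.asg_def by auto
  have up': "M.asg H ?home a \<inter> M.up H lev (Suc (Suc b)) = M.asg H home a \<inter> M.up H lev (Suc (Suc b))" for a b
  unfolding asg' using j j0 unfolding M.up_def by auto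
  have "filed H lev ?home K (F(P1 := insert e (F P1)))"
  unfolding filed_def up'
  proof (intro allI impI conjI)
  fix b a assume ba: "b < D" "a < k"
  have "F (b * k + a) = {x \<in> M.asg H home a. lev x = Suc b}" using fl ba unfolding filed_def by simp
  moreover have "b * k + a = P1 \<longleftrightarrow> b = 0 & a = l" unfolding P1_def j0 using idx_eq[OF ba(2) True, of b 0] by simp
  ultimately show "(F(P1 := insert e (F P1))) (b * k + a) = {x \<in> M.asg H ?home a. lev x = Suc b}"
  unfolding asg' using j j0 by auto
  show "espan ep (K (b * k + a)) = espan ep (M.asg H home a \<inter> M.up H lev (Suc (Suc b)))"
  using fl ba unfolding filed_def by simp
  qed
  define s6 where "s6 = s5\<lparr>vr := (vr s5)(17 := 0), ck := Suc (Suc (ck s5))\<rparr>"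
  have c6: "reps (D * k) s6 K (F(P1 := insert e (F P1)))" "potall (D * k) s6 = potall (D * k) s5"
  using r5 reps_cong[of s6 s5] unfolding s6_def by simp_all
  have l6: "ar s6 14 0 = lev" "ar s6 15 0 = ?home" using v5 unfolding s6_def by simp_all
  have "prs H s6 {}" unfolding prs_def l6 using P' c6(1) \<open>filed H lev ?home K _\<close> by blast
  moreover have ph: "phi H lev ?home + 1 = phi H lev home"
  proof (rule phi_insert[OF j(2) True H])
  show "M.ind (M.asg H ?home l)" using P' True unfolding M.pushrel_def by simp
  have nin: "e \<notin> M.asg H home l" using p(3) unfolding M.asg_def by simp
  have "M.asg H ?home l \<inter> M.up H lev (Suc j) = insert e (M.asg H home l \<inter> M.up H lev (Suc j))"
  unfolding asg' using p(2) j unfolding M.up_def by auto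
  then show "card (M.asg H ?home l \<inter> M.up H lev (Suc j)) = Suc (card (M.asg H home l \<inter> M.up H lev (Suc j)))"
  using nin M.ind_finite[OF p(6)[OF True]] by simp
  show "card (M.asg H ?home l \<inter> M.up H lev (Suc j')) = card (M.asg H home l \<inter> M.up H lev (Suc j'))" if "j' ~= j" for j'
  using up'[of l "j' - 1"] that j0 by simp
  qed (simp add: asg')
  moreover have "(100 + 5 * w) * phi H lev home = (100 + 5 * w) * phi H lev ?home + (100 + 5 * w)"
  using ph by (metis add_mult_distrib2 mult.right_neutral)
  ultimately have "token_inv H s B s6"
  unfolding token_inv_def l6 c6(2) using i(1-3,5,6) v5 c5' unfolding lev_def[symmetric] home_def[symmetric]
  by (simp add: s6_def)
  then show ?thesis using v5 j0 unfolding s6_def by simp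
  next
  case False
  then obtain j' where j': "j = Suc j'" by (cases j) auto
  define P2 where "P2 = j' * k + l"
  have j'D: "j' < D" using j j' by simp
  have P2: "P2 < D * k" "P1 - k = P2" "k <= P1" "P2 ~= P1"
  using idx_less[OF j'D True] k1 unfolding P1_def P2_def j' by auto
  define s6 where "s6 = s5\<lparr>vr := (vr s5)(5 := P2), ck := Suc (Suc (ck s5))\<rparr>"
  let ?F = "F(P1 := insert e (F P1))"
  have F2: "?F P2 = {x \<in> M.asg H home l. lev x = j}" "espan ep (K P2) = espan ep (?S l)"
  using fl j'D True P2(4) unfolding filed_def P2_def j' by auto
  have sp2: "espan ep (K P2 \<union> F P2) = espan ep (M.asg H home l \<inter> M.up H lev j)"
  using filed_span[OF fl j'D True] unfolding P2_def j' .
  have c6: "reps (D * k) s6 K ?F" "potall (D * k) s6 = potall (D * k) s5"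
  using r5 reps_cong[of s6 s5] unfolding s6_def by simp_all
  have "wp contract (wp (Asg 6 (Var 41) ;; Put 15 (Num 0) (Var 6) (Num 0)) (token_inv H s B)) s6"
  proof (rule wp_contract_fam[OF c6(1) P2(1)])
  show "vr s6 5 = P2" "vr s6 7 = fst (ep e)" "vr s6 8 = snd (ep e)" "e < m"
  using v5 em unfolding s6_def by simp_all
  \<comment> \<open>The invariant says that every forest spans the raised \<open>e\<close> one level
    below. As the edges of its own level and above do not span it, the circuit passes through an
    edge of level exactly \<open>j\<close>, and the contraction finds one.\<close>
  have "e \<in> M.up H lev (Suc j)" using p(2) j unfolding M.up_def by simp
  then have "e \<in> espan ep (M.asg H home l \<inter> M.up H lev j)" using p(7)[of j l] j j' True by auto
  then show "e \<in> espan ep (K P2 \<union> ?F P2)" using sp2 P2(4) by simp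
  show "e \<notin> espan ep (K P2)" using F2(2) ne by simp
  fix s7 :: st and g
  assume f7: "frame s6 s7" and g7: "vr s7 41 = g" and gF: "g \<in> ?F P2"
  and sp7: "espan ep (insert e (K P2) \<union> (?F P2 - {g})) = espan ep (K P2 \<union> ?F P2)"
  and r7: "reps (D * k) s7 (K(P2 := insert e (K P2))) (?F(P2 := ?F P2 - {g}))"
  and c7: "ck s7 + 20 * potall (D * k) s7 <= ck s6 + 30 + 20 * potall (D * k) s6"
  let ?home = "home(e := Suc l, g := 0)"
  have g: "g \<in> M.asg H home l" "lev g = j" using gF F2(1) by auto
  have ins: "espan ep (insert e (K P2)) = espan ep (insert e (?S l))"
  using M.sp_Un_cong[OF F2(2), of "{e}"] by simp
  have sp8: "espan ep (insert e (?S l) \<union> ({y \<in> M.asg H home l. lev y = j} - {g})) =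
  espan ep (M.asg H home l \<inter> M.up H lev j)"
  using M.sp_Un_cong[OF ins, of "?F P2 - {g}"] sp7 sp2 F2(1) P2(4) by simp
  note kick = M.pushrel_insert_kick[OF P _ j(1) _ True _ g sp8]
  have kj: "lev e <= D" "1 <= j" "\<And>i'. i' < l ==> e \<in> espan ep (M.asg H home i' \<inter> M.up H lev (lev e))"
  using j j' before by auto
  note P' = kick(1)[OF kj] and low = kick(2)[OF kj] and cards = kick(3)[OF kj]
  and high = kick(4)[OF kj] and new = kick(5)[OF kj]
  have ge: "g ~= e" using g p(3) unfolding M.asg_def by auto
  have asg': "M.asg H ?home a = (if a = l then insert e (M.asg H home a) - {g} else M.asg H home a)" for a
  using p(2,3) g ge unfolding M.asg_def by auto
  have asgl: "M.asg H ?home l = insert e (M.asg H home l) - {g}" using asg'[of l] by simp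
  have sets: "{x \<in> insert e A - {g}. lev x = Suc j} = insert e {x \<in> A. lev x = Suc j}"
  "{x \<in> insert e A - {g}. lev x = j} = {x \<in> A. lev x = j} - {g}"
  "c ~= Suc j ==> c ~= j ==> {x \<in> insert e A - {g}. lev x = c} = {x \<in> A. lev x = c}" for A c
  using j(1) g(2) ge by auto
  have nin: "e \<notin> M.asg H home l" using p(3) unfolding M.asg_def by simp
  let ?K2 = "K(P2 := insert e (K P2))" and ?F2 = "?F(P2 := ?F P2 - {g})"
  have "filed H lev ?home ?K2 ?F2"
  unfolding filed_def
  proof (intro allI impI conjI)
  fix b a assume ba: "b < D" "a < k"
  have Fb: "F (b * k + a) = {x \<in> M.asg H home a. lev x = Suc b}"
  "espan ep (K (b * k + a)) = espan ep (M.asg H home a \<inter> M.up H lev (Suc (Suc b)))"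
  using fl ba unfolding filed_def by simp_all
  have e1: "b * k + a = P1 \<longleftrightarrow> b = j & a = l" unfolding P1_def using idx_eq[OF ba(2) True] .
  have e2: "b * k + a = P2 \<longleftrightarrow> b = j' & a = l" unfolding P2_def using idx_eq[OF ba(2) True] .
  show "?F2 (b * k + a) = {x \<in> M.asg H ?home a. lev x = Suc b}"
  proof (cases "a = l")
  case al: True
  consider "b = j" | "b = j'" | "b ~= j" "b ~= j'" by blast
  then show ?thesis
  proof cases
  case 1
  then have "?F2 (b * k + a) = insert e (F P1)" using e1 al P2(4) by simp
  moreover have "F P1 = {x \<in> M.asg H home l. lev x = Suc j}" using Fb(1) e1 1 al by simp
  ultimately show ?thesis unfolding al 1 asgl sets by simp
  next
  case 2
  then have "?F2 (b * k + a) = ?F P2 - {g}" using e2 al by simp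
  moreover have "Suc b = j" using 2 j' by simp
  ultimately show ?thesis unfolding al asgl F2(1) by (simp only: sets)
  next
  case 3
  then have "?F2 (b * k + a) = F (b * k + a)" using e1 e2 by simp
  moreover have "Suc b ~= Suc j" "Suc b ~= j" using 3 j' by auto
  ultimately show ?thesis using Fb(1) sets(3)[of "Suc b" "M.asg H home l"] unfolding al asgl by simp
  qed
  next
  case False
  then have "?F2 (b * k + a) = F (b * k + a)" using e1 e2 by simp
  then show ?thesis unfolding Fb(1) asg' using False by simp
  qed
  show "espan ep (?K2 (b * k + a)) = espan ep (M.asg H ?home a \<inter> M.up H lev (Suc (Suc b)))"
  proof (cases "a = l")
  case al: True
  consider "b = j'" | "b < j'" | "j' < b" by linarith
  then show ?thesis
  proof cases
  case 1
  then have "?K2 (b * k + a) = insert e (K P2)" using e2 al by simp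
  then show ?thesis using ins new unfolding al 1 j' by simp
  next
  case 2
  then have "?K2 (b * k + a) = K (b * k + a)" using e2 by simp
  then show ?thesis using Fb(2) low[of "Suc (Suc b)"] 2 unfolding al j' by simp
  next
  case 3
  then have "?K2 (b * k + a) = K (b * k + a)" using e2 by simp
  then show ?thesis using Fb(2) high[of "Suc (Suc b)"] 3 unfolding al j' by simp
  qed
  next
  case False
  then have "?K2 (b * k + a) = K (b * k + a)" using e2 by simp
  then show ?thesis unfolding asg' using False Fb(2) by simp
  qed
  qed
  define s8 where "s8 = s7\<lparr>vr := (vr s7)(6 := g), ar := put 15 0 g 0 (ar s7), ck := Suc (Suc (ck s7))\<rparr>"
  have c8: "reps (D * k) s8 ?K2 ?F2" "potall (D * k) s8 = potall (D * k) s7"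
  using r7 reps_cong[of s8 s7] unfolding s8_def by simp_all
  have v7: "\<forall>x<30. x \<notin> {5, 7, 8, 10, 18} --> vr s7 x = vr s1 x" "rw s7 = rw s1"
  "\<forall>t p. 10 < t & t ~= 15 --> ar s7 t p = ar s1 t p" "ar s7 14 0 = lev" "ar s7 15 0 = home(e := Suc l)"
  using f7 v5 unfolding frame_def s6_def by auto
  have l8: "ar s8 14 0 = lev" "ar s8 15 0 = ?home" using v7 unfolding s8_def by simp_all
  have "prs H s8 {g}" unfolding prs_def l8 using P' c8(1) \<open>filed H lev ?home ?K2 ?F2\<close> by blast
  moreover have ph: "phi H lev ?home + 1 = phi H lev home"
  proof (rule phi_insert[OF j(2) True H])
  show "M.ind (M.asg H ?home l)" using P' True unfolding M.pushrel_def by simp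
  show "card (M.asg H ?home l \<inter> M.up H lev (Suc j)) = Suc (card (M.asg H home l \<inter> M.up H lev (Suc j)))"
  using new nin M.ind_finite[OF p(6)[OF True]] by simp
  show "card (M.asg H ?home l \<inter> M.up H lev (Suc b)) = card (M.asg H home l \<inter> M.up H lev (Suc b))" if "b ~= j" for b
  using cards[of "Suc b"] high[of "Suc b"] that by (cases "b < j") auto
  qed (simp add: asg')
  moreover have "(100 + 5 * w) * phi H lev home = (100 + 5 * w) * phi H lev ?home + (100 + 5 * w)"
  using ph by (metis add_mult_distrib2 mult.right_neutral)
  moreover have "ck s8 + 20 * potall (D * k) s7 <= ck s1 + 76 + 5 * w + 20 * potall (D * k) s1"
  using c7 c6(2) c5' unfolding s8_def s6_def by simp
  ultimately have "token_inv H s B s8"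
  unfolding token_inv_def l8 c8(2) using i(1-3,5,6) v7 act unfolding lev_def[symmetric] home_def[symmetric]
  by (simp add: s8_def)
  then show "wp (Asg 6 (Var 41) ;; Put 15 (Num 0) (Var 6) (Num 0)) (token_inv H s B) s7"
  using g7 unfolding s8_def by simp
  qed
  then show ?thesis
  unfolding token_kick_def using v5 False P2 unfolding s6_def by simp
  qed
  qed (use em in simp)
  then show ?thesis using True v3 P1 jk unfolding s4_def l_def P1_def by simp
  qed
  qed
  then show ?thesis
  unfolding token_step_def s2_def using False v1 ed j jk unfolding lev_def e_def by simp
 qed
qed

lemma filed_unassigned:
 assumes "filed H lev home K F" "home e = 0"
 shows "filed H (lev(e := l)) home K F"
proof -
 have "{x \<in> M.asg H home i. (lev(e := l)) x = Suc a} = {x \<in> M.asg H home i. lev x = Suc a}" for i a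
  using assms(2) unfolding M.asg_def by auto
 moreover have "M.asg H home i \<inter> M.up H (lev(e := l)) a = M.asg H home i \<inter> M.up H lev a" for i a
  using assms(2) unfolding M.asg_def M.up_def by auto
 ultimately show ?thesis using assms(1) unfolding filed_def by simp
qed

definition outer_inv :: "nat list => st => nat => st => bool" where
 "outer_inv hs s B s' \<longleftrightarrow> vr s' 16 <= length hs &
  (\<forall>x<30. x \<notin> {5, 6, 7, 8, 10, 16, 17, 18} --> vr s' x = vr s x) & rw s' = rw s &
  (\<forall>t p. 10 < t & t ~= 14 & t ~= 15 --> ar s' t p = ar s t p) & prs (set hs) s' {} &
  (\<forall>i<length hs. ar s' 14 0 (hs ! i) = 0 \<longleftrightarrow> vr s' 16 <= i) &
  ck s' + 20 * potall (D * k) s' + (100 + 5 * w) * phi (set hs) (ar s' 14 0) (ar s' 15 0) <= B + 20 * vr s' 16"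

lemma wp_outer_step:
 assumes I: "outer_inv hs s B s1" and lt: "vr s1 16 < length hs" and ls: "listing s hs"
  and s: "edges s" "vr s 4 = k" "vr s 11 = k" "vr s 15 = D" and H: "set hs \<subseteq> {..<m}"
 shows "wp (Asg 6 (Arr 13 (Num 0) (Var 16)) ;; Put 14 (Num 0) (Var 6) (Num 1) ;; Asg 17 (Num 1) ;;
  Loop (Eq (Var 17) (Num 1)) token_step ;; Asg 16 (Plus (Var 16) (Num 1))) (outer_inv hs s B) (tick s1)"
proof -
 have i: "\<forall>x<30. x \<notin> {5, 6, 7, 8, 10, 16, 17, 18} --> vr s1 x = vr s x" "rw s1 = rw s"
  "\<forall>t p. 10 < t & t ~= 14 & t ~= 15 --> ar s1 t p = ar s t p" "prs (set hs) s1 {}"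
  "\<forall>i<length hs. ar s1 14 0 (hs ! i) = 0 \<longleftrightarrow> vr s1 16 <= i"
  "ck s1 + 20 * potall (D * k) s1 + (100 + 5 * w) * phi (set hs) (ar s1 14 0) (ar s1 15 0) <= B + 20 * vr s1 16"
  using I unfolding outer_inv_def by simp_all
 define g e where "g = vr s1 16" and "e = hs ! g"
 have gl: "g < length hs" using lt unfolding g_def .
 have e13: "ar s1 13 0 g = e" using ls i(3) gl unfolding listing_def e_def by simp
 have dist: "distinct hs" using ls unfolding listing_def by simp
 have lenm: "length hs <= m"
 proof -
  have "card (set hs) <= card {..<m}" using H by (intro card_mono) auto
  then show ?thesis using distinct_card[OF dist] by simp
 qed
 define lev home where "lev = ar s1 14 0" and "home = ar s1 15 0"
 obtain K F where P: "M.pushrel (set hs) k D lev home {}" and R: "reps (D * k) s1 K F" and fl: "filed (set hs) lev home K F"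
  using i(4) unfolding prs_def lev_def home_def by blast
 have eH: "e \<in> set hs" using gl unfolding e_def by simp
 have l0: "lev e = 0" using i(5) gl unfolding e_def lev_def g_def by simp
 have h0: "home e = 0" using P eH l0 unfolding M.pushrel_def by auto
 define s3 where "s3 = s1\<lparr>ar := put 14 0 e 1 (ar s1), vr := (vr s1)(6 := e, 17 := 1), ck := Suc (Suc (Suc (Suc (ck s1))))\<rparr>"
 have c3: "reps (D * k) s3 K F" "potall (D * k) s3 = potall (D * k) s1"
  using R reps_cong[of s3 s1] unfolding s3_def by simp_all
 have l3: "ar s3 14 0 = lev(e := 1)" "ar s3 15 0 = home" unfolding s3_def lev_def home_def by simp_all
 have "M.pushrel (set hs) k D (lev(e := 1)) home {e}" by (rule M.pushrel_start[OF P eH l0 D1])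
 moreover have "filed (set hs) (lev(e := 1)) home K F" by (rule filed_unassigned[OF fl h0])
 ultimately have p3: "prs (set hs) s3 {vr s3 6}" unfolding prs_def l3 using c3(1) unfolding s3_def by auto
 have ph: "phi (set hs) (lev(e := 1)) home + 1 = phi (set hs) lev home"
  by (rule phi_relabel) (use eH l0 h0 in auto)
 define B2 where "B2 = ck s3 + 20 * potall (D * k) s3 + (100 + 5 * w) * phi (set hs) (ar s3 14 0) (ar s3 15 0) + 10"
 have B2: "B2 + 6 <= B + 20 * Suc g"
 proof -
  define X Y where "X = (100 + 5 * w) * phi (set hs) (lev(e := 1)) home" and "Y = (100 + 5 * w) * phi (set hs) lev home"
  have "X <= Y" unfolding X_def Y_def using ph by (intro mult_left_mono) auto
  moreover have "ck s3 = ck s1 + 4" unfolding s3_def by simp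
  ultimately show ?thesis
  using i(6) unfolding B2_def l3 c3(2) lev_def[symmetric] home_def[symmetric] g_def
  unfolding X_def[symmetric] Y_def[symmetric] by simp
 qed
 have "wp (Loop (Eq (Var 17) (Num 1)) token_step) (wp (Asg 16 (Plus (Var 16) (Num 1))) (outer_inv hs s B)) s3"
 proof (rule wp_Loop[where I = "token_inv (set hs) s3 B2" and B = B2])
  show "token_inv (set hs) s3 B2 s3" unfolding token_inv_def B2_def using p3 by (simp add: s3_def)
 next
  fix s' assume "token_inv (set hs) s3 B2 s'"
  then show "ck s' <= B2" unfolding token_inv_def by linarith
 next
  fix s' show "okb (Eq (Var 17) (Num 1)) s'" by simp
 next
  fix s' assume T: "token_inv (set hs) s3 B2 s'" and b: "bv (Eq (Var 17) (Num 1)) s'"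
  show "wp token_step (token_inv (set hs) s3 B2) (tick s')"
  proof (rule wp_token_step[OF T])
  show "edges s3" using s(1) i(3) unfolding edges_def s3_def by simp
  qed (use b i(1) s H in \<open>auto simp: s3_def\<close>)
 next
  fix s' assume T: "token_inv (set hs) s3 B2 s'" and b: "\<not> bv (Eq (Var 17) (Num 1)) s'"
  have t: "\<forall>x<30. x \<notin> {5, 6, 7, 8, 10, 17, 18} --> vr s' x = vr s3 x" "rw s' = rw s3"
  "\<forall>t p. 10 < t & t ~= 14 & t ~= 15 --> ar s' t p = ar s3 t p" "prs (set hs) s' {}"
  "\<forall>x\<in>set hs. ar s' 14 0 x = 0 \<longleftrightarrow> ar s3 14 0 x = 0"
  "ck s' + 20 * potall (D * k) s' + (100 + 5 * w) * phi (set hs) (ar s' 14 0) (ar s' 15 0) <= B2"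
  using T b unfolding token_inv_def by auto
  have v': "vr s' 16 = g" using t(1) unfolding s3_def g_def by simp
  define s4 where "s4 = s'\<lparr>vr := (vr s')(16 := Suc g), ck := Suc (Suc (ck s'))\<rparr>"
  have c4: "potall (D * k) s4 = potall (D * k) s'" "prs (set hs) s4 {}"
  using t(4) reps_cong[of s4 s'] unfolding s4_def prs_def by simp_all
  have "(lev(e := 1)) (hs ! a) = 0 \<longleftrightarrow> Suc g <= a" if "a < length hs" for a
  proof (cases "a = g")
  case False
  then have "hs ! a ~= e" using dist that gl nth_eq_iff_index_eq unfolding e_def by blast
  then show ?thesis using i(5) that False unfolding lev_def g_def by auto
  qed (simp add: e_def)
  then have lv: "\<forall>a<length hs. ar s' 14 0 (hs ! a) = 0 \<longleftrightarrow> Suc g <= a" using t(5) unfolding l3 by simp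
  have "outer_inv hs s B s4"
  unfolding outer_inv_def c4 using gl lv t(1-3,6) i(1-3) B2 c4(2) unfolding s4_def s3_def by simp
  then show "wp (Asg 16 (Plus (Var 16) (Num 1))) (outer_inv hs s B) (tick s')"
  using v' gl lenm cap_m unfolding s4_def by simp
 qed
 then show ?thesis using e13 unfolding s3_def g_def by simp
qed

lemma phi_le: "finite H ==> phi H lev home <= D * k * n + card H * Suc D"
proof -
 assume "finite H"
 have "(\<Sum>(j, i)\<in>{..<D} \<times> {..<k}. n - card (M.asg H home i \<inter> M.up H lev (Suc j))) <= (\<Sum>p\<in>{..<D} \<times> {..<k}. n)"
  by (rule sum_mono) auto
 moreover have "(\<Sum>x\<in>H. Suc D - lev x) <= (\<Sum>x\<in>H. Suc D)" by (rule sum_mono) auto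
 ultimately show ?thesis unfolding phi_def by simp
qed

theorem wp_push_relabel:
 assumes s: "vr s 2 = n" "vr s 4 = k" "vr s 15 = D" "edges s" "listing s hs" "set hs \<subseteq> {..<m}"
  and zero: "ar s 14 0 = (\<lambda>_. 0)" "ar s 15 0 = (\<lambda>_. 0)"
  and Q: "\<And>s'. \<forall>x<30. x \<notin> {5, 6, 7, 8, 9, 10, 11, 16, 17, 18} --> vr s' x = vr s x ==> rw s' = rw s ==>
  \<forall>t p. 10 < t & t ~= 14 & t ~= 15 --> ar s' t p = ar s t p ==>
  M.pushrel (set hs) k D (ar s' 14 0) (ar s' 15 0) {} ==> \<forall>x\<in>set hs. ar s' 14 0 x ~= 0 ==>
  ck s' <= ck s + 10 + D * k * (11 * n + 4 + 40 * (n * floor_log n)) +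
  (100 + 5 * w) * (D * k * n + length hs * Suc D) + 20 * length hs ==> Q s'"
 shows "wp push_relabel Q s"
proof -
 let ?C = "D * k * (11 * n + 4 + 40 * (n * floor_log n))"
 define s0 where "s0 = s\<lparr>vr := (vr s)(9 := D * k), ck := Suc (ck s)\<rparr>"
 have Dk: "D * k < cap"
 proof -
  have "D * k <= Suc D * Suc k" by (intro mult_mono) auto
  then show ?thesis using capD by (rule le_less_trans)
 qed
 have "wp (init_all ;; Asg 11 (Var 4) ;; Asg 16 (Num 0) ;;
  Loop (Less (Var 16) (Var 12))
  (Asg 6 (Arr 13 (Num 0) (Var 16)) ;; Put 14 (Num 0) (Var 6) (Num 1) ;; Asg 17 (Num 1) ;;
  Loop (Eq (Var 17) (Num 1)) token_step ;; Asg 16 (Plus (Var 16) (Num 1)))) Q s0"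
  unfolding wp_Seq[of init_all]
 proof (rule wp_init_fam[where c = "D * k"])
  fix s1 :: st assume a: "\<forall>x<30. x ~= 5 --> vr s1 x = vr s0 x" "rw s1 = rw s0"
  "\<forall>t p. 10 < t --> ar s1 t p = ar s0 t p" "reps (D * k) s1 (\<lambda>_. {}) (\<lambda>_. {})"
  "ck s1 + 20 * potall (D * k) s1 <= ck s0 + 2 + ?C"
  define s2 where "s2 = s1\<lparr>vr := (vr s1)(11 := k, 16 := 0), ck := Suc (Suc (ck s1))\<rparr>"
  have s1: "\<forall>x<30. x \<notin> {5, 9} --> vr s1 x = vr s x" "rw s1 = rw s" "\<forall>t p. 10 < t --> ar s1 t p = ar s t p"
  "ck s1 + 20 * potall (D * k) s1 <= ck s + 3 + ?C" using a unfolding s0_def by auto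
  have c2: "reps (D * k) s2 (\<lambda>_. {}) (\<lambda>_. {})" "potall (D * k) s2 = potall (D * k) s1"
  using a(4) reps_cong[of s2 s1] unfolding s2_def by simp_all
  have z2: "ar s2 14 0 = (\<lambda>_. 0)" "ar s2 15 0 = (\<lambda>_. 0)" using zero s1(3) unfolding s2_def by simp_all
  have ls2: "listing s2 hs" using s(5) s1 unfolding listing_def s2_def by simp
  have "filed (set hs) (\<lambda>_. 0) (\<lambda>_. 0) (\<lambda>_. {}) (\<lambda>_. {})" unfolding filed_def M.asg_def by simp
  then have p2: "prs (set hs) s2 {}" unfolding prs_def z2 using M.pushrel_init[of "set hs" k D] c2(1) by auto
  define B where "B = ck s2 + 20 * potall (D * k) s2 + (100 + 5 * w) * phi (set hs) (ar s2 14 0) (ar s2 15 0)"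
  have "phi (set hs) (ar s2 14 0) (ar s2 15 0) <= D * k * n + length hs * Suc D"
  using phi_le[of "set hs"] distinct_card[of hs] s(5) unfolding listing_def by (metis finite_set)
  then have "(100 + 5 * w) * phi (set hs) (ar s2 14 0) (ar s2 15 0) <= (100 + 5 * w) * (D * k * n + length hs * Suc D)"
  by (rule mult_left_mono) simp
  then have B: "B <= ck s + 5 + ?C + (100 + 5 * w) * (D * k * n + length hs * Suc D)"
  proof -
  have "ck s2 = ck s1 + 2" unfolding s2_def by simp
  then show ?thesis using s1(4) c2(2) \<open>(100 + 5 * w) * phi (set hs) (ar s2 14 0) (ar s2 15 0) <= _\<close>
  unfolding B_def by linarith
  qed
  have "wp (Loop (Less (Var 16) (Var 12))
  (Asg 6 (Arr 13 (Num 0) (Var 16)) ;; Put 14 (Num 0) (Var 6) (Num 1) ;; Asg 17 (Num 1) ;;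
  Loop (Eq (Var 17) (Num 1)) token_step ;; Asg 16 (Plus (Var 16) (Num 1)))) Q s2"
  proof (rule wp_Loop[where I = "outer_inv hs s2 B" and B = "B + 20 * length hs"])
  show "outer_inv hs s2 B s2" unfolding outer_inv_def B_def using p2 z2 by (simp add: s2_def)
  next
  fix s' assume "outer_inv hs s2 B s'"
  then show "ck s' <= B + 20 * length hs" unfolding outer_inv_def by linarith
  next
  fix s' show "okb (Less (Var 16) (Var 12)) s'" by simp
  next
  fix s' assume I: "outer_inv hs s2 B s'" and b: "bv (Less (Var 16) (Var 12)) s'"
  have "vr s' 12 = length hs" using I ls2 unfolding outer_inv_def listing_def by simp
  then show "wp (Asg 6 (Arr 13 (Num 0) (Var 16)) ;; Put 14 (Num 0) (Var 6) (Num 1) ;; Asg 17 (Num 1) ;;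
  Loop (Eq (Var 17) (Num 1)) token_step ;; Asg 16 (Plus (Var 16) (Num 1))) (outer_inv hs s2 B) (tick s')"
  using b s s1 by (intro wp_outer_step[OF I _ ls2]) (auto simp: s2_def edges_def)
  next
  fix s' assume I: "outer_inv hs s2 B s'" and b: "\<not> bv (Less (Var 16) (Var 12)) s'"
  have i: "vr s' 16 <= length hs" "\<forall>x<30. x \<notin> {5, 6, 7, 8, 10, 16, 17, 18} --> vr s' x = vr s2 x" "rw s' = rw s2"
  "\<forall>t p. 10 < t & t ~= 14 & t ~= 15 --> ar s' t p = ar s2 t p" "prs (set hs) s' {}"
  "\<forall>i<length hs. ar s' 14 0 (hs ! i) = 0 \<longleftrightarrow> vr s' 16 <= i"
  "ck s' + 20 * potall (D * k) s' + (100 + 5 * w) * phi (set hs) (ar s' 14 0) (ar s' 15 0) <= B + 20 * vr s' 16"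
  using I unfolding outer_inv_def by simp_all
  have "vr s' 12 = length hs" using i(2) ls2 unfolding listing_def by simp
  then have g: "vr s' 16 = length hs" using b i(1) by simp
  show "Q (tick s')"
  proof (rule Q)
  show "\<forall>x\<in>set hs. ar (tick s') 14 0 x ~= 0" using i(6) g by (auto simp: in_set_conv_nth)
  show "M.pushrel (set hs) k D (ar (tick s') 14 0) (ar (tick s') 15 0) {}" using i(5) unfolding prs_def by simp
  show "ck (tick s') <= ck s + 10 + ?C + (100 + 5 * w) * (D * k * n + length hs * Suc D) + 20 * length hs"
  using i(7) g B by simp
  qed (use i s1 in \<open>auto simp: s2_def\<close>)
  qed
  then show "wp (Asg 11 (Var 4) ;; Asg 16 (Num 0) ;;
  Loop (Less (Var 16) (Var 12))
  (Asg 6 (Arr 13 (Num 0) (Var 16)) ;; Put 14 (Num 0) (Var 6) (Num 1) ;; Asg 17 (Num 1) ;;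
  Loop (Eq (Var 17) (Num 1)) token_step ;; Asg 16 (Plus (Var 16) (Num 1)))) Q s1"
  using s1(1) s(2) unfolding s2_def by simp
 qed (use s Dk in \<open>simp_all add: s0_def\<close>)
 then show ?thesis unfolding push_relabel_def using s Dk unfolding s0_def by simp
qed

end

section \<open>Augmenting paths on the machine\<close>

text \<open>
 Array 16 is the queue of reached edges, and array 17 holds for every reached edge the one it was
 reached from. The structures below \<open>k\<close> represent the forests, with the reached edges contracted,
 and structure \<open>k\<close> a forest that spans the edges processed so far: an edge spanned by it has nothing
 new to reach.
\<close>

definition label_step :: com where
 "label_step = Asg 7 (EU (Var 25)) ;; Asg 8 (EV (Var 25)) ;;
  Cond (Eq (F5 5 (Var 7)) (F5 5 (Var 8))) (Asg 28 (Num 0))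
  (pick ;; Asg 26 (Var 41) ;; Asg 7 (EU (Var 26)) ;; Asg 8 (EV (Var 26)) ;; contract ;;
  Put 16 (Num 0) (Var 21) (Var 26) ;; Put 17 (Num 0) (Var 26) (Var 25) ;; Asg 21 (Plus (Var 21) (Num 1)))"

definition label_loop :: com where
 "label_loop = Asg 28 (Num 1) ;; Loop (Eq (Var 28) (Num 1)) label_step"

definition augment :: com where
 "augment = Asg 26 (Var 25) ;; Asg 27 (Plus (Var 24) (Num 1)) ;;
  Loop (Less (Num 0) (Var 27))
  (Asg 29 (Arr 15 (Num 0) (Var 26)) ;; Put 15 (Num 0) (Var 26) (Var 27) ;; Asg 27 (Var 29) ;;
  Asg 26 (Arr 17 (Num 0) (Var 26)))"

context task
begin

definition env :: "nat list => st => bool" where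
 "env hs s \<longleftrightarrow> vr s 2 = n & vr s 4 = k & listing s hs & edges s & ar s 19 0 = (\<lambda>_. 0)"

definition good :: "nat set => (nat => nat) => bool" where
 "good H home \<longleftrightarrow> H \<subseteq> {..<m} & (\<forall>x\<in>H. home x <= k) & (\<forall>i. M.ind (M.asg H home i))"

lemma good_disjoint: "i ~= j ==> M.asg H home i \<inter> M.asg H home j = {}"
 unfolding M.asg_def by auto

lemma good_empty: "good H home ==> k <= i ==> M.asg H home i = {}"
 unfolding good_def M.asg_def by auto

text \<open>\<open>r\<close> is \<open>qh\<close>, or \<open>Suc qh\<close> while the head of the
  queue is being processed and already belongs to the forest of structure \<open>k\<close>. The
  budget \<open>B\<close> provides 100 ticks per edge not yet reached, \<open>60 + 30 * k\<close>
  per edge that may still enter that forest and 30 per edge not yet processed; \<open>c\<close> is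
  the reserve of the current operation.\<close>

definition srch_body where
 "srch_body H I s qh r c B par K F \<longleftrightarrow> (M.bfs H k I (ar s 16 0) (vr s 21) par qh & reps (Suc k) s K F &
  (\<forall>i<k. K i = I i \<inter> ar s 16 0 ` {..<vr s 21} & F i = I i - ar s 16 0 ` {..<vr s 21}) &
  K k = {} & F k \<subseteq> ar s 16 0 ` {..<r} & M.ind (F k) & F k \<subseteq> H &
  (\<forall>b h. b < vr s 21 --> h < k --> ar s 16 0 b \<in> I h --> ar s 17 0 (ar s 16 0 b) = ar s 16 0 (par b)) &
  ck s + 20 * potall (Suc k) s + 100 * (card H - vr s 21) + (60 + 30 * k) * (n - card (F k)) +
  30 * (card H - qh) + c <= B)"

definition srch :: "nat set => (nat => nat set) => st => nat => nat => nat => nat => bool" where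
 "srch H I s qh r c B \<longleftrightarrow> (\<exists>par K F. srch_body H I s qh r c B par K F)"

lemma bfs_size: "M.bfs H k I q nq par qh ==> finite H ==> nq <= card H"
proof -
 assume b: "M.bfs H k I q nq par qh" and f: "finite H"
 have "card (q ` {..<nq}) = nq" using b unfolding M.bfs_def by (simp add: card_image)
 moreover have "card (q ` {..<nq}) <= card H" using b f unfolding M.bfs_def by (intro card_mono) auto
 ultimately show ?thesis by simp
qed

definition same_but :: "nat set => nat set => st => st => bool" where
 "same_but V A s s' \<longleftrightarrow> (\<forall>x<30. x \<notin> V --> vr s' x = vr s x) & (\<forall>t p. 10 < t & t \<notin> A --> ar s' t p = ar s t p)"

definition label_inv :: "nat set => (nat => nat set) => nat => nat => nat => nat => st => st => bool" where
 "label_inv H I qh i c B s s' \<longleftrightarrow> same_but {7, 8, 21, 26, 28} {16, 17} s s' &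
  vr s 21 <= vr s' 21 & (\<forall>b<vr s 21. ar s' 16 0 b = ar s 16 0 b) &
  (vr s' 28 = 1 & srch H I s' qh (Suc qh) (c + 6) B \<or>
  vr s' 28 = 0 & srch H I s' qh (Suc qh) (c + 1) B &
  ar s 16 0 qh \<in> espan ep (I i \<inter> ar s' 16 0 ` {..<vr s' 21}))"

lemma wp_label_step:
 assumes I: "label_inv H I qh i c B s s1" and act: "vr s1 28 = 1"
  and s: "edges s" "vr s 5 = i" "i < k" "vr s 25 = ar s 16 0 qh" "qh < vr s 21"
  and H: "H \<subseteq> {..<m}" and Ii: "\<And>i. i < k ==> M.ind (I i)" "\<And>i. i < k ==> I i \<subseteq> H"
  and disj: "\<And>i j. i < k ==> j < k ==> i ~= j ==> I i \<inter> I j = {}"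
  and e: "ar s 16 0 qh \<in> espan ep (I i)"
 shows "wp label_step (label_inv H I qh i c B s) (tick s1)"
proof -
 have i: "same_but {7, 8, 21, 26, 28} {16, 17} s s1" "vr s 21 <= vr s1 21" "\<forall>b<vr s 21. ar s1 16 0 b = ar s 16 0 b"
  "srch H I s1 qh (Suc qh) (c + 6) B" using I act unfolding label_inv_def by auto
 define q nq where "q = ar s1 16 0" and "nq = vr s1 21"
 obtain par K F where sb: "srch_body H I s1 qh (Suc qh) (c + 6) B par K F" using i(4) unfolding srch_def by blast
 note sb' = sb[unfolded srch_body_def, folded q_def nq_def]
 have b: "M.bfs H k I q nq par qh" and R: "reps (Suc k) s1 K F"
  and KF0: "\<forall>i<k. K i = I i \<inter> q ` {..<nq} & F i = I i - q ` {..<nq}"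
  and Fk: "K k = {}" "F k \<subseteq> q ` {..<Suc qh}" "M.ind (F k)" "F k \<subseteq> H"
  and pa0: "\<forall>b h. b < nq --> h < k --> q b \<in> I h --> ar s1 17 0 (q b) = q (par b)"
  and ck: "ck s1 + 20 * potall (Suc k) s1 + 100 * (card H - nq) + (60 + 30 * k) * (n - card (F k)) +
  30 * (card H - qh) + (c + 6) <= B"
  using sb' by simp_all
 have KF: "\<And>i. i < k ==> K i = I i \<inter> q ` {..<nq}" "\<And>i. i < k ==> F i = I i - q ` {..<nq}" using KF0 by simp_all
 have pa: "\<And>b h. b < nq ==> h < k ==> q b \<in> I h ==> ar s1 17 0 (q b) = q (par b)" using pa0 by simp
 have finH: "finite H" by (rule finite_subset[OF H]) simp
 define e0 where "e0 = q qh"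
 have e0: "ar s 16 0 qh = e0" "vr s1 25 = e0" using i s(4,5) unfolding e0_def q_def same_but_def by auto
 have qn: "qh < nq" using s(5) i(2) unfolding nq_def by simp
 have e0H: "e0 \<in> H" using b qn unfolding M.bfs_def e0_def by auto
 then have e0m: "e0 < m" using H by auto
 have ed: "edges s1" using s(1) i(1) unfolding same_but_def edges_def by simp
 have v1: "vr s1 5 = i" using i(1) s(2) unfolding same_but_def by simp
 have uni: "K i \<union> F i = I i" using KF[OF s(3)] by blast
 have rp: "rep (view s1 i) (K i) (F i)" using R s(3) unfolding reps_def by simp
 have fine: "ar s1 5 i (fst (ep e0)) = ar s1 5 i (snd (ep e0)) \<longleftrightarrow> e0 \<in> espan ep (K i)"
  by (rule fine_iff[OF rp e0m])
 have coarse: "ar s1 0 i (fst (ep e0)) = ar s1 0 i (snd (ep e0))"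
  using coarse_iff[OF rp e0m] e e0 uni by simp
 have ee: "ar s1 11 0 x = fst (ep x)" "ar s1 12 0 x = snd (ep x)" if "x < m" for x using ed that unfolding edges_def by auto
 define s2 where "s2 = s1\<lparr>vr := (vr s1)(7 := fst (ep e0), 8 := snd (ep e0)), ck := Suc (Suc (Suc (Suc (ck s1))))\<rparr>"
 have R2: "reps (Suc k) s2 K F" "potall (Suc k) s2 = potall (Suc k) s1"
  using R reps_cong[of s2 s1] unfolding s2_def by simp_all
 show ?thesis
 proof (cases "e0 \<in> espan ep (K i)")
  case True
  have tt: "ar s1 5 i (fst (ep e0)) = ar s1 5 i (snd (ep e0))" using fine True by simp
  define s3 where "s3 = s2\<lparr>vr := (vr s2)(28 := 0), ck := Suc (ck s2)\<rparr>"
  have R3: "reps (Suc k) s3 K F" "potall (Suc k) s3 = potall (Suc k) s1"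
  using R reps_cong[of s3 s1] unfolding s3_def s2_def by simp_all
  have "srch_body H I s3 qh (Suc qh) (c + 1) B par K F"
  unfolding srch_body_def
  proof (intro conjI)
  show "ck s3 + 20 * potall (Suc k) s3 + 100 * (card H - vr s3 21) + (60 + 30 * k) * (n - card (F k)) +
  30 * (card H - qh) + (c + 1) <= B"
  unfolding R3(2) using ck unfolding s3_def s2_def nq_def by simp
  qed (use b R3 KF Fk pa in \<open>simp_all add: s3_def s2_def q_def nq_def\<close>)
  then have "srch H I s3 qh (Suc qh) (c + 1) B" unfolding srch_def by blast
  moreover have "ar s 16 0 qh \<in> espan ep (I i \<inter> ar s3 16 0 ` {..<vr s3 21})"
  using True KF(1)[OF s(3)] e0(1) unfolding s3_def s2_def q_def nq_def by simp
  ultimately have "label_inv H I qh i c B s s3"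
  unfolding label_inv_def using i(1-3) unfolding s3_def s2_def same_but_def by simp
  then show ?thesis
  unfolding label_step_def s3_def s2_def using e0(2) v1 ee[OF e0m] tt by simp
 next
  case False
  have ne: "ar s2 5 i (fst (ep e0)) ~= ar s2 5 i (snd (ep e0))" using fine False unfolding s2_def by simp
  have bd: "fst (ep e0) < n" "snd (ep e0) < n" using ep[OF e0m] by auto
  have rp2: "rep (view s2 i) (K i) (F i)" using R2 s(3) unfolding reps_def by simp
  have p2: "vr s2 5 = i" "vr s2 7 = fst (ep e0)" "vr s2 8 = snd (ep e0)"
  "ar s2 0 i (fst (ep e0)) = ar s2 0 i (snd (ep e0))" "ep e0 = (fst (ep e0), snd (ep e0))"
  using v1 coarse unfolding s2_def by simp_all
  note W = wp_pick[OF rp2 p2(1-3) bd ne p2(4,5)]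
  have "wp pick (wp (Asg 26 (Var 41) ;; Asg 7 (EU (Var 26)) ;; Asg 8 (EV (Var 26)) ;; contract ;;
  Put 16 (Num 0) (Var 21) (Var 26) ;; Put 17 (Num 0) (Var 26) (Var 25) ;; Asg 21 (Plus (Var 21) (Num 1)))
  (label_inv H I qh i c B s)) s2"
  proof (rule wp_mono[OF W])
  fix s3 :: st
  assume P3: "(\<forall>x<30. vr s3 x = vr s2 x) & rw s3 = rw s2 & ar s3 = ar s2 & ck s3 <= ck s2 + 7 &
  (\<exists>x y g. vr s3 40 = x & vr s3 43 = y & vr s3 41 = g & {x, y} = {ar s2 5 i (fst (ep e0)), ar s2 5 i (snd (ep e0))} &
  ar s2 10 i x <= ar s2 10 i y & ar s2 9 i y = Suc g & g \<in> F i &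
  conn ep (insert e0 (K i) \<union> (F i - {g})) = conn ep (K i \<union> F i))"
  define g where "g = vr s3 41"
  have s3: "\<forall>x<30. vr s3 x = vr s2 x" "rw s3 = rw s2" "ar s3 = ar s2" "ck s3 <= ck s2 + 7" "vr s3 41 = g" "g \<in> F i"
  "conn ep (insert e0 (K i) \<union> (F i - {g})) = conn ep (K i \<union> F i)"
  using P3 unfolding g_def by auto
  have gi: "g \<in> I i" "g \<notin> q ` {..<nq}" using s3(6) KF(2)[OF s(3)] by auto
  have gH: "g \<in> H" using gi(1) Ii(2)[OF s(3)] by blast
  then have gm: "g < m" using H by auto
  have gn: "g \<notin> espan ep (I i - {g})" by (rule M.ind_not_span[OF Ii(1)[OF s(3)] gi(1)])
  have KI: "K i \<subseteq> I i - {g}" "F i - {g} \<subseteq> I i - {g}" using gi KF[OF s(3)] by auto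
  have gspan: "g \<in> espan ep (K i \<union> F i)" unfolding uni by (rule M.sp_base) (rule gi(1))
  \<comment> \<open>\<open>g\<close> lies on the circuit that \<open>e0\<close> closes with
    \<open>I i\<close>: otherwise \<open>e0\<close> and the other contracted and tree edges, which
    together still span \<open>g\<close>, would all lie in the span of
    \<open>I i - {g}\<close>.\<close>
  have e0n: "e0 \<notin> espan ep (I i - {g})"
  proof
  assume a: "e0 \<in> espan ep (I i - {g})"
  have "insert e0 (K i) \<union> (F i - {g}) \<subseteq> espan ep (I i - {g})"
  using a KI M.sp_ext[of "I i - {g}"] by blast
  then have "espan ep (insert e0 (K i) \<union> (F i - {g})) \<subseteq> espan ep (I i - {g})" by (rule M.sp_least)
  moreover have "g \<in> espan ep (insert e0 (K i) \<union> (F i - {g}))" using gspan s3(7) unfolding espan_def by simp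
  ultimately show False using gn by blast
  qed
  define s4 where "s4 = s3\<lparr>vr := (vr s3)(26 := g, 7 := fst (ep g), 8 := snd (ep g)), ck := Suc (Suc (Suc (ck s3)))\<rparr>"
  have a3: "ar s3 = ar s1" using s3(3) unfolding s2_def by simp
  have R4: "reps (Suc k) s4 K F" "potall (Suc k) s4 = potall (Suc k) s1"
  using R reps_cong[of s4 s1] a3 unfolding s4_def by simp_all
  have "wp contract (wp (Put 16 (Num 0) (Var 21) (Var 26) ;; Put 17 (Num 0) (Var 26) (Var 25) ;; Asg 21 (Plus (Var 21) (Num 1)))
  (label_inv H I qh i c B s)) s4"
  proof (rule wp_contract_fam[OF R4(1), of i g])
  show "i < Suc k" "vr s4 5 = i" "vr s4 7 = fst (ep g)" "vr s4 8 = snd (ep g)" "g < m"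
  using s(3) s3(1) v1 gm unfolding s4_def s2_def by simp_all
  show "g \<in> espan ep (K i \<union> F i)" by (rule gspan)
  show "g \<notin> espan ep (K i)" using M.sp_mono[OF KI(1)] gn by blast
  fix s5 :: st and g'
  assume f5: "frame s4 s5" and g': "vr s5 41 = g'" "g' \<in> F i"
  and sp5: "espan ep (insert g (K i) \<union> (F i - {g'})) = espan ep (K i \<union> F i)"
  and r5: "reps (Suc k) s5 (K(i := insert g (K i))) (F(i := F i - {g'}))"
  and c5: "ck s5 + 20 * potall (Suc k) s5 <= ck s4 + 30 + 20 * potall (Suc k) s4"
  \<comment> \<open>Here the tree edge \<open>g\<close> itself is contracted. As \<open>I i\<close>
    is independent, the only edge that the contraction can remove is \<open>g\<close>; so
    \<open>g\<close> just moves from the tree part to the contracted part, which records it as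
    reached.\<close>
  have gg: "g' = g"
  proof (rule ccontr)
  assume ng: "g' ~= g"
  have g'I: "g' \<in> I i" "g' \<notin> q ` {..<nq}" using g'(2) KF(2)[OF s(3)] by auto
  have "insert g (K i) \<union> (F i - {g'}) \<subseteq> I i - {g'}" using gi(1) ng g'I KF[OF s(3)] by auto
  then have "espan ep (insert g (K i) \<union> (F i - {g'})) \<subseteq> espan ep (I i - {g'})" by (rule M.sp_mono)
  moreover have "g' \<in> espan ep (K i \<union> F i)" unfolding uni by (rule M.sp_base) (rule g'I(1))
  ultimately show False using sp5 M.ind_not_span[OF Ii(1)[OF s(3)] g'I(1)] by blast
  qed
  define s6 where "s6 = s5\<lparr>ar := put 17 0 g e0 (put 16 0 nq g (ar s5)), vr := (vr s5)(21 := Suc nq),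
  ck := Suc (Suc (Suc (ck s5)))\<rparr>"
  have v5: "\<forall>x<30. x \<notin> {7, 8, 26} --> vr s5 x = vr s1 x" "vr s5 26 = g" "\<forall>t p. 10 < t --> ar s5 t p = ar s1 t p"
  using f5 s3(1) a3 unfolding frame_def s4_def s2_def by auto
  have q6: "ar s6 16 0 = q(nq := g)" "vr s6 21 = Suc nq" "ar s6 17 0 = (ar s1 17 0)(g := e0)"
  using v5 unfolding s6_def q_def by simp_all
  let ?q = "q(nq := g)" and ?K = "K(i := insert g (K i))" and ?F = "F(i := F i - {g})"
  have R6: "reps (Suc k) s6 ?K ?F" "potall (Suc k) s6 = potall (Suc k) s5"
  using r5 reps_cong[of s6 s5] unfolding s6_def gg by simp_all
  have im: "?q ` {..<Suc nq} = insert g (q ` {..<nq})" unfolding lessThan_Suc by auto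
  have b6: "M.bfs H k I ?q (Suc nq) (par(nq := qh)) qh"
  by (rule M.bfs_label[OF b gi(1) s(3) gH gi(2) qn]) (use e e0 e0n disj in \<open>auto simp: e0_def\<close>)
  have sz: "Suc nq <= card H" using bfs_size[OF b6 finH] .
  have "srch_body H I s6 qh (Suc qh) (c + 6) B (par(nq := qh)) ?K ?F"
  unfolding srch_body_def q6
  proof (intro conjI allI impI)
  show "M.bfs H k I ?q (Suc nq) (par(nq := qh)) qh" by (rule b6)
  show "reps (Suc k) s6 ?K ?F" by (rule R6)
  fix i' assume i': "i' < k"
  have "g \<in> I i' \<longleftrightarrow> i' = i" using disj[OF i' s(3)] gi(1) by blast
  then show "?K i' = I i' \<inter> ?q ` {..<Suc nq}" "?F i' = I i' - ?q ` {..<Suc nq}"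
  unfolding im using KF[OF i'] gi by auto
  next
  show "?K k = {}" using Fk(1) s(3) by simp
  have "?q ` {..<Suc qh} = q ` {..<Suc qh}" using qn by auto
  then show "?F k \<subseteq> ?q ` {..<Suc qh}" using Fk(2) s(3) by simp
  show "M.ind (?F k)" "?F k \<subseteq> H" using Fk s(3) by simp_all
  next
  fix b' h assume b': "b' < Suc nq" "h < k" "?q b' \<in> I h"
  show "((ar s1 17 0)(g := e0)) (?q b') = ?q ((par(nq := qh)) b')"
  proof (cases "b' = nq")
  case True
  then show ?thesis using qn unfolding e0_def by simp
  next
  case F: False
  then have bn: "b' < nq" using b'(1) by simp
  have "q b' ~= g" using gi(2) bn by auto
  moreover have "par b' < b'" using b bn b'(2,3) F unfolding M.bfs_def by simp
  ultimately show ?thesis using pa[OF bn b'(2)] b'(3) F bn by simp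
  qed
  next
  have kk: "?F k = F k" using s(3) by simp
  show "ck s6 + 20 * potall (Suc k) s6 + 100 * (card H - Suc nq) + (60 + 30 * k) * (n - card (?F k)) +
  30 * (card H - qh) + (c + 6) <= B"
  unfolding kk R6(2) using ck c5 R4(2) s3(4) sz unfolding s6_def s4_def s2_def by simp
  qed
  then have "srch H I s6 qh (Suc qh) (c + 6) B" unfolding srch_def by blast
  then have "label_inv H I qh i c B s s6"
  unfolding label_inv_def using i(1-3) act v5 q6 unfolding same_but_def nq_def q_def
  by (simp add: s6_def)
  then show "wp (Put 16 (Num 0) (Var 21) (Var 26) ;; Put 17 (Num 0) (Var 26) (Var 25) ;; Asg 21 (Plus (Var 21) (Num 1)))
  (label_inv H I qh i c B s) s5"
  proof -
  have "card H <= m" using card_mono[OF _ H] by simp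
  then have "Suc nq < cap" using sz cap_m by simp
  moreover have "vr s5 21 = nq" "vr s5 25 = e0" using v5(1) e0(2) unfolding nq_def by simp_all
  ultimately show ?thesis using \<open>label_inv H I qh i c B s s6\<close> v5(2) unfolding s6_def by simp
  qed
  qed
  then show "wp (Asg 26 (Var 41) ;; Asg 7 (EU (Var 26)) ;; Asg 8 (EV (Var 26)) ;; contract ;;
  Put 16 (Num 0) (Var 21) (Var 26) ;; Put 17 (Num 0) (Var 26) (Var 25) ;; Asg 21 (Plus (Var 21) (Num 1)))
  (label_inv H I qh i c B s) s3"
  using s3(5) a3 ee[OF gm] unfolding s4_def by simp
  qed
  then show ?thesis
  unfolding label_step_def s2_def using e0(2) v1 ee[OF e0m] ne by (simp add: s2_def)
 qed
qed

lemma wp_label_loop: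
 assumes S: "srch H I s qh (Suc qh) (c + 7) B"
  and s: "edges s" "vr s 5 = i" "i < k" "vr s 25 = ar s 16 0 qh" "qh < vr s 21"
  and H: "H \<subseteq> {..<m}" and Ii: "\<And>i. i < k ==> M.ind (I i)" "\<And>i. i < k ==> I i \<subseteq> H"
  and disj: "\<And>i j. i < k ==> j < k ==> i ~= j ==> I i \<inter> I j = {}"
  and e: "ar s 16 0 qh \<in> espan ep (I i)"
  and Q: "\<And>s'. same_but {7, 8, 21, 26, 28} {16, 17} s s' ==> vr s 21 <= vr s' 21 ==>
  \<forall>b<vr s 21. ar s' 16 0 b = ar s 16 0 b ==> srch H I s' qh (Suc qh) c B ==>
  ar s 16 0 qh \<in> espan ep (I i \<inter> ar s' 16 0 ` {..<vr s' 21}) ==> Q s'"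
 shows "wp label_loop Q s"
proof -
 define s1 where "s1 = s\<lparr>vr := (vr s)(28 := 1), ck := Suc (ck s)\<rparr>"
 have ctick: "srch H I s' qh r c' B" if "srch H I s0 qh r (c' + 1) B" "s' = s0\<lparr>vr := (vr s0)(28 := v), ck := Suc (ck s0)\<rparr>" for s0 s' r c' v
  using that reps_cong[of s' s0] unfolding srch_def srch_body_def by simp
 have ctick': "srch H I (tick s0) qh r c' B" if "srch H I s0 qh r (c' + 1) B" for s0 r c'
  using that reps_cong[of "tick s0" s0] unfolding srch_def srch_body_def by simp
 have "wp (Loop (Eq (Var 28) (Num 1)) label_step) Q s1"
 proof (rule wp_Loop[where I = "label_inv H I qh i c B s1" and B = B])
  have "srch H I s qh (Suc qh) (c + 6 + 1) B" using S by (simp only: add.assoc) simp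
  from ctick[OF this s1_def] have "srch H I s1 qh (Suc qh) (c + 6) B" .
  then show "label_inv H I qh i c B s1 s1" unfolding label_inv_def same_but_def by (simp add: s1_def)
 next
  fix s' assume "label_inv H I qh i c B s1 s'"
  then show "ck s' <= B" unfolding label_inv_def srch_def srch_body_def by auto
 next
  fix s' show "okb (Eq (Var 28) (Num 1)) s'" by simp
 next
  fix s' assume L: "label_inv H I qh i c B s1 s'" and b: "bv (Eq (Var 28) (Num 1)) s'"
  show "wp label_step (label_inv H I qh i c B s1) (tick s')"
  by (rule wp_label_step[OF L]) (use b s H Ii disj e in \<open>simp_all add: s1_def edges_def\<close>)
 next
  fix s' assume L: "label_inv H I qh i c B s1 s'" and b: "\<not> bv (Eq (Var 28) (Num 1)) s'"
  have l: "same_but {7, 8, 21, 26, 28} {16, 17} s1 s'" "vr s1 21 <= vr s' 21" "\<forall>b<vr s1 21. ar s' 16 0 b = ar s1 16 0 b"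
  "srch H I s' qh (Suc qh) (c + 1) B" "ar s1 16 0 qh \<in> espan ep (I i \<inter> ar s' 16 0 ` {..<vr s' 21})"
  using L b unfolding label_inv_def by auto
  show "Q (tick s')"
  proof (rule Q)
  show "srch H I (tick s') qh (Suc qh) c B" by (rule ctick'[OF l(4)])
  show "same_but {7, 8, 21, 26, 28} {16, 17} s (tick s')" using l(1) unfolding same_but_def s1_def by simp
  qed (use l in \<open>simp_all add: s1_def\<close>)
 qed
 then show ?thesis unfolding label_loop_def s1_def by simp
qed

section \<open>Executing an augmenting path\<close>

definition assigned :: "nat set => (nat => nat) => nat" where
 "assigned H home = card {x \<in> H. home x ~= 0}"

lemma wp_augment:
 assumes b: "M.bfs H k (M.asg H home) q nq par qh" "qh < nq" and g: "good H home"
  and pa: "\<And>b h. b < nq ==> h < k ==> q b \<in> M.asg H home h ==> ar s 17 0 (q b) = q (par b)"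
  and s: "vr s 25 = q qh" "vr s 24 = i" "i < k" "ar s 15 0 = home"
  and fr: "q qh \<notin> espan ep (M.asg H home i)"
  and Q: "\<And>s'. same_but {26, 27, 29} {15} s s' ==> good H (ar s' 15 0) ==>
  assigned H (ar s' 15 0) = Suc (assigned H home) ==> ck s' <= ck s + 3 + 5 * card H ==> Q s'"
 shows "wp augment Q s"
proof -
 have Hm: "H \<subseteq> {..<m}" "finite H" using g finite_subset[of H "{..<m}"] unfolding good_def by simp_all
 have inj: "inj_on q {..<nq}" and qH: "q ` {..<nq} \<subseteq> H" using b(1) unfolding M.bfs_def by auto
 have nqH: "nq <= card H" by (rule bfs_size[OF b(1) Hm(2)])
 define s1 where "s1 = s\<lparr>vr := (vr s)(26 := q qh, 27 := Suc i), ck := Suc (Suc (ck s))\<rparr>"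
 \<comment> \<open>Variable 27 is the successor of the forest that the current edge enters.
   Positions up to \<open>b\<close> still have their old homes, so the predecessors recorded by the
   search remain valid for them. The walk stops at an edge that had no home, and this one raises the
   number of assigned edges.\<close>
 define J where "J s' \<longleftrightarrow> same_but {26, 27, 29} {15} s s' & good H (ar s' 15 0) &
  (vr s' 27 = 0 & assigned H (ar s' 15 0) = Suc (assigned H home) & ck s' <= ck s + 2 + 5 * card H \<or>
  (\<exists>b i. vr s' 27 = Suc i & i < k & vr s' 26 = q b & b <= qh & assigned H (ar s' 15 0) = assigned H home &
  M.chain (M.asg H (ar s' 15 0)) q par b & M.free_for (M.asg H (ar s' 15 0)) q b i &
  (\<forall>a\<le>b. ar s' 15 0 (q a) = home (q a)) & ck s' + 5 * Suc b <= ck s + 2 + 5 * card H))" for s' :: st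
 have "wp (Loop (Less (Num 0) (Var 27))
  (Asg 29 (Arr 15 (Num 0) (Var 26)) ;; Put 15 (Num 0) (Var 26) (Var 27) ;; Asg 27 (Var 29) ;;
  Asg 26 (Arr 17 (Num 0) (Var 26)))) Q s1"
 proof (rule wp_Loop[where I = J and B = "ck s + 2 + 5 * card H"])
  have ch: "M.chain (M.asg H home) q par qh"
  by (rule M.bfs_chain[OF b]) (use good_empty[OF g] in auto)
  have "M.free_for (M.asg H home) q qh i"
  unfolding M.free_for_def
  proof (intro conjI allI impI fr)
  fix a assume "a < qh"
  then have "q a \<in> espan ep (M.asg H home i \<inter> q ` {..<nq})" using b(1) s(3) unfolding M.bfs_def by blast
  then show "q a \<in> espan ep (M.asg H home i)" by (rule M.sp_mono') blast
  qed
  then have "\<exists>b i. vr s1 27 = Suc i & i < k & vr s1 26 = q b & b <= qh & assigned H (ar s1 15 0) = assigned H home &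
  M.chain (M.asg H (ar s1 15 0)) q par b & M.free_for (M.asg H (ar s1 15 0)) q b i &
  (\<forall>a\<le>b. ar s1 15 0 (q a) = home (q a)) & ck s1 + 5 * Suc b <= ck s + 2 + 5 * card H"
  using ch s nqH b(2) by (intro exI[of _ qh] exI[of _ i]) (simp add: s1_def)
  then show "J s1" unfolding J_def using g s(4) by (simp add: s1_def same_but_def)
 next
  fix s' assume "J s'"
  then show "ck s' <= ck s + 2 + 5 * card H" unfolding J_def by auto
 next
  fix s' show "okb (Less (Num 0) (Var 27)) s'" by simp
 next
  fix s' assume Js: "J s'" and bb: "bv (Less (Num 0) (Var 27)) s'"
  define hm where "hm = ar s' 15 0"
  have sb: "same_but {26, 27, 29} {15} s s'" and gd: "good H hm" using Js unfolding J_def hm_def by auto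
  obtain b' i' where bi: "vr s' 27 = Suc i'" "i' < k" "vr s' 26 = q b'" "b' <= qh" "assigned H hm = assigned H home"
  "M.chain (M.asg H hm) q par b'" "M.free_for (M.asg H hm) q b' i'"
  "\<And>a. a <= b' ==> hm (q a) = home (q a)" "ck s' + 5 * Suc b' <= ck s + 2 + 5 * card H"
  using Js bb unfolding J_def hm_def by auto
  have bn: "b' < nq" using bi(4) b(2) by simp
  have qb: "q b' \<in> H" using qH bn by auto
  let ?hm = "hm(q b' := Suc i')"
  define s2 where "s2 = s'\<lparr>ar := put 15 0 (q b') (Suc i') (ar s'), vr := (vr s')(29 := hm (q b'), 27 := hm (q b'), 26 := ar s' 17 0 (q b')),
  ck := Suc (Suc (Suc (Suc (Suc (ck s')))))\<rparr>"
  have h2: "ar s2 15 0 = ?hm" unfolding s2_def hm_def by simp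
  have sb2: "same_but {26, 27, 29} {15} s s2" using sb unfolding same_but_def s2_def by simp
  have indb: "M.ind (insert (q b') (M.asg H hm i'))"
  using bi(7) gd unfolding M.free_for_def good_def by (intro M.ind_insert) auto
  have "J s2"
  proof (cases "hm (q b')")
  case 0
  have asg': "M.asg H ?hm j = (if j = i' then insert (q b') (M.asg H hm j) else M.asg H hm j)" for j
  using 0 qb unfolding M.asg_def by auto
  have g2: "good H ?hm" using gd indb bi(2) unfolding good_def asg' by auto
  have "{x \<in> H. ?hm x ~= 0} = insert (q b') {x \<in> H. hm x ~= 0}" "q b' \<notin> {x \<in> H. hm x ~= 0}" using 0 qb by auto
  then have "assigned H ?hm = Suc (assigned H hm)" unfolding assigned_def using Hm(2) by simp
  then show ?thesis unfolding J_def h2 using g2 sb2 0 bi(5,9) by (simp add: s2_def)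
  next
  case (Suc h)
  have asgh: "q b' \<in> M.asg H hm h" using Suc qb unfolding M.asg_def by simp
  have "q b' \<notin> espan ep (M.asg H hm i')" using bi(7) unfolding M.free_for_def by (rule conjunct1)
  then have hi: "h ~= i'" using M.sp_base[OF asgh] by auto
  have asg': "M.asg H ?hm = (M.asg H hm)(i' := insert (q b') (M.asg H hm i'), h := M.asg H hm h - {q b'})"
  proof
  fix j
  show "M.asg H ?hm j = ((M.asg H hm)(i' := insert (q b') (M.asg H hm i'), h := M.asg H hm h - {q b'})) j"
  using Suc qb hi unfolding M.asg_def by (cases "j = h"; cases "j = i'") auto
  qed
  have injb: "a = a'" if "a <= b'" "a' <= b'" "q a = q a'" for a a'
  using inj_onD[OF inj that(3)] that(1,2) bn by simp
  have ii: "M.ind (M.asg H hm j)" for j using gd unfolding good_def by simp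
  note mv = M.move_chain[OF bi(6,7) asgh ii good_disjoint[of _ _ H hm] injb asg']
  have pb: "par b' < b'" by (rule mv(1))
  have mv2: "M.chain (M.asg H ?hm) q par (par b')" by (rule mv(2))
  have "M.free_for (M.asg H ?hm) q (par b') h" by (rule mv(3))
  note mv2 = mv2 this
  have gk: "\<forall>x\<in>H. hm x <= k" using gd unfolding good_def by simp
  have hk: "h < k" using bspec[OF gk qb] Suc by simp
  have gk': "?hm x <= k" if "x \<in> H" for x using bspec[OF gk that] bi(2) by (cases "x = q b'") simp_all
  have "good H ?hm" unfolding good_def by (intro conjI ballI allI Hm(1) gk' mv(4))
  moreover have "{x \<in> H. ?hm x ~= 0} = {x \<in> H. hm x ~= 0}" using Suc by auto
  then have "assigned H ?hm = assigned H home" using bi(5) unfolding assigned_def by simp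
  moreover have "q b' \<in> M.asg H home h" using asgh bi(8)[of b'] unfolding M.asg_def by simp
  then have "ar s' 17 0 (q b') = q (par b')" using pa[OF bn hk] sb unfolding same_but_def by simp
  moreover have "\<forall>a\<le>par b'. ?hm (q a) = home (q a)"
  proof (intro allI impI)
  fix a assume that: "a <= par b'"
  have "q a ~= q b'" using injb[of a b'] that pb by auto
  then show "?hm (q a) = home (q a)" using bi(8)[of a] that pb by simp
  qed
  moreover have "ck s2 + 5 * Suc (par b') <= ck s + 2 + 5 * card H" using bi(9) pb unfolding s2_def by simp
  moreover have "vr s2 27 = Suc h" "vr s2 26 = ar s' 17 0 (q b')" using Suc unfolding s2_def by simp_all
  moreover have "par b' <= qh" using pb bi(4) by simp
  ultimately have "vr s2 27 = Suc h & h < k & vr s2 26 = q (par b') & par b' <= qh & assigned H (ar s2 15 0) = assigned H home &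
  M.chain (M.asg H (ar s2 15 0)) q par (par b') & M.free_for (M.asg H (ar s2 15 0)) q (par b') h &
  (\<forall>a\<le>par b'. ar s2 15 0 (q a) = home (q a)) & ck s2 + 5 * Suc (par b') <= ck s + 2 + 5 * card H"
  and "good H (ar s2 15 0)"
  unfolding h2 using mv2 hk by (simp_all only: simp_thms)
  then show ?thesis unfolding J_def using sb2 by blast
  qed
  then show "wp (Asg 29 (Arr 15 (Num 0) (Var 26)) ;; Put 15 (Num 0) (Var 26) (Var 27) ;; Asg 27 (Var 29) ;;
  Asg 26 (Arr 17 (Num 0) (Var 26))) J (tick s')"
  unfolding s2_def hm_def using bi(1,3) by simp
 next
  fix s' assume Js: "J s'" and bb: "\<not> bv (Less (Num 0) (Var 27)) s'"
  have z: "vr s' 27 = 0" using bb by simp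
  have "same_but {26, 27, 29} {15} s s'" "good H (ar s' 15 0)"
  "assigned H (ar s' 15 0) = Suc (assigned H home)" "ck s' <= ck s + 2 + 5 * card H"
  using Js z unfolding J_def by auto
  then show "Q (tick s')" by (intro Q) (simp_all add: same_but_def)
 qed
 then show ?thesis unfolding augment_def s1_def using s capk n2 k1 k_cap by simp
qed

end

section \<open>One round of search and augmentation\<close>

definition forests_step :: com where
 "forests_step = Asg 5 (Var 24) ;; Asg 7 (EU (Var 25)) ;; Asg 8 (EV (Var 25)) ;;
  Cond (Eq (F5 0 (Var 7)) (F5 0 (Var 8)))
  (label_loop ;; Asg 24 (Plus (Var 24) (Num 1)))
  (augment ;; Asg 23 (Num 0) ;; Asg 24 (Var 4))"

definition forests :: com where
 "forests = Asg 24 (Num 0) ;; Loop (Less (Var 24) (Var 4)) forests_step"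

text \<open>Only an edge that enlarges the forest of structure \<open>k\<close> is tested against
  all \<open>k\<close> forests. This happens at most \<open>n - 1\<close> times in a round; without
  this filter a round would cost \<open>k\<close> times the number of all edges.\<close>

definition process :: com where
 "process = Asg 25 (Arr 16 (Num 0) (Var 22)) ;; Asg 5 (Var 4) ;; Asg 7 (EU (Var 25)) ;; Asg 8 (EV (Var 25)) ;;
  Cond (Eq (F5 0 (Var 7)) (F5 0 (Var 8))) (Asg 28 (Num 0)) (Asg 6 (Var 25) ;; link ;; forests) ;;
  Asg 22 (Plus (Var 22) (Num 1))"

definition search_round :: com where
 "search_round = Asg 22 (Num 0) ;; Asg 23 (Num 1) ;;
  Loop (Eq (Var 23) (Num 1))
  (Cond (Eq (Var 22) (Var 21)) (Asg 23 (Num 0) ;; Asg 19 (Num 0) ;; Asg 0 (Num 0)) process)"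

definition setup_step :: com where
 "setup_step = Asg 6 (Arr 13 (Num 0) (Var 16)) ;;
  Cond (Eq (Arr 15 (Num 0) (Var 6)) (Num 0))
  (Put 16 (Num 0) (Var 21) (Var 6) ;; Asg 21 (Plus (Var 21) (Num 1)))
  (Asg 5 (Minus (Arr 15 (Num 0) (Var 6)) (Num 1)) ;; link ;; Asg 20 (Plus (Var 20) (Num 1))) ;;
  Asg 16 (Plus (Var 16) (Num 1))"

definition setup_round :: com where
 "setup_round = Asg 9 (Plus (Var 4) (Num 1)) ;; init_all ;; Asg 20 (Num 0) ;; Asg 21 (Num 0) ;; Asg 16 (Num 0) ;;
  Loop (Less (Var 16) (Var 12)) setup_step"

definition augmentation_round :: com where
 "augmentation_round = setup_round ;;
  Cond (Eq (Var 20) (Times (Var 4) (Minus (Var 2) (Num 1)))) (Asg 0 (Num 1) ;; Asg 19 (Num 0)) search_round"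

definition augmentation :: com where
 "augmentation = Asg 19 (Num 1) ;; Loop (Eq (Var 19) (Num 1)) augmentation_round"

context task
begin

lemma srch_cong:
 assumes "srch H I s qh r c B" "\<And>t p. t <= 10 ==> ar s' t p = ar s t p" "ar s' 16 0 = ar s 16 0"
  "ar s' 17 0 = ar s 17 0" "vr s' 21 = vr s 21" "ck s' + c' <= ck s + c"
 shows "srch H I s' qh r c' B"
proof -
 obtain par K F where b: "srch_body H I s qh r c B par K F" using assms(1) unfolding srch_def by blast
 have "srch_body H I s' qh r c' B par K F"
  using b assms(6) reps_cong[of s' s "Suc k", OF assms(2)] unfolding srch_body_def assms(3,4,5)
  by simp
 then show ?thesis unfolding srch_def by blast
qed

lemma srch_bound: "srch H I s qh r c B ==> ck s + c <= B"
 unfolding srch_def srch_body_def by auto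

lemma srch_bfs: "srch H I s qh r c B ==> qh <= vr s 21 & ar s 16 0 ` {..<vr s 21} \<subseteq> H & H - (\<Union>i<k. I i) \<subseteq> ar s 16 0 ` {..<vr s 21} &
  (\<forall>a i. a < qh --> i < k --> ar s 16 0 a \<in> espan ep (I i \<inter> ar s 16 0 ` {..<vr s 21}))"
 unfolding srch_def srch_body_def M.bfs_def by (elim exE conjE) (intro conjI; assumption)

lemma srch_coarse:
 assumes S: "srch H I s qh r c B" and i: "i < k" and e: "e < m"
 shows "ar s 0 i (fst (ep e)) = ar s 0 i (snd (ep e)) \<longleftrightarrow> e \<in> espan ep (I i)"
proof -
 obtain par K F where b: "srch_body H I s qh r c B par K F" using S unfolding srch_def by blast
 have "reps (Suc k) s K F" using b unfolding srch_body_def by simp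
 then have r: "rep (view s i) (K i) (F i)" using i unfolding reps_def by simp
 have "K i \<union> F i = I i" using b i unfolding srch_body_def by auto
 with coarse_iff[OF r e] show ?thesis by simp
qed

lemma srch_advance:
 assumes S: "srch H I s qh r c B" and r: "r <= Suc qh" and q: "qh < vr s 21" and H: "finite H"
  and e: "\<And>i. i < k ==> ar s 16 0 qh \<in> espan ep (I i \<inter> ar s 16 0 ` {..<vr s 21})"
 shows "srch H I s (Suc qh) (Suc qh) (c + 30) B"
proof -
 obtain par K F where "srch_body H I s qh r c B par K F" using S unfolding srch_def by blast
 note b = this[unfolded srch_body_def]
 have b1: "M.bfs H k I (ar s 16 0) (vr s 21) par qh" using b by simp
 have b2: "M.bfs H k I (ar s 16 0) (vr s 21) par (Suc qh)" by (rule M.bfs_advance[OF b1 q e])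
 have "qh < card H" using bfs_size[OF b1 H] q by simp
 moreover have "F k \<subseteq> ar s 16 0 ` {..<Suc qh}"
 proof -
  have "F k \<subseteq> ar s 16 0 ` {..<r}" using b by simp
  also have "\<dots> \<subseteq> ar s 16 0 ` {..<Suc qh}" using r by (intro image_mono) simp
  finally show ?thesis .
 qed
 moreover define X where "X = (60 + 30 * k) * (n - card (F k))"
 moreover have "ck s + 20 * potall (Suc k) s + 100 * (card H - vr s 21) + X + 30 * (card H - qh) + c <= B"
  using b unfolding X_def by simp
 ultimately have "srch_body H I s (Suc qh) (Suc qh) (c + 30) B par K F"
  unfolding srch_body_def using b b2 by (simp add: X_def[symmetric])
 then show ?thesis unfolding srch_def by blast
qed

definition advanced :: "nat set => (nat => nat) => st => nat => bool" where
 "advanced H home s B \<longleftrightarrow> vr s 23 = 0 & good H (ar s 15 0) & assigned H (ar s 15 0) = Suc (assigned H home) &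
  ck s <= B + 5 * card H + 10"

definition forests_inv :: "nat set => (nat => nat) => nat => nat => nat => st => st => bool" where
 "forests_inv H home qh c B s s' \<longleftrightarrow> same_but {5, 7, 8, 21, 23, 24, 26, 27, 28, 29} {15, 16, 17} s s' & vr s' 24 <= k &
  (vr s' 23 = 1 & ar s' 15 0 = home & srch H (M.asg H home) s' qh (Suc qh) (13 * (k - vr s' 24) + c) B &
  vr s 21 <= vr s' 21 & (\<forall>b<vr s 21. ar s' 16 0 b = ar s 16 0 b) &
  (\<forall>i<vr s' 24. ar s 16 0 qh \<in> espan ep (M.asg H home i \<inter> ar s' 16 0 ` {..<vr s' 21})) \<or>
  vr s' 24 = k & advanced H home s' B)"

lemma wp_forests_step:
 assumes J: "forests_inv H home qh c B s s1" and lt: "vr s1 24 < k" and c: "c \<ge> 1"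
  and s: "edges s" "vr s 4 = k" "vr s 25 = ar s 16 0 qh" "qh < vr s 21" and g: "good H home"
 shows "wp forests_step (forests_inv H home qh c B s) (tick s1)"
proof -
 let ?I = "M.asg H home"
 define i where "i = vr s1 24"
 have ik: "i < k" using lt unfolding i_def .
 have j: "same_but {5, 7, 8, 21, 23, 24, 26, 27, 28, 29} {15, 16, 17} s s1" "vr s1 23 = 1" "ar s1 15 0 = home"
  "srch H ?I s1 qh (Suc qh) (13 * (k - i) + c) B" "vr s 21 <= vr s1 21" "\<forall>b<vr s 21. ar s1 16 0 b = ar s 16 0 b"
  "\<forall>j<i. ar s 16 0 qh \<in> espan ep (?I j \<inter> ar s1 16 0 ` {..<vr s1 21})"
  using J lt unfolding forests_inv_def i_def by auto
 define e0 where "e0 = ar s 16 0 qh"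
 have v1: "vr s1 25 = e0" "vr s1 4 = k" "ar s1 16 0 qh = e0" using j(1,6) s unfolding same_but_def e0_def by simp_all
 have ed: "edges s1" using s(1) j(1) unfolding same_but_def edges_def by simp
 have qn: "qh < vr s1 21" using s(4) j(5) by simp
 have Hm: "H \<subseteq> {..<m}" using g unfolding good_def by simp
 have "e0 \<in> H" using srch_bfs[OF j(4)] qn v1(3) by auto
 then have e0m: "e0 < m" using Hm by auto
 have ee: "ar s1 11 0 e0 = fst (ep e0)" "ar s1 12 0 e0 = snd (ep e0)" using ed e0m unfolding edges_def by auto
 define s2 where "s2 = s1\<lparr>vr := (vr s1)(5 := i, 7 := fst (ep e0), 8 := snd (ep e0)), ck := Suc (Suc (Suc (Suc (Suc (ck s1)))))\<rparr>"
 have v2: "vr s2 25 = ar s2 16 0 qh" "qh < vr s2 21" "edges s2" "vr s2 5 = i" "vr s2 24 = i" "ar s2 15 0 = home"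
  using v1 qn ed j(3) unfolding s2_def edges_def i_def by simp_all
 have c': "13 * (k - i) + c = 13 * (k - Suc i) + c + 8 + 5" using ik by simp
 have S2: "srch H ?I s2 qh (Suc qh) (13 * (k - Suc i) + c + 1 + 7) B"
  by (rule srch_cong[OF j(4)]) (use c' in \<open>simp_all add: s2_def\<close>)
 have gI: "M.ind (?I i)" "?I i \<subseteq> H" for i using g unfolding good_def M.asg_def by auto
 show ?thesis
 proof (cases "e0 \<in> espan ep (?I i)")
  case True
  have t: "ar s1 0 i (fst (ep e0)) = ar s1 0 i (snd (ep e0))" using srch_coarse[OF j(4) ik e0m] True by simp
  have "wp label_loop (wp (Asg 24 (Plus (Var 24) (Num 1))) (forests_inv H home qh c B s)) s2"
  proof (rule wp_label_loop[OF S2 v2(3,4) ik v2(1,2) Hm gI good_disjoint])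
  show "ar s2 16 0 qh \<in> espan ep (?I i)" using True v1(3) unfolding s2_def by simp
  fix s3 :: st
  assume s3: "same_but {7, 8, 21, 26, 28} {16, 17} s2 s3" "vr s2 21 <= vr s3 21" "\<forall>b<vr s2 21. ar s3 16 0 b = ar s2 16 0 b"
  "srch H ?I s3 qh (Suc qh) (13 * (k - Suc i) + c + 1) B"
  "ar s2 16 0 qh \<in> espan ep (?I i \<inter> ar s3 16 0 ` {..<vr s3 21})"
  define s4 where "s4 = s3\<lparr>vr := (vr s3)(24 := Suc i), ck := Suc (ck s3)\<rparr>"
  have S4: "srch H ?I s4 qh (Suc qh) (13 * (k - Suc i) + c) B"
  by (rule srch_cong[OF s3(4)]) (simp_all add: s4_def)
  have a: "\<forall>b<vr s 21. ar s4 16 0 b = ar s 16 0 b" "vr s 21 <= vr s4 21" "vr s4 23 = 1" "vr s4 24 = Suc i"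
  "ar s4 15 0 = home" "vr s3 24 = i"
  using s3(1-3) j(2,3,5,6) v2(5) unfolding same_but_def s4_def s2_def by simp_all
  have sb: "same_but {5, 7, 8, 21, 23, 24, 26, 27, 28, 29} {15, 16, 17} s s4"
  using j(1) s3(1) unfolding same_but_def s4_def s2_def by simp
  \<comment> \<open>The queue only grows, so what the earlier forests span by their reached edges
    stays spanned.\<close>
  have im: "ar s1 16 0 ` {..<vr s1 21} \<subseteq> ar s4 16 0 ` {..<vr s4 21}"
  proof
  fix x assume "x \<in> ar s1 16 0 ` {..<vr s1 21}"
  then obtain b where "x = ar s1 16 0 b" "b < vr s1 21" by blast
  then have "x = ar s4 16 0 b" "b < vr s4 21" using s3(2,3) unfolding s4_def s2_def by simp_all
  then show "x \<in> ar s4 16 0 ` {..<vr s4 21}" by blast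
  qed
  have sp: "\<forall>j<Suc i. ar s 16 0 qh \<in> espan ep (?I j \<inter> ar s4 16 0 ` {..<vr s4 21})"
  proof (intro allI impI)
  fix j' assume "j' < Suc i"
  show "ar s 16 0 qh \<in> espan ep (?I j' \<inter> ar s4 16 0 ` {..<vr s4 21})"
  proof (cases "j' = i")
  case True
  then show ?thesis using s3(5) v1(3) unfolding s4_def s2_def e0_def by simp
  next
  case False
  then have "ar s 16 0 qh \<in> espan ep (?I j' \<inter> ar s1 16 0 ` {..<vr s1 21})" using j(7) \<open>j' < Suc i\<close> by simp
  then show ?thesis by (rule M.sp_mono') (use im in blast)
  qed
  qed
  have "forests_inv H home qh c B s s4"
  unfolding forests_inv_def a(4) using sb S4 a sp ik by (intro conjI disjI1) simp_all
  moreover have "Suc i < cap" using ik k_cap by simp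
  ultimately show "wp (Asg 24 (Plus (Var 24) (Num 1))) (forests_inv H home qh c B s) s3"
  unfolding s4_def using a(6) by simp
  qed auto
  then show ?thesis unfolding forests_step_def s2_def i_def using v1 ee t by (simp add: i_def)
 next
  case False
  have t: "ar s1 0 i (fst (ep e0)) ~= ar s1 0 i (snd (ep e0))" using srch_coarse[OF j(4) ik e0m] False by simp
  obtain par K F where "srch_body H ?I s2 qh (Suc qh) (13 * (k - Suc i) + c + 1 + 7) B par K F" using S2 unfolding srch_def by blast
  note b = this[unfolded srch_body_def]
  have b1: "M.bfs H k ?I (ar s2 16 0) (vr s2 21) par qh" using b by simp
  have pa: "\<forall>b h. b < vr s2 21 --> h < k --> ar s2 16 0 b \<in> ?I h --> ar s2 17 0 (ar s2 16 0 b) = ar s2 16 0 (par b)"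
  using b by simp
  have cB: "ck s2 + 8 <= B" using srch_bound[OF S2] by simp
  have "wp augment (wp (Asg 23 (Num 0) ;; Asg 24 (Var 4)) (forests_inv H home qh c B s)) s2"
  proof (rule wp_augment[OF b1 v2(2) g pa[rule_format] v2(1,5) ik v2(6)])
  show "ar s2 16 0 qh \<notin> espan ep (?I i)" using False v1(3) unfolding s2_def by simp
  fix s3 :: st
  assume s3: "same_but {26, 27, 29} {15} s2 s3" "good H (ar s3 15 0)" "assigned H (ar s3 15 0) = Suc (assigned H home)"
  "ck s3 <= ck s2 + 3 + 5 * card H"
  have v3: "vr s3 4 = k" using s3(1) v1 unfolding same_but_def s2_def by simp
  have "same_but {5, 7, 8, 21, 23, 24, 26, 27, 28, 29} {15, 16, 17} s (s3\<lparr>vr := (vr s3)(23 := 0, 24 := k), ck := Suc (Suc (ck s3))\<rparr>)"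
  using j(1) s3(1) unfolding same_but_def s2_def by simp
  then show "wp (Asg 23 (Num 0) ;; Asg 24 (Var 4)) (forests_inv H home qh c B s) s3"
  using s3 v3 cB unfolding forests_inv_def advanced_def by simp
  qed auto
  then show ?thesis unfolding forests_step_def s2_def i_def using v1 ee t by (simp add: i_def)
 qed
qed

lemma wp_forests:
 assumes S: "srch H (M.asg H home) s qh (Suc qh) (13 * k + c + 2) B"
  and s: "edges s" "vr s 4 = k" "vr s 25 = ar s 16 0 qh" "qh < vr s 21" "ar s 15 0 = home" "vr s 23 = 1" and g: "good H home"
  and Q: "\<And>s'. same_but {5, 7, 8, 21, 23, 24, 26, 27, 28, 29} {15, 16, 17} s s' ==>
  (vr s' 23 = 1 & ar s' 15 0 = home & srch H (M.asg H home) s' (Suc qh) (Suc qh) (c + 30) B) \<or>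
  (vr s' 23 = 0 & good H (ar s' 15 0) & assigned H (ar s' 15 0) = Suc (assigned H home) &
  ck s' <= B + 5 * card H + 11) ==> Q s'"
 shows "wp forests Q s"
proof -
 have Hm: "finite H" using g finite_subset[of H "{..<m}"] unfolding good_def by simp
 define s1 where "s1 = s\<lparr>vr := (vr s)(24 := 0), ck := Suc (ck s)\<rparr>"
 have s1: "edges s1" "vr s1 4 = k" "vr s1 25 = ar s1 16 0 qh" "qh < vr s1 21"
  using s unfolding s1_def edges_def by simp_all
 have "wp (Loop (Less (Var 24) (Var 4)) forests_step) Q s1"
 proof (rule wp_Loop[where I = "forests_inv H home qh (c + 1) B s1" and B = "B + 5 * card H + 10"])
  have "srch H (M.asg H home) s1 qh (Suc qh) (13 * k + (c + 1)) B"
  by (rule srch_cong[OF S]) (simp_all add: s1_def)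
  then show "forests_inv H home qh (c + 1) B s1 s1" using s unfolding forests_inv_def same_but_def s1_def by simp
 next
  fix s' assume "forests_inv H home qh (c + 1) B s1 s'"
  then show "ck s' <= B + 5 * card H + 10" unfolding forests_inv_def advanced_def using srch_bound by fastforce
 next
  fix s' show "okb (Less (Var 24) (Var 4)) s'" by simp
 next
  fix s' assume J: "forests_inv H home qh (c + 1) B s1 s'" and b: "bv (Less (Var 24) (Var 4)) s'"
  have "vr s' 4 = k" using J s1(2) unfolding forests_inv_def same_but_def by simp
  then show "wp forests_step (forests_inv H home qh (c + 1) B s1) (tick s')"
  using b by (intro wp_forests_step[OF J _ _ s1 g]) simp_all
 next
  fix s' assume J: "forests_inv H home qh (c + 1) B s1 s'" and b: "\<not> bv (Less (Var 24) (Var 4)) s'"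
  have v4: "vr s' 4 = k" and sb: "same_but {5, 7, 8, 21, 23, 24, 26, 27, 28, 29} {15, 16, 17} s1 s'" and le: "vr s' 24 <= k"
  using J s1(2) unfolding forests_inv_def same_but_def by simp_all
  have k': "vr s' 24 = k" using b v4 le by simp
  show "Q (tick s')"
  proof (rule Q)
  show "same_but {5, 7, 8, 21, 23, 24, 26, 27, 28, 29} {15, 16, 17} s (tick s')"
  using sb unfolding same_but_def s1_def by simp
  consider (a) "vr s' 23 = 1" "ar s' 15 0 = home" "srch H (M.asg H home) s' qh (Suc qh) (13 * (k - vr s' 24) + (c + 1)) B"
  "vr s1 21 <= vr s' 21" "\<forall>b<vr s1 21. ar s' 16 0 b = ar s1 16 0 b"
  "\<forall>i<vr s' 24. ar s1 16 0 qh \<in> espan ep (M.asg H home i \<inter> ar s' 16 0 ` {..<vr s' 21})"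
  | (b) "advanced H home s' B" using J unfolding forests_inv_def by blast
  then show "(vr (tick s') 23 = 1 & ar (tick s') 15 0 = home & srch H (M.asg H home) (tick s') (Suc qh) (Suc qh) (c + 30) B) \<or>
  (vr (tick s') 23 = 0 & good H (ar (tick s') 15 0) & assigned H (ar (tick s') 15 0) = Suc (assigned H home) &
  ck (tick s') <= B + 5 * card H + 11)"
  proof cases
  case a
  have "srch H (M.asg H home) s' (Suc qh) (Suc qh) (13 * (k - vr s' 24) + (c + 1) + 30) B"
  by (rule srch_advance[OF a(3)]) (use Hm a(4,5,6) s1(4) k' in simp_all)
  then have "srch H (M.asg H home) (tick s') (Suc qh) (Suc qh) (c + 30) B"
  by (rule srch_cong) (use k' in simp_all)
  then show ?thesis using a by simp
  next
  case b
  then show ?thesis unfolding advanced_def by simp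
  qed
  qed
 qed
 then show ?thesis unfolding forests_def s1_def by simp
qed

text \<open>The certificate left by a failed search: a tight set that contains all unassigned edges,
  in the form required by \<open>sparsifier_span\<close> and \<open>packing_optimal\<close>.\<close>

definition stuck :: "nat set => (nat => nat) => bool" where
 "stuck H home \<longleftrightarrow> (\<exists>X\<subseteq>H. (\<forall>i<k. X \<subseteq> espan ep (M.asg H home i \<inter> X)) & H - X \<subseteq> (\<Union>i<k. M.asg H home i))"

definition search_inv :: "nat set => (nat => nat) => nat => st => st => bool" where
 "search_inv H home B s s' \<longleftrightarrow> same_but {0, 5, 6, 7, 8, 19, 21, 22, 23, 24, 25, 26, 27, 28, 29} {15, 16, 17} s s' &
  (vr s' 23 = 1 & vr s' 19 = 1 & ar s' 15 0 = home & srch H (M.asg H home) s' (vr s' 22) (vr s' 22) 10 B \<or>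
  vr s' 23 = 0 & ck s' <= B + 5 * card H + 20 &
  (vr s' 19 = 1 & good H (ar s' 15 0) & assigned H (ar s' 15 0) = Suc (assigned H home) \<or>
  vr s' 19 = 0 & vr s' 0 = 0 & ar s' 15 0 = home & stuck H home))"

lemma wp_search_step:
 assumes J: "search_inv H home B s s1" and run: "vr s1 23 = 1"
  and s: "edges s" "vr s 4 = k" and g: "good H home"
 shows "wp (Cond (Eq (Var 22) (Var 21)) (Asg 23 (Num 0) ;; Asg 19 (Num 0) ;; Asg 0 (Num 0)) process) (search_inv H home B s) (tick s1)"
proof -
 let ?I = "M.asg H home"
 define qh q where "qh = vr s1 22" and "q = ar s1 16 0"
 have Hm: "H \<subseteq> {..<m}" using g unfolding good_def by simp
 then have fin: "finite H" by (rule finite_subset) simp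
 have j: "same_but {0, 5, 6, 7, 8, 19, 21, 22, 23, 24, 25, 26, 27, 28, 29} {15, 16, 17} s s1" "vr s1 19 = 1" "ar s1 15 0 = home"
  "srch H ?I s1 qh qh 10 B" using J run unfolding search_inv_def qh_def by auto
 have cB: "ck s1 + 10 <= B" by (rule srch_bound[OF j(4)])
 note bf = srch_bfs[OF j(4), folded q_def]
 show ?thesis
 proof (cases "qh = vr s1 21")
  case True
  \<comment> \<open>The queue is exhausted: every reached edge has been processed, so the set of all
    reached edges is tight.\<close>
  have "stuck H home"
  unfolding stuck_def
  proof (intro exI[of _ "q ` {..<qh}"] conjI allI impI)
  show "q ` {..<qh} \<subseteq> H" "H - q ` {..<qh} \<subseteq> (\<Union>i<k. ?I i)" using bf unfolding True by auto
  fix i assume "i < k"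
  then show "q ` {..<qh} \<subseteq> espan ep (?I i \<inter> q ` {..<qh})" using bf unfolding True[symmetric] by auto
  qed
  moreover have "same_but {0, 5, 6, 7, 8, 19, 21, 22, 23, 24, 25, 26, 27, 28, 29} {15, 16, 17} s
  (s1\<lparr>vr := (vr s1)(23 := 0, 19 := 0, 0 := 0), ck := Suc (Suc (Suc (Suc (Suc (ck s1)))))\<rparr>)"
  using j(1) unfolding same_but_def by simp
  ultimately show ?thesis using True j(3) cB unfolding search_inv_def qh_def by simp
 next
  case False
  then have qn: "qh < vr s1 21" using bf by simp
  define e0 where "e0 = q qh"
  have eH: "e0 \<in> H" using bf qn unfolding e0_def by auto
  then have e0m: "e0 < m" using Hm by auto
  have ed: "edges s1" and v4: "vr s1 4 = k" using s j(1) unfolding same_but_def edges_def by simp_all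
  have ee: "ar s1 11 0 e0 = fst (ep e0)" "ar s1 12 0 e0 = snd (ep e0)" using ed e0m unfolding edges_def by auto
  obtain par K F where "srch_body H ?I s1 qh qh 10 B par K F" using j(4) unfolding srch_def by blast
  note b = this[unfolded srch_body_def, folded q_def]
  have R: "reps (Suc k) s1 K F" and Fk: "K k = {}" "F k \<subseteq> q ` {..<qh}" "M.ind (F k)" "F k \<subseteq> H" using b by simp_all
  have r: "rep (view s1 k) (K k) (F k)" using R unfolding reps_def by simp
  have co: "ar s1 0 k (fst (ep e0)) = ar s1 0 k (snd (ep e0)) \<longleftrightarrow> e0 \<in> espan ep (F k)"
  using coarse_iff[OF r e0m] Fk(1) by simp
  have lt22: "Suc qh < cap"
  proof -
  have "M.bfs H k ?I q (vr s1 21) par qh" using b by simp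
  then have "vr s1 21 <= card H" by (rule bfs_size[OF _ fin])
  also have "\<dots> <= m" using card_mono[OF _ Hm] by simp
  finally show ?thesis using qn cap_m by simp
  qed
  define s2 where "s2 = s1\<lparr>vr := (vr s1)(25 := e0, 5 := k, 7 := fst (ep e0), 8 := snd (ep e0)), ck := ck s1 + 7\<rparr>"
  have fin_step: "wp (Asg 22 (Plus (Var 22) (Num 1))) (search_inv H home B s) s3"
  if s3: "same_but {5, 6, 7, 8, 21, 23, 24, 25, 26, 27, 28, 29} {15, 16, 17} s1 s3"
  "(vr s3 23 = 1 & ar s3 15 0 = home & srch H ?I s3 (Suc qh) (Suc qh) 11 B) \<or>
  (vr s3 23 = 0 & good H (ar s3 15 0) & assigned H (ar s3 15 0) = Suc (assigned H home) & ck s3 <= B + 5 * card H + 11)" for s3 :: st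
  proof -
  define s4 where "s4 = s3\<lparr>vr := (vr s3)(22 := Suc qh), ck := Suc (ck s3)\<rparr>"
  have v: "vr s3 22 = qh" "vr s3 19 = 1" using s3(1) j(2) unfolding same_but_def qh_def by simp_all
  have sb: "same_but {0, 5, 6, 7, 8, 19, 21, 22, 23, 24, 25, 26, 27, 28, 29} {15, 16, 17} s s4"
  using j(1) s3(1) unfolding same_but_def s4_def by simp
  have "search_inv H home B s s4"
  using s3(2)
  proof (elim disjE)
  assume a: "vr s3 23 = 1 & ar s3 15 0 = home & srch H ?I s3 (Suc qh) (Suc qh) 11 B"
  have "srch H ?I s4 (Suc qh) (Suc qh) 10 B"
  by (rule srch_cong[of H ?I s3 "Suc qh" "Suc qh" 11 B]) (use a in \<open>simp_all add: s4_def\<close>)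
  then show ?thesis using a sb v unfolding search_inv_def by (simp add: s4_def)
  next
  assume a: "vr s3 23 = 0 & good H (ar s3 15 0) & assigned H (ar s3 15 0) = Suc (assigned H home) & ck s3 <= B + 5 * card H + 11"
  then show ?thesis using sb v unfolding search_inv_def by (simp add: s4_def)
  qed
  then show ?thesis unfolding s4_def using v lt22 by simp
  qed
  show ?thesis
  proof (cases "e0 \<in> espan ep (F k)")
  case True
  \<comment> \<open>The forest \<open>F k\<close> consists of processed edges, which the reached
    part of each \<open>I i\<close> spans; so an edge spanned by \<open>F k\<close> is spanned there
    as well and counts as processed.\<close>
  have sp: "ar s1 16 0 qh \<in> espan ep (?I i \<inter> ar s1 16 0 ` {..<vr s1 21})" if "i < k" for i
  proof -
  have "F k \<subseteq> espan ep (?I i \<inter> q ` {..<vr s1 21})" using bf that Fk(2) by auto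
  then have "espan ep (F k) \<subseteq> espan ep (?I i \<inter> q ` {..<vr s1 21})" by (rule M.sp_least)
  then show ?thesis using True unfolding e0_def q_def by blast
  qed
  define s3 where "s3 = s2\<lparr>vr := (vr s2)(28 := 0), ck := Suc (ck s2)\<rparr>"
  have "srch H ?I s1 (Suc qh) (Suc qh) (10 + 30) B"
  by (rule srch_advance[OF j(4) _ qn fin sp]) simp_all
  then have "srch H ?I s3 (Suc qh) (Suc qh) 11 B"
  by (rule srch_cong) (simp_all add: s3_def s2_def)
  moreover have "same_but {5, 6, 7, 8, 21, 23, 24, 25, 26, 27, 28, 29} {15, 16, 17} s1 s3"
  unfolding same_but_def s3_def s2_def by simp
  ultimately have "wp (Asg 22 (Plus (Var 22) (Num 1))) (search_inv H home B s) s3"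
  using run j(3) by (intro fin_step) (simp_all add: s3_def s2_def)
  then show ?thesis unfolding process_def s3_def s2_def using False ee v4 co True
  by (simp add: qh_def q_def e0_def numeral_eq_Suc)
  next
  case nsp: False
  have nt: "ar s1 0 k (fst (ep e0)) ~= ar s1 0 k (snd (ep e0))" using co nsp by simp
  define s3 where "s3 = s2\<lparr>vr := (vr s2)(6 := e0), ck := Suc (ck s2)\<rparr>"
  have R3: "reps (Suc k) s3 K F" "potall (Suc k) s3 = potall (Suc k) s1"
  using R reps_cong[of s3 s1] unfolding s3_def s2_def by simp_all
  have "wp link (wp forests (wp (Asg 22 (Plus (Var 22) (Num 1))) (search_inv H home B s))) s3"
  proof (rule wp_link_fam[OF R3(1), of k e0])
  show "k < Suc k" "vr s3 5 = k" "vr s3 6 = e0" "e0 < m" "edges s3" "e0 \<notin> espan ep (K k \<union> F k)"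
  using e0m ed nsp Fk(1) unfolding s3_def s2_def edges_def by simp_all
  fix s4 :: st
  assume f4: "frame s3 s4" and r4: "reps (Suc k) s4 K (F(k := insert e0 (F k)))"
  and c4: "ck s4 + 20 * potall (Suc k) s4 <= ck s3 + 30 + 20 * potall (Suc k) s3"
  have a4: "ar s4 16 0 = q" "ar s4 17 0 = ar s1 17 0" "vr s4 21 = vr s1 21" "ar s4 15 0 = home" "vr s4 23 = 1"
  "vr s4 25 = e0" "vr s4 4 = k" "edges s4"
  using f4 j(3) run v4 ed unfolding frame_def s3_def s2_def q_def edges_def by simp_all
  have indF: "M.ind (insert e0 (F k))" by (rule M.ind_insert[OF Fk(3) nsp])
  have e0F: "e0 \<notin> F k" using nsp M.sp_base by auto
  have cF: "card (insert e0 (F k)) = Suc (card (F k))" using e0F M.ind_finite[OF Fk(3)] by simp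
  have "insert e0 (F k) \<subseteq> {..<m}" using eH Fk(4) Hm by blast
  \<comment> \<open>Enlarging \<open>F k\<close> therefore frees a full \<open>60 + 30 * k\<close>
    ticks of the budget, which pay for the pass over the \<open>k\<close> forests.\<close>
  from ind_card[OF indF this] have lF: "card (F k) < n" using n2 cF by simp
  let ?F = "F(k := insert e0 (F k))"
  have "srch_body H ?I s4 qh (Suc qh) (13 * k + 9 + 2) B par K ?F"
  unfolding srch_body_def a4
  proof (intro conjI)
  show "M.bfs H k ?I q (vr s1 21) par qh" using b by simp
  show "reps (Suc k) s4 K ?F" by (rule r4)
  show "\<forall>i<k. K i = ?I i \<inter> q ` {..<vr s1 21} & ?F i = ?I i - q ` {..<vr s1 21}" using b by simp
  show "K k = {}" by fact
  show "?F k \<subseteq> q ` {..<Suc qh}" using Fk(2) unfolding e0_def lessThan_Suc by auto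
  show "M.ind (?F k)" "?F k \<subseteq> H" using indF eH Fk(4) by simp_all
  show "\<forall>b h. b < vr s1 21 --> h < k --> q b \<in> ?I h --> ar s1 17 0 (q b) = q (par b)" using b by simp
  have *: "ck s1 + 20 * potall (Suc k) s1 + 100 * (card H - vr s1 21) + (60 + 30 * k) * (n - card (F k)) +
  30 * (card H - qh) + 10 <= B" using b by simp
  define X where "X = (60 + 30 * k) * (n - Suc (card (F k)))"
  have nn: "n - card (F k) = Suc (n - Suc (card (F k)))" using lF by simp
  have "(60 + 30 * k) * (n - card (F k)) = 60 + 30 * k + X" unfolding nn X_def by (rule mult_Suc_right)
  then show "ck s4 + 20 * potall (Suc k) s4 + 100 * (card H - vr s1 21) + (60 + 30 * k) * (n - card (?F k)) +
  30 * (card H - qh) + (13 * k + 9 + 2) <= B"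
  using * c4 R3(2) cF unfolding s3_def s2_def by (simp add: X_def[symmetric])
  qed
  then have S4: "srch H ?I s4 qh (Suc qh) (13 * k + 9 + 2) B" unfolding srch_def by blast
  show "wp forests (wp (Asg 22 (Plus (Var 22) (Num 1))) (search_inv H home B s)) s4"
  proof (rule wp_forests[OF S4 a4(8,7) _ _ a4(4,5) g])
  show "vr s4 25 = ar s4 16 0 qh" "qh < vr s4 21" using a4 qn unfolding e0_def by simp_all
  fix s5 :: st
  assume s5: "same_but {5, 7, 8, 21, 23, 24, 26, 27, 28, 29} {15, 16, 17} s4 s5"
  "(vr s5 23 = 1 & ar s5 15 0 = home & srch H ?I s5 (Suc qh) (Suc qh) (9 + 30) B) \<or>
  (vr s5 23 = 0 & good H (ar s5 15 0) & assigned H (ar s5 15 0) = Suc (assigned H home) & ck s5 <= B + 5 * card H + 11)"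
  show "wp (Asg 22 (Plus (Var 22) (Num 1))) (search_inv H home B s) s5"
  proof (rule fin_step)
  show "same_but {5, 6, 7, 8, 21, 23, 24, 25, 26, 27, 28, 29} {15, 16, 17} s1 s5"
  using s5(1) f4 unfolding same_but_def frame_def s3_def s2_def by simp
  have "srch H ?I s5 (Suc qh) (Suc qh) 11 B" if "srch H ?I s5 (Suc qh) (Suc qh) (9 + 30) B"
  by (rule srch_cong[OF that]) simp_all
  then show "(vr s5 23 = 1 & ar s5 15 0 = home & srch H ?I s5 (Suc qh) (Suc qh) 11 B) \<or>
  (vr s5 23 = 0 & good H (ar s5 15 0) & assigned H (ar s5 15 0) = Suc (assigned H home) & ck s5 <= B + 5 * card H + 11)"
  using s5(2) by blast
  qed
  qed
  qed
  then show ?thesis unfolding process_def s3_def s2_def using False ee v4 nt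
  by (simp add: qh_def q_def e0_def numeral_eq_Suc)
  qed
 qed
qed

lemma wp_search_round:
 assumes S: "srch H (M.asg H home) s 0 0 12 B" and s: "edges s" "vr s 4 = k" "vr s 19 = 1" "ar s 15 0 = home" and g: "good H home"
  and Q: "\<And>s'. same_but {0, 5, 6, 7, 8, 19, 21, 22, 23, 24, 25, 26, 27, 28, 29} {15, 16, 17} s s' ==> ck s' <= B + 5 * card H + 21 ==>
  vr s' 19 = 1 & good H (ar s' 15 0) & assigned H (ar s' 15 0) = Suc (assigned H home) \<or>
  vr s' 19 = 0 & vr s' 0 = 0 & ar s' 15 0 = home & stuck H home ==> Q s'"
 shows "wp search_round Q s"
proof -
 define s1 where "s1 = s\<lparr>vr := (vr s)(22 := 0, 23 := 1), ck := Suc (Suc (ck s))\<rparr>"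
 have s1: "edges s1" "vr s1 4 = k" using s unfolding s1_def edges_def by simp_all
 have "wp (Loop (Eq (Var 23) (Num 1)) (Cond (Eq (Var 22) (Var 21)) (Asg 23 (Num 0) ;; Asg 19 (Num 0) ;; Asg 0 (Num 0)) process)) Q s1"
 proof (rule wp_Loop[where I = "search_inv H home B s1" and B = "B + 5 * card H + 20"])
  have "srch H (M.asg H home) s1 0 0 10 B"
  by (rule srch_cong[OF S]) (simp_all add: s1_def)
  then show "search_inv H home B s1 s1" using s unfolding search_inv_def same_but_def s1_def by simp
 next
  fix s' assume "search_inv H home B s1 s'"
  then show "ck s' <= B + 5 * card H + 20" unfolding search_inv_def using srch_bound by fastforce
 next
  fix s' show "okb (Eq (Var 23) (Num 1)) s'" by simp
 next
  fix s' assume J: "search_inv H home B s1 s'" and b: "bv (Eq (Var 23) (Num 1)) s'"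
  show "wp (Cond (Eq (Var 22) (Var 21)) (Asg 23 (Num 0) ;; Asg 19 (Num 0) ;; Asg 0 (Num 0)) process) (search_inv H home B s1) (tick s')"
  using b by (intro wp_search_step[OF J _ s1 g]) simp
 next
  fix s' assume J: "search_inv H home B s1 s'" and b: "\<not> bv (Eq (Var 23) (Num 1)) s'"
  have sb: "same_but {0, 5, 6, 7, 8, 19, 21, 22, 23, 24, 25, 26, 27, 28, 29} {15, 16, 17} s1 s'"
  and r: "ck s' <= B + 5 * card H + 20" "vr s' 19 = 1 & good H (ar s' 15 0) & assigned H (ar s' 15 0) = Suc (assigned H home) \<or>
  vr s' 19 = 0 & vr s' 0 = 0 & ar s' 15 0 = home & stuck H home"
  using J b unfolding search_inv_def by auto
  show "Q (tick s')"
  by (rule Q) (use sb r in \<open>simp_all add: same_but_def s1_def\<close>)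
 qed
 then show ?thesis unfolding search_round_def s1_def by simp
qed

section \<open>Loading the current packing into fresh structures\<close>

definition setup_inv :: "nat list => (nat => nat) => nat => st => st => bool" where
 "setup_inv hs home B s s' \<longleftrightarrow> same_but {5, 6, 16, 20, 21} {16} s s' & vr s' 16 <= length hs &
  reps (Suc k) s' (\<lambda>_. {}) (\<lambda>i. M.asg (set (take (vr s' 16) hs)) home i) &
  vr s' 20 = card {x \<in> set (take (vr s' 16) hs). home x ~= 0} &
  ar s' 16 0 ` {..<vr s' 21} = {x \<in> set (take (vr s' 16) hs). home x = 0} & inj_on (ar s' 16 0) {..<vr s' 21} &
  ck s' + 20 * potall (Suc k) s' + 45 * (length hs - vr s' 16) <= B"

lemma wp_setup_step:
 assumes J: "setup_inv hs home B s s1" and lt: "vr s1 16 < length hs"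
  and s: "edges s" "listing s hs" "ar s 15 0 = home" and g: "good (set hs) home"
 shows "wp setup_step (setup_inv hs home B s) (tick s1)"
proof -
 define g where "g = vr s1 16"
 define S where "S = set (take g hs)"
 define x where "x = hs ! g"
 have gl: "g < length hs" using lt unfolding g_def .
 have j: "same_but {5, 6, 16, 20, 21} {16} s s1" "reps (Suc k) s1 (\<lambda>_. {}) (\<lambda>i. M.asg S home i)"
  "vr s1 20 = card {x \<in> S. home x ~= 0}" "ar s1 16 0 ` {..<vr s1 21} = {x \<in> S. home x = 0}" "inj_on (ar s1 16 0) {..<vr s1 21}"
  "ck s1 + 20 * potall (Suc k) s1 + 45 * (length hs - g) <= B"
  using J unfolding setup_inv_def g_def S_def by simp_all
 have dist: "distinct hs" using s(2) unfolding listing_def by simp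
 have Hm: "set hs \<subseteq> {..<m}" using \<open>good (set hs) home\<close> unfolding good_def by simp
 have lenm: "length hs <= m" using card_mono[OF _ Hm] distinct_card[OF dist] by simp
 have S': "set (take (Suc g) hs) = insert x S" using gl unfolding S_def x_def by (simp add: take_Suc_conv_app_nth)
 have xS: "x \<notin> S"
 proof
  assume "x \<in> S"
  then obtain j where "j < g" "hs ! j = x" unfolding S_def using gl by (auto simp: in_set_conv_nth)
  then show False using nth_eq_iff_index_eq[OF dist, of j g] gl unfolding x_def by simp
 qed
 have xH: "x \<in> set hs" using gl unfolding x_def by simp
 then have xm: "x < m" using Hm by auto
 have SH: "S \<subseteq> set hs" unfolding S_def by (rule set_take_subset)
 have finS: "finite S" unfolding S_def by simp
 have cS: "card S = g" unfolding S_def using distinct_card[OF distinct_take[OF dist, of g]] gl by simp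
 have v: "ar s1 13 0 g = x" "ar s1 15 0 = home" using j(1) s gl unfolding same_but_def listing_def x_def by simp_all
 have ed: "edges s1" using s(1) j(1) unfolding same_but_def edges_def by simp
 have q21: "vr s1 21 <= g"
 proof -
  have "vr s1 21 = card (ar s1 16 0 ` {..<vr s1 21})" using card_image[OF j(5)] by simp
  also have "\<dots> <= card S" unfolding j(4) by (rule card_mono[OF finS]) auto
  finally show ?thesis using cS by simp
 qed
 have lg: "length hs - g = Suc (length hs - Suc g)" using gl by simp
 show ?thesis
 proof (cases "home x = 0")
  case True
  define s2 where "s2 = s1\<lparr>ar := put 16 0 (vr s1 21) x (ar s1), vr := (vr s1)(6 := x, 21 := Suc (vr s1 21), 16 := Suc g),
  ck := ck s1 + 6\<rparr>"
  have a2: "vr s2 16 = Suc g" "ar s2 16 0 = (ar s1 16 0)(vr s1 21 := x)" "vr s2 21 = Suc (vr s1 21)" "vr s2 20 = vr s1 20"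
  unfolding s2_def by simp_all
  have R: "reps (Suc k) s2 (\<lambda>_. {}) (\<lambda>i. M.asg S home i)" "potall (Suc k) s2 = potall (Suc k) s1"
  using j(2) reps_cong[of s2 s1] unfolding s2_def by simp_all
  have as: "M.asg (insert x S) home = M.asg S home" using True unfolding M.asg_def by (auto simp: fun_eq_iff)
  have im: "ar s1 16 0 ` {..<vr s1 21} \<subseteq> S" using j(4) by auto
  have "setup_inv hs home B s s2"
  unfolding setup_inv_def a2 S' as
  proof (intro conjI)
  show "same_but {5, 6, 16, 20, 21} {16} s s2" using j(1) unfolding same_but_def s2_def by simp
  show "Suc g <= length hs" using gl by simp
  show "vr s1 20 = card {x' \<in> insert x S. home x' ~= 0}"
  unfolding j(3) by (rule arg_cong[where f = card]) (use True in auto)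
  show "inj_on ((ar s1 16 0)(vr s1 21 := x)) {..<Suc (vr s1 21)}"
  unfolding lessThan_Suc using j(5) im xS by (auto simp: inj_on_def)
  have "((ar s1 16 0)(vr s1 21 := x)) ` {..<Suc (vr s1 21)} = insert x (ar s1 16 0 ` {..<vr s1 21})"
  unfolding lessThan_Suc by auto
  then show "((ar s1 16 0)(vr s1 21 := x)) ` {..<Suc (vr s1 21)} = {x' \<in> insert x S. home x' = 0}"
  unfolding j(4) using True by auto
  show "ck s2 + 20 * potall (Suc k) s2 + 45 * (length hs - Suc g) <= B" using j(6) R(2) lg unfolding s2_def by simp
  qed (rule R)
  then show ?thesis unfolding setup_step_def s2_def using v True q21 gl lenm cap_m by (simp add: g_def numeral_eq_Suc)
 next
  case False
  then obtain i where i: "home x = Suc i" by (cases "home x") auto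
  have ik: "i < k" using \<open>good (set hs) home\<close> xH i unfolding good_def by auto
  define s2 where "s2 = s1\<lparr>vr := (vr s1)(6 := x, 5 := i), ck := ck s1 + 4\<rparr>"
  have R: "reps (Suc k) s2 (\<lambda>_. {}) (\<lambda>i. M.asg S home i)" "potall (Suc k) s2 = potall (Suc k) s1"
  using j(2) reps_cong[of s2 s1] unfolding s2_def by simp_all
  have "wp link (wp (Asg 20 (Plus (Var 20) (Num 1)) ;; Asg 16 (Plus (Var 16) (Num 1))) (setup_inv hs home B s)) s2"
  proof (rule wp_link_fam[OF R(1), of i x])
  show "i < Suc k" "vr s2 5 = i" "vr s2 6 = x" "x < m" "edges s2"
  using ik xm ed unfolding s2_def edges_def by simp_all
  \<comment> \<open>The edges loaded so far belong to an independent set that also contains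
    \<open>x\<close>, so they do not span \<open>x\<close> and \<open>link\<close> is
    applicable.\<close>
  have "M.ind (M.asg (set hs) home i)" using \<open>good (set hs) home\<close> unfolding good_def by simp
  moreover have "x \<in> M.asg (set hs) home i" using i xH unfolding M.asg_def by simp
  ultimately have "x \<notin> espan ep (M.asg (set hs) home i - {x})" by (rule M.ind_not_span)
  moreover have "M.asg S home i \<subseteq> M.asg (set hs) home i - {x}" using SH xS unfolding M.asg_def by auto
  ultimately show "x \<notin> espan ep ({} \<union> M.asg S home i)" using M.sp_mono'[of x "M.asg S home i"] by auto
  fix s3 :: st
  assume f3: "frame s2 s3" and r3: "reps (Suc k) s3 (\<lambda>_. {}) ((\<lambda>i. M.asg S home i)(i := insert x (M.asg S home i)))"
  and c3: "ck s3 + 20 * potall (Suc k) s3 <= ck s2 + 30 + 20 * potall (Suc k) s2"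
  have as: "(\<lambda>i. M.asg S home i)(i := insert x (M.asg S home i)) = (\<lambda>i. M.asg (insert x S) home i)"
  using i unfolding M.asg_def by (auto simp: fun_eq_iff)
  define s4 where "s4 = s3\<lparr>vr := (vr s3)(20 := Suc (vr s1 20), 16 := Suc g), ck := Suc (Suc (ck s3))\<rparr>"
  have v3: "vr s3 20 = vr s1 20" "vr s3 16 = g" using f3 unfolding frame_def s2_def g_def by simp_all
  have a4: "vr s4 16 = Suc g" "ar s4 16 0 = ar s1 16 0" "vr s4 21 = vr s1 21" "vr s4 20 = Suc (vr s1 20)"
  using f3 unfolding s4_def frame_def s2_def by simp_all
  have R4: "reps (Suc k) s4 (\<lambda>_. {}) (\<lambda>i. M.asg (insert x S) home i)" "potall (Suc k) s4 = potall (Suc k) s3"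
  using r3 reps_cong[of s4 s3] unfolding s4_def as by simp_all
  have "setup_inv hs home B s s4"
  unfolding setup_inv_def a4 S'
  proof (intro conjI)
  show "same_but {5, 6, 16, 20, 21} {16} s s4" using j(1) f3 unfolding same_but_def s4_def frame_def s2_def by simp
  show "Suc g <= length hs" using gl by simp
  have "{x' \<in> insert x S. home x' ~= 0} = insert x {x' \<in> S. home x' ~= 0}" using i by auto
  then show "Suc (vr s1 20) = card {x' \<in> insert x S. home x' ~= 0}" unfolding j(3) using xS finS by simp
  show "ar s1 16 0 ` {..<vr s1 21} = {x' \<in> insert x S. home x' = 0}" unfolding j(4) using i by auto
  show "ck s4 + 20 * potall (Suc k) s4 + 45 * (length hs - Suc g) <= B"
  using j(6) R(2) R4(2) c3 lg unfolding s4_def s2_def by simp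
  qed (rule R4 j(5))+
  moreover have "vr s1 20 <= g" unfolding j(3) using card_mono[OF finS, of "{x \<in> S. home x ~= 0}"] cS by auto
  ultimately show "wp (Asg 20 (Plus (Var 20) (Num 1)) ;; Asg 16 (Plus (Var 16) (Num 1))) (setup_inv hs home B s) s3"
  unfolding s4_def using v3 gl lenm cap_m by simp
  qed
  then show ?thesis unfolding setup_step_def s2_def using v i by (simp add: g_def numeral_eq_Suc)
 qed
qed

lemma wp_setup_round:
 assumes e: "env hs s" "ar s 15 0 = home" and g: "good (set hs) home"
  and B: "ck s + 30 + c + Suc k * (11 * n + 4 + 40 * (n * floor_log n)) + 175 * length hs + (60 + 30 * k) * n <= B"
  and Q: "\<And>s'. same_but {5, 6, 9, 16, 20, 21} {16} s s' ==> vr s' 20 = assigned (set hs) home ==>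
  srch (set hs) (M.asg (set hs) home) s' 0 0 c B ==> Q s'"
 shows "wp setup_round Q s"
proof -
 let ?C = "Suc k * (11 * n + 4 + 40 * (n * floor_log n))"
 define s0 where "s0 = s\<lparr>vr := (vr s)(9 := Suc k), ck := Suc (ck s)\<rparr>"
 have ev: "vr s 2 = n" "vr s 4 = k" "listing s hs" "edges s" using e(1) unfolding env_def by simp_all
 have len: "length hs = card (set hs)" using ev(3) distinct_card unfolding listing_def by fastforce
 have kc: "Suc k < cap" using k_cap k1 by simp
 have "wp init_all (wp (Asg 20 (Num 0) ;; Asg 21 (Num 0) ;; Asg 16 (Num 0) ;; Loop (Less (Var 16) (Var 12)) setup_step) Q) s0"
 proof (rule wp_init_fam[where c = "Suc k"])
  show "vr s0 2 = n" "vr s0 9 = Suc k" "Suc k < cap" using ev kc unfolding s0_def by simp_all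
  fix s1 :: st
  assume s1: "\<forall>x<30. x ~= 5 --> vr s1 x = vr s0 x" "rw s1 = rw s0" "\<forall>t p. 10 < t --> ar s1 t p = ar s0 t p"
  and r1: "reps (Suc k) s1 (\<lambda>_. {}) (\<lambda>_. {})" and c1: "ck s1 + 20 * potall (Suc k) s1 <= ck s0 + 2 + ?C"
  define s2 where "s2 = s1\<lparr>vr := (vr s1)(20 := 0, 21 := 0, 16 := 0), ck := Suc (Suc (Suc (ck s1)))\<rparr>"
  have R2: "reps (Suc k) s2 (\<lambda>_. {}) (\<lambda>_. {})" "potall (Suc k) s2 = potall (Suc k) s1"
  using r1 reps_cong[of s2 s1] unfolding s2_def by simp_all
  define B2 where "B2 = ck s + 6 + ?C + 45 * length hs"
  have s2: "edges s2" "listing s2 hs" "ar s2 15 0 = home" using s1 ev e unfolding s2_def s0_def edges_def listing_def by simp_all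
  have as0: "M.asg {} home = (\<lambda>_. {})" unfolding M.asg_def by simp
  have "wp (Loop (Less (Var 16) (Var 12)) setup_step) Q s2"
  proof (rule wp_Loop[where I = "setup_inv hs home B2 s2" and B = B2])
  show "setup_inv hs home B2 s2 s2"
  unfolding setup_inv_def same_but_def using R2 c1 as0 by (simp add: s2_def B2_def s0_def)
  next
  fix s' assume "setup_inv hs home B2 s2 s'"
  then show "ck s' <= B2" unfolding setup_inv_def by simp
  next
  fix s' show "okb (Less (Var 16) (Var 12)) s'" by simp
  next
  fix s' assume J: "setup_inv hs home B2 s2 s'" and b: "bv (Less (Var 16) (Var 12)) s'"
  have "vr s' 12 = length hs" using J s2(2) unfolding setup_inv_def same_but_def listing_def by simp
  then show "wp setup_step (setup_inv hs home B2 s2) (tick s')"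
  using b by (intro wp_setup_step[OF J _ s2 g]) simp
  next
  fix s' assume J: "setup_inv hs home B2 s2 s'" and b: "\<not> bv (Less (Var 16) (Var 12)) s'"
  have "vr s' 12 = length hs" "vr s' 16 <= length hs" using J s2(2) unfolding setup_inv_def same_but_def listing_def by simp_all
  then have all: "vr s' 16 = length hs" using b by simp
  have j: "same_but {5, 6, 16, 20, 21} {16} s2 s'" "reps (Suc k) s' (\<lambda>_. {}) (\<lambda>i. M.asg (set hs) home i)"
  "vr s' 20 = card {x \<in> set hs. home x ~= 0}" "ar s' 16 0 ` {..<vr s' 21} = {x \<in> set hs. home x = 0}"
  "inj_on (ar s' 16 0) {..<vr s' 21}" "ck s' + 20 * potall (Suc k) s' <= B2"
  using J unfolding setup_inv_def all by simp_all
  let ?H = "set hs" and ?I = "M.asg (set hs) home" and ?q = "ar s' 16 0"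
  have nq: "?q b \<notin> ?I h" if "b < vr s' 21" for b h
  proof -
  have "?q b \<in> {x \<in> set hs. home x = 0}" using j(4) that by blast
  then show ?thesis unfolding M.asg_def by simp
  qed
  have dj: "?I i \<inter> ?q ` {..<vr s' 21} = {}" for i using nq by auto
  have bf: "M.bfs ?H k ?I ?q (vr s' 21) (\<lambda>_. 0) 0"
  unfolding M.bfs_def
  proof (intro conjI)
  show "?H - (\<Union>i<k. ?I i) \<subseteq> ?q ` {..<vr s' 21}"
  proof
  fix x assume x: "x \<in> ?H - (\<Union>i<k. ?I i)"
  have "home x = 0"
  proof (rule ccontr)
  assume "home x ~= 0"
  then obtain i where "home x = Suc i" by (cases "home x") auto
  moreover have "home x <= k" using g x unfolding good_def by auto
  ultimately show False using x unfolding M.asg_def by auto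
  qed
  then show "x \<in> ?q ` {..<vr s' 21}" unfolding j(4) using x by simp
  qed
  show "?q ` {..<vr s' 21} \<subseteq> ?H" unfolding j(4) by auto
  qed (use j(5) nq in auto)
  have Ik: "?I k = {}" by (rule good_empty[OF g]) simp
  define s3 where "s3 = tick s'"
  have R3: "reps (Suc k) s3 (\<lambda>_. {}) ?I" "potall (Suc k) s3 = potall (Suc k) s'"
  using j(2) reps_cong[of s3 s'] unfolding s3_def by simp_all
  have "srch_body ?H ?I s3 0 0 c B (\<lambda>_. 0) (\<lambda>_. {}) ?I"
  unfolding srch_body_def
  proof (intro conjI)
  show "M.bfs ?H k ?I (ar s3 16 0) (vr s3 21) (\<lambda>_. 0) 0" using bf unfolding s3_def by simp
  show "reps (Suc k) s3 (\<lambda>_. {}) ?I" by (rule R3)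
  show "\<forall>i<k. {} = ?I i \<inter> ar s3 16 0 ` {..<vr s3 21} & ?I i = ?I i - ar s3 16 0 ` {..<vr s3 21}"
  using dj unfolding s3_def by auto
  show "?I k \<subseteq> ar s3 16 0 ` {..<0}" "M.ind (?I k)" "?I k \<subseteq> ?H" unfolding Ik by (simp_all add: M.ind_empty)
  show "\<forall>b h. b < vr s3 21 --> h < k --> ar s3 16 0 b \<in> ?I h --> ar s3 17 0 (ar s3 16 0 b) = ar s3 16 0 0"
  using nq unfolding s3_def by simp
  define X Y where "X = (60 + 30 * k) * n" and "Y = ?C"
  have "(60 + 30 * k) * (n - card (?I k)) = X" unfolding Ik X_def by simp
  moreover have "100 * (card ?H - vr s3 21) <= 100 * length hs" using len by simp
  ultimately show "ck s3 + 20 * potall (Suc k) s3 + 100 * (card ?H - vr s3 21) + (60 + 30 * k) * (n - card (?I k)) +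
  30 * (card ?H - 0) + c <= B"
  using j(6) B R3(2) len unfolding B2_def X_def[symmetric] Y_def[symmetric] s3_def by simp
  qed simp
  then have "srch ?H ?I s3 0 0 c B" unfolding srch_def by blast
  moreover have "same_but {5, 6, 9, 16, 20, 21} {16} s s3" using j(1) s1 unfolding same_but_def s3_def s2_def s0_def by simp
  moreover have "vr s3 20 = assigned ?H home" using j(3) unfolding s3_def assigned_def by simp
  ultimately show "Q (tick s')" using Q[of s3] unfolding s3_def by simp
  qed
  then show "wp (Asg 20 (Num 0) ;; Asg 21 (Num 0) ;; Asg 16 (Num 0) ;; Loop (Less (Var 16) (Var 12)) setup_step) Q s1"
  unfolding s2_def by simp
 qed
 then show ?thesis unfolding setup_round_def s0_def using ev kc by simp
qed

section \<open>Bounding the number of rounds\<close>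

lemma assigned_sum:
 assumes g: "good H home"
 shows "assigned H home = (\<Sum>i<k. card (M.asg H home i))" "{x \<in> H. home x ~= 0} = (\<Union>i<k. M.asg H home i)"
  "assigned H home <= k * (n - 1)" "M.packs k H (M.asg H home)"
proof -
 have H: "H \<subseteq> {..<m}" "finite H" "\<forall>x\<in>H. home x <= k" "\<And>i. M.ind (M.asg H home i)"
  using g finite_subset[of H "{..<m}"] unfolding good_def by simp_all
 show U: "{x \<in> H. home x ~= 0} = (\<Union>i<k. M.asg H home i)"
 proof
  show "{x \<in> H. home x ~= 0} \<subseteq> (\<Union>i<k. M.asg H home i)"
  proof
  fix x assume x: "x \<in> {x \<in> H. home x ~= 0}"
  then obtain i where i: "home x = Suc i" by (cases "home x") auto
  then have "i < k" using x H(3) by auto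
  then show "x \<in> (\<Union>i<k. M.asg H home i)" using x i unfolding M.asg_def by auto
  qed
 qed (auto simp: M.asg_def)
 have sub: "M.asg H home i \<subseteq> H" for i unfolding M.asg_def by auto
 have "card (\<Union>i<k. M.asg H home i) = (\<Sum>i<k. card (M.asg H home i))"
  by (rule card_UN_disjoint) (use finite_subset[OF sub H(2)] good_disjoint in auto)
 then show sum: "assigned H home = (\<Sum>i<k. card (M.asg H home i))" unfolding assigned_def U .
 have "(\<Sum>i<k. card (M.asg H home i)) <= (\<Sum>i<k. n - 1)"
 proof (rule sum_mono)
  fix i show "card (M.asg H home i) <= n - 1" by (rule ind_card[OF H(4)]) (use sub[of i] H(1) in blast)
 qed
 then show "assigned H home <= k * (n - 1)" unfolding sum by simp
 show "M.packs k H (M.asg H home)" unfolding M.packs_def using H(4) sub good_disjoint by simp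
qed

text \<open>At most \<open>k * (n - 1)\<close> edges are assigned, and
  \<open>k * n \<le> D * D\<close> makes this less than \<open>D * (D + 1)\<close>, as the
  pigeonhole argument of \<open>pushrel_gap\<close> demands. The comparison is with every later
  packing.\<close>

lemma gap:
 assumes P: "M.pushrel H k D lev home {}" and lev: "\<forall>x\<in>H. lev x ~= 0" and H: "H \<subseteq> {..<m}"
 shows "good H home" "good H home' ==> assigned H home' <= assigned H home + D"
proof -
 have a: "\<forall>x\<in>H. home x <= k" "\<forall>i<k. M.ind (M.asg H home i)" using P unfolding M.pushrel_def by auto
 have e: "M.asg H home i = {}" if "\<not> i < k" for i using a(1) that unfolding M.asg_def by auto
 have "M.ind (M.asg H home i)" for i using a(2) e[of i] M.ind_empty by (cases "i < k") auto
 then show g: "good H home" unfolding good_def using a(1) H by simp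
 assume g': "good H home'"
 have "k * (n - 1) < D * (D + 1)"
 proof -
  have "k * (n - 1) <= k * n" by simp
  also have "\<dots> <= D * D" by (rule DD)
  also have "\<dots> < D * (D + 1)" using D1 by simp
  finally show ?thesis .
 qed
 then have "card (\<Union>i<k. M.asg H home i) < D * (D + 1)"
  using assigned_sum(2,3)[OF g] unfolding assigned_def by simp
 from M.pushrel_gap[OF P _ assigned_sum(4)[OF g'] this] lev
 show "assigned H home' <= assigned H home + D" unfolding assigned_sum(1)[OF g] assigned_sum(1)[OF g'] by simp
qed

text \<open>Each of the \<open>h\<close> edges is charged 45 ticks for loading, 100 for being
  reached, 30 for being processed and 5 for being moved along the path, which makes 180.\<close>

definition round_cost :: "nat => nat" where
 "round_cost h = Suc k * (11 * n + 4 + 40 * (n * floor_log n)) + 180 * h + (60 + 30 * k) * n + 100"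

definition settled :: "nat set => st => bool" where
 "settled H s \<longleftrightarrow> (vr s 0 = 1 & assigned H (ar s 15 0) = k * (n - 1) \<or>
  vr s 0 = 0 & assigned H (ar s 15 0) ~= k * (n - 1) & stuck H (ar s 15 0))"

abbreviation "aug_vars \<equiv> {0, 5, 6, 7, 8, 9, 16, 19, 20, 21, 22, 23, 24, 25, 26, 27, 28, 29 :: nat}"

lemma wp_augmentation_round:
 assumes e: "env hs s" "vr s 19 = 1" and g: "good (set hs) (ar s 15 0)"
  and Q: "\<And>s'. same_but aug_vars {15, 16, 17} s s' ==> ck s' + 10 <= ck s + round_cost (length hs) ==> good (set hs) (ar s' 15 0) ==>
  vr s' 19 = 1 & assigned (set hs) (ar s' 15 0) = Suc (assigned (set hs) (ar s 15 0)) \<or>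
  vr s' 19 = 0 & ar s' 15 0 = ar s 15 0 & settled (set hs) s' ==> Q s'"
 shows "wp augmentation_round Q s"
proof -
 define home where "home = ar s 15 0"
 let ?H = "set hs"
 define B where "B = ck s + 30 + 13 + Suc k * (11 * n + 4 + 40 * (n * floor_log n)) + 175 * length hs + (60 + 30 * k) * n"
 have len: "card ?H = length hs" using e(1) distinct_card unfolding env_def listing_def by fastforce
 have Bc: "B + 5 * card ?H + 21 + 10 <= ck s + round_cost (length hs)" unfolding B_def round_cost_def len by simp
 have kn: "k * (n - 1) < cap" using capk by (rule le_less_trans[rotated]) simp
 have "wp setup_round (wp (Cond (Eq (Var 20) (Times (Var 4) (Minus (Var 2) (Num 1)))) (Asg 0 (Num 1) ;; Asg 19 (Num 0)) search_round) Q) s"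
 proof (rule wp_setup_round[OF e(1) home_def[symmetric], of 13 B])
  show "good ?H home" using g unfolding home_def .
  show "ck s + 30 + 13 + Suc k * (11 * n + 4 + 40 * (n * floor_log n)) + 175 * length hs + (60 + 30 * k) * n <= B"
  unfolding B_def by simp
  fix s1 :: st
  assume s1: "same_but {5, 6, 9, 16, 20, 21} {16} s s1" "vr s1 20 = assigned ?H home" "srch ?H (M.asg ?H home) s1 0 0 13 B"
  have v: "vr s1 2 = n" "vr s1 4 = k" "edges s1" "vr s1 19 = 1" "ar s1 15 0 = home"
  using s1(1) e unfolding same_but_def env_def edges_def home_def by simp_all
  have cB: "ck s1 + 13 <= B" by (rule srch_bound[OF s1(3)])
  show "wp (Cond (Eq (Var 20) (Times (Var 4) (Minus (Var 2) (Num 1)))) (Asg 0 (Num 1) ;; Asg 19 (Num 0)) search_round) Q s1"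
  proof (cases "assigned ?H home = k * (n - 1)")
  case True
  define s2 where "s2 = s1\<lparr>vr := (vr s1)(0 := 1, 19 := 0), ck := Suc (Suc (Suc (ck s1)))\<rparr>"
  have "Q s2"
  proof (rule Q)
  show "same_but aug_vars {15, 16, 17} s s2" using s1(1) unfolding same_but_def s2_def by simp
  show "ck s2 + 10 <= ck s + round_cost (length hs)" using cB Bc unfolding s2_def by simp
  have a2: "ar s2 15 0 = home" "vr s2 19 = 0" "vr s2 0 = 1" using v unfolding s2_def by simp_all
  then show "good ?H (ar s2 15 0)" using g unfolding home_def by simp
  show "vr s2 19 = 1 & assigned ?H (ar s2 15 0) = Suc (assigned ?H (ar s 15 0)) \<or>
  vr s2 19 = 0 & ar s2 15 0 = ar s 15 0 & settled ?H s2"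
  using a2 True unfolding settled_def home_def by simp
  qed
  then show ?thesis unfolding s2_def using v s1(2) True kn n2 by simp
  next
  case False
  have "wp search_round Q (tick s1)"
  proof (rule wp_search_round[of ?H home])
  show "srch ?H (M.asg ?H home) (tick s1) 0 0 12 B" by (rule srch_cong[OF s1(3)]) simp_all
  show "edges (tick s1)" "vr (tick s1) 4 = k" "vr (tick s1) 19 = 1" "ar (tick s1) 15 0 = home" "good ?H home"
  using v g unfolding edges_def home_def by simp_all
  fix s2 :: st
  assume s2: "same_but {0, 5, 6, 7, 8, 19, 21, 22, 23, 24, 25, 26, 27, 28, 29} {15, 16, 17} (tick s1) s2"
  "ck s2 <= B + 5 * card ?H + 21"
  "vr s2 19 = 1 & good ?H (ar s2 15 0) & assigned ?H (ar s2 15 0) = Suc (assigned ?H home) \<or>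
  vr s2 19 = 0 & vr s2 0 = 0 & ar s2 15 0 = home & stuck ?H home"
  show "Q s2"
  proof (rule Q)
  show "same_but aug_vars {15, 16, 17} s s2" using s1(1) s2(1) unfolding same_but_def by simp
  show "ck s2 + 10 <= ck s + round_cost (length hs)" using s2(2) Bc by simp
  show "good ?H (ar s2 15 0)" using s2(3) g unfolding home_def by auto
  show "vr s2 19 = 1 & assigned ?H (ar s2 15 0) = Suc (assigned ?H (ar s 15 0)) \<or>
  vr s2 19 = 0 & ar s2 15 0 = ar s 15 0 & settled ?H s2"
  using s2(3) False unfolding settled_def home_def by auto
  qed
  qed
  then show ?thesis using v s1(2) False kn n2 by simp
  qed
 qed
 then show ?thesis unfolding augmentation_round_def by simp
qed

text \<open>A successful round assigns one more edge, which by \<open>gap\<close> can happen at most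
  \<open>D\<close> times; the round that settles the matter is the last one. Hence the factor
  \<open>Suc D\<close>.\<close>

theorem wp_augmentation:
 assumes e: "env hs s" and P: "M.pushrel (set hs) k D (ar s 14 0) (ar s 15 0) {}" and lev: "\<forall>x\<in>set hs. ar s 14 0 x ~= 0"
  and H: "set hs \<subseteq> {..<m}"
  and Q: "\<And>s'. same_but aug_vars {15, 16, 17} s s' ==> good (set hs) (ar s' 15 0) ==> settled (set hs) s' ==>
  ck s' <= ck s + 2 + Suc D * round_cost (length hs) ==> Q s'"
 shows "wp augmentation Q s"
proof -
 let ?H = "set hs" and ?a = "\<lambda>s. assigned (set hs) (ar s 15 0)"
 define R where "R = round_cost (length hs)"
 define s1 where "s1 = s\<lparr>vr := (vr s)(19 := 1), ck := Suc (ck s)\<rparr>"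
 define J where "J s' \<longleftrightarrow> same_but aug_vars {15, 16, 17} s s' & good ?H (ar s' 15 0) & ?a s <= ?a s' &
  (vr s' 19 = 1 & ck s' <= ck s + 1 + (?a s' - ?a s) * R \<or> vr s' 19 = 0 & settled ?H s' & ck s' <= ck s + 1 + Suc (?a s' - ?a s) * R)" for s' :: st
 have g: "good ?H (ar s 15 0)" by (rule gap(1)[OF P lev H])
 have up: "?a s' - ?a s <= D" if "good ?H (ar s' 15 0)" for s' using gap(2)[OF P lev H that] by simp
 have mul: "x * R <= Suc D * R" if "x <= Suc D" for x using that by (rule mult_le_mono1)
 have "wp (Loop (Eq (Var 19) (Num 1)) augmentation_round) Q s1"
 proof (rule wp_Loop[where I = J and B = "ck s + 1 + Suc D * R"])
  show "J s1" unfolding J_def using g by (simp add: s1_def same_but_def)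
 next
  fix s' assume j: "J s'"
  then have u: "?a s' - ?a s <= D" by (intro up) (simp add: J_def)
  show "ck s' <= ck s + 1 + Suc D * R"
  using j mul[of "?a s' - ?a s"] mul[of "Suc (?a s' - ?a s)"] u unfolding J_def by linarith
 next
  fix s' show "okb (Eq (Var 19) (Num 1)) s'" by simp
 next
  fix s' assume j: "J s'" and b: "bv (Eq (Var 19) (Num 1)) s'"
  have j': "same_but aug_vars {15, 16, 17} s s'" "good ?H (ar s' 15 0)" "?a s <= ?a s'" "ck s' <= ck s + 1 + (?a s' - ?a s) * R"
  using j b unfolding J_def by auto
  show "wp augmentation_round J (tick s')"
  proof (rule wp_augmentation_round[of hs])
  show "env hs (tick s')" using e j'(1) unfolding env_def listing_def edges_def same_but_def by simp
  show "vr (tick s') 19 = 1" "good ?H (ar (tick s') 15 0)" using b j'(2) by simp_all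
  fix s2 :: st
  assume s2: "same_but aug_vars {15, 16, 17} (tick s') s2" "ck s2 + 10 <= ck (tick s') + round_cost (length hs)" "good ?H (ar s2 15 0)"
  "vr s2 19 = 1 & ?a s2 = Suc (?a (tick s')) \<or> vr s2 19 = 0 & ar s2 15 0 = ar (tick s') 15 0 & settled ?H s2"
  have sb: "same_but aug_vars {15, 16, 17} s s2" using j'(1) s2(1) unfolding same_but_def by simp
  have c: "ck s2 <= ck s + 1 + Suc (?a s' - ?a s) * R" using s2(2) j'(4) unfolding R_def by simp
  show "J s2"
  using s2(4)
  proof (elim disjE conjE)
  assume "vr s2 19 = 1" "?a s2 = Suc (?a (tick s'))"
  moreover from this have "?a s2 - ?a s = Suc (?a s' - ?a s)" using j'(3) by simp
  ultimately show ?thesis unfolding J_def using sb s2(3) c j'(3) by (simp only: simp_thms)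
  next
  assume "vr s2 19 = 0" "ar s2 15 0 = ar (tick s') 15 0" "settled ?H s2"
  then show ?thesis unfolding J_def using sb s2(3) c j'(3) by simp
  qed
  qed
 next
  fix s' assume j: "J s'" and b: "\<not> bv (Eq (Var 19) (Num 1)) s'"
  have j': "same_but aug_vars {15, 16, 17} s s'" "good ?H (ar s' 15 0)" "settled ?H s'" "ck s' <= ck s + 1 + Suc (?a s' - ?a s) * R"
  using j b unfolding J_def by auto
  show "Q (tick s')"
  proof (rule Q)
  show "ck (tick s') <= ck s + 2 + Suc D * round_cost (length hs)"
  proof -
  have "Suc (?a s' - ?a s) <= Suc D" using up[OF j'(2)] by simp
  from order_trans[OF j'(4) add_left_mono[OF mul[OF this]]] show ?thesis unfolding R_def by simp
  qed
  qed (use j' in \<open>simp_all add: same_but_def settled_def\<close>)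
 qed
 then show ?thesis unfolding augmentation_def s1_def by simp
qed

end

section \<open>Writing the trees to memory\<close>

definition emit_step :: com where
 "emit_step = Asg 6 (Arr 13 (Num 0) (Var 16)) ;;
  Cond (Eq (Arr 15 (Num 0) (Var 6)) (Num 0)) (Asg 28 (Num 0))
  (Asg 5 (Minus (Arr 15 (Num 0) (Var 6)) (Num 1)) ;;
  PutRaw (Plus (Times (Var 5) (Minus (Var 2) (Num 1))) (Arr 19 (Num 0) (Var 5))) (Var 6) ;;
  Put 19 (Num 0) (Var 5) (Plus (Arr 19 (Num 0) (Var 5)) (Num 1))) ;;
  Asg 16 (Plus (Var 16) (Num 1))"

definition emit :: com where
 "emit = Asg 16 (Num 0) ;; Loop (Less (Var 16) (Var 12)) emit_step ;; Asg 1 (Num 0)"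

definition solve :: com where
 "solve = sparsify ;; push_relabel ;; augmentation ;; emit"

definition init_cost :: "nat => nat" where
 "init_cost n = 11 * n + 4 + 40 * (n * floor_log n)"

definition solve_cost :: "nat => nat => nat => nat => nat => nat => nat" where
 "solve_cost n m k L D w = 30 + L * init_cost n + m * (60 + 5 * w) + D * k * init_cost n +
  (100 + 5 * w) * (D * k * n + L * n * Suc D) + 30 * (L * n) +
  Suc D * (Suc k * init_cost n + 180 * (L * n) + (60 + 30 * k) * n + 100)"

lemma block_eq:
 fixes a a' N :: nat
 assumes "a < N" "a' < N"
 shows "i * N + a = i' * N + a' \<longleftrightarrow> i = i' & a = a'"
proof
 assume e: "i * N + a = i' * N + a'"
 have "(i * N + a) div N = i" "(i' * N + a') div N = i'" using assms by simp_all
 then show "i = i' & a = a'" using e by simp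
qed simp

context task
begin

text \<open>Array 19 counts the edges already written for each tree. The output overwrites the
  input, whose edges have been copied to the arrays 11 and 12, and starts at address 0.\<close>

definition emit_inv :: "nat list => st => st => bool" where
 "emit_inv hs s s' \<longleftrightarrow> same_but {5, 6, 16, 28} {19} s s' & vr s' 16 <= length hs &
  (\<forall>i<k. ar s' 19 0 i = card (M.asg (set (take (vr s' 16) hs)) (ar s 15 0) i) &
  (\<lambda>j. rw s' (i * (n - 1) + j)) ` {..<card (M.asg (set (take (vr s' 16) hs)) (ar s 15 0) i)} =
  M.asg (set (take (vr s' 16) hs)) (ar s 15 0) i) &
  ck s' + 8 * (length hs - vr s' 16) <= ck s + 8 * length hs"

lemma wp_emit_step:
 assumes J: "emit_inv hs s s1" and lt: "vr s1 16 < length hs"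
  and s: "vr s 2 = n" "listing s hs" and gd: "good (set hs) (ar s 15 0)" and rb: "m < rb"
 shows "wp emit_step (emit_inv hs s) (tick s1)"
proof -
 define home where "home = ar s 15 0"
 define g where "g = vr s1 16"
 define S where "S = set (take g hs)"
 define x where "x = hs ! g"
 have gl: "g < length hs" using lt unfolding g_def .
 note jj = J[unfolded emit_inv_def, folded g_def, folded S_def home_def]
 note j = conjunct1[OF jj] conjunct1[OF conjunct2[OF conjunct2[OF jj]]] conjunct2[OF conjunct2[OF conjunct2[OF jj]]]
 have dist: "distinct hs" using s(2) unfolding listing_def by simp
 have Hm: "set hs \<subseteq> {..<m}" using gd unfolding good_def by simp
 have lenm: "length hs <= m" using card_mono[OF _ Hm] distinct_card[OF dist] by simp
 have S': "set (take (Suc g) hs) = insert x S" using gl unfolding S_def x_def by (simp add: take_Suc_conv_app_nth)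
 have xS: "x \<notin> S"
 proof
  assume "x \<in> S"
  then obtain j where "j < g" "hs ! j = x" unfolding S_def using gl by (auto simp: in_set_conv_nth)
  then show False using nth_eq_iff_index_eq[OF dist, of j g] gl unfolding x_def by simp
 qed
 have xH: "x \<in> set hs" using gl unfolding x_def by simp
 have SH: "S \<subseteq> set hs" unfolding S_def by (rule set_take_subset)
 have finS: "finite (M.asg S home i)" for i unfolding S_def M.asg_def by simp
 have v: "ar s1 13 0 g = x" "ar s1 15 0 = home" "vr s1 2 = n"
  using j(1) s gl unfolding same_but_def listing_def x_def home_def by simp_all
 have lg: "length hs - g = Suc (length hs - Suc g)" using gl by simp
 show ?thesis
 proof (cases "home x = 0")
  case True
  define s2 where "s2 = s1\<lparr>vr := (vr s1)(6 := x, 28 := 0, 16 := Suc g), ck := Suc (Suc (Suc (Suc (Suc (ck s1)))))\<rparr>"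
  have a2: "vr s2 16 = Suc g" "ar s2 = ar s1" "rw s2 = rw s1" unfolding s2_def by simp_all
  have as: "M.asg (insert x S) home = M.asg S home" using True unfolding M.asg_def by (auto simp: fun_eq_iff)
  have "same_but {5, 6, 16, 28} {19} s s2" using j(1) unfolding same_but_def s2_def by simp
  moreover have "ck s2 + 8 * (length hs - Suc g) <= ck s + 8 * length hs" using j(3) lg unfolding s2_def by simp
  ultimately have "emit_inv hs s s2"
  unfolding emit_inv_def a2 S' home_def[symmetric] as using j(2) gl by (intro conjI) simp_all
  then show ?thesis unfolding emit_step_def s2_def using v True gl lenm cap_m by (simp add: g_def)
 next
  case False
  then obtain i where i: "home x = Suc i" by (cases "home x") auto
  have ik: "i < k" using gd xH i unfolding good_def home_def by auto
  have small: "card (M.asg S home i') <= n - 1" for i'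
  proof (rule ind_card)
  have "M.ind (M.asg (set hs) home i')" using gd unfolding good_def home_def by simp
  moreover have sub: "M.asg S home i' \<subseteq> M.asg (set hs) home i'" using SH unfolding M.asg_def by auto
  ultimately show "M.ind (M.asg S home i')" by (rule M.ind_subset)
  show "M.asg S home i' \<subseteq> {..<m}" using SH Hm unfolding M.asg_def by auto
  qed
  define c where "c = card (M.asg S home i)"
  have xI: "insert x (M.asg S home i) \<subseteq> M.asg (set hs) home i" using i xH SH unfolding M.asg_def by auto
  have xn: "x \<notin> M.asg S home i" using xS unfolding M.asg_def by simp
  have cn: "c < n - 1"
  proof -
  have "M.ind (M.asg (set hs) home i)" using gd unfolding good_def home_def by simp
  then have "M.ind (insert x (M.asg S home i))" using xI by (rule M.ind_subset)
  moreover have "insert x (M.asg S home i) \<subseteq> {..<m}" using xH SH Hm unfolding M.asg_def by auto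
  ultimately have "card (insert x (M.asg S home i)) <= n - 1" by (rule ind_card)
  then show ?thesis using xn finS[of i] unfolding c_def by simp
  qed
  \<comment> \<open>Tree \<open>i\<close> owns a block of \<open>n - 1\<close> cells. Since
    \<open>c < n - 1\<close>, the address stays in that block, and below \<open>m\<close> because
    \<open>k * (n - 1) \<le> m\<close>.\<close>
  define ad where "ad = i * (n - 1) + c"
  have adm: "ad < m"
  proof -
  have "ad < Suc i * (n - 1)" using cn unfolding ad_def by simp
  also have "\<dots> <= k * (n - 1)" using ik by (intro mult_le_mono1) simp
  finally show ?thesis using km by simp
  qed
  have c19: "ar s1 19 0 i = c" using j(2) ik unfolding c_def by simp
  define s2 where "s2 = s1\<lparr>rw := (rw s1)(ad := x), ar := put 19 0 i (Suc c) (ar s1), vr := (vr s1)(6 := x, 5 := i, 16 := Suc g),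
  ck := Suc (Suc (Suc (Suc (Suc (Suc (Suc (ck s1)))))))\<rparr>"
  have as: "M.asg (insert x S) home i' = (if i' = i then insert x (M.asg S home i) else M.asg S home i')" for i'
  using i unfolding M.asg_def by auto
  have "emit_inv hs s s2"
  unfolding emit_inv_def home_def[symmetric]
  proof (intro conjI allI impI)
  show "same_but {5, 6, 16, 28} {19} s s2" using j(1) unfolding same_but_def s2_def by simp
  show "vr s2 16 <= length hs" using gl unfolding s2_def by simp
  show "ck s2 + 8 * (length hs - vr s2 16) <= ck s + 8 * length hs" using j(3) lg unfolding s2_def by simp
  have v16: "vr s2 16 = Suc g" unfolding s2_def by simp
  fix i' assume i': "i' < k"
  have old: "ar s1 19 0 i' = card (M.asg S home i')" "(\<lambda>j. rw s1 (i' * (n - 1) + j)) ` {..<card (M.asg S home i')} = M.asg S home i'"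
  using j(2) i' by blast+
  show "ar s2 19 0 i' = card (M.asg (set (take (vr s2 16) hs)) home i')"
  unfolding v16 S' as using old(1) xn finS[of i] by (simp add: s2_def c_def)
  have same: "rw s2 (i' * (n - 1) + j) = rw s1 (i' * (n - 1) + j)" if "j < ar s1 19 0 i'" for j
  proof -
  have "j < n - 1" using that old(1) small[of i'] by simp
  from block_eq[OF this cn, of i' i] have "i' * (n - 1) + j ~= ad" using that c19 unfolding ad_def by auto
  then show ?thesis unfolding s2_def by simp
  qed
  have "(\<lambda>j. rw s2 (i' * (n - 1) + j)) ` {..<card (M.asg S home i')} = (\<lambda>j. rw s1 (i' * (n - 1) + j)) ` {..<card (M.asg S home i')}"
  by (intro image_cong) (use same old(1) in auto)
  then have im: "(\<lambda>j. rw s2 (i' * (n - 1) + j)) ` {..<card (M.asg S home i')} = M.asg S home i'" unfolding old(2) .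
  show "(\<lambda>j. rw s2 (i' * (n - 1) + j)) ` {..<card (M.asg (set (take (vr s2 16) hs)) home i')} = M.asg (set (take (vr s2 16) hs)) home i'"
  proof (cases "i' = i")
  case True
  have "card (insert x (M.asg S home i)) = Suc c" "rw s2 (i * (n - 1) + c) = x"
  using xn finS[of i] unfolding s2_def c_def ad_def by simp_all
  then show ?thesis unfolding v16 S' as using im True by (simp add: lessThan_Suc c_def)
  next
  case False
  then show ?thesis unfolding v16 S' as using im by simp
  qed
  qed
  moreover have "i * (n - 1) + c < rb" "i * (n - 1) + c < cap" "i * (n - 1) < cap" "Suc c < cap" "Suc g < cap"
  proof -
  show "i * (n - 1) + c < rb" "i * (n - 1) + c < cap" "i * (n - 1) < cap" using adm rb cap_m unfolding ad_def by simp_all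
  show "Suc g < cap" using gl lenm cap_m by simp
  show "Suc c < cap" using cn le_less_trans[OF le_square cap_n] by simp
  qed
  ultimately show ?thesis unfolding emit_step_def s2_def ad_def using v i c19 n2
  by (simp add: g_def[symmetric])
 qed
qed

lemma wp_emit:
 assumes e: "env hs s" and gd: "good (set hs) (ar s 15 0)" and rb: "m < rb"
  and Q: "\<And>s'. vr s' 0 = vr s 0 ==> vr s' 1 = 0 ==> \<forall>i<k. (\<lambda>j. rw s' (i * (n - 1) + j)) ` {..<card (M.asg (set hs) (ar s 15 0) i)} =
  M.asg (set hs) (ar s 15 0) i ==> ck s' <= ck s + 3 + 8 * length hs ==> Q s'"
 shows "wp emit Q s"
proof -
 define s1 where "s1 = s\<lparr>vr := (vr s)(16 := 0), ck := Suc (ck s)\<rparr>"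
 have s1: "vr s1 2 = n" "listing s1 hs" "good (set hs) (ar s1 15 0)" "vr s1 12 = length hs"
  using e gd unfolding env_def s1_def listing_def by simp_all
 have "wp (Loop (Less (Var 16) (Var 12)) emit_step) (wp (Asg 1 (Num 0)) Q) s1"
 proof (rule wp_Loop[where I = "emit_inv hs s1" and B = "ck s1 + 8 * length hs"])
  show "emit_inv hs s1 s1"
  using e unfolding emit_inv_def same_but_def env_def by (simp add: s1_def M.asg_def)
 next
  fix s' assume "emit_inv hs s1 s'"
  then show "ck s' <= ck s1 + 8 * length hs" unfolding emit_inv_def by simp
 next
  fix s' show "okb (Less (Var 16) (Var 12)) s'" by simp
 next
  fix s' assume J: "emit_inv hs s1 s'" and b: "bv (Less (Var 16) (Var 12)) s'"
  have "vr s' 12 = length hs" using J s1(4) unfolding emit_inv_def same_but_def by simp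
  then show "wp emit_step (emit_inv hs s1) (tick s')"
  using b by (intro wp_emit_step[OF J _ s1(1-3) rb]) simp
 next
  fix s' assume J: "emit_inv hs s1 s'" and b: "\<not> bv (Less (Var 16) (Var 12)) s'"
  have "vr s' 12 = length hs" "vr s' 16 <= length hs" using J s1(4) unfolding emit_inv_def same_but_def by simp_all
  then have all: "vr s' 16 = length hs" using b by simp
  have a: "ar s1 15 0 = ar s 15 0" "vr s1 0 = vr s 0" unfolding s1_def by simp_all
  note jj = J[unfolded emit_inv_def all a take_all[OF order.refl] diff_self_eq_0 mult_0_right add_0_right]
  note j = conjunct1[OF jj] conjunct2[OF conjunct2[OF conjunct2[OF jj]]] conjunct1[OF conjunct2[OF conjunct2[OF jj]]]
  define s2 where "s2 = s'\<lparr>vr := (vr s')(1 := 0), ck := Suc (Suc (ck s'))\<rparr>"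
  have "Q s2"
  proof (rule Q)
  show "vr s2 0 = vr s 0" using j(1) a(2) unfolding same_but_def s2_def by simp
  show "\<forall>i<k. (\<lambda>j. rw s2 (i * (n - 1) + j)) ` {..<card (M.asg (set hs) (ar s 15 0) i)} = M.asg (set hs) (ar s 15 0) i"
  using j(3) unfolding s2_def by simp
  qed (use j(2) in \<open>simp_all add: s2_def s1_def\<close>)
  then show "wp (Asg 1 (Num 0)) Q (tick s')" unfolding s2_def by simp
 qed
 then show ?thesis unfolding emit_def s1_def by simp
qed

section \<open>Correctness of both verdicts\<close>

definition solvable :: "(nat => nat set) => bool" where
 "solvable T \<longleftrightarrow> M.packs k {..<m} T & (\<forall>i<k. card (T i) = n - 1)"

lemma solvable_of_full:
 assumes g: "good H home" and full: "assigned H home = k * (n - 1)"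
 shows "solvable (M.asg H home)"
proof -
 have H: "H \<subseteq> {..<m}" "\<And>i. M.ind (M.asg H home i)" using g unfolding good_def by simp_all
 have le: "card (M.asg H home i) <= n - 1" for i
  by (rule ind_card[OF H(2)]) (use H(1) in \<open>auto simp: M.asg_def\<close>)
 have "card (M.asg H home i) = n - 1" if "i < k" for i
 proof (rule ccontr)
  assume "card (M.asg H home i) ~= n - 1"
  then have "card (M.asg H home i) < n - 1" using le[of i] by simp
  then have "(\<Sum>i<k. card (M.asg H home i)) < (\<Sum>i<k. n - 1)"
  using le that by (intro sum_strict_mono_ex1) auto
  then show False using full unfolding assigned_sum(1)[OF g] by simp
 qed
 moreover have "M.packs k {..<m} (M.asg H home)" using assigned_sum(4)[OF g] H(1) unfolding M.packs_def by blast
 ultimately show ?thesis unfolding solvable_def by simp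
qed

lemma not_solvable_of_stuck:
 assumes g: "good H home" and st: "stuck H home" and less: "assigned H home ~= k * (n - 1)"
  and F: "M.sparse L F {..<m}" and H: "H = (\<Union>j<L. F j)"
 shows "\<not> solvable T"
proof
 assume T: "solvable T"
 obtain X where X: "X \<subseteq> H" "\<forall>i<k. X \<subseteq> espan ep (M.asg H home i \<inter> X)" "H - X \<subseteq> (\<Union>i<k. M.asg H home i)"
  using st unfolding stuck_def by blast
 have Hm: "H \<subseteq> {..<m}" using g unfolding good_def by simp
 then have fin: "finite H" by (rule finite_subset) simp
 have f: "\<forall>i j. i < j --> j < L --> F i \<inter> F j = {}" "\<forall>j. Suc j < L --> F (Suc j) \<subseteq> espan ep (F j)"
  "{..<m} - (\<Union>j<L. F j) \<subseteq> espan ep (F (L - 1))" using F unfolding M.sparse_def by simp_all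
 have rk: "M.rk H < 2 ^ Suc lg"
 proof -
  obtain B where B: "B \<subseteq> H" "M.ind B" "M.rk H = card B" by (rule M.basis_exists[OF fin])
  have "M.rk H <= n - 1" unfolding B(3) by (rule ind_card[OF B(2)]) (use B(1) Hm in blast)
  also have "\<dots> < 2 ^ Suc lg" using lg n2 by simp
  finally show ?thesis .
 qed
 have "F (L - 1) \<subseteq> espan ep X"
  by (rule M.sparsifier_span[where k = k and H = H and F = F and lg = "Suc lg" and I = "M.asg H home"])
  (use assigned_sum(4)[OF g] fin f X rk L k1 H in auto)
 then have "espan ep (F (L - 1)) \<subseteq> espan ep X" by (rule M.sp_least)
 then have out: "{..<m} - H \<subseteq> espan ep X" using f(3) unfolding H by (rule order_trans[rotated])
 have "(\<Sum>i<k. card (T i)) <= (\<Sum>i<k. card (M.asg H home i))"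
  by (rule M.packing_optimal[OF assigned_sum(4)[OF g], of "{..<m}" T X]) (use T Hm X out in \<open>simp_all add: solvable_def\<close>)
 moreover have "(\<Sum>i<k. card (T i)) = k * (n - 1)" using T unfolding solvable_def by simp
 ultimately show False using less assigned_sum(1,3)[OF g] by simp
qed

theorem wp_solve:
 assumes s: "vr s 2 = n" "vr s 3 = m" "vr s 4 = k" "vr s 14 = L" "vr s 15 = D" "edges s"
  and zero: "ar s 14 0 = (\<lambda>_. 0)" "ar s 15 0 = (\<lambda>_. 0)" "ar s 19 0 = (\<lambda>_. 0)" and rb: "m < rb"
  and Q: "\<And>s'. vr s' 1 = 0 ==> ck s' <= ck s + solve_cost n m k L D w ==>
  vr s' 0 = 1 & solvable (\<lambda>i. (\<lambda>j. rw s' (i * (n - 1) + j)) ` {..<n - 1}) \<or> vr s' 0 = 0 & (\<nexists>T. solvable T) ==> Q s'"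
 shows "wp solve Q s"
proof -
 have "wp sparsify (wp (push_relabel ;; augmentation ;; emit) Q) s"
 proof (rule wp_sparsify[OF s(1,2,4,6)])
  fix s1 :: st and F hs
  assume s1: "\<forall>x<30. x \<notin> {5, 6, 7, 8, 9, 10, 11, 12} --> vr s1 x = vr s x" "rw s1 = rw s"
  "\<forall>t p. 10 < t & t ~= 13 --> ar s1 t p = ar s t p"
  and F: "M.sparse L F {..<m}" and l1: "listing s1 hs" and hs: "set hs = (\<Union>j<L. F j)"
  and c1: "ck s1 <= ck s + 10 + L * (11 * n + 4 + 40 * (n * floor_log n)) + m * (60 + 5 * w)"
  have Hm: "set hs \<subseteq> {..<m}" using F unfolding hs M.sparse_def by auto
  have len: "length hs <= L * n"
  proof -
  have "length hs = card (set hs)" using l1 distinct_card unfolding listing_def by fastforce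
  also have "\<dots> <= (\<Sum>j<L. card (F j))" unfolding hs by (rule card_UN_le) simp
  also have "\<dots> <= (\<Sum>j<L. n)"
  proof (rule sum_mono)
  fix j assume "j \<in> {..<L}"
  then have "M.ind (F j)" "F j \<subseteq> {..<m}" using F unfolding M.sparse_def by simp_all
  then have "card (F j) <= n - 1" by (rule ind_card)
  then show "card (F j) <= n" by simp
  qed
  finally show ?thesis by simp
  qed
  have v1: "vr s1 2 = n" "vr s1 4 = k" "vr s1 15 = D" "edges s1" "ar s1 14 0 = (\<lambda>_. 0)" "ar s1 15 0 = (\<lambda>_. 0)" "ar s1 19 0 = (\<lambda>_. 0)"
  using s s1 zero unfolding edges_def by simp_all
  have "wp push_relabel (wp (augmentation ;; emit) Q) s1"
  proof (rule wp_push_relabel[OF v1(1-4) l1 Hm v1(5,6)])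
  fix s2 :: st
  assume s2: "\<forall>x<30. x \<notin> {5, 6, 7, 8, 9, 10, 11, 16, 17, 18} --> vr s2 x = vr s1 x" "rw s2 = rw s1"
  "\<forall>t p. 10 < t & t ~= 14 & t ~= 15 --> ar s2 t p = ar s1 t p"
  and P: "M.pushrel (set hs) k D (ar s2 14 0) (ar s2 15 0) {}" and lev: "\<forall>x\<in>set hs. ar s2 14 0 x ~= 0"
  and c2: "ck s2 <= ck s1 + 10 + D * k * (11 * n + 4 + 40 * (n * floor_log n)) +
  (100 + 5 * w) * (D * k * n + length hs * Suc D) + 20 * length hs"
  have e2: "env hs s2" using v1 l1 s2 unfolding env_def listing_def edges_def by simp
  have "wp augmentation (wp emit Q) s2"
  proof (rule wp_augmentation[OF e2 P lev Hm])
  fix s3 :: st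
  assume s3: "same_but aug_vars {15, 16, 17} s2 s3" "good (set hs) (ar s3 15 0)" "settled (set hs) s3"
  "ck s3 <= ck s2 + 2 + Suc D * round_cost (length hs)"
  have e3: "env hs s3" using e2 s3(1) unfolding env_def listing_def edges_def same_but_def by simp
  show "wp emit Q s3"
  proof (rule wp_emit[OF e3 s3(2) rb])
  fix s4 :: st
  assume s4: "vr s4 0 = vr s3 0" "vr s4 1 = 0" "ck s4 <= ck s3 + 3 + 8 * length hs"
  and o: "\<forall>i<k. (\<lambda>j. rw s4 (i * (n - 1) + j)) ` {..<card (M.asg (set hs) (ar s3 15 0) i)} = M.asg (set hs) (ar s3 15 0) i"
  let ?I = "M.asg (set hs) (ar s3 15 0)" and ?O = "\<lambda>i. (\<lambda>j. rw s4 (i * (n - 1) + j)) ` {..<n - 1}"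
  show "Q s4"
  proof (rule Q)
  show "vr s4 1 = 0" by fact
  show "vr s4 0 = 1 & solvable ?O \<or> vr s4 0 = 0 & (\<nexists>T. solvable T)"
  proof (cases "assigned (set hs) (ar s3 15 0) = k * (n - 1)")
  case True
  have sI: "solvable ?I" by (rule solvable_of_full[OF s3(2) True])
  have "?O i = ?I i" if "i < k" for i using o sI that unfolding solvable_def by simp
  then have "solvable ?O" using sI unfolding solvable_def M.packs_def by simp
  then show ?thesis using s3(3) True s4(1) unfolding settled_def by simp
  next
  case False
  then have "stuck (set hs) (ar s3 15 0)" "vr s3 0 = 0" using s3(3) unfolding settled_def by simp_all
  with not_solvable_of_stuck[OF s3(2) _ False F hs] show ?thesis using s4(1) by simp
  qed
  have "(100 + 5 * w) * (D * k * n + length hs * Suc D) <= (100 + 5 * w) * (D * k * n + L * n * Suc D)"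
  using len by (intro mult_left_mono add_left_mono mult_right_mono) simp_all
  moreover have "Suc D * round_cost (length hs) <= Suc D * (Suc k * init_cost n + 180 * (L * n) + (60 + 30 * k) * n + 100)"
  using len unfolding round_cost_def init_cost_def by (intro mult_left_mono add_right_mono add_left_mono) simp_all
  ultimately show "ck s4 <= ck s + solve_cost n m k L D w"
  using c1 c2 s3(4) s4(3) len unfolding solve_cost_def init_cost_def[symmetric] by linarith
  qed
  qed
  qed
  then show "wp (augmentation ;; emit) Q s2" by simp
  qed
  then show "wp (push_relabel ;; augmentation ;; emit) Q s1" by simp
 qed
 then show ?thesis unfolding solve_def by simp
qed

end

section \<open>Spanning trees and independent edge sets\<close>

text \<open>The edge names from \<open>length es\<close> on form a star around vertex 0, which is a basis of the complete graph.\<close>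

definition ends_of :: "(nat \<times> nat) list => nat => nat \<times> nat" where
 "ends_of es e = (if e < length es then es ! e else (0, e - length es))"

locale input =
 fixes n :: nat and es :: "(nat \<times> nat) list" and k :: nat
 assumes graph: "is_graph n es" and n2: "2 <= n"

sublocale input \<subseteq> M: matroid "espan (ends_of es)"
 by (rule graphic.matroid_axioms)

context input
begin

abbreviation "m \<equiv> length es"
abbreviation "ep \<equiv> ends_of es"

lemma ep_less: "e < m ==> fst (ep e) < n & snd (ep e) < n"
 using graph nth_mem[of e es] unfolding is_graph_def ends_of_def by (cases "es ! e") auto

lemma ep_star: "ep (m + v) = (0, v)"
 unfolding ends_of_def by simp

text \<open>Starts behind \<open>m\<close> because the edge named \<open>m\<close> is a loop at
  vertex 0.\<close>

abbreviation "star \<equiv> {Suc m..<m + n}"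

lemma card_star: "card star = n - 1"
 by simp

lemma star_conn: "u < n ==> v < n ==> (u, v) \<in> conn ep star"
proof -
 have z: "(0, v) \<in> conn ep star" if "v < n" for v
 proof (cases "v = 0")
  case False
  then have "m + v \<in> star" using that by auto
  from conn_edge[OF this, of ep] show ?thesis unfolding ep_star .
 qed simp
 assume "u < n" "v < n"
 then show ?thesis using conn_trans[OF conn_sym[OF z] z] by simp
qed

lemma rank_le:
 assumes "M.ind J" "\<And>e. e \<in> J ==> fst (ep e) < n & snd (ep e) < n"
 shows "card J <= n - 1"
proof -
 have "J \<subseteq> espan ep star"
 proof
  fix e assume "e \<in> J"
  then show "e \<in> espan ep star" using star_conn[of "fst (ep e)" "snd (ep e)"] assms(2)[of e] unfolding espan_def by simp
 qed
 then have "card J <= card star" using assms(1) by (intro M.steinitz) auto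
 then show ?thesis unfolding card_star .
qed

text \<open>Without the edge \<open>m + v\<close> no star edge touches \<open>v\<close>, so
  \<open>v\<close> is connected to nothing but itself.\<close>

lemma ind_star: "M.ind star"
 unfolding M.ind_def
proof (intro conjI ballI)
 fix e assume "e \<in> star"
 then obtain v where v: "e = m + v" "0 < v" using that[of "e - m"] by auto
 have "(x, y) \<in> conn ep (star - {e}) ==> x = v \<longleftrightarrow> y = v" for x y
  unfolding conn_def
 proof (induction rule: rtrancl_induct)
  case (step y z)
  have "y ~= v & z ~= v" using step(2) v by (auto simp: ends_of_def)
  then show ?case using step(3) by simp
 qed simp
 from this[of 0 v] have "(0, v) \<notin> conn ep (star - {e})" using v(2) by auto
 then show "e \<notin> espan ep (star - {e})" using ep_star[of v] unfolding espan_def v(1)[symmetric] by simp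
qed simp

lemma conn_edge_ends:
 assumes "F \<subseteq> {..<m}"
 shows "{(x, y). \<exists>e\<in>F. edge_ends es e = {x, y}}\<^sup>* = conn ep F"
proof -
 have e: "edge_ends es e = {x, y} \<longleftrightarrow> ep e = (x, y) \<or> ep e = (y, x)" if "e \<in> F" for e x y
  using that assms unfolding edge_ends_def ends_of_def by (cases "es ! e") (auto simp: doubleton_eq_iff)
 have "(x, y) \<in> {(x, y). \<exists>e\<in>F. edge_ends es e = {x, y}} \<longleftrightarrow> (x, y) \<in> ep ` F \<union> (ep ` F)\<inverse>" for x y
  using e by (auto simp: image_iff) (metis)+
 then have "{(x, y). \<exists>e\<in>F. edge_ends es e = {x, y}} = ep ` F \<union> (ep ` F)\<inverse>" by auto
 then show ?thesis unfolding conn_def by simp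
qed

text \<open>All edges of a cycle but the last form a path between the ends of the last edge, which
  is therefore spanned by the others. For a loop this path is empty.\<close>

lemma acyclic_of_ind:
 assumes ind: "M.ind F" and F: "F \<subseteq> {..<m}"
 shows "acyclic_edges F (edge_ends es)"
 unfolding acyclic_edges_def
proof (intro notI, elim exE)
 fix vs cs assume c: "is_cycle F (edge_ends es) vs cs"
 obtain l where l: "length vs = Suc l" "length cs = Suc l" using c unfolding is_cycle_def by (cases vs) auto
 have ce: "edge_ends es (cs ! i) = {vs ! i, vs ! (Suc i mod Suc l)}" if "i < Suc l" for i
  using c that l unfolding is_cycle_def by simp
 have cF: "cs ! i \<in> F" if "i < Suc l" for i using c that l nth_mem[of i cs] unfolding is_cycle_def by auto
 define e where "e = cs ! l"
 have path: "i <= l ==> (vs ! 0, vs ! i) \<in> conn ep (F - {e})" for i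
 proof (induction i)
  case (Suc i)
  have "cs ! i ~= e" unfolding e_def using c l Suc.prems nth_eq_iff_index_eq[of cs i l] unfolding is_cycle_def by simp
  then have "cs ! i \<in> F - {e}" using cF[of i] Suc.prems by simp
  moreover have "edge_ends es (cs ! i) = {vs ! i, vs ! Suc i}" using ce[of i] Suc.prems by simp
  ultimately have "(vs ! i, vs ! Suc i) \<in> {(x, y). \<exists>e'\<in>F - {e}. edge_ends es e' = {x, y}}\<^sup>*" by (intro r_into_rtrancl) blast
  moreover have "F - {e} \<subseteq> {..<m}" using F by blast
  ultimately have "(vs ! i, vs ! Suc i) \<in> conn ep (F - {e})" using conn_edge_ends by simp
  then show ?case using Suc conn_trans by (meson Suc_leD)
 qed simp
 have "edge_ends es e = {vs ! l, vs ! 0}" using ce[of l] unfolding e_def by simp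
 then have "ep e = (vs ! l, vs ! 0) \<or> ep e = (vs ! 0, vs ! l)"
  using cF[of l] F unfolding e_def edge_ends_def ends_of_def by (cases "es ! (cs ! l)") (auto simp: doubleton_eq_iff)
 then have "e \<in> espan ep (F - {e})" unfolding espan_def using path[of l] conn_sym[OF path[of l]] by auto
 then show False using M.ind_not_span[OF ind, of e] cF[of l] unfolding e_def by simp
qed

text \<open>If 0 were not connected to \<open>v\<close>, adding the star edge of \<open>v\<close>
  would give \<open>n\<close> independent edges, more than the rank allows.\<close>

lemma connected_of_ind:
 assumes ind: "M.ind F" and F: "F \<subseteq> {..<m}" and card: "card F = n - 1"
 shows "connected_by {..<n} F (edge_ends es)"
proof -
 have z: "(0, v) \<in> conn ep F" if v: "v < n" for v
 proof (rule ccontr)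
  assume "(0, v) \<notin> conn ep F"
  then have "m + v \<notin> espan ep F" unfolding espan_def by (simp add: ep_star)
  then have "M.ind (insert (m + v) F)" by (rule M.ind_insert[OF ind])
  then have "card (insert (m + v) F) <= n - 1"
  proof (rule rank_le)
  fix e assume "e \<in> insert (m + v) F"
  then show "fst (ep e) < n & snd (ep e) < n" using ep_less[of e] F v n2 ep_star[of v] by auto
  qed
  moreover have "m + v \<notin> F" using F by auto
  ultimately show False using card n2 M.ind_finite[OF ind] by simp
 qed
 have "(u, v) \<in> conn ep F" if "u < n" "v < n" for u v using conn_trans[OF conn_sym[OF z] z] that by simp
 then show ?thesis unfolding connected_by_def conn_edge_ends[OF F] using n2 by (auto simp: lessThan_empty_iff)
qed

definition packing :: "(nat => nat set) => bool" where
 "packing T \<longleftrightarrow> M.packs k {..<m} T & (\<forall>i<k. card (T i) = n - 1)"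

lemma trees_of_packing: "packing T ==> are_disjoint_trees n es k T"
 unfolding are_disjoint_trees_def edge_disjoint_spanning_trees_def spanning_tree_def packing_def M.packs_def
 using acyclic_of_ind connected_of_ind by simp

text \<open>A basis of a connected edge set spans the star, so it has exactly \<open>n - 1\<close>
  edges; choosing one basis inside each tree keeps the sets disjoint.\<close>

lemma packing_of_trees:
 assumes T: "are_disjoint_trees n es k T"
 shows "\<exists>J. packing J"
proof -
 have "\<exists>J\<subseteq>T i. M.ind J & card J = n - 1" if i: "i < k" for i
 proof -
  have t: "T i \<subseteq> {..<m}" "connected_by {..<n} (T i) (edge_ends es)"
  using T i unfolding are_disjoint_trees_def edge_disjoint_spanning_trees_def spanning_tree_def by auto
  obtain B where B: "B \<subseteq> T i" "M.ind B" "T i \<subseteq> espan ep B"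
  by (rule M.basis_exists[OF finite_subset[OF t(1) finite_lessThan]])
  have "conn ep (T i) \<subseteq> conn ep B" by (rule conn_least) (use B(3) in \<open>auto simp: espan_def\<close>)
  moreover have "(0, v) \<in> conn ep (T i)" if "v < n" for v
  using t(2) that n2 unfolding connected_by_def conn_edge_ends[OF t(1)] by simp
  ultimately have z: "(0, v) \<in> conn ep B" if "v < n" for v using that by blast
  have "star \<subseteq> espan ep B"
  proof
  fix x assume "x \<in> star"
  then have "m + (x - m) = x" "x - m < n" by auto
  then show "x \<in> espan ep B" using z[of "x - m"] ep_star[of "x - m"] unfolding espan_def by simp
  qed
  then have "card star <= card B" by (rule M.steinitz[OF M.ind_finite[OF B(2)] ind_star])
  moreover have "card B <= n - 1" by (rule rank_le[OF B(2)]) (use B(1) t(1) ep_less in auto)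
  ultimately show ?thesis using B(1,2) unfolding card_star by auto
 qed
 then obtain J where J: "\<And>i. i < k ==> J i \<subseteq> T i & M.ind (J i) & card (J i) = n - 1" by metis
 have T': "\<forall>i<k. T i \<subseteq> {..<m}" "\<forall>i<k. \<forall>j<k. i ~= j --> T i \<inter> T j = {}"
  using T unfolding are_disjoint_trees_def edge_disjoint_spanning_trees_def spanning_tree_def by auto
 have "\<forall>i<k. \<forall>j<k. i ~= j --> J i \<inter> J j = {}"
 proof (intro allI impI)
  fix i j assume "i < k" "j < k" "i ~= j"
  then show "J i \<inter> J j = {}" using J[of i] J[of j] T'(2) by blast
 qed
 moreover have "J i \<subseteq> {..<m}" if "i < k" for i using J[OF that] T'(1) that by blast
 ultimately show ?thesis unfolding packing_def M.packs_def using J by blast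
qed

lemma packing_size:
 assumes "packing J"
 shows "k * (n - 1) <= m"
proof -
 have J: "M.packs k {..<m} J" "\<And>i. i < k ==> card (J i) = n - 1" using assms unfolding packing_def by auto
 have "card (\<Union>i<k. J i \<inter> UNIV) = (\<Sum>i<k. card (J i \<inter> UNIV))" by (rule M.card_packed[OF J(1)]) simp
 moreover have "(\<Union>i<k. J i) \<subseteq> {..<m}" using J(1) unfolding M.packs_def by auto
 ultimately show ?thesis using card_mono[of "{..<m}" "\<Union>i<k. J i"] J(2) by simp
qed

end

section \<open>The complete program\<close>

definition read_edges :: com where
 "read_edges = Asg 6 (Num 0) ;; Loop (Less (Var 6) (Var 3))
  (Put 11 (Num 0) (Var 6) (Raw (Plus (Plus (Var 6) (Var 6)) (Num 3))) ;;
  Put 12 (Num 0) (Var 6) (Raw (Plus (Plus (Var 6) (Var 6)) (Num 4))) ;; Asg 6 (Plus (Var 6) (Num 1)))"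

definition compute_levels :: com where
 "compute_levels = Asg 7 (Num 1) ;; Asg 14 (Num 1) ;;
  Loop (Less (Var 7) (Var 2)) (Asg 7 (Plus (Var 7) (Var 7)) ;; Asg 14 (Plus (Var 14) (Num 1))) ;;
  Asg 14 (Times (Times (Num 2) (Var 4)) (Var 14))"

definition compute_depth :: com where
 "compute_depth = Asg 15 (Num 1) ;; Loop (Less (Times (Var 15) (Var 15)) (Times (Var 4) (Var 2))) (Asg 15 (Plus (Var 15) (Num 1)))"

text \<open>\<open>k\<close> disjoint trees need \<open>k * (n - 1)\<close> edges. Rejecting smaller
  graphs at once ensures that the output fits into the input area, and, for
  \<open>n \<ge> 2\<close>, that \<open>k \<le> m\<close>, which the time bound relies on.\<close>

definition main :: com where
 "main = Cond (Eq (Var 4) (Num 0)) (Asg 0 (Num 1))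
  (Cond (Less (Var 3) (Times (Var 4) (Minus (Var 2) (Num 1)))) (Asg 0 (Num 0))
  (read_edges ;; compute_levels ;; compute_depth ;; solve))"

text \<open>Loads \<open>n\<close>, \<open>m\<close> and \<open>k\<close> and sets \<open>cap = (n + m + k + 2) ^ 4\<close> and \<open>rb = 2 m + 3\<close>.\<close>

definition prologue :: program where
 "prologue = [Const 102 0, Load 2 102, Const 102 1, Load 3 102, Const 102 2, Load 4 102,
  Op Add 103 2 3, Op Add 103 103 4, Op Add 103 103 102, Op Mul 103 103 103, Op Mul 100 103 103,
  Op Add 101 3 3, Const 102 3, Op Add 101 101 102]"

definition prog :: program where
 "prog = prologue @ ccom 14 main"

lemma wfc_main: "wfc main"
 unfolding main_def read_edges_def compute_levels_def compute_depth_def solve_def emit_def emit_step_def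
  augmentation_def augmentation_round_def setup_round_def setup_step_def search_round_def process_def forests_def
  forests_step_def augment_def label_loop_def label_step_def push_relabel_def token_step_def token_kick_def
  sparsify_def sparsify_step_def search_def init_all_def init_one_def contract_def merge_end_def merge_relabel_def
  merge_begin_def pick_def link_def link_end_def link_evert_def link_mid_def link_relabel_def link_begin_def
 by simp

lemma fold_prologue:
 assumes M: "M 0 = n" "M (Suc 0) = m" "M 2 = k" and X: "n + m + k + 2 = X"
  and small: "X < 2 ^ w" "X * X < 2 ^ w" "X * X * (X * X) < 2 ^ w" "m + m + 3 < 2 ^ w" "0 < w"
 shows "fold (sx w) prologue (\<lambda>_. 0, M) =
  ((\<lambda>_. 0)(2 := n, 3 := m, 4 := k, 103 := X * X, 100 := X * X * (X * X), 101 := m + m + 3, 102 := 3), M)"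
proof -
 have 1: "(n + m) mod 2 ^ w = n + m" "(n + m + k) mod 2 ^ w = n + m + k" "X mod 2 ^ w = X" "(X * X) mod 2 ^ w = X * X"
  "(X * X * (X * X)) mod 2 ^ w = X * X * (X * X)" "(m + m) mod 2 ^ w = m + m" "(m + m + 3) mod 2 ^ w = m + m + 3"
  "0 mod 2 ^ w = (0::nat)" "1 mod 2 ^ w = (1::nat)" "2 mod 2 ^ w = (2::nat)" "3 mod 2 ^ w = (3::nat)"
  using small X by (intro mod_less; linarith)+
 have "fold (sx w) prologue (\<lambda>_. 0, M) = ((\<lambda>_. 0)(102 := 0, 2 := n, 102 := 1, 3 := m, 102 := 2, 4 := k, 103 := n + m, 103 := n + m + k,
  103 := X, 103 := X * X, 100 := X * X * (X * X), 101 := m + m, 102 := 3, 101 := m + m + 3), M)"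
  unfolding prologue_def by (simp only: fold_simps sx.simps apply_op.simps wrap_def fun_upd_apply M One_nat_def[symmetric] refl if_True
  numeral_eq_iff num.distinct num.inject if_False simp_thms X M(2)[unfolded One_nat_def[symmetric]] 1)
 also have "\<dots> = ((\<lambda>_. 0)(2 := n, 3 := m, 4 := k, 103 := X * X, 100 := X * X * (X * X), 101 := m + m + 3, 102 := 3), M)"
  by (simp add: fun_eq_iff)
 finally show ?thesis .
qed

lemma pairs_nth:
 "length (concat (map (\<lambda>(u, v). [u, v]) es)) = 2 * length es"
 "i < length es ==> concat (map (\<lambda>(u, v). [u, v]) es) ! (2 * i) = fst (es ! i) &
  concat (map (\<lambda>(u, v). [u, v]) es) ! Suc (2 * i) = snd (es ! i)"
proof (induction es arbitrary: i)
 case (Cons e es)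
 { case 1 show ?case using Cons(1) by (cases e) simp }
 { case 2 then show ?case using Cons(2)[of "i - 1"] by (cases e; cases i) auto }
qed simp_all

lemma cost_arith:
 fixes n k s lam l D w f m :: real
 assumes n: "1 <= n" and k: "1 <= k" and s: "1 <= s" "s * s = k * n" and lam: "1 <= lam" and l: "0 <= l" "l <= 3 * lam"
  and D: "0 <= D" "D <= 2 * s" and w: "0 <= w" "w <= 5 * lam" and f: "0 <= f" "f <= lam" and m: "0 <= m"
 shows "20 + 4 * m + 3 * l + 2 * D + (30 + 2 * k * l * (11 * n + 4 + 40 * (n * f)) + m * (60 + 5 * w) + D * k * (11 * n + 4 + 40 * (n * f)) +
  (100 + 5 * w) * (D * k * n + 2 * k * l * n * (D + 1)) + 30 * (2 * k * l * n) +
  (D + 1) * ((k + 1) * (11 * n + 4 + 40 * (n * f)) + 180 * (2 * k * l * n) + (60 + 30 * k) * n + 100))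
  <= 12000 * (m + s * s * s + 1) * lam ^ 2"
proof -
 define i where "i = 11 * n + 4 + 40 * (n * f)"
 define p where "p = k * n"
 define S where "S = s * p"
 define Z where "Z = lam * lam"
 define q where "q = p * lam"
 define V where "V = S * lam"
 have "n <= p" using mult_right_mono[OF k, of n] n unfolding p_def by simp
 then have np: "n <= p" "1 <= p" using n by linarith+
 have S: "p <= S" "s <= S" using mult_right_mono[OF s(1), of p] mult_left_mono[OF np(2), of s] np s unfolding S_def by simp_all
 have "lam <= Z" using mult_right_mono[OF lam, of lam] lam unfolding Z_def by simp
 then have Z: "lam <= Z" "1 <= Z" using lam by linarith+
 have pq: "p <= q" using mult_left_mono[OF lam, of p] np unfolding q_def by simp
 have V: "S <= V" "V <= S * Z" "p * Z <= S * Z"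
  using mult_left_mono[OF lam, of S] mult_left_mono[OF Z(1), of S] mult_right_mono[OF S(1), of Z] S s Z unfolding V_def by simp_all
 have mZ: "m <= m * lam" "m * lam <= m * Z" using mult_left_mono[OF lam, of m] mult_left_mono[OF Z(1), of m] m by simp_all
 have i0: "0 <= i" unfolding i_def using n f by simp
 have "n <= n * lam" using mult_left_mono[OF lam, of n] n by simp
 then have nl: "1 <= n * lam" "n <= n * lam" using n by linarith+
 have "n * f <= n * lam" using mult_left_mono[OF f(2), of n] n by simp
 then have i: "i <= 55 * (n * lam)" unfolding i_def using nl by linarith
 have ki: "k * i <= 55 * q" using mult_left_mono[OF i, of k] k unfolding q_def p_def by (simp add: algebra_simps)
 have ki0: "0 <= k * i" "i <= k * i" using mult_right_mono[OF k i0] i0 k by simp_all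
 have q0: "0 <= q" using pq np by simp
 have sq: "s * q = V" unfolding V_def S_def q_def by simp
 have a1: "2 * k * l * i <= 330 * (p * Z)"
 proof -
  have "l * (k * i) <= (3 * lam) * (55 * q)" by (rule mult_mono[OF l(2) ki]) (use lam ki0 in simp_all)
  then show ?thesis unfolding q_def Z_def by (simp add: algebra_simps)
 qed
 have a2: "2 * k * l * n <= 6 * q" "0 <= 2 * k * l * n"
  using mult_right_mono[OF l(2), of p] np k n l unfolding q_def p_def by (simp_all add: algebra_simps)
 have a3: "D * k * i <= 110 * V"
 proof -
  have "D * (k * i) <= (2 * s) * (55 * q)" by (rule mult_mono[OF D(2) ki]) (use s ki0 in simp_all)
  then show ?thesis using sq by (simp add: algebra_simps)
 qed
 have a4: "m * (60 + 5 * w) <= 85 * (m * lam)" using mult_left_mono[of "60 + 5 * w" "85 * lam" m] w lam m by (simp add: algebra_simps)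
 have D1: "D + 1 <= 3 * s" using D s by simp
 have Dp: "D * k * n <= 2 * V" using mult_right_mono[OF D(2), of p] np V unfolding S_def p_def by (simp add: algebra_simps)
 have DL: "2 * k * l * n * (D + 1) <= 18 * V"
 proof -
  have "2 * k * l * n * (D + 1) <= (6 * q) * (3 * s)" by (rule mult_mono[OF a2(1) D1]) (use q0 D in simp_all)
  then show ?thesis using sq by (simp add: algebra_simps)
 qed
 have a5: "(100 + 5 * w) * (D * k * n + 2 * k * l * n * (D + 1)) <= 2500 * (S * Z)"
 proof -
  have "(100 + 5 * w) * (D * k * n + 2 * k * l * n * (D + 1)) <= (125 * lam) * (20 * V)"
  by (rule mult_mono) (use w lam Dp DL a2 D k n in simp_all)
  then show ?thesis unfolding V_def Z_def by (simp add: algebra_simps)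
 qed
 have a6: "(D + 1) * ((k + 1) * i + 180 * (2 * k * l * n) + (60 + 30 * k) * n + 100) <= 4140 * V"
 proof -
  have "(k + 1) * i <= 110 * q" using ki ki0 by (simp add: algebra_simps)
  moreover have "(60 + 30 * k) * n <= 90 * q" using np pq unfolding p_def by (simp add: algebra_simps)
  ultimately have "(k + 1) * i + 180 * (2 * k * l * n) + (60 + 30 * k) * n + 100 <= 1380 * q" using a2 np pq by linarith
  then have "(D + 1) * ((k + 1) * i + 180 * (2 * k * l * n) + (60 + 30 * k) * n + 100) <= (3 * s) * (1380 * q)"
  using s D1 i0 a2 k n by (intro mult_mono) simp_all
  then show ?thesis using sq by (simp add: algebra_simps)
 qed
 have qV: "q <= V" using mult_right_mono[OF S(1), of lam] lam unfolding q_def V_def by simp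
 have SS: "s * s * s = S" unfolding S_def p_def using s(2) by (simp add: mult.commute)
 have "12000 * (m + S + 1) * lam ^ 2 = 12000 * (m * Z) + 12000 * (S * Z) + 12000 * Z"
  unfolding Z_def by (simp add: algebra_simps power2_eq_square)
 then show ?thesis unfolding SS i_def[symmetric] using a1 a2 a3 a4 a5 a6 qV V mZ m Z S l D np by linarith
qed

section \<open>Choice of the parameters and the main program\<close>

context input
begin

definition X :: nat where "X = n + m + k + 2"
text \<open>The fourth power leaves room for squaring the counter in the computation of the depth,
  which is only known to be at most \<open>k * n < X * X\<close>.\<close>

definition cap :: nat where "cap = X * X * (X * X)"
definition rb :: nat where "rb = 2 * m + 3"

sublocale P: imp cap rb .

lemma caps: "X * X < cap" "X * X * X < cap" "16 <= X * X" "n < X" "m < X" "k < X" "k * n < X * X" "4 < cap" "4 <= X"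
  "X < cap" "a <= X * X ==> 8 * a < cap"
proof -
 show X: "4 <= X" using n2 unfolding X_def by simp
 show X2: "16 <= X * X" using mult_le_mono[OF X X] by simp
 define Y where "Y = X * X"
 have Y: "16 <= Y" using X2 unfolding Y_def .
 have c8: "8 * a < cap" if "a <= Y" for a
 proof -
  have "8 * a <= 8 * Y" using that by simp
  also have "\<dots> < Y * Y" using Y by simp
  finally show ?thesis unfolding cap_def Y_def .
 qed
 then show "a <= X * X ==> 8 * a < cap" unfolding Y_def .
 show "X * X < cap" using c8[of Y] Y unfolding Y_def[symmetric] by simp
 then show "4 < cap" "X < cap" using X2 le_square[of X] by linarith+
 have "Y * X < Y * Y" using Y X mult_le_mono2[of 4 X X] unfolding Y_def by (intro mult_strict_left_mono) simp_all
 then show "X * X * X < cap" unfolding cap_def Y_def .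
 show "n < X" "m < X" "k < X" unfolding X_def by simp_all
 then show "k * n < X * X" by (intro mult_strict_mono) simp_all
qed

text \<open>The zero arrays come from the memory behind the input, which is 0 initially; levels,
  homes and output counters start from these zeros.\<close>

definition begun :: "st => bool" where
 "begun s \<longleftrightarrow> vr s 2 = n & vr s 3 = m & vr s 4 = k & (\<forall>t. t ~= 11 & t ~= 12 --> ar s t 0 = (\<lambda>_. 0)) &
  (\<forall>i<m. rw s (2 * i + 3) = fst (es ! i) & rw s (2 * i + 4) = snd (es ! i))"

lemma wp_read_edges:
 assumes b: "begun s"
  and Q: "\<And>s'. begun s' ==> \<forall>i<m. ar s' 11 0 i = fst (es ! i) & ar s' 12 0 i = snd (es ! i) ==> ck s' <= ck s + 2 + 4 * m ==> Q s'"
 shows "P.wp read_edges Q s"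
proof -
 define J where "J s' \<longleftrightarrow> begun s' & vr s' 6 <= m & (\<forall>i<vr s' 6. ar s' 11 0 i = fst (es ! i) & ar s' 12 0 i = snd (es ! i)) &
  ck s' = ck s + 1 + 4 * vr s' 6" for s' :: st
 have "P.wp (Loop (Less (Var 6) (Var 3))
  (Put 11 (Num 0) (Var 6) (Raw (Plus (Plus (Var 6) (Var 6)) (Num 3))) ;;
  Put 12 (Num 0) (Var 6) (Raw (Plus (Plus (Var 6) (Var 6)) (Num 4))) ;; Asg 6 (Plus (Var 6) (Num 1)))) Q
  (s\<lparr>vr := (vr s)(6 := 0), ck := Suc (ck s)\<rparr>)"
 proof (rule P.wp_Loop[where I = J and B = "ck s + 1 + 4 * m"])
  show "J (s\<lparr>vr := (vr s)(6 := 0), ck := Suc (ck s)\<rparr>)" using b unfolding J_def begun_def by simp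
 next
  fix s' assume "J s'"
  then show "ck s' <= ck s + 1 + 4 * m" unfolding J_def by simp
 next
  fix s' show "P.okb (Less (Var 6) (Var 3)) s'" by simp
 next
  fix s' assume j: "J s'" and t: "bv (Less (Var 6) (Var 3)) s'"
  define i where "i = vr s' 6"
  have v: "begun s'" "i < m" "\<forall>i'<i. ar s' 11 0 i' = fst (es ! i') & ar s' 12 0 i' = snd (es ! i')" "ck s' = ck s + 1 + 4 * i"
  using j t unfolding J_def begun_def i_def by auto
  have c: "i + i + 4 < cap" using v(2) caps(5,9) caps(11)[of X] le_square[of X] by linarith
  have rb: "i + i + 4 < rb" using v(2) unfolding rb_def by simp
  define s2 where "s2 = s'\<lparr>ar := put 12 0 i (snd (es ! i)) (put 11 0 i (fst (es ! i)) (ar s')), vr := (vr s')(6 := Suc i),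
  ck := Suc (Suc (Suc (Suc (ck s'))))\<rparr>"
  have rr: "rw s' (i + i + 3) = fst (es ! i)" "rw s' (i + i + 4) = snd (es ! i)" using v(1,2) unfolding begun_def mult_2 by blast+
  have "begun s2" using v(1) unfolding begun_def s2_def by simp
  moreover have "\<forall>i'<Suc i. ar s2 11 0 i' = fst (es ! i') & ar s2 12 0 i' = snd (es ! i')"
  using v(3) unfolding s2_def less_Suc_eq by auto
  ultimately have "J s2" unfolding J_def using v(2,4) by (simp add: s2_def)
  then show "P.wp (Put 11 (Num 0) (Var 6) (Raw (Plus (Plus (Var 6) (Var 6)) (Num 3))) ;;
  Put 12 (Num 0) (Var 6) (Raw (Plus (Plus (Var 6) (Var 6)) (Num 4))) ;; Asg 6 (Plus (Var 6) (Num 1))) J (tick s')"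
  unfolding s2_def using rr c rb v(2) by (simp add: i_def[symmetric])
 next
  fix s' assume j: "J s'" and t: "\<not> bv (Less (Var 6) (Var 3)) s'"
  have "vr s' 6 = m" using j t unfolding J_def begun_def by simp
  then show "Q (tick s')" using j unfolding J_def by (intro Q) (simp_all add: begun_def)
 qed
 then show ?thesis unfolding read_edges_def by simp
qed

lemma wp_compute_levels:
 assumes v: "vr s 2 = n" "vr s 4 = k"
  and Q: "\<And>s' lg. \<forall>x. x ~= 7 & x ~= 14 --> vr s' x = vr s x ==> ar s' = ar s ==> vr s' 14 = 2 * k * Suc lg ==> n <= 2 ^ lg ==> 2 ^ lg < 2 * n ==>
  ck s' <= ck s + 4 + 3 * lg ==> Q s'"
 shows "P.wp compute_levels Q s"
proof -
 define J where "J s' \<longleftrightarrow> (\<exists>l. (\<forall>x. x ~= 7 & x ~= 14 --> vr s' x = vr s x) & ar s' = ar s & vr s' 7 = 2 ^ l & vr s' 14 = Suc l &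
  2 ^ l < 2 * n & ck s' = ck s + 2 + 3 * l)" for s' :: st
 have ll: "l < 2 * n" if "2 ^ l < 2 * n" for l using that less_exp[of l] by linarith
 have nc: "8 * (n * X) < cap" by (rule caps(11)) (use caps(4) in simp)
 have n8: "8 * n < cap" using caps(4) le_square[of X] by (intro caps(11)) linarith
 have "P.wp (Loop (Less (Var 7) (Var 2)) (Asg 7 (Plus (Var 7) (Var 7)) ;; Asg 14 (Plus (Var 14) (Num 1))))
  (P.wp (Asg 14 (Times (Times (Num 2) (Var 4)) (Var 14))) Q) (s\<lparr>vr := (vr s)(7 := 1, 14 := 1), ck := Suc (Suc (ck s))\<rparr>)"
 proof (rule P.wp_Loop[where I = J and B = "ck s + 2 + 6 * n"])
  show "J (s\<lparr>vr := (vr s)(7 := 1, 14 := 1), ck := Suc (Suc (ck s))\<rparr>)"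
  unfolding J_def using n2 by (intro exI[of _ 0]) simp
 next
  fix s' assume "J s'"
  then obtain l where "2 ^ l < 2 * n" "ck s' = ck s + 2 + 3 * l" unfolding J_def by blast
  then show "ck s' <= ck s + 2 + 6 * n" using ll[of l] by simp
 next
  fix s' show "P.okb (Less (Var 7) (Var 2)) s'" by simp
 next
  fix s' assume j: "J s'" and t: "bv (Less (Var 7) (Var 2)) s'"
  obtain l where l: "\<forall>x. x ~= 7 & x ~= 14 --> vr s' x = vr s x" "ar s' = ar s" "vr s' 7 = 2 ^ l" "vr s' 14 = Suc l" "2 ^ l < 2 * n"
  "ck s' = ck s + 2 + 3 * l" using j unfolding J_def by blast
  have lt: "2 ^ l < n" using t l(1,3) v(1) by simp
  have "J (s'\<lparr>vr := (vr s')(7 := 2 ^ l + 2 ^ l, 14 := Suc (Suc l)), ck := Suc (Suc (Suc (ck s')))\<rparr>)"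
  unfolding J_def using l lt by (intro exI[of _ "Suc l"]) simp
  moreover have "2 ^ l + 2 ^ l < cap" "Suc (Suc l) < cap" using lt ll[OF l(5)] n8 n2 by linarith+
  ultimately show "P.wp (Asg 7 (Plus (Var 7) (Var 7)) ;; Asg 14 (Plus (Var 14) (Num 1))) J (tick s')"
  using l(3,4) by simp
 next
  fix s' assume j: "J s'" and t: "\<not> bv (Less (Var 7) (Var 2)) s'"
  obtain l where l: "\<forall>x. x ~= 7 & x ~= 14 --> vr s' x = vr s x" "ar s' = ar s" "vr s' 7 = 2 ^ l" "vr s' 14 = Suc l" "2 ^ l < 2 * n"
  "ck s' = ck s + 2 + 3 * l" using j unfolding J_def by blast
  have ge: "n <= 2 ^ l" using t l(1,3) v(1) by simp
  have "2 * k * Suc l <= 8 * (n * X)"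
  proof -
  have "2 * k * Suc l <= 2 * X * (2 * n)" by (intro mult_le_mono) (use ll[OF l(5)] caps(6) in simp_all)
  also have "\<dots> <= 8 * (n * X)" by (simp add: algebra_simps)
  finally show ?thesis .
  qed
  then have "2 * k * Suc l < cap" using nc by (rule le_less_trans)
  moreover from this have "2 * k < cap" by simp
  moreover have "Q (s'\<lparr>vr := (vr s')(14 := 2 * k * Suc l), ck := Suc (Suc (ck s'))\<rparr>)"
  by (rule Q[of _ l]) (use l ge in simp_all)
  ultimately show "P.wp (Asg 14 (Times (Times (Num 2) (Var 4)) (Var 14))) Q (tick s')" using l(1,4) v(2) by simp
 qed
 then show ?thesis unfolding compute_levels_def by simp
qed

lemma wp_compute_depth:
 assumes v: "vr s 2 = n" "vr s 4 = k" and k: "1 <= k"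
  and Q: "\<And>s' D. \<forall>x. x ~= 15 --> vr s' x = vr s x ==> ar s' = ar s ==> vr s' 15 = D ==> k * n <= D * D ==> 1 <= D ==> (D - 1) * (D - 1) < k * n ==>
  ck s' <= ck s + 2 + 2 * D ==> Q s'"
 shows "P.wp compute_depth Q s"
proof -
 define J where "J s' \<longleftrightarrow> (\<forall>x. x ~= 15 --> vr s' x = vr s x) & ar s' = ar s & 1 <= vr s' 15 & (vr s' 15 - 1) * (vr s' 15 - 1) < k * n &
  ck s' + 1 = ck s + 2 * vr s' 15" for s' :: st
 have kn: "1 <= k * n" using k n2 by simp
 have le: "d <= k * n" if "1 <= d" "(d - 1) * (d - 1) < k * n" for d
  using le_square[of "d - 1"] that by linarith
 have cc: "d * d < cap" "Suc d < cap" if "d <= k * n" for d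
 proof -
  have d: "d < X * X" using that caps(7) by simp
  then show "d * d < cap" unfolding cap_def by (intro mult_strict_mono) (use caps(9) in simp_all)
  show "Suc d < cap" using d caps(1) by linarith
 qed
 have "P.wp (Loop (Less (Times (Var 15) (Var 15)) (Times (Var 4) (Var 2))) (Asg 15 (Plus (Var 15) (Num 1)))) Q
  (s\<lparr>vr := (vr s)(15 := 1), ck := Suc (ck s)\<rparr>)"
 proof (rule P.wp_Loop[where I = J and B = "ck s + 2 * (k * n)"])
  show "J (s\<lparr>vr := (vr s)(15 := 1), ck := Suc (ck s)\<rparr>)" unfolding J_def using kn by simp
 next
  fix s' assume "J s'"
  then show "ck s' <= ck s + 2 * (k * n)" using le[of "vr s' 15"] unfolding J_def by simp
 next
  fix s' assume j: "J s'"
  then have "vr s' 15 <= k * n" "vr s' 4 = k" "vr s' 2 = n" using le[of "vr s' 15"] v unfolding J_def by simp_all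
  then show "P.okb (Less (Times (Var 15) (Var 15)) (Times (Var 4) (Var 2))) s'"
  using cc(1)[of "vr s' 15"] less_trans[OF caps(7,1)] by simp
 next
  fix s' assume j: "J s'" and t: "bv (Less (Times (Var 15) (Var 15)) (Times (Var 4) (Var 2))) s'"
  have "vr s' 15 * vr s' 15 < k * n" using t j v unfolding J_def by simp
  moreover have "vr s' 15 <= k * n" using j le[of "vr s' 15"] unfolding J_def by simp
  ultimately show "P.wp (Asg 15 (Plus (Var 15) (Num 1))) J (tick s')" using j cc(2)[of "vr s' 15"] unfolding J_def by simp
 next
  fix s' assume j: "J s'" and t: "\<not> bv (Less (Times (Var 15) (Var 15)) (Times (Var 4) (Var 2))) s'"
  have "k * n <= vr s' 15 * vr s' 15" using t j v unfolding J_def by simp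
  then show "Q (tick s')" using j unfolding J_def by (intro Q[of _ "vr s' 15"]) simp_all
 qed
 then show ?thesis unfolding compute_depth_def by simp
qed

text \<open>The last argument of \<open>solve_cost\<close> is the bit length of the number of
  sparsifying forests. It bounds the depth of the binary searches and is not the word size of the
  machine.\<close>

definition total_cost :: "nat => nat => nat" where
 "total_cost lg D = 20 + 4 * m + 3 * lg + 2 * D + solve_cost n m k (2 * k * Suc lg) D (Suc (floor_log (2 * k * Suc lg)))"

definition answer :: "st => bool" where
 "answer s \<longleftrightarrow> vr s 1 = 0 & (vr s 0 = 1 & packing (\<lambda>i. (\<lambda>j. rw s (i * (n - 1) + j)) ` {..<n - 1}) \<or> vr s 0 = 0 & (\<nexists>T. packing T))"

theorem wp_main:
 assumes b: "begun s" "vr s 1 = 0" "ck s = 0"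
 shows "P.wp main (\<lambda>s'. answer s' & (ck s' <= 3 \<or> 1 <= k & k * (n - 1) <= m &
  (\<exists>lg D. 2 ^ lg < 2 * n & 1 <= D & (D - 1) * (D - 1) < k * n & ck s' <= total_cost lg D))) s"
proof -
 have v: "vr s 2 = n" "vr s 3 = m" "vr s 4 = k" using b(1) unfolding begun_def by simp_all
 have kc: "k * (n - 1) < cap"
  using mult_le_mono2[of "n - 1" n k] less_trans[OF caps(7,1)] by linarith
 consider (zero) "k = 0" | (few) "k ~= 0" "m < k * (n - 1)" | (run) "1 <= k" "k * (n - 1) <= m" by linarith
 then show ?thesis
 proof cases
  case zero
  then have "packing T" for T unfolding packing_def M.packs_def by simp
  moreover have "vr s 4 = 0" using v zero by simp
  ultimately show ?thesis using b(2,3) unfolding main_def answer_def by simp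
 next
  case few
  then have "\<nexists>T. packing T" using packing_size by fastforce
  then show ?thesis using few v b kc n2 unfolding main_def answer_def by simp
 next
  case run
  let ?P = "\<lambda>s'. answer s' & (ck s' <= 3 \<or> 1 <= k & k * (n - 1) <= m &
  (\<exists>lg D. 2 ^ lg < 2 * n & 1 <= D & (D - 1) * (D - 1) < k * n & ck s' <= total_cost lg D))"
  have "P.wp read_edges (P.wp compute_levels (P.wp compute_depth (P.wp solve ?P))) (s\<lparr>ck := 2\<rparr>)"
  proof (rule wp_read_edges)
  show "begun (s\<lparr>ck := 2\<rparr>)" using b(1) unfolding begun_def by simp
  fix s1 :: st
  assume s1: "begun s1" "\<forall>i<m. ar s1 11 0 i = fst (es ! i) & ar s1 12 0 i = snd (es ! i)" "ck s1 <= ck (s\<lparr>ck := 2\<rparr>) + 2 + 4 * m"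
  have v1: "vr s1 2 = n" "vr s1 4 = k" "vr s1 3 = m" using s1(1) unfolding begun_def by simp_all
  show "P.wp compute_levels (P.wp compute_depth (P.wp solve ?P)) s1"
  proof (rule wp_compute_levels[OF v1(1,2)])
  fix s2 :: st and lg
  assume s2: "\<forall>x. x ~= 7 & x ~= 14 --> vr s2 x = vr s1 x" "ar s2 = ar s1" "vr s2 14 = 2 * k * Suc lg" "n <= 2 ^ lg" "2 ^ lg < 2 * n"
  "ck s2 <= ck s1 + 4 + 3 * lg"
  have v2: "vr s2 2 = n" "vr s2 4 = k" "vr s2 3 = m" using s2(1) v1 by simp_all
  show "P.wp compute_depth (P.wp solve ?P) s2"
  proof (rule wp_compute_depth[OF v2(1,2) run(1)])
  fix s3 :: st and D
  assume s3: "\<forall>x. x ~= 15 --> vr s3 x = vr s2 x" "ar s3 = ar s2" "vr s3 15 = D" "k * n <= D * D" "1 <= D" "(D - 1) * (D - 1) < k * n"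
  "ck s3 <= ck s2 + 2 + 2 * D"
  let ?L = "2 * k * Suc lg"
  let ?w = "Suc (floor_log ?L)"
  have Dkn: "D <= k * n" using le_square[of "D - 1"] s3(5,6) by linarith
  interpret T: task cap rb n m ep k lg ?L D ?w
  proof
  show "fst (ep e) < n & snd (ep e) < n" if "e < m" for e by (rule ep_less[OF that])
  have "n * n <= X * X" using caps(4) by (intro mult_le_mono) simp_all
  then show "n * n < cap" using caps(1) by (rule le_less_trans)
  show "m < cap" using caps(5,10) by simp
  show "4 < cap" by (rule caps(8))
  show "?L < 2 ^ ?w" using floor_log_exp2_gt[of ?L] by simp
  have "Suc lg <= 2 * n" using s2(5) less_exp[of lg] by linarith
  then have "2 * ?L <= 8 * (k * n)" using mult_le_mono2[of "Suc lg" "2 * n" "4 * k"] by (simp add: algebra_simps)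
  also have "\<dots> < cap" by (rule caps(11)) (use caps(7) in simp)
  finally show "2 * ?L < cap" .
  have "Suc D * Suc k <= (X * X) * X" using Dkn caps(6,7) by (intro mult_le_mono) simp_all
  then show "Suc D * Suc k < cap" using caps(2) by (rule le_less_trans)
  show "k * n < cap" by (rule less_trans[OF caps(7,1)])
  show "ep (m + v) = (0, v)" for v by (rule ep_star)
  qed (use n2 run s2 s3 in simp_all)
  have zero: "ar s3 14 0 = (\<lambda>_. 0)" "ar s3 15 0 = (\<lambda>_. 0)" "ar s3 19 0 = (\<lambda>_. 0)"
  using s1(1) s2(2) s3(2) unfolding begun_def by simp_all
  have sol: "T.solvable T' \<longleftrightarrow> packing T'" for T' unfolding T.solvable_def packing_def by simp
  show "P.wp solve ?P s3"
  proof (rule T.wp_solve)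
  show "vr s3 2 = n" "vr s3 3 = m" "vr s3 4 = k" "vr s3 14 = ?L" "vr s3 15 = D" using s3(1,3) s2(1,3) v1 by simp_all
  show "T.edges s3" using s1(2) s2(2) s3(2) unfolding T.edges_def ends_of_def by simp
  show "m < rb" unfolding rb_def by simp
  fix s4 :: st
  assume s4: "vr s4 1 = 0" "ck s4 <= ck s3 + solve_cost n m k ?L D ?w"
  "vr s4 0 = 1 & T.solvable (\<lambda>i. (\<lambda>j. rw s4 (i * (n - 1) + j)) ` {..<n - 1}) \<or> vr s4 0 = 0 & (\<nexists>T. T.solvable T)"
  have "ck s4 <= total_cost lg D" using s4(2) s1(3) s2(6) s3(7) unfolding total_cost_def by simp
  moreover have "answer s4" using s4(1,3) unfolding answer_def sol by simp
  ultimately show "?P s4" using run s2(5) s3(5,6) by blast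
  qed (rule zero)+
  qed
  qed
  qed
  then show ?thesis unfolding main_def using run v b(3) kc n2 by (simp add: numeral_2_eq_2)
 qed
qed

lemma total_cost_le:
 assumes k: "1 <= k" and km: "k * (n - 1) <= m" and lg: "2 ^ lg < 2 * n" and D: "1 <= D" "(D - 1) * (D - 1) < k * n"
 shows "real (total_cost lg D) <= 12000 * (real m + (real k * real n) powr (3/2) + 1) * log 2 (real (n + m + 2)) ^ 2"
proof -
 define N where "N = n + m + 2"
 define lam where "lam = log 2 (real N)"
 define L where "L = 2 * k * Suc lg"
 define s where "s = sqrt (real k * real n)"
 have "k * 1 <= k * (n - 1)" using n2 by (intro mult_le_mono2) simp
 \<comment> \<open>The time bound has no \<open>k\<close> under its logarithm, so logarithms of
   \<open>k\<close> have to be absorbed by that of \<open>n + m + 2\<close>.\<close>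
 then have km': "k <= m" using km by linarith
 have kn: "1 <= k * n" using k n2 by simp
 have N4: "4 <= N" "n <= N" "k <= N" using n2 km' unfolding N_def by simp_all
 have lamI: "real a <= c * lam" if "2 ^ a <= N ^ c" for a c :: nat
 proof -
  have "real a <= log 2 (real (N ^ c))" by (rule le_log2_of_power[OF that])
  also have "\<dots> = c * lam" unfolding lam_def using N4(1) by (simp add: log_nat_power)
  finally show ?thesis .
 qed
 have l1: "1 <= lam" using lamI[of 1 1] N4 by simp
 have lg1: "real (Suc lg) <= 3 * lam"
 proof (rule order_trans[OF lamI[of _ 2]])
  have "2 ^ Suc lg <= 4 * n" using lg by simp
  also have "\<dots> <= N * N" using N4 by (intro mult_le_mono) simp_all
  finally show "2 ^ Suc lg <= N ^ 2" by (simp add: power2_eq_square)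
 qed (use l1 in simp)
 have fl: "real (floor_log n) <= lam" using lamI[of "floor_log n" 1] floor_log_exp2_le[of n] n2 N4 by simp
 have L0: "0 < L" unfolding L_def using k by simp
 have w: "real (Suc (floor_log L)) <= 5 * lam"
 proof -
  have "Suc lg <= 2 * n" using lg less_exp[of lg] by linarith
  then have "L <= 4 * (k * n)" unfolding L_def using mult_le_mono2[of "Suc lg" "2 * n" "2 * k"] by (simp add: algebra_simps)
  also have "\<dots> <= (N * N) * (N * N)" using N4 mult_le_mono[of 2 N 2 N] by (intro mult_le_mono) simp_all
  finally have "L <= N ^ 4" by (simp add: power4_eq_xxxx mult.assoc)
  then have "2 ^ floor_log L <= N ^ 4" using floor_log_exp2_le[OF L0] by linarith
  from lamI[OF this] show ?thesis using l1 by simp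
 qed
 have ss: "s * s = real k * real n" unfolding s_def by simp
 have s1: "1 <= s" unfolding s_def using kn by (simp add: of_nat_mult[symmetric] del: of_nat_mult)
 have "real ((D - 1) * (D - 1)) < real (k * n)" using D(2) by (rule of_nat_less_iff[THEN iffD2])
 then have "(real D - 1) * (real D - 1) < s * s" unfolding ss using D(1) by (simp add: of_nat_diff)
 then have "real D - 1 < s" using s1 D(1) by (meson less_eq_real_def mult_mono not_less order_trans zero_le_one)
 then have D2: "real D <= 2 * s" using s1 by simp
 have "s * s * s = s powr 3" using s1 powr_realpow[of s 3] by (simp add: power3_eq_cube)
 also have "\<dots> = (s powr 2) powr (3/2)" by (simp add: powr_powr)
 also have "s powr 2 = real k * real n" using s1 ss by (simp add: power2_eq_square)
 finally have S: "(real k * real n) powr (3/2) = s * s * s" by simp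
 define i where "i = 11 * real n + 4 + 40 * (real n * real (floor_log n))"
 note C = cost_arith[of "real n" "real k" s lam "real (Suc lg)" "real D" "real (Suc (floor_log L))" "real (floor_log n)" "real m"]
 have "real (total_cost lg D) <= 20 + 4 * real m + 3 * real (Suc lg) + 2 * real D +
  (30 + 2 * real k * real (Suc lg) * i + real m * (60 + 5 * real (Suc (floor_log L))) + real D * real k * i +
  (100 + 5 * real (Suc (floor_log L))) * (real D * real k * real n + 2 * real k * real (Suc lg) * real n * (real D + 1)) +
  30 * (2 * real k * real (Suc lg) * real n) +
  (real D + 1) * ((real k + 1) * i + 180 * (2 * real k * real (Suc lg) * real n) + (60 + 30 * real k) * real n + 100))"
  unfolding total_cost_def solve_cost_def init_cost_def L_def[symmetric] i_def by (simp add: L_def algebra_simps)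
 also have "\<dots> <= 12000 * (real m + s * s * s + 1) * lam ^ 2"
  unfolding i_def by (rule C) (use n2 k s1 ss l1 lg1 D2 w fl in simp_all)
 finally show ?thesis unfolding S lam_def N_def .
qed

text \<open>The arrays need \<open>20 * cap^2 = 20 * X^8\<close> cells and the raw memory at most
  \<open>2 * X^8\<close> more. The remaining five of the 13 factors absorb the constant, as
  \<open>22 \<le> 4^5\<close> and \<open>4 \<le> X\<close>.\<close>

lemma space: "20 * (cap * cap) + rb <= 2 ^ word_size 13 n es k"
proof -
 let ?l = "nat \<lceil>log 2 (real X)\<rceil>"
 have X0: "4 <= X" by (rule caps(9))
 have "real X = 2 powr log 2 (real X)" using X0 by simp
 also have "\<dots> <= 2 powr real ?l" by (intro powr_mono real_nat_ceiling_ge) simp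
 also have "\<dots> = real (2 ^ ?l)" by (simp add: powr_realpow)
 finally have "X <= 2 ^ ?l" using of_nat_le_iff by blast
 then have "X ^ 13 <= (2 ^ ?l) ^ 13" by (rule power_mono) simp
 also have "\<dots> = 2 ^ word_size 13 n es k" unfolding word_size_def X_def by (simp add: power_mult[symmetric] mult.commute)
 finally have pw: "X ^ 13 <= 2 ^ word_size 13 n es k" .
 have c8: "cap * cap = X ^ 8" unfolding cap_def by (simp add: numeral_eq_Suc mult.assoc)
 have "rb <= 2 * X" unfolding rb_def X_def by simp
 also have "\<dots> <= 2 * X ^ 8" using X0 self_le_power[of X 8] by simp
 finally have "20 * (cap * cap) + rb <= 22 * X ^ 8" unfolding c8 by simp
 also have "\<dots> <= X ^ 5 * X ^ 8" using power_mono[OF X0, of 5] by (intro mult_le_mono1) simp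
 also have "\<dots> = X ^ 13" by (simp add: power_add[symmetric])
 finally show ?thesis using pw by simp
qed

section \<open>The run of the compiled program on its input\<close>

lemma input_mem:
 defines "mem0 \<equiv> mem (init_config n es k)"
 shows "mem0 0 = n" "mem0 (Suc 0) = m" "mem0 2 = k" "rb <= a ==> mem0 a = 0" "mem0 a < cap"
  "i < m ==> mem0 (2 * i + 3) = fst (es ! i) & mem0 (2 * i + 4) = snd (es ! i)"
proof -
 let ?P = "concat (map (\<lambda>(u, v). [u, v]) es)"
 have len: "length (input_words n es k) = rb" unfolding input_words_def rb_def by (simp add: pairs_nth(1))
 have m0: "mem0 a = (if a < rb then input_words n es k ! a else 0)" for a unfolding mem0_def init_config_def len by simp
 show "mem0 0 = n" "mem0 (Suc 0) = m" "mem0 2 = k" unfolding m0 by (simp_all add: rb_def input_words_def)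
 show "rb <= a ==> mem0 a = 0" unfolding m0 by simp
 have "x < X" if "x \<in> set (input_words n es k)" for x
  using that graph caps(4,5,6) unfolding input_words_def is_graph_def by fastforce
 then show "mem0 a < cap" unfolding m0 using nth_mem[of a "input_words n es k"] caps(10) len by fastforce
 assume i: "i < m"
 have e: "2 * i + 3 = Suc (Suc (Suc (2 * i)))" "2 * i + 4 = Suc (Suc (Suc (Suc (2 * i))))" by simp_all
 show "mem0 (2 * i + 3) = fst (es ! i) & mem0 (2 * i + 4) = snd (es ! i)"
  unfolding m0 e using i pairs_nth(2)[OF i] by (simp add: input_words_def rb_def)
qed

lemma run_prog:
 "\<exists>t y. run prog (word_size 13 n es k) t (init_config n es k) = return_pmf y & halted prog y & correct_output n es k y &
  real t <= (14 + 12000 * real (clen main + 3)) * (real m + (real k * real n) powr (3/2) + 1) * log 2 (real (n + m + 2)) ^ 2"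
proof -
 define w where "w = word_size 13 n es k"
 define mem0 where "mem0 = mem (init_config n es k)"
 note im = input_mem[folded mem0_def]
 interpret R: ram cap rb w using caps(8) space unfolding w_def by unfold_locales
 have capw: "cap < 2 ^ w" using R.cap_less by simp
 have rbw: "rb <= X * X" using mult_le_mono1[OF caps(9), of X] unfolding rb_def by (simp add: X_def)
 have w0: "0 < w" using capw caps(8) by (cases w) simp_all
 define x0 where "x0 = fold (sx w) prologue (\<lambda>_. 0, mem0)"
 have sm: "X < 2 ^ w" "X * X < 2 ^ w" "X * X * (X * X) < 2 ^ w" "m + m + 3 < 2 ^ w"
  using capw caps(1,10) rbw unfolding rb_def cap_def by linarith+
 have x0: "fst x0 = (\<lambda>_. 0)(2 := n, 3 := m, 4 := k, 103 := X * X, 100 := cap, 101 := rb, 102 := 3)" "snd x0 = mem0"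
  unfolding x0_def fold_prologue[where M = mem0, OF im(1,2,3) X_def[symmetric] sm w0] cap_def rb_def mult_2 by (simp_all only: fst_conv snd_conv)
 define s0 where "s0 = \<lparr>vr = (\<lambda>_. 0)(2 := n, 3 := m, 4 := k), ar = (\<lambda>_ _ _. 0), rw = mem0, ck = 0\<rparr>"
 have sim0: "R.sim s0 x0"
 proof -
  have z: "mem0 (R.addr t p q) = 0" for t p q by (rule im(4)[OF R.addr_ge])
  have c: "n < cap" "m < cap" "k < cap" "0 < cap" using caps(4,5,6,10) by linarith+
  show ?thesis unfolding R.sim_def x0 s0_def st.simps using c im(5) z by (intro conjI allI impI) auto
 qed
 have "begun s0" unfolding begun_def s0_def using im(6) by simp
 from wp_main[OF this] obtain s' where s': "P.big main s0 s'" "answer s'"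
  "ck s' <= 3 \<or> 1 <= k & k * (n - 1) <= m &
  (\<exists>lg D. 2 ^ lg < 2 * n & 1 <= D & (D - 1) * (D - 1) < k * n & ck s' <= total_cost lg D)"
  unfolding P.wp_def s0_def by auto
 define M where "M = clen main + 3"
 have len: "length prologue = 14" unfolding prologue_def by simp
 have at: "code_at prog 0 prologue" "code_at prog 14 (ccom 14 main)" unfolding code_at_def prog_def using len by fastforce+
 have "R.leads prog (M * (ck s' - ck s0)) 14 x0 (14 + clen main) s'"
  by (rule R.compile_correct[OF s'(1) wfc_main _ at(2) sim0]) (simp add: M_def)
 then obtain t y where t: "t <= M * ck s'" "run prog w t (conf 14 x0) = return_pmf (conf (14 + clen main) y)" "R.sim s' y"
  unfolding R.leads_def s0_def by auto
 have st: "list_all straight prologue" unfolding prologue_def by simp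
 have "init_config n es k = conf 0 (\<lambda>_. 0, mem0)" unfolding mem0_def init_config_def by simp
 then have "run prog w 14 (init_config n es k) = return_pmf (conf 14 x0)" using run_straight[OF at(1) st, of w "(\<lambda>_. 0, mem0)"] len unfolding x0_def by simp
 from run_trans[OF this t(2)] have run: "run prog w (14 + t) (init_config n es k) = return_pmf (conf (14 + clen main) y)" .
 have halt: "halted prog (conf (14 + clen main) y)" unfolding halted_def prog_def using len by simp
 have y: "fst y 0 = vr s' 0" "fst y 1 = vr s' 1" "\<And>a. a < rb ==> snd y a = rw s' a" using t(3) unfolding R.sim_def by auto
 have out: "correct_output n es k (conf (14 + clen main) y)"
 proof (cases "vr s' 0 = 1")
  case True
  let ?T = "\<lambda>i. (\<lambda>j. rw s' (i * (n - 1) + j)) ` {..<n - 1}"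
  have pk: "packing ?T" "vr s' 1 = 0" using s'(2) True unfolding answer_def by simp_all
  have "output_trees n (conf (14 + clen main) y) i = ?T i" if i: "i < k" for i
  unfolding output_trees_def
  proof (rule image_cong)
  fix j assume "j \<in> {..<n - 1}"
  then have "i * (n - 1) + j < Suc i * (n - 1)" by simp
  also have "\<dots> <= k * (n - 1)" using i by (intro mult_le_mono1) simp
  also have "\<dots> < rb" using packing_size[OF pk(1)] unfolding rb_def by simp
  finally show "mem (conf (14 + clen main) y) (reg (conf (14 + clen main) y) 1 + i * (n - 1) + j) = rw s' (i * (n - 1) + j)"
  using y(2,3) pk(2) by simp
  qed simp
  then have "packing (output_trees n (conf (14 + clen main) y))" using pk(1) unfolding packing_def M.packs_def by simp
  then show ?thesis using trees_of_packing y(1) True unfolding correct_output_def by simp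
 next
  case False
  then have "vr s' 0 = 0" "\<nexists>T. packing T" using s'(2) unfolding answer_def by auto
  then show ?thesis using packing_of_trees y(1) unfolding correct_output_def by auto
 qed
 define B where "B = (real m + (real k * real n) powr (3/2) + 1) * log 2 (real (n + m + 2)) ^ 2"
 \<comment> \<open>This absorbs the 14 instructions of the prologue and the few ticks spent when the
   input is settled at once.\<close>
 have B1: "1 <= B"
 proof -
  have "1 <= log 2 (real (n + m + 2))" using le_log2_of_power[of 1 "n + m + 2"] by simp
  then have "1 <= log 2 (real (n + m + 2)) ^ 2" by (rule one_le_power)
  moreover have "1 <= real m + (real k * real n) powr (3/2) + 1" by simp
  ultimately show ?thesis unfolding B_def using mult_mono[of 1 _ 1] by fastforce
 qed
 have "real (ck s') <= 12000 * B"
  using s'(3)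
 proof (elim disjE conjE exE)
  assume "ck s' <= 3"
  then show ?thesis using B1 by simp
 next
  fix lg D assume a: "1 <= k" "k * (n - 1) <= m" "2 ^ lg < 2 * n" "1 <= D" "(D - 1) * (D - 1) < k * n" "ck s' <= total_cost lg D"
  then have "real (ck s') <= real (total_cost lg D)" by simp
  also note total_cost_le[OF a(1-5)]
  finally show ?thesis unfolding B_def by (simp only: mult.assoc)
 qed
 then have "real M * real (ck s') <= real M * (12000 * B)" by (intro mult_left_mono) simp_all
 moreover have "real t <= real M * real (ck s')" using t(1) by (metis of_nat_le_iff of_nat_mult)
 ultimately have "real (14 + t) <= (14 + 12000 * real M) * B" using B1 by (simp add: algebra_simps)
 then show ?thesis using run halt out unfolding B_def M_def w_def mult.assoc by blast
qed

end

theorem theorem7p9: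
 fixes c :: real
 assumes "c > 0"
 shows "\<exists>(P :: program) (K :: nat) (C :: real) (d :: nat). K \<ge> 1 \<and> C > 0 \<and>
  (\<forall>(n :: nat) (es :: (nat \<times> nat) list) (k :: nat). is_graph n es \<longrightarrow>
  measure_pmf.prob
  (run P (word_size K n es k) (time_bound C d n es k) (init_config n es k))
  {s. halted P s \<and> correct_output n es k s}
  \<ge> 1 - real n powr (- c))"
proof (intro exI conjI allI impI)
 show "(1::nat) \<le> 13" by simp
 show "0 < 14 + 12000 * real (clen main + 3)" by simp
 fix n es k assume g: "is_graph n es"
 let ?C = "14 + 12000 * real (clen main + 3)"
 let ?run = "run prog (word_size 13 n es k) (time_bound ?C 2 n es k) (init_config n es k)"
 let ?A = "{s. halted prog s \<and> correct_output n es k s}"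
 show "1 - real n powr (- c) \<le> measure_pmf.prob ?run ?A"
 proof (cases "n = 1")
  \<comment> \<open>For a single vertex \<open>n powr (- c) = 1\<close>, so the required probability
    is 0.\<close>
  case True
  then show ?thesis by simp
 next
  case False
  then interpret input n es k using g unfolding is_graph_def by unfold_locales (auto simp: is_graph_def)
  obtain t y where t: "run prog (word_size 13 n es k) t (init_config n es k) = return_pmf y" "halted prog y" "correct_output n es k y"
  "real t \<le> ?C * (real (length es) + (real k * real n) powr (3/2) + 1) * log 2 (real (n + length es + 2)) ^ 2"
  using run_prog by blast
  have "t \<le> time_bound ?C 2 n es k" unfolding time_bound_def using t(4) by (rule le_nat_floor)
  \<comment> \<open>A halted configuration persists, so running on to the time bound does not change
    the result.\<close>
  then obtain u where "time_bound ?C 2 n es k = t + u" using le_Suc_ex by blast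
  then have "?run = return_pmf y" using run_trans[OF t(1) run_halted[OF t(2), of _ u]] by simp
  then show ?thesis using t(2,3) by (simp add: measure_return_pmf)
 qed
qed

end
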